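(* Let $V$ be an indecomposable object in ${}^{\mathcal C}_{\mathcal C}\mathcal{YD}$ such that the Nichols algebra $\mathcal B(V)$ is finite-dimensional. Then $V$ is simple and isomorphic to one of $\Bbbk_{\chi^{k}}$ with $k\in\{1,3,5\}$, $V_{1,1}$, $V_{4,2}$, $V_{3,1}$, $V_{2,2}$, $V_{1,4}$, $V_{4,5}$, $V_{2,4}$, $V_{3,5}$, $V_{4,4}$, $V_{1,5}$, $V_{4,1}$, $V_{1,2}$. Moreover, for these objects $V$ the Nichols algebra $\mathcal B(V)$ has the following presentation by generators and relations and the following dimension, where the generator is $x=v$ for $V=\Bbbk_{\chi^l}$, the generators are $x=v_1$, $y=v_2$ for $V=V_{i,j}$, and in each row with a parameter $j$ one takes $j\in\{1,5\}$ (second indices read modulo $6$): (1) $V=\Bbbk_{\chi^l}$, $l\in\{1,3,5\}$: $x^2=0$; $\dim\mathcal B(V)=2$. (2) $V=V_{3,j}$: $x^2=0$, $xy+\xi^{-j}yx=0$, $y^3=0$; $\dim\mathcal B(V)=6$. (3) $V=V_{2,j+3}$: $y^2+\xi x^2=0$, $xy-yx=0$, $x^3=0$; $\dim\mathcal B(V)=6$. (4) $V=V_{1,j}$: $x^6=0$, $x^2y+\xi^{j}yx^2+(1+\xi^j)xyx=0$, $x^3+y^2x+xy^2+yxy=0$, $x^2y+yx^2+xyx+y^3=0$; $\dim\mathcal B(V)=36$. (5) $V=V_{4,j}$: $x^3=0$, $y^3-x^2y-yx^2+xyx=0$, $y^2x+xy^2-yxy=0$, $\xi^jx^2y+\xi^{5j}yx^2+xyx=0$;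 $\dim\mathcal B(V)=18$. (6) $V=V_{4,j+3}$: $x^3=0$, $\xi^{2j}x^2y+\xi^{4j}xyx+yx^2=0$, $y^6=0$, $y^2x+(\xi^{5j}+\xi^{4j})yxy-xy^2=0$; $\dim\mathcal B(V)=36$. (7) $V=V_{1,j+3}$: $x^3=0$, $y^3+x^2y+yx^2+xyx=0$, $y^2x+xy^2+yxy=0$, $\xi^{2j}x^2y+\xi^{4j}xyx+yx^2=0$; $\dim\mathcal B(V)=18$.
   Context: $\Bbbk$ is an algebraically closed field of characteristic zero and $\xi\in\Bbbk$ is a primitive $6$-th root of unity. $\mathcal C$ is the $12$-dimensional Hopf algebra generated as an algebra by $a,b$ with relations $a^6=1$, $b^2=0$, $ba=\xi ab$, with comultiplication $\Delta(a)=a\otimes a+(\xi^4+\xi^5)\,b\otimes ba^3$, $\Delta(b)=b\otimes a^4+a\otimes b$, counit $\epsilon(a)=1$, $\epsilon(b)=0$, and antipode $S(a)=a^5$, $S(b)=\xi^{-2}ba$. ${}^{\mathcal C}_{\mathcal C}\mathcal{YD}$ is the category of left Yetter-Drinfeld modules over $\mathcal C$ (left modules and left comodules with $\delta(h\cdot v)=h_{(1)}v_{(-1)}S(h_{(3)})\otimes h_{(2)}\cdot v_{(0)}$), with braiding $c(v\otimes w)=v_{(-1)}\cdot w\otimes v_{(0)}$. The Nichols algebra $\mathcal B(V)$ is the $\mathbb N$-graded Hopf algebra $R=\oplus_{n\ge0}R(n)$ in this category with $R(0)=\Bbbk$, $R(1)=V$, generated as an algebra by $R(1)$, and whose space of primitive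 elements is $V$. For $i\in\{0,\dots,5\}$, $\Bbbk_{\chi^i}=\Bbbk v$ is the one-dimensional object with $a\cdot v=\xi^iv$, $b\cdot v=0$, $\delta(v)=a^{3i}\otimes v$. Let $\Lambda=\{(i,j)\in\{0,\dots,5\}^2\mid 3i\not\equiv j \bmod 6\}$. For $(i,j)\in\Lambda$ (indices read modulo $6$), $V_{i,j}$ is the two-dimensional object with basis $v_1,v_2$ and $a\cdot v_1=\xi^iv_1$, $b\cdot v_1=0$, $a\cdot v_2=\xi^{i+1}v_2$, $b\cdot v_2=v_1$, $\delta(v_1)=a^{-j}\otimes v_1+\xi^4(\xi^{4i}-\xi^{i+j})\,ba^{-1-j}\otimes v_2$, $\delta(v_2)=a^{3-j}\otimes v_2+(\xi^{2i}+\xi^{j-i})\,ba^{2-j}\otimes v_1$. *)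

theory Defs
  imports
    Complex_Main
    "HOL-Library.Poly_Mapping"
    "HOL-Library.Function_Algebras"
    "HOL-Library.Product_Plus"
    "HOL-Computational_Algebra.Polynomial"
begin

section \<open>Multilinear forms and tensor products\<close>

text \<open>
  A vector space is a type of class \<open>ab_group_add\<close> together with a scalar multiplication
  satisfying \<^const>\<open>vector_space\<close>.
\<close>

definition linform :: "('k::field \<Rightarrow> 'v::ab_group_add \<Rightarrow> 'v) \<Rightarrow> ('v \<Rightarrow> 'k) \<Rightarrow> bool"
  where "linform s \<phi> \<longleftrightarrow> Vector_Spaces.linear s (*) \<phi>"

definition bilform ::
  "('k::field \<Rightarrow> 'v::ab_group_add \<Rightarrow> 'v) \<Rightarrow> ('k \<Rightarrow> 'w::ab_group_add \<Rightarrow> 'w)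
    \<Rightarrow> ('v \<Rightarrow> 'w \<Rightarrow> 'k) \<Rightarrow> bool"
  where "bilform s t \<beta> \<longleftrightarrow>
    (\<forall>w. linform s (\<lambda>v. \<beta> v w)) \<and> (\<forall>v. linform t (\<lambda>w. \<beta> v w))"

definition trilform ::
  "('k::field \<Rightarrow> 'v::ab_group_add \<Rightarrow> 'v) \<Rightarrow> ('k \<Rightarrow> 'w::ab_group_add \<Rightarrow> 'w)
    \<Rightarrow> ('k \<Rightarrow> 'x::ab_group_add \<Rightarrow> 'x) \<Rightarrow> ('v \<Rightarrow> 'w \<Rightarrow> 'x \<Rightarrow> 'k) \<Rightarrow> bool"
  where "trilform s t u \<tau> \<longleftrightarrow>
    (\<forall>w x. linform s (\<lambda>v. \<tau> v w x)) \<and> (\<forall>v x. linform t (\<lambda>w. \<tau> v w x)) \<and>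
    (\<forall>v w. linform u (\<lambda>x. \<tau> v w x))"

text \<open>
  Over a field, \<open>V \<otimes> W\<close> embeds into the dual of the space of bilinear forms on \<open>V \<times> W\<close>, with
  \<open>v \<otimes> w\<close> going to evaluation at \<open>(v, w)\<close>; \<open>tensors s t\<close> is the image of this embedding
  (see \<open>tensor_universal\<close> below for the universal property).  With this encoding,
  \<open>T \<beta>\<close> for a tensor \<open>T = \<Sum> v\<^sub>i \<otimes> w\<^sub>i\<close> and a bilinear form \<open>\<beta>\<close> is the sum
  \<open>\<Sum> \<beta> v\<^sub>i w\<^sub>i\<close>.  So Sweedler notation is read as follows: if \<open>\<Delta> h\<close> is \<open>h\<^sub>1 \<otimes> h\<^sub>2\<close> then
  \<open>\<Delta> h (\<lambda>x y. \<beta> x y)\<close> is \<open>\<beta> h\<^sub>1 h\<^sub>2\<close>.  An identity in an \<open>n\<close>-fold tensor product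
  (\<open>n = 1, 2, 3\<close>) is stated by testing it against all \<open>n\<close>-linear forms, which separate points.
\<close>

type_synonym ('k, 'v, 'w) tensor = "('v \<Rightarrow> 'w \<Rightarrow> 'k) \<Rightarrow> 'k"

definition tscale :: "'k::field \<Rightarrow> ('k, 'v, 'w) tensor \<Rightarrow> ('k, 'v, 'w) tensor"
  where "tscale c T = (\<lambda>\<beta>. c * T \<beta>)"

definition pure ::
  "('k::field \<Rightarrow> 'v::ab_group_add \<Rightarrow> 'v) \<Rightarrow> ('k \<Rightarrow> 'w::ab_group_add \<Rightarrow> 'w)
    \<Rightarrow> 'v \<Rightarrow> 'w \<Rightarrow> ('k, 'v, 'w) tensor"
  where "pure s t v w = (\<lambda>\<beta>. if bilform s t \<beta> then \<beta> v w else 0)"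

definition tspan ::
  "('k::field \<Rightarrow> 'v::ab_group_add \<Rightarrow> 'v) \<Rightarrow> ('k \<Rightarrow> 'w::ab_group_add \<Rightarrow> 'w)
    \<Rightarrow> 'v set \<Rightarrow> 'w set \<Rightarrow> ('k, 'v, 'w) tensor set"
  where "tspan s t A B = module.span tscale {pure s t v w | v w. v \<in> A \<and> w \<in> B}"

abbreviation tensors ::
  "('k::field \<Rightarrow> 'v::ab_group_add \<Rightarrow> 'v) \<Rightarrow> ('k \<Rightarrow> 'w::ab_group_add \<Rightarrow> 'w)
    \<Rightarrow> ('k, 'v, 'w) tensor set"
  where "tensors s t \<equiv> tspan s t UNIV UNIV"

lemma vector_space_tscale: "vector_space tscale"
  by standard (auto simp: tscale_def fun_eq_iff algebra_simps)

lemma linform_separates: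
  fixes s :: "'k::field \<Rightarrow> 'v::ab_group_add \<Rightarrow> 'v"
  assumes "vector_space s" and "\<And>\<phi>. linform s \<phi> \<Longrightarrow> \<phi> x = \<phi> y"
  shows "x = y"
proof (rule ccontr)
  assume "x \<noteq> y"
  interpret A: vector_space s by fact
  interpret K: vector_space "(*) :: 'k \<Rightarrow> 'k \<Rightarrow> 'k"
    by standard (auto simp: algebra_simps)
  interpret P: vector_space_pair s "(*) :: 'k \<Rightarrow> 'k \<Rightarrow> 'k" ..
  have "A.independent {x - y}"
    using \<open>x \<noteq> y\<close> by simp
  then obtain \<phi> where \<phi>: "Vector_Spaces.linear s (*) \<phi>" "\<phi> (x - y) = 1"
    using P.linear_independent_extend[of "{x - y}" "\<lambda>_. 1"] by auto
  moreover have "\<phi> x = \<phi> y"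
    using assms(2) \<phi>(1) by (simp add: linform_def)
  ultimately show False
    by (simp add: P.linear_diff)
qed

lemma tensor_universal:
  fixes s :: "'k::field \<Rightarrow> 'v::ab_group_add \<Rightarrow> 'v"
    and t :: "'k \<Rightarrow> 'w::ab_group_add \<Rightarrow> 'w"
    and u :: "'k \<Rightarrow> 'x::ab_group_add \<Rightarrow> 'x"
  assumes "vector_space s" "vector_space t" "vector_space u"
    and F1: "\<And>w. Vector_Spaces.linear s u (\<lambda>v. F v w)"
    and F2: "\<And>v. Vector_Spaces.linear t u (\<lambda>w. F v w)"
  shows "\<exists>f. (\<forall>v w. f (pure s t v w) = F v w) \<and>
    (\<forall>T\<in>tensors s t. \<forall>U\<in>tensors s t. f (T + U) = f T + f U) \<and>
    (\<forall>c. \<forall>T\<in>tensors s t. f (tscale c T) = u c (f T))"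
proof -
  interpret U: vector_space u by fact
  interpret T: vector_space "tscale :: 'k \<Rightarrow> ('k, 'v, 'w) tensor \<Rightarrow> ('k, 'v, 'w) tensor"
    by (rule vector_space_tscale)
  define rep where "rep T x \<longleftrightarrow> (\<forall>\<phi>. linform u \<phi> \<longrightarrow> \<phi> x = T (\<lambda>v w. \<phi> (F v w)))" for T x
  have lf: "\<phi> (x + y) = \<phi> x + \<phi> y" "\<phi> (u c x) = c * \<phi> x" "\<phi> 0 = 0"
    if "linform u \<phi>" for \<phi> x y c
  proof -
    interpret L: Vector_Spaces.linear u "(*)" \<phi> using that by (simp add: linform_def)
    show "\<phi> (x + y) = \<phi> x + \<phi> y" "\<phi> (u c x) = c * \<phi> x" "\<phi> 0 = 0"
      by (rule L.add L.scale L.zero)+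
  qed
  have bil: "bilform s t (\<lambda>v w. \<phi> (F v w))" if "linform u \<phi>" for \<phi>
    using Vector_Spaces.linear_compose[OF F1, of "(*)" \<phi>]
      Vector_Spaces.linear_compose[OF F2, of "(*)" \<phi>] that
    by (simp add: bilform_def linform_def o_def)
  have uniq: "x = y" if "rep T x" "rep T y" for T x y
    by (rule linform_separates[OF assms(3)]) (use that rep_def in metis)
  have rp: "rep (pure s t v w) (F v w)" for v w
    by (simp add: rep_def pure_def bil)
  have ra: "rep (T + T') (x + x')" if "rep T x" "rep T' x'" for T T' x x'
    using that by (simp add: rep_def lf)
  have rs: "rep (tscale c T) (u c x)" if "rep T x" for c T x
    using that by (simp add: rep_def lf tscale_def)
  have r0: "rep 0 0"
    by (simp add: rep_def lf)
  have ex: "\<exists>x. rep T x" if "T \<in> tensors s t" for T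
    using that unfolding tspan_def
  proof (induction rule: T.span_induct_alt)
    case base
    show ?case using r0 by (auto simp: zero_fun_def)
  next
    case (step c S T)
    then show ?case using rp ra rs by blast
  qed
  define f where "f T = (THE x. rep T x)" for T
  have f: "f T = x" if "rep T x" for T x
    unfolding f_def using that uniq by blast
  have "f (pure s t v w) = F v w" for v w
    by (rule f[OF rp])
  moreover have "f (T + T') = f T + f T'" if "T \<in> tensors s t" "T' \<in> tensors s t" for T T'
  proof -
    obtain x x' where "rep T x" "rep T' x'"
      using ex[OF \<open>T \<in> _\<close>] ex[OF \<open>T' \<in> _\<close>] by blast
    then show ?thesis using ra f by metis
  qed
  moreover have "f (tscale c T) = u c (f T)" if "T \<in> tensors s t" for c T
  proof -
    obtain x where "rep T x" using ex \<open>T \<in> tensors s t\<close> by blast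
    then show ?thesis using rs f by metis
  qed
  ultimately show ?thesis by blast
qed

section \<open>Free algebras and presentations\<close>

text \<open>
  Words form a monoid under concatenation, written additively so that
  \<open>'g word \<Rightarrow>\<^sub>0 'k\<close> is the monoid algebra, i.e. the free associative algebra on \<open>'g\<close>.
\<close>

datatype 'g word = Word (letters: "'g list")

instantiation word :: (type) monoid_add
begin

definition zero_word :: "'g word" where "zero_word = Word []"

definition plus_word :: "'g word \<Rightarrow> 'g word \<Rightarrow> 'g word"
  where "plus_word v w = Word (letters v @ letters w)"

instance
  by standard (auto simp: zero_word_def plus_word_def word.expand)

end

type_synonym ('g, 'k) free_alg = "'g word \<Rightarrow>\<^sub>0 'k"

definition var :: "'g \<Rightarrow> ('g, 'k::field) free_alg"
  where "var g = Poly_Mapping.single (Word [g]) 1"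

definition fscale :: "'k::field \<Rightarrow> ('g, 'k) free_alg \<Rightarrow> ('g, 'k) free_alg"  (infixr \<open>\<cdot>\<close> 72)
  where "fscale c p = Poly_Mapping.single 0 c * p"

definition fa_eval ::
  "('k::field \<Rightarrow> 'a::ring_1 \<Rightarrow> 'a) \<Rightarrow> ('g \<Rightarrow> 'a) \<Rightarrow> ('g, 'k) free_alg \<Rightarrow> 'a"
  where "fa_eval s e p =
    (\<Sum>w\<in>Poly_Mapping.keys p. s (Poly_Mapping.lookup p w) (prod_list (map e (letters w))))"

definition two_sided_ideal :: "'a::ring_1 set \<Rightarrow> bool"
  where "two_sided_ideal I \<longleftrightarrow> 0 \<in> I \<and> (\<forall>x\<in>I. \<forall>y\<in>I. x + y \<in> I) \<and>
    (\<forall>x\<in>I. \<forall>r. r * x \<in> I \<and> x * r \<in> I)"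

definition ideal_generated :: "'a::ring_1 set \<Rightarrow> 'a set"
  where "ideal_generated S = two_sided_ideal hull S"

definition algebra :: "('k::field \<Rightarrow> 'a::ring_1 \<Rightarrow> 'a) \<Rightarrow> bool"
  where "algebra s \<longleftrightarrow> vector_space s \<and>
    (\<forall>c x y. s c (x * y) = s c x * y \<and> s c (x * y) = x * s c y)"

definition subalgebra :: "('k::field \<Rightarrow> 'a::ring_1 \<Rightarrow> 'a) \<Rightarrow> 'a set \<Rightarrow> bool"
  where "subalgebra s A \<longleftrightarrow> module.subspace s A \<and> 1 \<in> A \<and> (\<forall>x\<in>A. \<forall>y\<in>A. x * y \<in> A)"

definition presented_by ::
  "('k::field \<Rightarrow> 'a::ring_1 \<Rightarrow> 'a) \<Rightarrow> ('g \<Rightarrow> 'a) \<Rightarrow> ('g, 'k) free_alg set \<Rightarrow> bool"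
  where "presented_by s e rels \<longleftrightarrow> algebra s \<and> surj (fa_eval s e) \<and>
    {p. fa_eval s e p = 0} = ideal_generated rels"

datatype gen = GX | GY

definition gens :: "'a \<Rightarrow> 'a \<Rightarrow> gen \<Rightarrow> 'a"
  where "gens x y g = (case g of GX \<Rightarrow> x | GY \<Rightarrow> y)"

definition has_basis :: "('k::field \<Rightarrow> 'v::ab_group_add \<Rightarrow> 'v) \<Rightarrow> 'v set \<Rightarrow> bool"
  where "has_basis s B \<longleftrightarrow> \<not> module.dependent s B \<and> module.span s B = UNIV"

definition finite_dim :: "('k::field \<Rightarrow> 'v::ab_group_add \<Rightarrow> 'v) \<Rightarrow> bool"
  where "finite_dim s \<longleftrightarrow> (\<exists>B. finite_dimensional_vector_space s B)"

text \<open>\<^const>\<open>vector_space.dim\<close> is 0 on infinite-dimensional spaces, hence the first conjunct.\<close>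

definition has_dim :: "('k::field \<Rightarrow> 'v::ab_group_add \<Rightarrow> 'v) \<Rightarrow> nat \<Rightarrow> bool"
  where "has_dim s d \<longleftrightarrow> finite_dim s \<and> vector_space.dim s (UNIV :: 'v set) = d"

section \<open>Hopf algebras and Yetter-Drinfeld modules\<close>

record ('k, 'h) hopf =
  hscale :: "'k \<Rightarrow> 'h \<Rightarrow> 'h"
  comult :: "'h \<Rightarrow> ('k, 'h, 'h) tensor"
  counit :: "'h \<Rightarrow> 'k"
  antipode :: "'h \<Rightarrow> 'h"

definition hopf_algebra :: "('k::field, 'h::ring_1) hopf \<Rightarrow> bool"
  where "hopf_algebra H \<longleftrightarrow>
    (let s = hscale H; \<Delta> = comult H; \<epsilon> = counit H; S = antipode H in
      algebra s \<and>
      Vector_Spaces.linear s tscale \<Delta> \<and> (\<forall>h. \<Delta> h \<in> tensors s s) \<and>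
      linform s \<epsilon> \<and>
      Vector_Spaces.linear s s S \<and>
      (\<forall>h \<tau>. trilform s s s \<tau> \<longrightarrow>
        \<Delta> h (\<lambda>x z. \<Delta> x (\<lambda>x' y. \<tau> x' y z)) = \<Delta> h (\<lambda>x y. \<Delta> y (\<lambda>y' z. \<tau> x y' z))) \<and>
      (\<forall>h \<phi>. linform s \<phi> \<longrightarrow>
        \<Delta> h (\<lambda>x y. \<epsilon> x * \<phi> y) = \<phi> h \<and> \<Delta> h (\<lambda>x y. \<phi> x * \<epsilon> y) = \<phi> h) \<and>
      \<Delta> 1 = pure s s 1 1 \<and>
      (\<forall>g h \<beta>. bilform s s \<beta> \<longrightarrow>
        \<Delta> (g * h) \<beta> = \<Delta> g (\<lambda>g1 g2. \<Delta> h (\<lambda>h1 h2. \<beta> (g1 * h1) (g2 * h2)))) \<and>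
      \<epsilon> 1 = 1 \<and> (\<forall>g h. \<epsilon> (g * h) = \<epsilon> g * \<epsilon> h) \<and>
      (\<forall>h \<phi>. linform s \<phi> \<longrightarrow>
        \<Delta> h (\<lambda>x y. \<phi> (S x * y)) = \<epsilon> h * \<phi> 1 \<and> \<Delta> h (\<lambda>x y. \<phi> (x * S y)) = \<epsilon> h * \<phi> 1))"

record ('k, 'h, 'v) yd =
  scale :: "'k \<Rightarrow> 'v \<Rightarrow> 'v"
  act :: "'h \<Rightarrow> 'v \<Rightarrow> 'v"
  coact :: "'v \<Rightarrow> ('k, 'h, 'v) tensor"

definition yd_module ::
  "('k::field, 'h::ring_1) hopf \<Rightarrow> ('k, 'h, 'v::ab_group_add, 'm) yd_scheme \<Rightarrow> bool"
  where "yd_module H V \<longleftrightarrow>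
    (let s = hscale H; \<Delta> = comult H; \<epsilon> = counit H; S = antipode H;
         t = scale V; \<rho> = act V; \<delta> = coact V in
      vector_space t \<and>
      (\<forall>v. Vector_Spaces.linear s t (\<lambda>h. \<rho> h v)) \<and> (\<forall>h. Vector_Spaces.linear t t (\<rho> h)) \<and>
      (\<forall>v. \<rho> 1 v = v) \<and> (\<forall>g h v. \<rho> (g * h) v = \<rho> g (\<rho> h v)) \<and>
      Vector_Spaces.linear t tscale \<delta> \<and> (\<forall>v. \<delta> v \<in> tensors s t) \<and>
      (\<forall>v \<tau>. trilform s s t \<tau> \<longrightarrow>
        \<delta> v (\<lambda>h w. \<Delta> h (\<lambda>x y. \<tau> x y w)) = \<delta> v (\<lambda>x w. \<delta> w (\<lambda>y w'. \<tau> x y w'))) \<and>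
      (\<forall>v \<phi>. linform t \<phi> \<longrightarrow> \<delta> v (\<lambda>h w. \<epsilon> h * \<phi> w) = \<phi> v) \<and>
      (\<forall>h v \<beta>. bilform s t \<beta> \<longrightarrow>
        \<delta> (\<rho> h v) \<beta> =
          \<Delta> h (\<lambda>h1 h'. \<Delta> h' (\<lambda>h2 h3. \<delta> v (\<lambda>g w. \<beta> (h1 * g * S h3) (\<rho> h2 w))))))"

definition yd_hom ::
  "('k::field, 'h::ring_1) hopf \<Rightarrow> ('k, 'h, 'v::ab_group_add, 'm) yd_scheme \<Rightarrow>
    ('k, 'h, 'w::ab_group_add, 'n) yd_scheme \<Rightarrow> ('v \<Rightarrow> 'w) \<Rightarrow> bool"
  where "yd_hom H V W f \<longleftrightarrow>
    Vector_Spaces.linear (scale V) (scale W) f \<and>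
    (\<forall>h v. f (act V h v) = act W h (f v)) \<and>
    (\<forall>v \<beta>. bilform (hscale H) (scale W) \<beta> \<longrightarrow>
      coact W (f v) \<beta> = coact V v (\<lambda>h w. \<beta> h (f w)))"

definition yd_isomorphic ::
  "('k::field, 'h::ring_1) hopf \<Rightarrow> ('k, 'h, 'v::ab_group_add, 'm) yd_scheme \<Rightarrow>
    ('k, 'h, 'w::ab_group_add, 'n) yd_scheme \<Rightarrow> bool"
  where "yd_isomorphic H V W \<longleftrightarrow> (\<exists>f. yd_hom H V W f \<and> bij f)"

definition yd_sub ::
  "('k::field, 'h::ring_1) hopf \<Rightarrow> ('k, 'h, 'v::ab_group_add, 'm) yd_scheme \<Rightarrow> 'v set \<Rightarrow> bool"
  where "yd_sub H V U \<longleftrightarrow> module.subspace (scale V) U \<and>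
    (\<forall>h. \<forall>u\<in>U. act V h u \<in> U) \<and>
    (\<forall>u\<in>U. coact V u \<in> tspan (hscale H) (scale V) UNIV U)"

definition yd_simple ::
  "('k::field, 'h::ring_1) hopf \<Rightarrow> ('k, 'h, 'v::ab_group_add, 'm) yd_scheme \<Rightarrow> bool"
  where "yd_simple H V \<longleftrightarrow> (UNIV :: 'v set) \<noteq> {0} \<and>
    (\<forall>U. yd_sub H V U \<longrightarrow> U = {0} \<or> U = UNIV)"

definition yd_indecomposable ::
  "('k::field, 'h::ring_1) hopf \<Rightarrow> ('k, 'h, 'v::ab_group_add, 'm) yd_scheme \<Rightarrow> bool"
  where "yd_indecomposable H V \<longleftrightarrow> (UNIV :: 'v set) \<noteq> {0} \<and>
    (\<forall>U W. yd_sub H V U \<and> yd_sub H V W \<and> U \<inter> W = {0} \<and> (\<forall>v. \<exists>u\<in>U. \<exists>w\<in>W. v = u + w)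
      \<longrightarrow> U = {0} \<or> W = {0})"

section \<open>Nichols algebras\<close>

record ('k, 'h, 'r) braided_hopf = "('k, 'h, 'r) yd" +
  bcomult :: "'r \<Rightarrow> ('k, 'r, 'r) tensor"
  bcounit :: "'r \<Rightarrow> 'k"
  bantipode :: "'r \<Rightarrow> 'r"

text \<open>
  A Hopf algebra in the braided category of Yetter-Drinfeld modules: all structure maps are
  morphisms of Yetter-Drinfeld modules (with the diagonal action and codiagonal coaction on
  \<open>R \<otimes> R\<close>), and the comultiplication is multiplicative for the product
  \<open>(r \<otimes> s)(r' \<otimes> s') = r (s\<^sub>-\<^sub>1 \<cdot> r') \<otimes> s\<^sub>0 s'\<close> on \<open>R \<otimes> R\<close> coming from the braiding.
\<close>

definition braided_hopf_algebra ::
  "('k::field, 'h::ring_1) hopf \<Rightarrow> ('k, 'h, 'r::ring_1) braided_hopf \<Rightarrow> bool"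
  where "braided_hopf_algebra H R \<longleftrightarrow>
    (let s = hscale H; \<Delta>\<^sub>H = comult H; \<epsilon>\<^sub>H = counit H;
         t = scale R; \<rho> = act R; \<delta> = coact R;
         \<Delta> = bcomult R; \<epsilon> = bcounit R; S = bantipode R in
      yd_module H R \<and>
      algebra t \<and>
      (\<forall>h. \<rho> h 1 = t (\<epsilon>\<^sub>H h) 1) \<and>
      (\<forall>h x y \<phi>. linform t \<phi> \<longrightarrow> \<phi> (\<rho> h (x * y)) = \<Delta>\<^sub>H h (\<lambda>h1 h2. \<phi> (\<rho> h1 x * \<rho> h2 y))) \<and>
      \<delta> 1 = pure s t 1 1 \<and>
      (\<forall>x y \<beta>. bilform s t \<beta> \<longrightarrow>
        \<delta> (x * y) \<beta> = \<delta> x (\<lambda>g x0. \<delta> y (\<lambda>h y0. \<beta> (g * h) (x0 * y0)))) \<and>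
      Vector_Spaces.linear t tscale \<Delta> \<and> (\<forall>x. \<Delta> x \<in> tensors t t) \<and>
      linform t \<epsilon> \<and>
      (\<forall>x \<tau>. trilform t t t \<tau> \<longrightarrow>
        \<Delta> x (\<lambda>u w. \<Delta> u (\<lambda>u' v. \<tau> u' v w)) = \<Delta> x (\<lambda>u v. \<Delta> v (\<lambda>v' w. \<tau> u v' w))) \<and>
      (\<forall>x \<phi>. linform t \<phi> \<longrightarrow>
        \<Delta> x (\<lambda>u v. \<epsilon> u * \<phi> v) = \<phi> x \<and> \<Delta> x (\<lambda>u v. \<phi> u * \<epsilon> v) = \<phi> x) \<and>
      (\<forall>h x \<beta>. bilform t t \<beta> \<longrightarrow>
        \<Delta> (\<rho> h x) \<beta> = \<Delta>\<^sub>H h (\<lambda>h1 h2. \<Delta> x (\<lambda>u v. \<beta> (\<rho> h1 u) (\<rho> h2 v)))) \<and>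
      (\<forall>h x. \<epsilon> (\<rho> h x) = \<epsilon>\<^sub>H h * \<epsilon> x) \<and>
      (\<forall>x \<tau>. trilform s t t \<tau> \<longrightarrow>
        \<delta> x (\<lambda>h x0. \<Delta> x0 (\<lambda>u v. \<tau> h u v)) =
        \<Delta> x (\<lambda>u v. \<delta> u (\<lambda>g u0. \<delta> v (\<lambda>h v0. \<tau> (g * h) u0 v0)))) \<and>
      (\<forall>x \<phi>. linform s \<phi> \<longrightarrow> \<delta> x (\<lambda>h x0. \<phi> h * \<epsilon> x0) = \<phi> 1 * \<epsilon> x) \<and>
      \<Delta> 1 = pure t t 1 1 \<and>
      (\<forall>x y \<beta>. bilform t t \<beta> \<longrightarrow>
        \<Delta> (x * y) \<beta> =
          \<Delta> x (\<lambda>x1 x2. \<Delta> y (\<lambda>y1 y2. \<delta> x2 (\<lambda>h x20. \<beta> (x1 * \<rho> h y1) (x20 * y2))))) \<and>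
      \<epsilon> 1 = 1 \<and> (\<forall>x y. \<epsilon> (x * y) = \<epsilon> x * \<epsilon> y) \<and>
      yd_hom H R R S \<and>
      (\<forall>x \<phi>. linform t \<phi> \<longrightarrow>
        \<Delta> x (\<lambda>u v. \<phi> (S u * v)) = \<epsilon> x * \<phi> 1 \<and> \<Delta> x (\<lambda>u v. \<phi> (u * S v)) = \<epsilon> x * \<phi> 1))"

definition graded_braided_hopf_algebra ::
  "('k::field, 'h::ring_1) hopf \<Rightarrow> ('k, 'h, 'r::ring_1) braided_hopf \<Rightarrow> (nat \<Rightarrow> 'r set) \<Rightarrow> bool"
  where "graded_braided_hopf_algebra H R G \<longleftrightarrow>
    braided_hopf_algebra H R \<and>
    (\<forall>n. yd_sub H R (G n)) \<and>
    module.span (scale R) (\<Union>n. G n) = UNIV \<and>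
    (\<forall>n. G n \<inter> module.span (scale R) (\<Union>m\<in>-{n}. G m) = {0}) \<and>
    1 \<in> G 0 \<and>
    (\<forall>m n. \<forall>x\<in>G m. \<forall>y\<in>G n. x * y \<in> G (m + n)) \<and>
    (\<forall>n. \<forall>x\<in>G n. bcomult R x \<in>
      module.span tscale (\<Union>i\<le>n. tspan (scale R) (scale R) (G i) (G (n - i)))) \<and>
    (\<forall>n>0. \<forall>x\<in>G n. bcounit R x = 0) \<and>
    (\<forall>n. bantipode R ` G n \<subseteq> G n)"

definition primitives :: "('k::field, 'h, 'r::ring_1) braided_hopf \<Rightarrow> 'r set"
  where "primitives R =
    {x. bcomult R x = pure (scale R) (scale R) x 1 + pure (scale R) (scale R) 1 x}"

text \<open>
  \<open>nichols_algebra H V R \<iota>\<close>: \<open>R\<close> is a realization of the Nichols algebra of \<open>V\<close>, with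
  \<open>\<iota>\<close> the identification of \<open>V\<close> with \<open>R(1)\<close>.
\<close>

definition nichols_algebra ::
  "('k::field, 'h::ring_1) hopf \<Rightarrow> ('k, 'h, 'v::ab_group_add) yd \<Rightarrow>
    ('k, 'h, 'r::ring_1) braided_hopf \<Rightarrow> ('v \<Rightarrow> 'r) \<Rightarrow> bool"
  where "nichols_algebra H V R \<iota> \<longleftrightarrow>
    (\<exists>G. graded_braided_hopf_algebra H R G \<and>
      G 0 = range (\<lambda>c. scale R c 1) \<and>
      yd_hom H V R \<iota> \<and> inj \<iota> \<and> range \<iota> = G 1 \<and>
      subalgebra (scale R) hull (G 1) = UNIV \<and>
      primitives R = G 1)"

section \<open>The 12-dimensional Hopf algebra and its simple objects\<close>

definition primitive_6th_root :: "'k::field \<Rightarrow> bool"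
  where "primitive_6th_root \<xi> \<longleftrightarrow> \<xi> ^ 6 = 1 \<and> (\<forall>n. 0 < n \<and> n < 6 \<longrightarrow> \<xi> ^ n \<noteq> 1)"

definition is_C :: "'k::field \<Rightarrow> ('k, 'h::ring_1) hopf \<Rightarrow> 'h \<Rightarrow> 'h \<Rightarrow> bool"
  where "is_C \<xi> H a b \<longleftrightarrow>
    (let T = pure (hscale H) (hscale H) in
      hopf_algebra H \<and>
      has_dim (hscale H) 12 \<and>
      presented_by (hscale H) (gens a b)
        {var GX ^ 6 - 1, var GY ^ 2, var GY * var GX - \<xi> \<cdot> (var GX * var GY)} \<and>
      comult H a = T a a + tscale (\<xi> ^ 4 + \<xi> ^ 5) (T b (b * a ^ 3)) \<and>
      comult H b = T b (a ^ 4) + T a b \<and>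
      counit H a = 1 \<and> counit H b = 0 \<and>
      antipode H a = a ^ 5 \<and> antipode H b = hscale H (\<xi> powi (-2)) (b * a))"

text \<open>Integer powers of \<open>a\<close>, using \<open>a\<^sup>6 = 1\<close>.\<close>

definition apow :: "'h::ring_1 \<Rightarrow> int \<Rightarrow> 'h"
  where "apow a n = a ^ nat (n mod 6)"

text \<open>
  \<open>is_chi \<xi> H a b i V v\<close> says that \<open>V\<close> is the one-dimensional object of index \<open>i\<close> spanned by \<open>v\<close>,
  and \<open>is_V \<xi> H a b i j V v\<^sub>1 v\<^sub>2\<close> that \<open>V\<close> is the object \<open>V\<^sub>i\<^sub>,\<^sub>j\<close> with its distinguished basis.
  The action is determined by its values on the generators \<open>a\<close>, \<open>b\<close>.
  All formulas depend only on \<open>i\<close> and \<open>j\<close> modulo 6.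
\<close>

definition is_chi ::
  "'k::field \<Rightarrow> ('k, 'h::ring_1) hopf \<Rightarrow> 'h \<Rightarrow> 'h \<Rightarrow> int \<Rightarrow>
    ('k, 'h, 'v::ab_group_add) yd \<Rightarrow> 'v \<Rightarrow> bool"
  where "is_chi \<xi> H a b i V v \<longleftrightarrow>
    yd_module H V \<and> has_basis (scale V) {v} \<and>
    act V a v = scale V (\<xi> powi i) v \<and> act V b v = 0 \<and>
    coact V v = pure (hscale H) (scale V) (apow a (3 * i)) v"

definition is_V ::
  "'k::field \<Rightarrow> ('k, 'h::ring_1) hopf \<Rightarrow> 'h \<Rightarrow> 'h \<Rightarrow> int \<Rightarrow> int \<Rightarrow>
    ('k, 'h, 'v::ab_group_add) yd \<Rightarrow> 'v \<Rightarrow> 'v \<Rightarrow> bool"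
  where "is_V \<xi> H a b i j V v\<^sub>1 v\<^sub>2 \<longleftrightarrow>
    (let T = pure (hscale H) (scale V) in
      (3 * i) mod 6 \<noteq> j mod 6 \<and>
      yd_module H V \<and> v\<^sub>1 \<noteq> v\<^sub>2 \<and> has_basis (scale V) {v\<^sub>1, v\<^sub>2} \<and>
      act V a v\<^sub>1 = scale V (\<xi> powi i) v\<^sub>1 \<and> act V b v\<^sub>1 = 0 \<and>
      act V a v\<^sub>2 = scale V (\<xi> powi (i + 1)) v\<^sub>2 \<and> act V b v\<^sub>2 = v\<^sub>1 \<and>
      coact V v\<^sub>1 = T (apow a (- j)) v\<^sub>1 +
        tscale (\<xi> ^ 4 * (\<xi> powi (4 * i) - \<xi> powi (i + j))) (T (b * apow a (- 1 - j)) v\<^sub>2) \<and>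
      coact V v\<^sub>2 = T (apow a (3 - j)) v\<^sub>2 +
        tscale (\<xi> powi (2 * i) + \<xi> powi (j - i)) (T (b * apow a (2 - j)) v\<^sub>1))"

definition iso_to_chi ::
  "'k::field \<Rightarrow> ('k, 'h::ring_1) hopf \<Rightarrow> 'h \<Rightarrow> 'h \<Rightarrow> int \<Rightarrow>
    ('k, 'h, 'v::ab_group_add) yd \<Rightarrow> bool"
  where "iso_to_chi \<xi> H a b i V \<longleftrightarrow>
    (\<exists>W :: ('k, 'h, 'k) yd. scale W = (*) \<and> is_chi \<xi> H a b i W 1 \<and> yd_isomorphic H V W)"

definition iso_to_V ::
  "'k::field \<Rightarrow> ('k, 'h::ring_1) hopf \<Rightarrow> 'h \<Rightarrow> 'h \<Rightarrow> int \<Rightarrow> int \<Rightarrow>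
    ('k, 'h, 'v::ab_group_add) yd \<Rightarrow> bool"
  where "iso_to_V \<xi> H a b i j V \<longleftrightarrow>
    (\<exists>W :: ('k, 'h, 'k \<times> 'k) yd. scale W = (\<lambda>c (x, y). (c * x, c * y)) \<and>
      is_V \<xi> H a b i j W (1, 0) (0, 1) \<and> yd_isomorphic H V W)"

end

theory Submission
  imports Defs
begin

text \<open>
  Why the theorem holds.  In a Nichols algebra an element of positive degree vanishes as soon as all
  its skew derivatives vanish: such an element would be primitive of degree at least two.  The
  component of degree \<open>(n - 1, 1)\<close> of the comultiplication, which \<open>derives\<close> records as a list of pairs,
  is a complete set of such derivatives, and the braiding on \<open>V\<close> alone determines it on products of
  generators (\<open>derives_mult\<close>, \<open>derives_nil_imp_zero\<close>).  All that is needed from the Hopf algebra is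
  therefore the braiding on \<open>V\<close>.

  Infinite dimension comes from trivial braidings.  If some subquotient of \<open>V\<close> is spanned by a
  vector with \<open>c (v \<otimes> v) = v \<otimes> v\<close>, then \<open>n\<close> successive derivatives of \<open>v\<^sup>n\<close> give \<open>n!\<close>, so no power of \<open>v\<close>
  vanishes and the algebra is infinite-dimensional (\<open>infinite_if_braiding_trivial\<close>).

  Classification of \<open>V\<close>.  The action of \<open>a\<close> and the grouplike part of the coaction commute and have
  order six, so \<open>V\<close> is a sum of weight spaces; \<open>b\<close> and the part \<open>X\<close> of the coaction at \<open>b\<close> are odd
  operators moving between them.  The weights also define an automorphism \<open>z\<close> of \<open>V\<close> with \<open>z\<^sup>6 = 1\<close>; its
  fixed space is a direct summand, hence everything or zero (\<open>indecomposable_z\<close>).  If \<open>z\<close> is trivial,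
  either all weights of \<open>a\<close> are odd, whence \<open>b\<close> and \<open>X\<close> act by zero and \<open>V\<close> is a \<open>\<chi>\<^sup>k\<close> with \<open>k\<close> odd, or a
  vector of even weight provides a trivial braiding.  If \<open>z\<close> has no fixed vector, \<open>b\<close> and \<open>X\<close> satisfy a
  Clifford-type relation whose right-hand side is invertible, and an
  indecomposable \<open>V\<close> is some \<open>V\<^sub>i\<^sub>,\<^sub>j\<close> (\<open>indecomposable_V\<close>); unless \<open>(i, j)\<close> is one of the twelve listed
  pairs, one of its two diagonal braiding coefficients is one.

  The presentations.  For each of these \<open>V\<close> every coefficient of the braiding is an Eisenstein integer
  in a primitive sixth root of unity \<open>\<zeta>\<close>, so the claims reduce to finite computations: the relations
  have vanishing derivatives; they rewrite every word to a combination of \<open>n\<close> chosen monomials;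
  and those monomials are independent, because multiplying a combination by suitable
  words isolates a coefficient times the monomial of top degree, which a chain of derivatives shows
  to be nonzero.  The data of such a computation is a certificate; its correctness is
  \<open>certificate_sound\<close>, and it is evaluated once per family with \<open>\<zeta> = \<xi>\<^sup>j\<close>, so that \<open>j = 1\<close> and \<open>j = 5\<close> are
  treated together wherever the two cases are conjugate.
\<close>


section \<open>Linear and bilinear forms\<close>

lemma linear_simps:
  assumes "Vector_Spaces.linear s t f"
  shows "f (x + y) = f x + f y" "f (s c x) = t c (f x)" "f 0 = 0" "f (- x) = - f x"
    "f (x - y) = f x - f y"
proof -
  interpret Vector_Spaces.linear s t f by fact
  show "f (x + y) = f x + f y" "f (s c x) = t c (f x)" "f 0 = 0" "f (- x) = - f x"
    "f (x - y) = f x - f y"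
    by (rule add scale zero neg diff)+
qed

lemma linear_sum_list:
  assumes "Vector_Spaces.linear s t f"
  shows "f (\<Sum>x\<leftarrow>xs. g x) = (\<Sum>x\<leftarrow>xs. f (g x))"
  by (induction xs) (simp_all add: linear_simps[OF assms])

lemma linearI:
  assumes "vector_space s" "vector_space t" "\<And>x y. f (x + y) = f x + f y"
    "\<And>c x. f (s c x) = t c (f x)"
  shows "Vector_Spaces.linear s t f"
proof -
  interpret s: vector_space s by fact
  interpret t: vector_space t by fact
  show ?thesis by unfold_locales (fact assms(3,4))+
qed

lemma vector_space_times: "vector_space ((*) :: 'k::field \<Rightarrow> 'k \<Rightarrow> 'k)"
  by standard (auto simp: algebra_simps)

lemma linear_imp_vector_space:
  assumes "Vector_Spaces.linear s t f" shows "vector_space s" "vector_space t"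
proof -
  interpret Vector_Spaces.linear s t f by fact
  show "vector_space s" "vector_space t" by unfold_locales
qed

lemma linformI:
  assumes "vector_space s" "\<And>x y. f (x + y) = f x + f y" "\<And>c x. f (s c x) = c * f x"
  shows "linform s f"
  unfolding linform_def by (intro linearI vector_space_times assms)

lemmas linform_simps = linear_simps[OF iffD1[OF linform_def]]
lemmas linform_sum_list = linear_sum_list[OF iffD1[OF linform_def]]

lemma bilformI:
  assumes "vector_space s" "vector_space t"
    "\<And>x y w. \<beta> (x + y) w = \<beta> x w + \<beta> y w" "\<And>c x w. \<beta> (s c x) w = c * \<beta> x w"
    "\<And>x v w. \<beta> x (v + w) = \<beta> x v + \<beta> x w" "\<And>c x w. \<beta> x (t c w) = c * \<beta> x w"
  shows "bilform s t \<beta>"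
  unfolding bilform_def by (intro conjI allI linformI assms)

lemma bilform_simps:
  assumes "bilform s t \<beta>"
  shows "\<beta> (x + y) w = \<beta> x w + \<beta> y w" "\<beta> (s c x) w = c * \<beta> x w" "\<beta> 0 w = 0"
    "\<beta> (x - y) w = \<beta> x w - \<beta> y w" "\<beta> (- x) w = - \<beta> x w"
    "\<beta> x (v + w) = \<beta> x v + \<beta> x w" "\<beta> x (t c w) = c * \<beta> x w" "\<beta> x 0 = 0"
    "\<beta> x (v - w) = \<beta> x v - \<beta> x w" "\<beta> x (- w) = - \<beta> x w"
proof -
  have 1: "linform s (\<lambda>v. \<beta> v w)" for w using assms by (simp add: bilform_def)
  have 2: "linform t (\<lambda>w. \<beta> v w)" for v using assms by (simp add: bilform_def)
  show "\<beta> (x + y) w = \<beta> x w + \<beta> y w" "\<beta> (s c x) w = c * \<beta> x w" "\<beta> 0 w = 0"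
    "\<beta> (x - y) w = \<beta> x w - \<beta> y w" "\<beta> (- x) w = - \<beta> x w"
    by (rule linform_simps[OF 1])+
  show "\<beta> x (v + w) = \<beta> x v + \<beta> x w" "\<beta> x (t c w) = c * \<beta> x w" "\<beta> x 0 = 0"
    "\<beta> x (v - w) = \<beta> x v - \<beta> x w" "\<beta> x (- w) = - \<beta> x w"
    by (rule linform_simps[OF 2])+
qed

lemma bilform_prod:
  assumes "linform s \<phi>" "linform t \<psi>"
  shows "bilform s t (\<lambda>x y. \<phi> x * \<psi> y)"
proof -
  have "vector_space s" "vector_space t"
    using assms linear_imp_vector_space unfolding linform_def by blast+
  then show ?thesis
    by (rule bilformI) (simp_all add: linform_simps[OF assms(1)] linform_simps[OF assms(2)] algebra_simps)
qed

lemma bilform_compose: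
  assumes "bilform s t \<beta>" "Vector_Spaces.linear s' s f" "Vector_Spaces.linear t' t g"
  shows "bilform s' t' (\<lambda>x y. \<beta> (f x) (g y))"
  by (rule bilformI)
    (use assms(2,3) linear_imp_vector_space in
      \<open>auto simp: linear_simps[OF assms(2)] linear_simps[OF assms(3)] bilform_simps[OF assms(1)]\<close>)

section \<open>Tensors as finite sums\<close>

text \<open>Evaluation of the tensor \<open>\<Sum> v \<otimes> w\<close>, the sum over a list of pairs, at a bilinear form.\<close>

definition lsum :: "('v \<times> 'w) list \<Rightarrow> ('v \<Rightarrow> 'w \<Rightarrow> 'k) \<Rightarrow> 'k::comm_monoid_add"
  where "lsum L \<beta> = (\<Sum>(v, w)\<leftarrow>L. \<beta> v w)"

lemma lsum_simps [simp]:
  "lsum [] \<beta> = 0" "lsum ((v, w) # L) \<beta> = \<beta> v w + lsum L \<beta>" "lsum (L @ M) \<beta> = lsum L \<beta> + lsum M \<beta>"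
  by (simp_all add: lsum_def)

lemma lsum_map: "lsum (map (\<lambda>(p, q). (f p q, g p q)) L) \<beta> = lsum L (\<lambda>p q. \<beta> (f p q) (g p q))"
  by (induction L) auto

lemma lsum_concat:
  "lsum (concat (map (\<lambda>(p, q). M p q) L)) \<beta> = lsum L (\<lambda>p q. lsum (M p q) \<beta>)"
  by (induction L) auto

lemma lsum_cong:
  "(\<And>p q. (p, q) \<in> set L \<Longrightarrow> \<beta> p q = \<gamma> p q) \<Longrightarrow> lsum L \<beta> = lsum L \<gamma>"
  by (induction L) auto

lemma lsum_add: "lsum L (\<lambda>p q. \<beta> p q + \<gamma> p q) = lsum L \<beta> + lsum L \<gamma>"
  by (induction L) (auto simp: algebra_simps)

lemma lsum_mult: "lsum L (\<lambda>p q. c * \<beta> p q) = c * (lsum L \<beta> :: 'k::comm_semiring_0)"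
  by (induction L) (auto simp: algebra_simps)

lemma lsum_mult_right: "lsum L (\<lambda>p q. \<beta> p q * c) = (lsum L \<beta> :: 'k::comm_semiring_0) * c"
  by (induction L) (auto simp: algebra_simps)

lemma lsum_zero: "lsum L (\<lambda>p q. 0) = 0"
  by (induction L) auto

lemma tspan_list:
  fixes s :: "'k::field \<Rightarrow> 'v::ab_group_add \<Rightarrow> 'v" and t :: "'k \<Rightarrow> 'w::ab_group_add \<Rightarrow> 'w"
  assumes "vector_space s" "vector_space t" and T: "T \<in> tspan s t A B" and A: "\<And>c x. x \<in> A \<Longrightarrow> s c x \<in> A"
  obtains L where "set L \<subseteq> A \<times> B"
    and "\<And>\<beta>. bilform s t \<beta> \<Longrightarrow> T \<beta> = lsum L \<beta>" "\<And>\<beta>. \<not> bilform s t \<beta> \<Longrightarrow> T \<beta> = 0"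
proof -
  interpret M: vector_space "tscale :: 'k \<Rightarrow> ('k, 'v, 'w) tensor \<Rightarrow> ('k, 'v, 'w) tensor"
    by (rule vector_space_tscale)
  have "\<exists>L. set L \<subseteq> A \<times> B \<and> (\<forall>\<beta>. T \<beta> = (if bilform s t \<beta> then lsum L \<beta> else 0))"
    using T unfolding tspan_def
  proof (induction rule: M.span_induct_alt)
    case base
    show ?case by (rule exI[of _ "[]"]) (simp add: zero_fun_def)
  next
    case (step c x y)
    then obtain v w L where *: "x = pure s t v w" "v \<in> A" "w \<in> B" "set L \<subseteq> A \<times> B"
      "\<forall>\<beta>. y \<beta> = (if bilform s t \<beta> then lsum L \<beta> else 0)" by blast
    show ?case
      by (rule exI[of _ "(s c v, w) # L"])
        (use * A in \<open>auto simp: tscale_def plus_fun_def pure_def bilform_simps\<close>)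
  qed
  then show ?thesis using that by metis
qed

lemma pure_in_tspan:
  fixes s :: "'k::field \<Rightarrow> 'v::ab_group_add \<Rightarrow> 'v" and t :: "'k \<Rightarrow> 'w::ab_group_add \<Rightarrow> 'w"
  shows "v \<in> A \<Longrightarrow> w \<in> B \<Longrightarrow> pure s t v w \<in> tspan s t A B"
proof -
  interpret M: vector_space "tscale :: 'k \<Rightarrow> ('k, 'v, 'w) tensor \<Rightarrow> ('k, 'v, 'w) tensor"
    by (rule vector_space_tscale)
  show "v \<in> A \<Longrightarrow> w \<in> B \<Longrightarrow> pure s t v w \<in> tspan s t A B"
    unfolding tspan_def by (rule M.span_base) blast
qed

lemma tspan_closed:
  fixes s :: "'k::field \<Rightarrow> 'v::ab_group_add \<Rightarrow> 'v" and t :: "'k \<Rightarrow> 'w::ab_group_add \<Rightarrow> 'w"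
  shows "0 \<in> tspan s t A B" "T \<in> tspan s t A B \<Longrightarrow> U \<in> tspan s t A B \<Longrightarrow> T + U \<in> tspan s t A B"
    "T \<in> tspan s t A B \<Longrightarrow> tscale c T \<in> tspan s t A B"
proof -
  interpret M: vector_space "tscale :: 'k \<Rightarrow> ('k, 'v, 'w) tensor \<Rightarrow> ('k, 'v, 'w) tensor"
    by (rule vector_space_tscale)
  show "0 \<in> tspan s t A B" "T \<in> tspan s t A B \<Longrightarrow> U \<in> tspan s t A B \<Longrightarrow> T + U \<in> tspan s t A B"
    "T \<in> tspan s t A B \<Longrightarrow> tscale c T \<in> tspan s t A B"
    unfolding tspan_def by (auto intro: M.span_zero M.span_add M.span_scale)
qed

text \<open>
  Product forms separate tensors: expanding both legs of the finitely many pure tensors in a basis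
  writes the value at an arbitrary form as a combination of values at products of coordinate forms.
\<close>

lemma product_forms_separate:
  fixes s :: "'k::field \<Rightarrow> 'v::ab_group_add \<Rightarrow> 'v" and t :: "'k \<Rightarrow> 'w::ab_group_add \<Rightarrow> 'w"
  assumes s: "vector_space s" and t: "vector_space t"
    and eq: "\<And>\<phi> \<psi>. linform s \<phi> \<Longrightarrow> linform t \<psi> \<Longrightarrow> lsum L (\<lambda>x y. \<phi> x * \<psi> y) = 0"
    and \<beta>: "bilform s t \<beta>"
  shows "lsum L \<beta> = 0"
proof -
  interpret s: vector_space s by fact
  interpret t: vector_space t by fact
  define B where "B = s.extend_basis {}"
  have ind: "s.independent B" and sp: "s.span B = UNIV"
    unfolding B_def using s.independent_extend_basis[OF s.independent_empty] s.span_extend_basis[OF s.independent_empty]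
    by auto
  define r where "r = s.representation B"
  have r_add: "r (x + y) b = r x b + r y b" and r_sc: "r (s c x) b = c * r x b" for x y b c
    unfolding r_def using s.representation_add[OF ind] s.representation_scale[OF ind] sp by auto
  have r_lin: "linform s (\<lambda>x. r x b)" for b
    by (rule linformI[OF s]) (simp_all add: r_add r_sc)
  have expand: "\<exists>F0. finite F0 \<and> (\<forall>F. finite F \<longrightarrow> F0 \<subseteq> F \<longrightarrow>
      lsum L \<beta> = (\<Sum>b\<in>F. lsum L (\<lambda>x y. r x b * \<beta> b y)))" for L
  proof (induction L)
    case Nil
    then show ?case by auto
  next
    case (Cons a L)
    obtain x y where a: "a = (x, y)" by (cases a)
    from Cons obtain F0 where F0: "finite F0" "\<And>F. finite F \<Longrightarrow> F0 \<subseteq> F \<Longrightarrow>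
      lsum L \<beta> = (\<Sum>b\<in>F. lsum L (\<lambda>x y. r x b * \<beta> b y))" by blast
    define X where "X = {b. r x b \<noteq> 0}"
    have X: "finite X" unfolding X_def r_def by (rule s.finite_representation)
    have "\<beta> x y = (\<Sum>b\<in>F. r x b * \<beta> b y)" if "finite F" "X \<subseteq> F" for F
    proof -
      have "x = (\<Sum>b\<in>X. s (r x b) b)"
        unfolding X_def r_def using s.sum_nonzero_representation_eq[OF ind, of x] sp by simp
      then have "\<beta> x y = \<beta> (\<Sum>b\<in>X. s (r x b) b) y" by simp
      also have "\<dots> = (\<Sum>b\<in>X. r x b * \<beta> b y)"
        using X by (induction X rule: finite_induct) (auto simp: bilform_simps[OF \<beta>])
      also have "\<dots> = (\<Sum>b\<in>F. r x b * \<beta> b y)"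
        by (rule sum.mono_neutral_left) (use that in \<open>auto simp: X_def\<close>)
      finally show ?thesis .
    qed
    then show ?case
      by (intro exI[of _ "F0 \<union> X"])
        (use F0 X in \<open>auto simp: a sum.distrib\<close>)
  qed
  obtain F where F: "finite F" "lsum L \<beta> = (\<Sum>b\<in>F. lsum L (\<lambda>x y. r x b * \<beta> b y))"
    using expand by blast
  have "lsum L (\<lambda>x y. r x b * \<beta> b y) = 0" for b
  proof (rule eq[OF r_lin])
    show "linform t (\<beta> b)" using \<beta> by (simp add: bilform_def)
  qed
  then show ?thesis using F by simp
qed

section \<open>Skew derivations of a Nichols algebra\<close>

declare One_nat_def [simp del]

lemma linear_ext_span:
  assumes f: "Vector_Spaces.linear s t f" and g: "Vector_Spaces.linear s t g"
    and B: "module.span s B = UNIV" and eq: "\<And>b. b \<in> B \<Longrightarrow> f b = g b"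
  shows "f = g"
proof
  fix x
  interpret s: vector_space s using f by (rule linear_imp_vector_space)
  have "x \<in> s.span B" using B by simp
  then show "f x = g x"
    by (induction rule: s.span_induct_alt) (simp_all add: linear_simps[OF f] linear_simps[OF g] eq)
qed

lemma tscale_apply [simp]: "tscale c T \<beta> = c * T \<beta>"
  by (simp add: tscale_def)

lemma bilform_left_simps:
  assumes "bilform s t \<beta>"
  shows "\<beta> (x + y) = (\<lambda>w. \<beta> x w + \<beta> y w)" "\<beta> (s c x) = (\<lambda>w. c * \<beta> x w)"
  by (rule ext, simp add: bilform_simps[OF assms])+

locale nichols =
  fixes H :: "('k::field, 'h::ring_1) hopf"
    and V :: "('k, 'h, 'v::ab_group_add) yd"
    and R :: "('k, 'h, 'r::ring_1) braided_hopf"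
    and \<iota> :: "'v \<Rightarrow> 'r" and G :: "nat \<Rightarrow> 'r set"
  assumes hopf: "hopf_algebra H" and ydV: "yd_module H V"
    and graded: "graded_braided_hopf_algebra H R G"
    and G0: "G 0 = range (\<lambda>c. scale R c 1)"
    and hom: "yd_hom H V R \<iota>" and inj: "inj \<iota>" and G1: "range \<iota> = G 1"
    and gen: "subalgebra (scale R) hull (G 1) = UNIV"
    and prim: "primitives R = G 1"
begin

abbreviation sH where "sH \<equiv> hscale H"
abbreviation sV where "sV \<equiv> scale V"
abbreviation sR where "sR \<equiv> scale R"

lemma bh: "braided_hopf_algebra H R"
  using graded by (simp add: graded_braided_hopf_algebra_def)

lemma ydR: "yd_module H R"
  using bh unfolding braided_hopf_algebra_def Let_def by blast

lemma algR: "algebra sR"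
  using bh unfolding braided_hopf_algebra_def Let_def by blast

lemma vsR: "vector_space sR"
  using algR by (simp add: algebra_def)

lemma vsV: "vector_space sV"
  using ydV unfolding yd_module_def Let_def by blast

lemma vsH: "vector_space sH"
  using hopf unfolding hopf_algebra_def Let_def algebra_def by blast

sublocale R: vector_space sR by (rule vsR)
sublocale V: vector_space sV by (rule vsV)

lemma mult_sR: "sR c x * y = sR c (x * y)" "x * sR c y = sR c (x * y)"
  using algR unfolding algebra_def by metis+

lemma comult_linear: "Vector_Spaces.linear sR tscale (bcomult R)"
  using bh unfolding braided_hopf_algebra_def Let_def by blast

lemma comult_in: "bcomult R x \<in> tensors sR sR"
  using bh unfolding braided_hopf_algebra_def Let_def by (elim conjE) (erule spec)

lemma counit_linform: "linform sR (bcounit R)"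
  using bh unfolding braided_hopf_algebra_def Let_def by blast

lemma coassoc: "trilform sR sR sR \<tau> \<Longrightarrow>
    bcomult R x (\<lambda>u w. bcomult R u (\<lambda>u' v. \<tau> u' v w)) = bcomult R x (\<lambda>u v. bcomult R v (\<lambda>v' w. \<tau> u v' w))"
  using bh unfolding braided_hopf_algebra_def Let_def by blast

lemma counit: "linform sR \<phi> \<Longrightarrow> bcomult R x (\<lambda>u v. bcounit R u * \<phi> v) = \<phi> x"
    "linform sR \<phi> \<Longrightarrow> bcomult R x (\<lambda>u v. \<phi> u * bcounit R v) = \<phi> x"
  using bh unfolding braided_hopf_algebra_def Let_def by blast+

lemma comult_one: "bcomult R 1 = pure sR sR 1 1"
  using bh unfolding braided_hopf_algebra_def Let_def by blast

lemma comult_mult: "bilform sR sR \<beta> \<Longrightarrow> bcomult R (x * y) \<beta> =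
    bcomult R x (\<lambda>x1 x2. bcomult R y (\<lambda>y1 y2. coact R x2 (\<lambda>h x20. \<beta> (x1 * act R h y1) (x20 * y2))))"
  using bh unfolding braided_hopf_algebra_def Let_def by blast

lemma counit_one: "bcounit R 1 = 1"
  using bh unfolding braided_hopf_algebra_def Let_def by blast

lemma act_one: "act R h 1 = sR (counit H h) 1"
  using bh unfolding braided_hopf_algebra_def Let_def by (elim conjE) (erule spec)

lemma act_linear: "Vector_Spaces.linear sH sR (\<lambda>h. act R h v)" "Vector_Spaces.linear sR sR (act R h)"
  using ydR unfolding yd_module_def Let_def by blast+

lemma coact_linear: "Vector_Spaces.linear sR tscale (coact R)"
  using ydR unfolding yd_module_def Let_def by blast

lemma coact_in: "coact R x \<in> tensors sH sR"
  using ydR unfolding yd_module_def Let_def by blast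

lemma coact_counit: "linform sR \<phi> \<Longrightarrow> coact R v (\<lambda>h w. counit H h * \<phi> w) = \<phi> v"
  using ydR unfolding yd_module_def Let_def by blast

lemma iota_linear: "Vector_Spaces.linear sV sR \<iota>"
  and iota_act: "\<iota> (act V h v) = act R h (\<iota> v)"
  and iota_coact: "bilform sH sR \<beta> \<Longrightarrow> coact R (\<iota> v) \<beta> = coact V v (\<lambda>h w. \<beta> h (\<iota> w))"
  using hom unfolding yd_hom_def by blast+

lemma G_yd_sub: "yd_sub H R (G n)"
  and G_span: "R.span (\<Union>n. G n) = UNIV"
  and G_disj: "G n \<inter> R.span (\<Union>m\<in>-{n}. G m) = {0}"
  and G_one: "1 \<in> G 0"
  using graded unfolding graded_braided_hopf_algebra_def by simp_all

lemma G_sub: "R.subspace (G n)"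
  using G_yd_sub by (simp add: yd_sub_def)

lemma G_coact: "x \<in> G n \<Longrightarrow> coact R x \<in> tspan sH sR UNIV (G n)"
  using G_yd_sub by (simp add: yd_sub_def)

lemma G_mult: "x \<in> G m \<Longrightarrow> y \<in> G n \<Longrightarrow> x * y \<in> G (m + n)"
  and G_comult: "x \<in> G n \<Longrightarrow> bcomult R x \<in>
      module.span tscale (\<Union>i\<le>n. tspan sR sR (G i) (G (n - i)))"
  and G_counit: "n > 0 \<Longrightarrow> x \<in> G n \<Longrightarrow> bcounit R x = 0"
  using graded unfolding graded_braided_hopf_algebra_def by simp_all

lemma iota_G: "\<iota> v \<in> G 1" using G1 by blast

lemma iota_primitive: "bcomult R (\<iota> v) = pure sR sR (\<iota> v) 1 + pure sR sR 1 (\<iota> v)"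
  using iota_G prim by (auto simp: primitives_def)

text \<open>The projection onto the component of degree \<open>n\<close>.\<close>

definition pr :: "nat \<Rightarrow> 'r \<Rightarrow> 'r"
  where "pr n r = (SOME x. x \<in> G n \<and> r - x \<in> R.span (\<Union>m\<in>-{n}. G m))"

lemma pr_props: "pr n r \<in> G n" "r - pr n r \<in> R.span (\<Union>m\<in>-{n}. G m)"
proof -
  have "\<exists>x. x \<in> G n \<and> r - x \<in> R.span (\<Union>m\<in>-{n}. G m)"
  proof -
    have "r \<in> R.span (\<Union>n. G n)" using G_span by simp
    then show ?thesis
    proof (induction rule: R.span_induct_alt)
      case base
      then show ?case by (rule exI[of _ 0]) (simp add: R.subspace_0[OF G_sub] R.span_zero)
    next
      case (step c x y)
      then obtain m z where x: "x \<in> G m" and z: "z \<in> G n" "y - z \<in> R.span (\<Union>m\<in>-{n}. G m)" by blast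
      show ?case
      proof (cases "m = n")
        case True
        then show ?thesis using x z
          by (intro exI[of _ "sR c x + z"])
            (auto simp: R.subspace_add[OF G_sub] R.subspace_scale[OF G_sub])
      next
        case False
        then have "sR c x \<in> R.span (\<Union>m\<in>-{n}. G m)"
          using x by (intro R.span_scale R.span_base) auto
        then have "sR c x + (y - z) \<in> R.span (\<Union>m\<in>-{n}. G m)" using z(2) by (rule R.span_add)
        then show ?thesis using z(1) by (intro exI[of _ z]) (simp add: algebra_simps)
      qed
    qed
  qed
  then have "pr n r \<in> G n \<and> r - pr n r \<in> R.span (\<Union>m\<in>-{n}. G m)"
    unfolding pr_def by (rule someI_ex)
  then show "pr n r \<in> G n" "r - pr n r \<in> R.span (\<Union>m\<in>-{n}. G m)" by auto
qed

lemma pr_unique: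
  assumes "x \<in> G n" "r - x \<in> R.span (\<Union>m\<in>-{n}. G m)"
  shows "pr n r = x"
proof -
  have "(r - x) - (r - pr n r) \<in> R.span (\<Union>m\<in>-{n}. G m)"
    using assms(2) pr_props(2) by (rule R.span_diff)
  then have "pr n r - x \<in> R.span (\<Union>m\<in>-{n}. G m)" by simp
  moreover have "pr n r - x \<in> G n"
    using pr_props(1) assms(1) by (rule R.subspace_diff[OF G_sub])
  ultimately have "pr n r - x \<in> {0}" using G_disj[of n] by blast
  then show ?thesis by simp
qed

lemma pr_same: "x \<in> G n \<Longrightarrow> pr n x = x"
  by (rule pr_unique) (simp_all add: R.span_zero)

lemma pr_other: "x \<in> G m \<Longrightarrow> m \<noteq> n \<Longrightarrow> pr n x = 0"
  by (rule pr_unique) (auto intro: R.subspace_0[OF G_sub] R.span_base)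

lemma pr_linear: "Vector_Spaces.linear sR sR (pr n)"
proof (rule linearI[OF vsR vsR])
  fix x y c
  have "x + y - (pr n x + pr n y) = (x - pr n x) + (y - pr n y)" by simp
  then show "pr n (x + y) = pr n x + pr n y"
    by (intro pr_unique) (metis R.subspace_add[OF G_sub] R.span_add pr_props)+
  have "sR c x - sR c (pr n x) = sR c (x - pr n x)" by (simp add: R.scale_right_diff_distrib)
  then show "pr n (sR c x) = sR c (pr n x)"
    by (intro pr_unique) (metis R.subspace_scale[OF G_sub] R.span_scale pr_props)+
qed

lemma linform_ext:
  assumes "linform sR \<phi>" "linform sR \<psi>" "\<And>n x. x \<in> G n \<Longrightarrow> \<phi> x = \<psi> x"
  shows "\<phi> x = \<psi> x"
proof -
  have "\<phi> = \<psi>"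
    by (rule linear_ext_span[OF _ _ G_span]) (use assms in \<open>auto simp: linform_def\<close>)
  then show ?thesis by simp
qed

lemma id_linear: "Vector_Spaces.linear sR sR (\<lambda>x. x)" "Vector_Spaces.linear sH sH (\<lambda>x. x)"
  by (auto intro!: linearI vsR vsH)

lemma comult_list: "\<exists>L. \<forall>\<beta>. bilform sR sR \<beta> \<longrightarrow> bcomult R x \<beta> = lsum L \<beta>"
proof -
  obtain L where "\<And>\<beta>. bilform sR sR \<beta> \<Longrightarrow> bcomult R x \<beta> = lsum L \<beta>"
    by (rule tspan_list[OF vsR vsR comult_in[of x]]) auto
  then show ?thesis by metis
qed

lemma coact_list: "\<exists>L. \<forall>\<beta>. bilform sH sR \<beta> \<longrightarrow> coact R x \<beta> = lsum L \<beta>"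
proof -
  obtain L where "\<And>\<beta>. bilform sH sR \<beta> \<Longrightarrow> coact R x \<beta> = lsum L \<beta>"
    by (rule tspan_list[OF vsH vsR coact_in[of x]]) auto
  then show ?thesis by metis
qed

lemma pr_mult_iota: "pr 1 (q * \<iota> u) = sR (bcounit R q) (\<iota> u)"
proof -
  have "(\<lambda>q. pr 1 (q * \<iota> u)) = (\<lambda>q. sR (bcounit R q) (\<iota> u))"
  proof (rule linear_ext_span[OF _ _ G_span])
    show "Vector_Spaces.linear sR sR (\<lambda>q. pr 1 (q * \<iota> u))"
      by (rule linearI[OF vsR vsR]) (simp_all add: linear_simps[OF pr_linear] distrib_right mult_sR)
    show "Vector_Spaces.linear sR sR (\<lambda>q. sR (bcounit R q) (\<iota> u))"
      by (rule linearI[OF vsR vsR]) (simp_all add: linform_simps[OF counit_linform] R.scale_left_distrib)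
    fix q assume "q \<in> (\<Union>n. G n)"
    then obtain n where q: "q \<in> G n" by blast
    show "pr 1 (q * \<iota> u) = sR (bcounit R q) (\<iota> u)"
    proof (cases "n = 0")
      case True
      then obtain c where "q = sR c 1" using q G0 by auto
      then show ?thesis using pr_same[OF iota_G]
        by (simp add: mult_sR linear_simps[OF pr_linear] linform_simps[OF counit_linform] counit_one)
    next
      case False
      have "q * \<iota> u \<in> G (n + 1)" using q iota_G by (rule G_mult)
      then have "pr 1 (q * \<iota> u) = 0" by (rule pr_other) (use False in simp)
      then show ?thesis using G_counit[OF _ q] False by simp
    qed
  qed
  then show ?thesis by metis
qed

lemma coact_pr:
  assumes \<kappa>: "bilform sH sR \<kappa>"
  shows "coact R q (\<lambda>h w. \<kappa> h (pr n w)) = coact R (pr n q) \<kappa>"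
proof (rule linform_ext[where x = q and \<psi> = "\<lambda>q. coact R (pr n q) \<kappa>"])
  show "linform sR (\<lambda>q. coact R q (\<lambda>h w. \<kappa> h (pr n w)))"
    by (rule linformI[OF vsR]) (simp_all add: linear_simps[OF coact_linear] plus_fun_def)
  show "linform sR (\<lambda>q. coact R (pr n q) \<kappa>)"
    by (rule linformI[OF vsR]) (simp_all add: linear_simps[OF coact_linear] linear_simps[OF pr_linear] plus_fun_def)
  fix m x assume x: "x \<in> G m"
  have \<kappa>': "bilform sH sR (\<lambda>h w. \<kappa> h (pr n w))"
    by (rule bilform_compose[OF \<kappa> id_linear(2) pr_linear])
  obtain L where L: "set L \<subseteq> UNIV \<times> G m" "\<And>\<beta>. bilform sH sR \<beta> \<Longrightarrow> coact R x \<beta> = lsum L \<beta>"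
    by (rule tspan_list[OF vsH vsR G_coact[OF x]]) auto
  show "coact R x (\<lambda>h w. \<kappa> h (pr n w)) = coact R (pr n x) \<kappa>"
  proof (cases "m = n")
    case True
    have "lsum L (\<lambda>h w. \<kappa> h (pr n w)) = lsum L \<kappa>"
      by (rule lsum_cong) (use L(1) True pr_same in auto)
    then show ?thesis using x True by (simp add: L(2) \<kappa> \<kappa>' pr_same)
  next
    case False
    have "lsum L (\<lambda>h w. \<kappa> h (pr n w)) = lsum L (\<lambda>h w. 0)"
      by (rule lsum_cong) (use L(1) False pr_other in \<open>auto simp: bilform_simps[OF \<kappa>]\<close>)
    moreover have "pr n x = 0" using x False by (rule pr_other)
    ultimately show ?thesis by (simp add: L(2) \<kappa>' lsum_zero linear_simps[OF coact_linear] zero_fun_def)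
  qed
qed

text \<open>
  \<open>derives r L\<close>: the component of \<open>\<Delta> r\<close> in \<open>R \<otimes> R(1)\<close> is \<open>\<Sum> p \<otimes> \<iota> w\<close>, the sum over \<open>(p, w)\<close> in \<open>L\<close>.
  When \<open>V\<close> has a basis, the coefficients \<open>p\<close> of the basis vectors are the skew derivations of \<open>r\<close>.
\<close>

definition derives :: "'r \<Rightarrow> ('r \<times> 'v) list \<Rightarrow> bool"
  where "derives r L \<longleftrightarrow> (\<forall>\<beta>. bilform sR sR \<beta> \<longrightarrow>
    bcomult R r (\<lambda>p q. \<beta> p (pr 1 q)) = lsum L (\<lambda>p w. \<beta> p (\<iota> w)))"

lemma bilform_pr: "bilform sR sR \<beta> \<Longrightarrow> bilform sR sR (\<lambda>p q. \<beta> p (pr n q))"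
  by (rule bilform_compose[OF _ id_linear(1) pr_linear])

lemma derives_one: "derives 1 []"
  unfolding derives_def
  by (auto simp: comult_one pure_def bilform_pr pr_other[OF G_one] bilform_simps)

lemma derives_zero: "derives 0 []"
  by (simp add: derives_def linear_simps[OF comult_linear] zero_fun_def)

lemma derives_add: "derives r L \<Longrightarrow> derives r' L' \<Longrightarrow> derives (r + r') (L @ L')"
  by (simp add: derives_def linear_simps[OF comult_linear] plus_fun_def)

lemma derives_scale: "derives r L \<Longrightarrow> derives (sR c r) (map (\<lambda>(p, w). (sR c p, w)) L)"
  by (auto simp: derives_def linear_simps[OF comult_linear] lsum_map bilform_simps lsum_mult)

text \<open>
  The braided Leibniz rule for right multiplication by a primitive element: \<open>\<iota> u\<close> is either taken
  off on the right, or moved by the braiding past the factor \<open>w\<close> that is taken off.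
\<close>

lemma derives_mult:
  assumes r: "derives r L"
    and N: "\<And>p w \<beta>. (p, w) \<in> set L \<Longrightarrow> bilform sV sV \<beta> \<Longrightarrow>
      coact V w (\<lambda>h w'. \<beta> (act V h u) w') = lsum (N w) \<beta>"
  shows "derives (r * \<iota> u)
    ((r, u) # concat (map (\<lambda>(p, w). map (\<lambda>(u', w'). (p * \<iota> u', w')) (N w)) L))"
  unfolding derives_def
proof (intro allI impI)
  fix \<beta> assume \<beta>: "bilform sR sR \<beta>"
  note bs = bilform_simps[OF \<beta>] bilform_left_simps[OF \<beta>]
  define y where "y = \<iota> u"
  define \<beta>' where "\<beta>' = (\<lambda>p q. \<beta> p (pr 1 q))"
  have \<beta>': "bilform sR sR \<beta>'" unfolding \<beta>'_def by (rule bilform_pr[OF \<beta>])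
  note b's = bilform_simps[OF \<beta>']
  define \<gamma> where "\<gamma> p q = coact R q (\<lambda>h x0. \<beta> (p * act R h y) x0)" for p q
  have bil1: "bilform sH sR (\<lambda>h x0. \<beta> (p * act R h y) x0)" for p
    by (rule bilformI[OF vsH vsR]) (simp_all add: linear_simps[OF act_linear(1)] bs distrib_left mult_sR)
  have \<gamma>: "bilform sR sR \<gamma>"
  proof (rule bilformI[OF vsR vsR])
    fix p p' q q' c
    obtain N where N: "\<And>\<beta>. bilform sH sR \<beta> \<Longrightarrow> coact R q \<beta> = lsum N \<beta>" using coact_list[of q] by blast
    show "\<gamma> (p + p') q = \<gamma> p q + \<gamma> p' q" "\<gamma> (sR c p) q = c * \<gamma> p q"
      unfolding \<gamma>_def N[OF bil1] by (simp_all add: distrib_right bs lsum_add mult_sR lsum_mult)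
    show "\<gamma> p (q + q') = \<gamma> p q + \<gamma> p q'" "\<gamma> p (sR c q) = c * \<gamma> p q"
      by (simp_all add: \<gamma>_def linear_simps[OF coact_linear] plus_fun_def)
  qed
  have inner: "bcomult R y (\<lambda>y1 y2. coact R x2 (\<lambda>h x20. \<beta>' (x1 * act R h y1) (x20 * y2)))
      = \<gamma> x1 (pr 1 x2) + bcounit R x2 * \<beta> x1 y" for x1 x2
  proof -
    obtain N where N: "\<And>\<beta>. bilform sH sR \<beta> \<Longrightarrow> coact R x2 \<beta> = lsum N \<beta>" using coact_list[of x2] by blast
    have bil2: "bilform sH sR (\<lambda>h x20. \<beta>' (x1 * act R h y1) (x20 * y2))" for y1 y2
      by (rule bilformI[OF vsH vsR])
        (simp_all add: linear_simps[OF act_linear(1)] b's distrib_left distrib_right mult_sR)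
    have bil3: "bilform sR sR (\<lambda>y1 y2. coact R x2 (\<lambda>h x20. \<beta>' (x1 * act R h y1) (x20 * y2)))"
      unfolding N[OF bil2]
      by (rule bilformI[OF vsR vsR])
        (simp_all add: linear_simps[OF act_linear(2)] b's distrib_left distrib_right mult_sR lsum_add lsum_mult)
    have "bcomult R y (\<lambda>y1 y2. coact R x2 (\<lambda>h x20. \<beta>' (x1 * act R h y1) (x20 * y2))) =
        coact R x2 (\<lambda>h x20. \<beta>' (x1 * act R h y) (x20 * 1)) +
        coact R x2 (\<lambda>h x20. \<beta>' (x1 * act R h 1) (x20 * y))"
      using bil3 unfolding y_def iota_primitive by (simp add: plus_fun_def pure_def)
    also have "coact R x2 (\<lambda>h x20. \<beta>' (x1 * act R h y) (x20 * 1)) = \<gamma> x1 (pr 1 x2)"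
      unfolding \<gamma>_def \<beta>'_def using coact_pr[OF bil1[of x1], where q = x2 and n = 1] by simp
    also have "coact R x2 (\<lambda>h x20. \<beta>' (x1 * act R h 1) (x20 * y)) =
        coact R x2 (\<lambda>h x20. counit H h * \<beta>' x1 (x20 * y))"
      by (simp add: act_one mult_sR b's)
    also have "\<dots> = \<beta>' x1 (x2 * y)"
      by (rule coact_counit[of "\<lambda>x. \<beta>' x1 (x * y)"])
        (auto intro!: linformI[OF vsR] simp: b's distrib_right mult_sR)
    also have "\<dots> = bcounit R x2 * \<beta> x1 y"
      by (simp add: \<beta>'_def y_def pr_mult_iota bs)
    finally show ?thesis .
  qed
  obtain D where D: "\<And>\<beta>. bilform sR sR \<beta> \<Longrightarrow> bcomult R r \<beta> = lsum D \<beta>" using comult_list[of r] by blast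
  have lin: "linform sR (\<lambda>x. \<beta> x y)"
    using \<beta> by (simp add: bilform_def)
  have bil4: "bilform sR sR (\<lambda>p q. \<beta> p y * bcounit R q)"
    by (rule bilform_prod[OF lin counit_linform])
  have bil5: "bilform sR sR (\<lambda>p q. \<gamma> p (pr 1 q))" by (rule bilform_pr[OF \<gamma>])
  have bil6: "bilform sR sR (\<lambda>p q. \<gamma> p (pr 1 q) + \<beta> p y * bcounit R q)"
    by (rule bilformI[OF vsR vsR]) (simp_all add: bs bilform_simps[OF bil5] linform_simps[OF counit_linform] algebra_simps)
  have "bcomult R (r * y) \<beta>' = bcomult R r (\<lambda>p q. \<gamma> p (pr 1 q) + \<beta> p y * bcounit R q)"
    unfolding comult_mult[OF \<beta>'] inner by (simp add: mult.commute)
  also have "\<dots> = bcomult R r (\<lambda>p q. \<gamma> p (pr 1 q)) + bcomult R r (\<lambda>p q. \<beta> p y * bcounit R q)"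
    by (simp add: D bil4 bil5 bil6 lsum_add)
  also have "bcomult R r (\<lambda>p q. \<beta> p y * bcounit R q) = \<beta> r y"
    by (rule counit(2)[OF lin])
  also have "bcomult R r (\<lambda>p q. \<gamma> p (pr 1 q)) = lsum L (\<lambda>p w. \<gamma> p (\<iota> w))"
    using r \<gamma> by (simp add: derives_def)
  also have "\<dots> = lsum L (\<lambda>p w. lsum (N w) (\<lambda>u' w'. \<beta> (p * \<iota> u') (\<iota> w')))"
  proof (rule lsum_cong)
    fix p w assume pw: "(p, w) \<in> set L"
    have "bilform sV sV (\<lambda>u' w'. \<beta> (p * \<iota> u') (\<iota> w'))"
      by (rule bilformI[OF vsV vsV]) (simp_all add: linear_simps[OF iota_linear] bs distrib_left mult_sR)
    from N[OF pw this]
    show "\<gamma> p (\<iota> w) = lsum (N w) (\<lambda>u' w'. \<beta> (p * \<iota> u') (\<iota> w'))"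
      unfolding \<gamma>_def iota_coact[OF bil1] by (simp add: y_def iota_act)
  qed
  finally show "bcomult R (r * \<iota> u) (\<lambda>p q. \<beta> p (pr 1 q)) =
      lsum ((r, u) # concat (map (\<lambda>(p, w). map (\<lambda>(u', w'). (p * \<iota> u', w')) (N w)) L))
        (\<lambda>p w. \<beta> p (\<iota> w))"
    by (simp add: \<beta>'_def y_def lsum_concat lsum_map)
qed

lemma sum_pr:
  assumes "i \<le> n" "x \<in> G i"
  shows "(\<Sum>j\<le>n. pr j x) = x"
proof -
  have "(\<Sum>j\<le>n. pr j x) = (\<Sum>j\<in>{i}. pr j x)"
    by (rule sum.mono_neutral_right) (use assms in \<open>auto intro: pr_other\<close>)
  then show ?thesis using pr_same[OF assms(2)] by simp
qed

text \<open>
  An element of positive degree all of whose derivations vanish is zero.  Its coproduct has zero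
  component in \<open>R(n-1) \<otimes> R(1)\<close>; by coassociativity every slice of the component in
  \<open>R(i) \<otimes> R(n-i)\<close> has vanishing derivations again, and so is zero by induction for \<open>0 < i < n\<close>.
  Hence the element is primitive, of degree different from 1.
\<close>

lemma derives_nil_imp_zero:
  assumes "r \<in> G n" "n > 0" "derives r []"
  shows "r = 0"
  using assms
proof (induction n arbitrary: r rule: less_induct)
  case (less n)
  interpret T: vector_space "tscale :: 'k \<Rightarrow> ('k, 'r, 'r) tensor \<Rightarrow> ('k, 'r, 'r) tensor"
    by (rule vector_space_tscale)
  define hom_pairs where "hom_pairs = {(p, q). \<exists>i\<le>n. p \<in> G i \<and> q \<in> G (n - i)}"
  have "\<exists>L. set L \<subseteq> hom_pairs \<and> (\<forall>\<beta>. bilform sR sR \<beta> \<longrightarrow> bcomult R r \<beta> = lsum L \<beta>)"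
    using G_comult[OF less.prems(1)]
  proof (induction rule: T.span_induct_alt)
    case base
    show ?case by (rule exI[of _ "[]"]) (simp add: zero_fun_def)
  next
    case (step c x y)
    then obtain i L where i: "i \<le> n" "x \<in> tspan sR sR (G i) (G (n - i))"
      and L: "set L \<subseteq> hom_pairs" "\<forall>\<beta>. bilform sR sR \<beta> \<longrightarrow> y \<beta> = lsum L \<beta>" by blast
    obtain L' where L': "set L' \<subseteq> G i \<times> G (n - i)" "\<And>\<beta>. bilform sR sR \<beta> \<Longrightarrow> x \<beta> = lsum L' \<beta>"
      by (rule tspan_list[OF vsR vsR i(2)]) (auto intro: R.subspace_scale[OF G_sub])
    show ?case
    proof (rule exI[of _ "map (\<lambda>(p, q). (sR c p, q)) L' @ L"], intro conjI allI impI)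
      show "set (map (\<lambda>(p, q). (sR c p, q)) L' @ L) \<subseteq> hom_pairs"
        using L(1) L'(1) i(1) unfolding hom_pairs_def by (auto intro: R.subspace_scale[OF G_sub])
      fix \<beta> assume "bilform sR sR \<beta>"
      then show "(tscale c x + y) \<beta> = lsum (map (\<lambda>(p, q). (sR c p, q)) L' @ L) \<beta>"
        using L(2) L'(2) by (simp add: lsum_map bilform_simps lsum_mult)
    qed
  qed
  then obtain L where L: "set L \<subseteq> hom_pairs"
    and rL: "\<And>\<beta>. bilform sR sR \<beta> \<Longrightarrow> bcomult R r \<beta> = lsum L \<beta>" by blast
  have zero: "bcomult R r (\<lambda>p q. \<psi> (pr i p) * \<phi> q) = 0"
    if i: "0 < i" "i < n" and \<psi>: "linform sR \<psi>" and \<phi>: "linform sR \<phi>" for i \<psi> \<phi>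
  proof -
    have \<psi>i: "linform sR (\<lambda>p. \<psi> (pr i p))"
      using Vector_Spaces.linear_compose[OF pr_linear, of "(*)" \<psi> i] \<psi> by (simp add: linform_def o_def)
    define slice where "slice = (\<Sum>(p, q)\<leftarrow>L. sR (\<psi> (pr i p)) q)"
    have slice: "F slice = lsum L (\<lambda>p q. \<psi> (pr i p) * F q)" if "linform sR F" for F
      unfolding slice_def lsum_def linform_sum_list[OF that]
      by (rule arg_cong[of _ _ sum_list]) (auto simp: linform_simps[OF that])
    have "slice \<in> G (n - i)"
    proof -
      have "(\<Sum>(p, q)\<leftarrow>L'. sR (\<psi> (pr i p)) q) \<in> G (n - i)" if "set L' \<subseteq> hom_pairs" for L'
        using that
      proof (induction L')
        case Nil
        then show ?case by (simp add: R.subspace_0[OF G_sub])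
      next
        case (Cons a L')
        obtain p q where a: "a = (p, q)" by (cases a)
        obtain j where j: "j \<le> n" "p \<in> G j" "q \<in> G (n - j)"
          using Cons.prems a by (auto simp: hom_pairs_def)
        have "sR (\<psi> (pr i p)) q \<in> G (n - i)"
        proof (cases "j = i")
          case True
          then show ?thesis using j by (auto intro: R.subspace_scale[OF G_sub])
        next
          case False
          then show ?thesis using j(2)
            by (simp add: pr_other linform_simps[OF \<psi>] R.subspace_0[OF G_sub])
        qed
        then show ?case using Cons a by (auto intro: R.subspace_add[OF G_sub])
      qed
      then show ?thesis unfolding slice_def using L by blast
    qed
    moreover have "derives slice []"
      unfolding derives_def
    proof (intro allI impI)
      fix \<kappa> assume \<kappa>: "bilform sR sR \<kappa>"
      note ks = bilform_simps[OF bilform_pr[OF \<kappa>]]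
      let ?\<tau> = "\<lambda>u v w. \<psi> (pr i u) * \<kappa> v (pr 1 w)"
      have tri: "trilform sR sR sR ?\<tau>"
        unfolding trilform_def
        by (intro conjI allI linformI vsR) (simp_all add: linform_simps[OF \<psi>i] ks algebra_simps)
      have "linform sR (\<lambda>q. bcomult R q (\<lambda>v w. \<kappa> v (pr 1 w)))"
        by (rule linformI[OF vsR]) (simp_all add: linear_simps[OF comult_linear] plus_fun_def)
      then have "bcomult R slice (\<lambda>v w. \<kappa> v (pr 1 w)) =
          lsum L (\<lambda>p q. \<psi> (pr i p) * bcomult R q (\<lambda>v w. \<kappa> v (pr 1 w)))"
        by (rule slice)
      also have "\<dots> = bcomult R r (\<lambda>p q. \<psi> (pr i p) * bcomult R q (\<lambda>v w. \<kappa> v (pr 1 w)))"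
        by (rule rL[symmetric], rule bilformI[OF vsR vsR])
          (simp_all add: linform_simps[OF \<psi>i] linear_simps[OF comult_linear] plus_fun_def algebra_simps)
      also have "\<dots> = bcomult R r (\<lambda>p q. bcomult R q (\<lambda>v w. ?\<tau> p v w))"
      proof -
        have "\<psi> (pr i p) * bcomult R q (\<lambda>v w. \<kappa> v (pr 1 w)) = bcomult R q (\<lambda>v w. ?\<tau> p v w)" for p q
        proof -
          obtain N where N: "\<And>\<beta>. bilform sR sR \<beta> \<Longrightarrow> bcomult R q \<beta> = lsum N \<beta>" using comult_list[of q] by blast
          have "bilform sR sR (\<lambda>v w. ?\<tau> p v w)"
            by (rule bilformI[OF vsR vsR]) (simp_all add: ks algebra_simps)
          then show ?thesis by (simp add: N bilform_pr[OF \<kappa>] lsum_mult)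
        qed
        then show ?thesis by simp
      qed
      also have "\<dots> = bcomult R r (\<lambda>u w. bcomult R u (\<lambda>u' v. ?\<tau> u' v w))"
        by (rule coassoc[OF tri, symmetric])
      also have "\<dots> = 0"
      proof -
        define \<theta> where "\<theta> u w = bcomult R u (\<lambda>u' v. \<psi> (pr i u') * \<kappa> v w)" for u w
        have \<theta>: "bilform sR sR \<theta>"
        proof (rule bilformI[OF vsR vsR])
          fix u u' w w' c
          obtain N where N: "\<And>\<beta>. bilform sR sR \<beta> \<Longrightarrow> bcomult R u \<beta> = lsum N \<beta>" using comult_list[of u] by blast
          have b: "bilform sR sR (\<lambda>u' v. \<psi> (pr i u') * \<kappa> v w)" for w
            using bilform_prod[OF \<psi>i, of sR "\<lambda>v. \<kappa> v w"] \<kappa> by (simp add: bilform_def)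
          show "\<theta> (u + u') w = \<theta> u w + \<theta> u' w" "\<theta> (sR c u) w = c * \<theta> u w"
            by (simp_all add: \<theta>_def linear_simps[OF comult_linear] plus_fun_def)
          show "\<theta> u (w + w') = \<theta> u w + \<theta> u w'" "\<theta> u (sR c w) = c * \<theta> u w"
            unfolding \<theta>_def N[OF b]
            by (simp_all add: bilform_simps[OF \<kappa>] algebra_simps lsum_add lsum_mult)
        qed
        have "bcomult R r (\<lambda>p q. \<theta> p (pr 1 q)) = 0"
          using less.prems(3) \<theta> by (simp add: derives_def)
        then show ?thesis by (simp add: \<theta>_def)
      qed
      finally show "bcomult R slice (\<lambda>v w. \<kappa> v (pr 1 w)) = lsum [] (\<lambda>p w. \<kappa> p (\<iota> w))" by simp
    qed
    ultimately have "slice = 0" using i by (intro less.IH[of "n - i"]) auto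
    moreover have "bcomult R r (\<lambda>p q. \<psi> (pr i p) * \<phi> q) = lsum L (\<lambda>p q. \<psi> (pr i p) * \<phi> q)"
      by (rule rL[OF bilform_prod[OF \<psi>i \<phi>]])
    ultimately show ?thesis using slice[OF \<phi>] by (simp add: linform_simps[OF \<phi>])
  qed
  have prod: "bcomult R r (\<lambda>p q. \<psi> p * \<phi> q) = \<psi> r * \<phi> 1 + \<psi> 1 * \<phi> r"
    if \<psi>: "linform sR \<psi>" and \<phi>: "linform sR \<phi>" for \<psi> \<phi>
  proof -
    have \<psi>i: "linform sR (\<lambda>p. \<psi> (pr i p))" for i
      using Vector_Spaces.linear_compose[OF pr_linear, of "(*)" \<psi> i] \<psi> by (simp add: linform_def o_def)
    have "lsum L (\<lambda>p q. \<psi> p * \<phi> q) = lsum L (\<lambda>p q. \<Sum>i\<le>n. \<psi> (pr i p) * \<phi> q)"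
    proof (rule lsum_cong)
      fix p q assume "(p, q) \<in> set L"
      then obtain j where j: "j \<le> n" "p \<in> G j" using L by (auto simp: hom_pairs_def)
      have "\<psi> p = \<psi> (\<Sum>i\<le>n. pr i p)" by (simp add: sum_pr[OF j])
      also have "\<dots> = (\<Sum>i\<le>n. \<psi> (pr i p))"
      proof -
        have "\<psi> (\<Sum>i\<in>A. pr i p) = (\<Sum>i\<in>A. \<psi> (pr i p))" if "finite A" for A :: "nat set"
          using that by (induction A rule: finite_induct) (simp_all add: linform_simps[OF \<psi>])
        then show ?thesis by simp
      qed
      finally show "\<psi> p * \<phi> q = (\<Sum>i\<le>n. \<psi> (pr i p) * \<phi> q)" by (simp add: sum_distrib_right)
    qed
    also have "\<dots> = (\<Sum>i\<le>n. lsum L (\<lambda>p q. \<psi> (pr i p) * \<phi> q))"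
      by (induction L) (auto simp: sum.distrib)
    also have "\<dots> = (\<Sum>i\<le>n. bcomult R r (\<lambda>p q. \<psi> (pr i p) * \<phi> q))"
      by (simp add: rL bilform_prod[OF \<psi>i \<phi>])
    also have "\<dots> = (\<Sum>i\<in>{0, n}. bcomult R r (\<lambda>p q. \<psi> (pr i p) * \<phi> q))"
      by (rule sum.mono_neutral_right) (use zero[OF _ _ \<psi> \<phi>] in auto)
    also have "\<dots> = bcomult R r (\<lambda>p q. \<psi> (pr 0 p) * \<phi> q) + bcomult R r (\<lambda>p q. \<psi> (pr n p) * \<phi> q)"
      using less.prems(2) by simp
    also have "bcomult R r (\<lambda>p q. \<psi> (pr 0 p) * \<phi> q) = \<psi> 1 * \<phi> r"
    proof -
      have "\<psi> (pr 0 p) = \<psi> 1 * bcounit R p" for p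
      proof (rule linform_ext[OF \<psi>i, where \<psi> = "\<lambda>p. \<psi> 1 * bcounit R p"])
        show "linform sR (\<lambda>p. \<psi> 1 * bcounit R p)"
          by (rule linformI[OF vsR]) (simp_all add: linform_simps[OF counit_linform] algebra_simps)
        fix m x assume x: "x \<in> G m"
        show "\<psi> (pr 0 x) = \<psi> 1 * bcounit R x"
        proof (cases "m = 0")
          case True
          then obtain c where "x = sR c 1" using x G0 by auto
          then show ?thesis
            by (simp add: linear_simps[OF pr_linear] pr_same[OF G_one] linform_simps[OF \<psi>]
                linform_simps[OF counit_linform] counit_one)
        next
          case False
          then show ?thesis using x by (simp add: pr_other G_counit linform_simps[OF \<psi>])
        qed
      qed
      then have "bcomult R r (\<lambda>p q. \<psi> (pr 0 p) * \<phi> q) = bcomult R r (\<lambda>p q. \<psi> 1 * (bcounit R p * \<phi> q))"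
        by (simp add: mult.assoc)
      also have "\<dots> = \<psi> 1 * bcomult R r (\<lambda>p q. bcounit R p * \<phi> q)"
      proof -
        have b: "bilform sR sR (\<lambda>p q. bcounit R p * \<phi> q)" by (rule bilform_prod[OF counit_linform \<phi>])
        then have "bilform sR sR (\<lambda>p q. \<psi> 1 * (bcounit R p * \<phi> q))"
          by (intro bilformI[OF vsR vsR]) (simp_all add: bilform_simps[OF b] algebra_simps linform_simps[OF counit_linform] linform_simps[OF \<phi>])
        then show ?thesis by (simp add: rL b lsum_mult)
      qed
      finally show ?thesis by (simp add: counit(1)[OF \<phi>])
    qed
    also have "bcomult R r (\<lambda>p q. \<psi> (pr n p) * \<phi> q) = \<psi> r * \<phi> 1"
    proof -
      have "bcomult R r (\<lambda>p q. \<psi> (pr n p) * \<phi> q) = lsum L (\<lambda>p q. \<psi> (pr n p) * bcounit R q * \<phi> 1)"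
        unfolding rL[OF bilform_prod[OF \<psi>i \<phi>]]
      proof (rule lsum_cong)
        fix p q assume "(p, q) \<in> set L"
        then obtain j where j: "j \<le> n" "p \<in> G j" "q \<in> G (n - j)" using L by (auto simp: hom_pairs_def)
        show "\<psi> (pr n p) * \<phi> q = \<psi> (pr n p) * bcounit R q * \<phi> 1"
        proof (cases "j = n")
          case True
          then obtain c where "q = sR c 1" using j G0 by auto
          then show ?thesis
            by (simp add: linform_simps[OF counit_linform] linform_simps[OF \<phi>] counit_one)
        next
          case False
          then show ?thesis using j by (simp add: pr_other linform_simps[OF \<psi>])
        qed
      qed
      also have "\<dots> = bcomult R r (\<lambda>p q. \<psi> (pr n p) * bcounit R q) * \<phi> 1"
        by (simp add: rL bilform_prod[OF \<psi>i counit_linform] lsum_mult_right)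
      also have "bcomult R r (\<lambda>p q. \<psi> (pr n p) * bcounit R q) = \<psi> (pr n r)"
        by (rule counit(2)[OF \<psi>i])
      finally show ?thesis using pr_same[OF less.prems(1)] by simp
    qed
    finally show ?thesis using rL[OF bilform_prod[OF \<psi> \<phi>]] by simp
  qed
  show ?case
  proof (cases "n = 1")
    case True
    show ?thesis
    proof (rule linform_separates[OF vsR])
      fix \<phi> assume \<phi>: "linform sR \<phi>"
      have "bcomult R r (\<lambda>p q. bcounit R p * \<phi> (pr 1 q)) = 0"
        using less.prems(3)[unfolded derives_def, rule_format, OF bilform_prod[OF counit_linform \<phi>]]
        by simp
      moreover have "linform sR (\<lambda>q. \<phi> (pr 1 q))"
        using Vector_Spaces.linear_compose[OF pr_linear, of "(*)" \<phi> 1] \<phi> by (simp add: linform_def o_def)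
      ultimately have "\<phi> (pr 1 r) = 0" using counit(1) by metis
      then show "\<phi> r = \<phi> 0" using less.prems(1) True by (simp add: pr_same linform_simps[OF \<phi>])
    qed
  next
    case False
    have "bcomult R r = pure sR sR r 1 + pure sR sR 1 r"
    proof
      fix \<beta>
      show "bcomult R r \<beta> = (pure sR sR r 1 + pure sR sR 1 r) \<beta>"
      proof (cases "bilform sR sR \<beta>")
        case True
        have "lsum (L @ [(- r, 1), (- 1, r)]) \<beta> = 0"
        proof (rule product_forms_separate[OF vsR vsR _ True])
          fix \<phi> \<psi> assume *: "linform sR \<phi>" "linform sR \<psi>"
          show "lsum (L @ [(- r, 1), (- 1, r)]) (\<lambda>x y. \<phi> x * \<psi> y) = 0"
            using prod[OF *] rL[OF bilform_prod[OF *]] by (simp add: linform_simps[OF *(1)])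
        qed
        then show ?thesis using True
          by (simp add: rL pure_def plus_fun_def bilform_simps algebra_simps eq_neg_iff_add_eq_0)
      next
        case False
        have "bcomult R r \<beta> = 0"
          by (rule tspan_list[OF vsR vsR comult_in[of r]]) (use False in auto)
        then show ?thesis using False by (simp add: pure_def)
      qed
    qed
    then have "r \<in> G 1" using prim by (auto simp: primitives_def)
    then have "r \<in> R.span (\<Union>m\<in>-{n}. G m)" using False by (intro R.span_base) auto
    then show ?thesis using less.prems(1) G_disj[of n] by blast
  qed
qed

end

section \<open>Trivial self-braidings and infinite dimension\<close>

context nichols
begin

text \<open>\<open>braids w u N\<close>: the braiding sends \<open>w \<otimes> u\<close> to \<open>\<Sum> u' \<otimes> w'\<close>, the sum over \<open>(u', w')\<close> in \<open>N\<close>.\<close>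

definition braids :: "'v \<Rightarrow> 'v \<Rightarrow> ('v \<times> 'v) list \<Rightarrow> bool"
  where "braids w u N \<longleftrightarrow> (\<forall>\<beta>. bilform sV sV \<beta> \<longrightarrow>
    coact V w (\<lambda>h w'. \<beta> (act V h u) w') = lsum N \<beta>)"

lemma derives_mult_braids:
  assumes "derives r L" "\<And>p w. (p, w) \<in> set L \<Longrightarrow> braids w u (N w)"
  shows "derives (r * \<iota> u)
    ((r, u) # concat (map (\<lambda>(p, w). map (\<lambda>(u', w'). (p * \<iota> u', w')) (N w)) L))"
  by (rule derives_mult[OF assms(1)]) (use assms(2) in \<open>auto simp: braids_def\<close>)

lemma coactV_linear: "Vector_Spaces.linear sV tscale (coact V)"
  using ydV unfolding yd_module_def Let_def by blast

lemma actV_linear: "Vector_Spaces.linear sH sV (\<lambda>h. act V h v)" "Vector_Spaces.linear sV sV (act V h)"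
  using ydV unfolding yd_module_def Let_def by blast+

lemma coactV_in: "coact V x \<in> tensors sH sV"
  using ydV unfolding yd_module_def Let_def by (elim conjE) (erule spec)

lemma coactV_list: "\<exists>L. \<forall>\<beta>. bilform sH sV \<beta> \<longrightarrow> coact V x \<beta> = lsum L \<beta>"
proof -
  obtain L where "\<And>\<beta>. bilform sH sV \<beta> \<Longrightarrow> coact V x \<beta> = lsum L \<beta>"
    by (rule tspan_list[OF vsH vsV coactV_in[of x]]) auto
  then show ?thesis by metis
qed

lemma bilform_actV: "bilform sV sV \<beta> \<Longrightarrow> bilform sH sV (\<lambda>h w'. \<beta> (act V h u) w')"
  by (rule bilformI[OF vsH vsV]) (simp_all add: linear_simps[OF actV_linear(1)] bilform_simps)

lemma braids_span:
  assumes gen: "\<And>w u. w \<in> A \<Longrightarrow> u \<in> B \<Longrightarrow> \<exists>N. braids w u N \<and> set N \<subseteq> M"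
    and M: "\<And>c p q. (p, q) \<in> M \<Longrightarrow> (sV c p, q) \<in> M"
    and w: "w \<in> V.span A" and u: "u \<in> V.span B"
  shows "\<exists>N. braids w u N \<and> set N \<subseteq> M"
proof -
  have sc: "set (map (\<lambda>(p, q). (sV c p, q)) N) \<subseteq> M" if "set N \<subseteq> M" for c N
    using that M by auto
  have left: "\<exists>N. braids w u N \<and> set N \<subseteq> M" if "u \<in> B" for u
    using w
  proof (induction rule: V.span_induct_alt)
    case base
    show ?case
      by (rule exI[of _ "[]"]) (simp add: braids_def linear_simps[OF coactV_linear] zero_fun_def)
  next
    case (step c x y)
    obtain N1 where N1: "braids x u N1" "set N1 \<subseteq> M" using gen[OF step(1) \<open>u \<in> B\<close>] by blast
    obtain N2 where N2: "braids y u N2" "set N2 \<subseteq> M" using step(2) by blast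
    have "braids (sV c x + y) u (map (\<lambda>(p, q). (sV c p, q)) N1 @ N2)"
      using N1(1) N2(1) unfolding braids_def
      by (auto simp: linear_simps[OF coactV_linear] plus_fun_def lsum_map bilform_simps lsum_mult)
    then show ?case using sc[OF N1(2)] N2(2)
      by (intro exI[of _ "map (\<lambda>(p, q). (sV c p, q)) N1 @ N2"]) auto
  qed
  show ?thesis using u
  proof (induction rule: V.span_induct_alt)
    case base
    show ?case
    proof (rule exI[of _ "[]"])
      have "coact V w (\<lambda>h w'. 0) = 0"
      proof -
        obtain L where L: "\<And>\<beta>. bilform sH sV \<beta> \<Longrightarrow> coact V w \<beta> = lsum L \<beta>" using coactV_list[of w] by blast
        have "bilform sH sV (\<lambda>h w'. 0)" by (rule bilformI[OF vsH vsV]) auto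
        from L[OF this] show ?thesis by (simp add: lsum_zero)
      qed
      then show "braids w 0 [] \<and> set [] \<subseteq> M"
        by (simp add: braids_def linear_simps[OF actV_linear(2)] bilform_simps)
    qed
  next
    case (step c x y)
    obtain N1 where N1: "braids w x N1" "set N1 \<subseteq> M" using left[OF step(1)] by blast
    obtain N2 where N2: "braids w y N2" "set N2 \<subseteq> M" using step(2) by blast
    have "braids w (sV c x + y) (map (\<lambda>(p, q). (sV c p, q)) N1 @ N2)"
      unfolding braids_def
    proof (intro allI impI)
      fix \<beta> assume \<beta>: "bilform sV sV \<beta>"
      obtain L where L: "\<And>\<beta>. bilform sH sV \<beta> \<Longrightarrow> coact V w \<beta> = lsum L \<beta>" using coactV_list[of w] by blast
      have "coact V w (\<lambda>h w'. \<beta> (act V h (sV c x + y)) w') =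
          c * coact V w (\<lambda>h w'. \<beta> (act V h x) w') + coact V w (\<lambda>h w'. \<beta> (act V h y) w')"
        unfolding L[OF bilform_actV[OF \<beta>]]
        by (simp add: linear_simps[OF actV_linear(2)] bilform_left_simps[OF \<beta>] lsum_add lsum_mult)
      then show "coact V w (\<lambda>h w'. \<beta> (act V h (sV c x + y)) w') =
          lsum (map (\<lambda>(p, q). (sV c p, q)) N1 @ N2) \<beta>"
        using N1(1) N2(1) \<beta>
        by (simp add: braids_def lsum_map bilform_left_simps[OF \<beta>] lsum_mult)
    qed
    then show ?case using sc[OF N1(2)] N2(2)
      by (intro exI[of _ "map (\<lambda>(p, q). (sV c p, q)) N1 @ N2"]) auto
  qed
qed

lemma derives_cong:
  "derives r L \<Longrightarrow> (\<And>\<beta>. bilform sR sR \<beta> \<Longrightarrow>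
    lsum L (\<lambda>p w. \<beta> p (\<iota> w)) = lsum L' (\<lambda>p w. \<beta> p (\<iota> w))) \<Longrightarrow> derives r L'"
  by (simp add: derives_def)

lemma linform_extends:
  assumes "linform sV f"
  shows "\<exists>\<phi>. linform sR \<phi> \<and> (\<forall>v. \<phi> (\<iota> v) = f v)"
proof -
  interpret P: vector_space_pair sV sR ..
  obtain g where g: "Vector_Spaces.linear sR sV g" "g \<circ> \<iota> = id"
    using P.linear_injective_left_inverse[OF iota_linear inj] by blast
  have "linform sR (\<lambda>r. f (g r))"
    using Vector_Spaces.linear_compose[OF g(1), of "(*)" f] assms by (simp add: linform_def o_def)
  moreover have "f (g (\<iota> v)) = f v" for v using g(2) by (metis comp_apply id_apply)
  ultimately show ?thesis by blast
qed

lemma power_iota_G: "\<iota> v ^ n \<in> G n"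
proof (induction n)
  case 0
  then show ?case by (simp add: G_one)
next
  case (Suc n)
  then show ?case using G_mult[OF iota_G Suc] by (simp add: plus_1_eq_Suc)
qed

lemma infinite_of_powers:
  assumes "\<And>n. \<iota> v ^ n \<noteq> 0"
  shows "\<not> finite_dim sR"
proof
  assume "finite_dim sR"
  then obtain B where "finite_dimensional_vector_space sR B" by (auto simp: finite_dim_def)
  then interpret F: finite_dimensional_vector_space sR B .
  have inj: "inj (\<lambda>n. \<iota> v ^ n)"
  proof (rule injI, rule ccontr)
    fix m n assume *: "\<iota> v ^ m = \<iota> v ^ n" "m \<noteq> n"
    then have "pr m (\<iota> v ^ m) = 0" using pr_other[OF power_iota_G, of n m v] by simp
    then show False using pr_same[OF power_iota_G, of m v] assms by simp
  qed
  have "R.independent (range (\<lambda>n. \<iota> v ^ n))"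
    unfolding R.dependent_def
  proof
    assume "\<exists>a\<in>range (\<lambda>n. \<iota> v ^ n). a \<in> R.span (range (\<lambda>n. \<iota> v ^ n) - {a})"
    then obtain n where n: "\<iota> v ^ n \<in> R.span (range (\<lambda>n. \<iota> v ^ n) - {\<iota> v ^ n})" by blast
    have "range (\<lambda>n. \<iota> v ^ n) - {\<iota> v ^ n} \<subseteq> (\<Union>m\<in>-{n}. G m)"
    proof
      fix x assume "x \<in> range (\<lambda>n. \<iota> v ^ n) - {\<iota> v ^ n}"
      then obtain m where "x = \<iota> v ^ m" "m \<noteq> n" by blast
      then show "x \<in> (\<Union>m\<in>-{n}. G m)" using power_iota_G[of v m] by blast
    qed
    from R.span_mono[OF this] n have "\<iota> v ^ n \<in> R.span (\<Union>m\<in>-{n}. G m)" by blast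
    with power_iota_G[of v n] G_disj[of n] assms[of n] show False by blast
  qed
  then have "finite (range (\<lambda>n. \<iota> v ^ n))" by (rule F.finiteI_independent)
  then show False using inj finite_imageD[of "\<lambda>n. \<iota> v ^ n" UNIV] by simp
qed

context
  fixes v :: 'v and U0 U :: "'v set"
  assumes U0: "V.subspace U0" and v: "v \<notin> U0" and U_def: "U = V.span (insert v U0)"
    and char0: "\<And>n. of_nat (Suc n) \<noteq> (0::'k)"
begin

text \<open>
  Tensors in \<open>U \<otimes> U\<close> modulo those with a leg in \<open>U\<^sub>0\<close> form a line, on which the braiding is trivial
  under the assumptions made below.  \<open>deg0 n\<close> is spanned by the products of \<open>n\<close> elements of \<open>U\<close>,
  and \<open>deg1 n\<close> by those in which at least one factor lies in \<open>U\<^sub>0\<close>.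
\<close>

definition mixed :: "('v \<times> 'v) set"
  where "mixed = {(p, q). p \<in> U0 \<and> q \<in> U \<or> p \<in> U \<and> q \<in> U0}"

primrec deg0 :: "nat \<Rightarrow> 'r set" where
  "deg0 0 = R.span {1}"
| "deg0 (Suc n) = R.span {p * \<iota> u | p u. p \<in> deg0 n \<and> u \<in> U}"

primrec deg1 :: "nat \<Rightarrow> 'r set" where
  "deg1 0 = {0}"
| "deg1 (Suc n) = R.span ({p * \<iota> u | p u. p \<in> deg1 n \<and> u \<in> U} \<union> {p * \<iota> u | p u. p \<in> deg0 n \<and> u \<in> U0})"

lemma deg_sub: "R.subspace (deg0 n)" "R.subspace (deg1 n)"
  by (cases n; simp)+

lemma deg_mult:
  "p \<in> deg0 n \<Longrightarrow> u \<in> U \<Longrightarrow> p * \<iota> u \<in> deg0 (Suc n)"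
  "p \<in> deg1 n \<Longrightarrow> u \<in> U \<Longrightarrow> p * \<iota> u \<in> deg1 (Suc n)"
  "p \<in> deg0 n \<Longrightarrow> u \<in> U0 \<Longrightarrow> p * \<iota> u \<in> deg1 (Suc n)"
  by (auto intro!: R.span_base)

lemma U0_sub_U: "U0 \<subseteq> U" and v_U: "v \<in> U" and U_sub: "V.subspace U"
  unfolding U_def using V.span_superset[of "insert v U0"] by auto

definition legs :: "nat \<Rightarrow> ('r \<times> 'v) set"
  where "legs n = {(p, w). p \<in> deg1 n \<and> w \<in> U \<or> p \<in> deg0 n \<and> w \<in> U0}"

context
  assumes cUU: "\<And>w u. w \<in> U \<Longrightarrow> u \<in> U \<Longrightarrow> \<exists>N. braids w u N \<and> set N \<subseteq> U \<times> U"
    and c0U: "\<And>w u. w \<in> U0 \<Longrightarrow> u \<in> U \<Longrightarrow> \<exists>N. braids w u N \<and> set N \<subseteq> mixed"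
    and cU0: "\<And>w u. w \<in> U \<Longrightarrow> u \<in> U0 \<Longrightarrow> \<exists>N. braids w u N \<and> set N \<subseteq> mixed"
    and cvv: "\<exists>N. braids v v ((v, v) # N) \<and> set N \<subseteq> mixed"
begin

lemma derives_closed:
  assumes r: "r \<in> R.span S" and S: "\<And>s. s \<in> S \<Longrightarrow> \<exists>L. derives s L \<and> set L \<subseteq> X"
    and X: "\<And>c p w. (p, w) \<in> X \<Longrightarrow> (sR c p, w) \<in> X"
  shows "\<exists>L. derives r L \<and> set L \<subseteq> X"
  using r
proof (induction rule: R.span_induct_alt)
  case base
  show ?case by (rule exI[of _ "[]"]) (simp add: derives_zero)
next
  case (step c x y)
  obtain L1 where L1: "derives x L1" "set L1 \<subseteq> X" using S[OF step(1)] by blast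
  obtain L2 where L2: "derives y L2" "set L2 \<subseteq> X" using step(2) by blast
  show ?case
    by (intro exI[of _ "map (\<lambda>(p, w). (sR c p, w)) L1 @ L2"] conjI derives_add derives_scale L1(1) L2(1))
      (use L1(2) L2(2) X in auto)
qed

lemma derives_deg0:
  "r \<in> deg0 n \<Longrightarrow> \<exists>L. derives r L \<and> set L \<subseteq> {(p, w). n > 0 \<and> p \<in> deg0 (n - 1) \<and> w \<in> U}"
proof (induction n arbitrary: r)
  case 0
  then show ?case
    by (intro derives_closed[of r "{1}"]) (auto intro: derives_one exI[of _ "[]"])
next
  case (Suc n)
  show ?case
  proof (rule derives_closed[of r "{p * \<iota> u | p u. p \<in> deg0 n \<and> u \<in> U}"])
    show "r \<in> R.span {p * \<iota> u | p u. p \<in> deg0 n \<and> u \<in> U}" using Suc.prems by simp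
    fix s assume "s \<in> {p * \<iota> u | p u. p \<in> deg0 n \<and> u \<in> U}"
    then obtain p u where s: "s = p * \<iota> u" "p \<in> deg0 n" "u \<in> U" by blast
    obtain L where L: "derives p L" "set L \<subseteq> {(p, w). n > 0 \<and> p \<in> deg0 (n - 1) \<and> w \<in> U}"
      using Suc.IH[OF s(2)] by blast
    obtain N where N: "\<And>w. w \<in> U \<Longrightarrow> braids w u (N w) \<and> set (N w) \<subseteq> U \<times> U"
      using cUU[OF _ s(3)] by metis
    have "derives s ((p, u) # concat (map (\<lambda>(p, w). map (\<lambda>(u', w'). (p * \<iota> u', w')) (N w)) L))"
      unfolding s(1) by (rule derives_mult_braids[OF L(1)]) (use L(2) N in auto)
    moreover have "(q * \<iota> u', w') \<in> {(p, w). p \<in> deg0 n \<and> w \<in> U}"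
      if "(q, w) \<in> set L" "(u', w') \<in> set (N w)" for q w u' w'
      using that L(2) N[of w] deg_mult(1)[of q "n - 1" u'] by (cases n) auto
    ultimately show "\<exists>L. derives s L \<and> set L \<subseteq> {(p, w). Suc n > 0 \<and> p \<in> deg0 (Suc n - 1) \<and> w \<in> U}"
      using s(2,3)
      by (intro exI[of _ "(p, u) # concat (map (\<lambda>(p, w). map (\<lambda>(u', w'). (p * \<iota> u', w')) (N w)) L)"]) auto
  next
    fix c p w assume "(p, w) \<in> {(p, w). Suc n > 0 \<and> p \<in> deg0 (Suc n - 1) \<and> w \<in> U}"
    then show "(sR c p, w) \<in> {(p, w). Suc n > 0 \<and> p \<in> deg0 (Suc n - 1) \<and> w \<in> U}"
      using R.subspace_scale[OF deg_sub(1)] by auto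
  qed
qed

lemma legs_scale: "(p, w) \<in> legs n \<Longrightarrow> (sR c p, w) \<in> legs n"
  using R.subspace_scale[OF deg_sub(1)] R.subspace_scale[OF deg_sub(2)] by (auto simp: legs_def)

lemma mixed_legs: "p \<in> deg0 n \<Longrightarrow> (u, w) \<in> mixed \<Longrightarrow> (p * \<iota> u, w) \<in> legs (Suc n)"
  using deg_mult[of p n u] by (auto simp: mixed_def legs_def simp del: deg0.simps deg1.simps)

text \<open>
  \<open>adapted u N\<close>: for each \<open>w\<close> in \<open>U\<close>, the list \<open>N w\<close> writes the braiding of \<open>w \<otimes> u\<close> within \<open>U \<otimes> U\<close>, and
  with a leg in \<open>U\<^sub>0\<close> whenever \<open>w\<close> is in \<open>U\<^sub>0\<close>.
\<close>

definition adapted :: "'v \<Rightarrow> ('v \<Rightarrow> ('v \<times> 'v) list) \<Rightarrow> bool"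
  where "adapted u N \<longleftrightarrow> (\<forall>w\<in>U. braids w u (N w) \<and> set (N w) \<subseteq> U \<times> U \<and> (w \<in> U0 \<longrightarrow> set (N w) \<subseteq> mixed))"

lemma mixed_sub: "mixed \<subseteq> U \<times> U"
  using U0_sub_U by (auto simp: mixed_def)

lemma adapted_exists:
  assumes "u \<in> U" shows "\<exists>N. adapted u N"
proof -
  have "\<exists>N. w \<in> U \<longrightarrow> braids w u N \<and> set N \<subseteq> U \<times> U \<and> (w \<in> U0 \<longrightarrow> set N \<subseteq> mixed)" for w
    using cUU[OF _ assms, of w] c0U[OF _ assms, of w] mixed_sub by (cases "w \<in> U0") fastforce+
  then show ?thesis unfolding adapted_def by metis
qed

lemma legs_step:
  assumes N: "adapted u N" and q: "(q, w) \<in> legs n" and N': "(u', w') \<in> set (N w)"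
  shows "(q * \<iota> u', w') \<in> legs (Suc n)"
proof (cases "q \<in> deg1 n \<and> w \<in> U")
  case True
  then have "u' \<in> U" "w' \<in> U" using N N' by (auto simp: adapted_def)
  then show ?thesis using True deg_mult(2)[of q n u'] by (auto simp: legs_def simp del: deg0.simps deg1.simps)
next
  case False
  then have "q \<in> deg0 n" "w \<in> U0" using q by (auto simp: legs_def)
  then show ?thesis using N N' U0_sub_U mixed_legs[of q n u' w'] by (auto simp: adapted_def)
qed

lemma derives_mult_adapted:
  assumes "derives r L" "adapted u N" "snd ` set L \<subseteq> U"
  shows "derives (r * \<iota> u) ((r, u) # concat (map (\<lambda>(p, w). map (\<lambda>(u', w'). (p * \<iota> u', w')) (N w)) L))"
  by (rule derives_mult_braids[OF assms(1)]) (use assms(2,3) in \<open>force simp: adapted_def\<close>)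

lemma legs_U: "set L \<subseteq> legs n \<Longrightarrow> snd ` set L \<subseteq> U"
  using U0_sub_U by (fastforce simp: legs_def)

lemma derives_mult_legs:
  assumes L: "derives r L" "set L \<subseteq> legs n" and u: "u \<in> U"
  shows "\<exists>L'. derives (r * \<iota> u) ((r, u) # L') \<and> set L' \<subseteq> legs (Suc n)"
proof -
  obtain N where N: "adapted u N" using adapted_exists[OF u] by blast
  have "set (concat (map (\<lambda>(p, w). map (\<lambda>(u', w'). (p * \<iota> u', w')) (N w)) L)) \<subseteq> legs (Suc n)"
    using legs_step[OF N] L(2) by fastforce
  then show ?thesis using derives_mult_adapted[OF L(1) N legs_U[OF L(2)]] by blast
qed

lemma derives_deg1:
  "r \<in> deg1 n \<Longrightarrow> \<exists>L. derives r L \<and> set L \<subseteq> {(p, w). n > 0 \<and> (p, w) \<in> legs (n - 1)}"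
proof (induction n arbitrary: r)
  case 0
  then show ?case by (intro exI[of _ "[]"]) (simp add: derives_zero)
next
  case (Suc n)
  show ?case
  proof (rule derives_closed[of r "{p * \<iota> u | p u. p \<in> deg1 n \<and> u \<in> U} \<union> {p * \<iota> u | p u. p \<in> deg0 n \<and> u \<in> U0}"])
    show "r \<in> R.span ({p * \<iota> u | p u. p \<in> deg1 n \<and> u \<in> U} \<union> {p * \<iota> u | p u. p \<in> deg0 n \<and> u \<in> U0})"
      using Suc.prems by simp
    fix s assume "s \<in> {p * \<iota> u | p u. p \<in> deg1 n \<and> u \<in> U} \<union> {p * \<iota> u | p u. p \<in> deg0 n \<and> u \<in> U0}"
    then consider p u where "s = p * \<iota> u" "p \<in> deg1 n" "u \<in> U" | p u where "s = p * \<iota> u" "p \<in> deg0 n" "u \<in> U0"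
      by blast
    then have "\<exists>L. derives s L \<and> set L \<subseteq> legs n"
    proof cases
      case 1
      obtain L where L: "derives p L" "set L \<subseteq> {(p, w). n > 0 \<and> (p, w) \<in> legs (n - 1)}"
        using Suc.IH[OF 1(2)] by blast
      have "\<exists>L'. derives (p * \<iota> u) ((p, u) # L') \<and> set L' \<subseteq> legs n"
      proof (cases n)
        case 0
        then have "L = []" using L(2) by (cases L) auto
        then show ?thesis using derives_mult_braids[OF L(1), of u "\<lambda>_. []"] by auto
      next
        case (Suc m)
        then show ?thesis using derives_mult_legs[OF L(1), of m u] L(2) 1 by auto
      qed
      then obtain L' where L': "derives (p * \<iota> u) ((p, u) # L')" "set L' \<subseteq> legs n" by blast
      then show ?thesis using 1 unfolding 1(1)
        by (intro exI[of _ "(p, u) # L'"]) (auto simp: legs_def)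
    next
      case 2
      obtain L where L: "derives p L" "set L \<subseteq> {(p, w). n > 0 \<and> p \<in> deg0 (n - 1) \<and> w \<in> U}"
        using derives_deg0[OF 2(2)] by blast
      obtain N where N: "\<And>w. w \<in> U \<Longrightarrow> braids w u (N w) \<and> set (N w) \<subseteq> mixed"
        using cU0[OF _ 2(3)] by metis
      have "derives s ((p, u) # concat (map (\<lambda>(p, w). map (\<lambda>(u', w'). (p * \<iota> u', w')) (N w)) L))"
        unfolding 2(1) by (rule derives_mult_braids[OF L(1)]) (use L(2) N in auto)
      moreover have "(q * \<iota> u', w') \<in> legs n" if "(q, w) \<in> set L" "(u', w') \<in> set (N w)" for q w u' w'
        using that L(2) N[of w] mixed_legs[of q "n - 1" u' w'] by (cases n) auto
      moreover have "(p, u) \<in> legs n" using 2 by (simp add: legs_def)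
      ultimately show ?thesis
        by (intro exI[of _ "(p, u) # concat (map (\<lambda>(p, w). map (\<lambda>(u', w'). (p * \<iota> u', w')) (N w)) L)"]) auto
    qed
    then show "\<exists>L. derives s L \<and> set L \<subseteq> {(p, w). Suc n > 0 \<and> (p, w) \<in> legs (Suc n - 1)}" by auto
  next
    fix c p w assume "(p, w) \<in> {(p, w). Suc n > 0 \<and> (p, w) \<in> legs (Suc n - 1)}"
    then show "(sR c p, w) \<in> {(p, w). Suc n > 0 \<and> (p, w) \<in> legs (Suc n - 1)}"
      using legs_scale by auto
  qed
qed

lemma power_deg0: "\<iota> v ^ n \<in> deg0 n"
proof (induction n)
  case 0
  then show ?case by (simp add: R.span_base)
next
  case (Suc n)
  then show ?case using deg_mult(1)[OF Suc v_U] by (simp only: power_Suc2)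
qed

lemma derives_power:
  "\<exists>L. derives (\<iota> v ^ Suc n) ((sR (of_nat (Suc n)) (\<iota> v ^ n), v) # L) \<and> set L \<subseteq> legs n"
proof (induction n)
  case 0
  have "derives (1 * \<iota> v) ((1, v) # [])"
    using derives_mult_braids[OF derives_one, of v "\<lambda>_. []"] by simp
  then show ?case by (intro exI[of _ "[]"]) simp
next
  case (Suc n)
  let ?c = "of_nat (Suc n) :: 'k"
  obtain L where L: "derives (\<iota> v ^ Suc n) ((sR ?c (\<iota> v ^ n), v) # L)" "set L \<subseteq> legs n"
    using Suc by blast
  obtain M where M: "braids v v ((v, v) # M)" "set M \<subseteq> mixed" using cvv by blast
  let ?p = "sR ?c (\<iota> v ^ n)"
  define r1 where "r1 = \<iota> v ^ Suc n"
  obtain N0 where N0: "adapted v N0" using adapted_exists[OF v_U] by blast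
  define N where "N = N0(v := (v, v) # M)"
  have N: "adapted v N" "N v = (v, v) # M"
    using N0 M v v_U mixed_sub by (auto simp: N_def adapted_def)
  define cat where "cat L = concat (map (\<lambda>(p, w). map (\<lambda>(u', w'). (p * \<iota> u', w')) (N w)) L)" for L
  define tail where "tail = map (\<lambda>(u', w'). (?p * \<iota> u', w')) M @ cat L"
  have "derives (r1 * \<iota> v) ((r1, v) # cat ((?p, v) # L))"
    unfolding cat_def r1_def by (rule derives_mult_adapted[OF L(1) N(1)]) (use legs_U[OF L(2)] v_U in auto)
  then have "derives (r1 * \<iota> v) ((sR (of_nat (Suc (Suc n))) r1, v) # tail)"
  proof (rule derives_cong)
    fix \<beta> assume \<beta>: "bilform sR sR \<beta>"
    have "?p * \<iota> v = sR ?c r1" by (simp add: r1_def mult_sR power_Suc2 del: power_Suc)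
    then show "lsum ((r1, v) # cat ((?p, v) # L)) (\<lambda>p w. \<beta> p (\<iota> w)) =
        lsum ((sR (of_nat (Suc (Suc n))) r1, v) # tail) (\<lambda>p w. \<beta> p (\<iota> w))"
      by (simp add: cat_def tail_def N(2) bilform_simps[OF \<beta>] algebra_simps)
  qed
  moreover have "set tail \<subseteq> legs (Suc n)"
    using M(2) mixed_legs[OF R.subspace_scale[OF deg_sub(1) power_deg0]]
      legs_step[OF N(1)] L(2) by (fastforce simp: tail_def cat_def)
  ultimately show ?case
    by (intro exI[of _ tail]) (simp add: r1_def power_Suc2 mult.assoc del: power_Suc of_nat_Suc)
qed

text \<open>
  If \<open>v\<^sup>n\<^sup>+\<^sup>1\<close> were a combination of products with a factor in \<open>U\<^sub>0\<close>, taking off \<open>v\<close> on the right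
  modulo \<open>U\<^sub>0\<close> would show the same for \<open>(n + 1) v\<^sup>n\<close>, down to \<open>v\<^sup>0 = 1\<close>.
\<close>

lemma power_not_deg1: "\<iota> v ^ n \<notin> deg1 n"
proof (induction n)
  case 0
  have "\<iota> v ^ 0 \<noteq> 0" by simp
  then show ?case by simp
next
  case (Suc n)
  show ?case
  proof
    assume "\<iota> v ^ Suc n \<in> deg1 (Suc n)"
    then obtain A where A: "derives (\<iota> v ^ Suc n) A" "set A \<subseteq> legs n"
      using derives_deg1[of "\<iota> v ^ Suc n" "Suc n"] by auto
    obtain B where B: "derives (\<iota> v ^ Suc n) ((sR (of_nat (Suc n)) (\<iota> v ^ n), v) # B)" "set B \<subseteq> legs n"
      using derives_power by blast
    interpret P: vector_space_pair sV "(*) :: 'k \<Rightarrow> 'k \<Rightarrow> 'k"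
      by (rule vector_space_pair.intro[OF vsV vector_space_times])
    obtain B0 where B0: "B0 \<subseteq> U0" "V.independent B0" "U0 \<subseteq> V.span B0"
      using V.maximal_independent_subset[of U0] by blast
    have spB0: "V.span B0 = U0"
      using B0 U0 by (simp add: V.span_minimal subset_antisym)
    have "V.independent (insert v B0)"
      using v spB0 B0(2) by (simp add: V.independent_insertI)
    then obtain f where f: "linform sV f" "\<forall>x\<in>insert v B0. f x = (if x = v then 1 else 0)"
      using P.linear_independent_extend[of "insert v B0" "\<lambda>x. if x = v then 1 else 0"]
      unfolding linform_def by blast
    have fv: "f v = 1" using f(2) by simp
    have fU0: "f w = 0" if "w \<in> U0" for w
    proof -
      have "w \<in> V.span B0" using that spB0 by simp
      then show ?thesis
      proof (induction rule: V.span_induct_alt)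
        case (step c x y)
        then show ?case using f(2) B0(1) v by (auto simp: linform_simps[OF f(1)])
      qed (simp add: linform_simps[OF f(1)])
    qed
    obtain \<phi> where \<phi>: "linform sR \<phi>" "\<And>v. \<phi> (\<iota> v) = f v" using linform_extends[OF f(1)] by blast
    define cmb where "cmb L = (\<Sum>(p, w)\<leftarrow>L. sR (f w) p)" for L :: "('r \<times> 'v) list"
    have cmb_in: "cmb L \<in> deg1 n" if "set L \<subseteq> legs n" for L
      using that
    proof (induction L)
      case Nil
      then show ?case by (simp add: cmb_def R.subspace_0[OF deg_sub(2)])
    next
      case (Cons a L)
      obtain p w where a: "a = (p, w)" by (cases a)
      have "sR (f w) p \<in> deg1 n"
        using Cons.prems a fU0 R.subspace_scale[OF deg_sub(2)] R.subspace_0[OF deg_sub(2)]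
        by (auto simp: legs_def)
      then show ?case using Cons by (auto simp: a cmb_def intro!: R.subspace_add[OF deg_sub(2)])
    qed
    have ev: "\<psi> (cmb L) = lsum L (\<lambda>p w. \<psi> p * \<phi> (\<iota> w))" if "linform sR \<psi>" for \<psi> L
      unfolding cmb_def lsum_def linform_sum_list[OF that]
      by (rule arg_cong[of _ _ sum_list]) (auto simp: linform_simps[OF that] \<phi>(2))
    have "cmb A = cmb ((sR (of_nat (Suc n)) (\<iota> v ^ n), v) # B)"
    proof (rule linform_separates[OF vsR])
      fix \<psi> assume \<psi>: "linform sR \<psi>"
      show "\<psi> (cmb A) = \<psi> (cmb ((sR (of_nat (Suc n)) (\<iota> v ^ n), v) # B))"
        using A(1)[unfolded derives_def, rule_format, OF bilform_prod[OF \<psi> \<phi>(1)]]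
          B(1)[unfolded derives_def, rule_format, OF bilform_prod[OF \<psi> \<phi>(1)]]
        unfolding ev[OF \<psi>] by simp
    qed
    then have "sR (of_nat (Suc n)) (\<iota> v ^ n) = cmb A - cmb B"
      by (simp add: cmb_def fv)
    then have "sR (of_nat (Suc n)) (\<iota> v ^ n) \<in> deg1 n"
      using R.subspace_diff[OF deg_sub(2) cmb_in[OF A(2)] cmb_in[OF B(2)]] by simp
    then have "sR (inverse (of_nat (Suc n))) (sR (of_nat (Suc n)) (\<iota> v ^ n)) \<in> deg1 n"
      by (rule R.subspace_scale[OF deg_sub(2)])
    then have "\<iota> v ^ n \<in> deg1 n" using char0[of n] by (simp del: of_nat_Suc)
    then show False using Suc by simp
  qed
qed

lemma infinite_if_braiding_trivial: "\<not> finite_dim sR"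
  by (rule infinite_of_powers[of v]) (metis power_not_deg1 R.subspace_0[OF deg_sub(2)])

end

end

end

section \<open>Evaluation of noncommutative polynomials\<close>

lemma free_alg_induct [case_names zero add]:
  fixes p :: "('g, 'k::field) free_alg"
  assumes "P 0" and step: "\<And>c w p. P p \<Longrightarrow> P (Poly_Mapping.single w c + p)"
  shows "P p"
proof (induction p rule: Poly_Mapping.update_induct)
  case const
  show ?case by fact
next
  case (update f a b)
  have "Poly_Mapping.update a b f = Poly_Mapping.single a b + f"
    using update(1) by (intro poly_mapping_eqI)
      (auto simp: lookup_update lookup_add lookup_single when_def in_keys_iff)
  then show ?case using step[OF update(3)] by metis
qed

locale algebra_eval =
  fixes s :: "'k::field \<Rightarrow> 'a::ring_1 \<Rightarrow> 'a" and e :: "'g \<Rightarrow> 'a"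
  assumes alg: "algebra s"
begin

lemma vs: "vector_space s" using alg by (simp add: algebra_def)
sublocale vector_space s by (rule vs)

lemma scale_mult: "s c x * y = s c (x * y)" "x * s c y = s c (x * y)"
  using alg unfolding algebra_def by metis+

definition word_val :: "'g word \<Rightarrow> 'a"
  where "word_val w = prod_list (map e (letters w))"

lemma word_val_simps: "word_val 0 = 1" "word_val (v + w) = word_val v * word_val w"
  by (simp_all add: word_val_def zero_word_def plus_word_def)

lemma fa_eval_superset:
  assumes "finite A" "Poly_Mapping.keys p \<subseteq> A"
  shows "fa_eval s e p = (\<Sum>w\<in>A. s (Poly_Mapping.lookup p w) (word_val w))"
  unfolding fa_eval_def word_val_def
  by (rule sum.mono_neutral_left) (use assms in \<open>auto simp: in_keys_iff\<close>)

lemma fa_eval_add: "fa_eval s e (p + q) = fa_eval s e p + fa_eval s e q"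
proof -
  let ?A = "Poly_Mapping.keys p \<union> Poly_Mapping.keys q"
  have "fa_eval s e (p + q) = (\<Sum>w\<in>?A. s (Poly_Mapping.lookup (p + q) w) (word_val w))"
    by (rule fa_eval_superset) (use keys_add[of p q] in auto)
  also have "\<dots> = (\<Sum>w\<in>?A. s (Poly_Mapping.lookup p w) (word_val w)) +
      (\<Sum>w\<in>?A. s (Poly_Mapping.lookup q w) (word_val w))"
    by (simp add: lookup_add scale_left_distrib sum.distrib)
  also have "\<dots> = fa_eval s e p + fa_eval s e q"
    using fa_eval_superset[of ?A p] fa_eval_superset[of ?A q] by simp
  finally show ?thesis .
qed

lemma fa_eval_zero: "fa_eval s e 0 = 0"
  by (simp add: fa_eval_def)

lemma fa_eval_single: "fa_eval s e (Poly_Mapping.single w c) = s c (word_val w)"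
  using fa_eval_superset[of "{w}" "Poly_Mapping.single w c"] by simp

lemma fa_eval_mult: "fa_eval s e (p * q) = fa_eval s e p * fa_eval s e q"
proof (induction p rule: free_alg_induct)
  case zero
  then show ?case by (simp add: fa_eval_zero)
next
  case (add c w p)
  have "fa_eval s e (Poly_Mapping.single w c * q) = s c (word_val w) * fa_eval s e q"
  proof (induction q rule: free_alg_induct)
    case zero
    then show ?case by (simp add: fa_eval_zero)
  next
    case (add d v q)
    then show ?case
      by (simp add: distrib_left fa_eval_add mult_single fa_eval_single word_val_simps scale_mult)
  qed
  then show ?case using add by (simp add: distrib_right fa_eval_add fa_eval_single)
qed

lemma fa_eval_one: "fa_eval s e 1 = 1"
  using fa_eval_single[of 0 1] by (simp add: word_val_simps)

lemma fa_eval_var: "fa_eval s e (var g) = e g"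
  by (simp add: var_def fa_eval_single word_val_def)

lemma fa_eval_fscale: "fa_eval s e (c \<cdot> p) = s c (fa_eval s e p)"
  by (simp add: fscale_def fa_eval_mult fa_eval_single word_val_simps scale_mult)

lemma fa_eval_diff: "fa_eval s e (p - q) = fa_eval s e p - fa_eval s e q"
  using fa_eval_add[of "p - q" q] by simp

lemma fa_eval_power: "fa_eval s e (p ^ n) = fa_eval s e p ^ n"
  by (induction n) (simp_all add: fa_eval_one fa_eval_mult)

lemma kernel_two_sided_ideal: "two_sided_ideal {p. fa_eval s e p = 0}"
  by (auto simp: two_sided_ideal_def fa_eval_zero fa_eval_add fa_eval_mult)

lemma presented_relation: "presented_by s e rels \<Longrightarrow> p \<in> rels \<Longrightarrow> fa_eval s e p = 0"
  unfolding presented_by_def ideal_generated_def using hull_subset by fastforce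

text \<open>A subspace with \<open>1\<close> that is stable under left multiplication by the generators is everything.\<close>

lemma left_stable_subspace:
  assumes "surj (fa_eval s e)" "subspace S" "1 \<in> S" "\<And>g x. x \<in> S \<Longrightarrow> e g * x \<in> S"
  shows "S = UNIV"
proof -
  have word: "prod_list (map e l) \<in> S" for l
    by (induction l) (use assms(3,4) in auto)
  have "fa_eval s e p \<in> S" for p
  proof (induction p rule: free_alg_induct)
    case zero
    then show ?case using subspace_0[OF assms(2)] by (simp add: fa_eval_zero)
  next
    case (add c w p)
    then show ?case using word
      by (simp add: fa_eval_add fa_eval_single word_val_def subspace_add[OF assms(2)] subspace_scale[OF assms(2)])
  qed
  then have "range (fa_eval s e) \<subseteq> S" by blast
  then show ?thesis using assms(1) by auto
qed

end

section \<open>The Hopf algebra of dimension 12\<close>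

locale root6 =
  fixes \<xi> :: "'k::field_char_0"
  assumes prim6: "primitive_6th_root \<xi>"
begin

lemma xi2: "\<xi>\<^sup>2 = \<xi> - 1"
proof -
  have n: "\<xi> ^ n \<noteq> 1" if "0 < n" "n < 6" for n using prim6 that by (auto simp: primitive_6th_root_def)
  have "(\<xi>\<^sup>2 - \<xi> + 1) * (\<xi> + 1) * (\<xi> ^ 3 - 1) = \<xi> ^ 6 - 1"
    by (simp add: algebra_simps power_numeral_reduce)
  also have "\<dots> = 0" using prim6 by (simp add: primitive_6th_root_def)
  finally have *: "(\<xi>\<^sup>2 - \<xi> + 1) * (\<xi> + 1) * (\<xi> ^ 3 - 1) = 0" .
  have "\<xi> ^ 3 - 1 \<noteq> 0" using n[of 3] by simp
  moreover have "\<xi> + 1 \<noteq> 0"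
  proof
    assume "\<xi> + 1 = 0"
    then have "\<xi> = -1" by (simp add: eq_neg_iff_add_eq_0)
    then show False using n[of 2] by simp
  qed
  ultimately have "\<xi>\<^sup>2 - \<xi> + 1 = 0" using * by simp
  then show ?thesis by (simp add: algebra_simps eq_diff_eq)
qed

lemma xi_mult: "\<xi> * \<xi> = \<xi> - 1" "\<xi> * (\<xi> * y) = \<xi> * y - y"
proof -
  show *: "\<xi> * \<xi> = \<xi> - 1" using xi2 by (simp only: power2_eq_square)
  have "\<xi> * (\<xi> * y) = \<xi> * \<xi> * y" by (simp only: mult.assoc)
  then show "\<xi> * (\<xi> * y) = \<xi> * y - y" by (simp only: * left_diff_distrib mult_1)
qed

lemma xi3: "\<xi> ^ 3 = -1"
proof -
  have "\<xi> ^ 3 = \<xi> * \<xi>\<^sup>2" by (simp add: power_numeral_reduce)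
  also have "\<dots> = -1" by (simp add: xi2 algebra_simps flip: power2_eq_square)
  finally show ?thesis .
qed

lemma xi6: "\<xi> ^ 6 = 1"
  using prim6 by (simp add: primitive_6th_root_def)

lemma xi_nonzero: "\<xi> \<noteq> 0"
  using xi6 by auto

lemma xi4: "\<xi> ^ 4 = - \<xi>" and xi5: "\<xi> ^ 5 = 1 - \<xi>"
proof -
  have "\<xi> ^ 4 = \<xi> * \<xi> ^ 3" "\<xi> ^ 5 = \<xi>\<^sup>2 * \<xi> ^ 3" by (simp_all add: power_numeral_reduce)
  then show "\<xi> ^ 4 = - \<xi>" "\<xi> ^ 5 = 1 - \<xi>" by (simp_all add: xi2 xi3)
qed

text \<open>Powers of \<open>\<xi>\<close> with integer exponents, which matter modulo 6 only.\<close>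

definition xp :: "int \<Rightarrow> 'k" where "xp n = \<xi> powi n"

lemma xp_add: "xp (m + n) = xp m * xp n"
  using xi_nonzero by (simp add: xp_def power_int_add)

lemma xp_nat: "n \<ge> 0 \<Longrightarrow> xp n = \<xi> ^ nat n"
  by (simp add: xp_def power_int_def)

lemma xp_mod: "xp (n mod 6) = xp n"
proof -
  have "xp (6 * m) = 1" for m
    using xi6 by (simp add: xp_def power_int_mult)
  then show ?thesis using xp_add[of "n mod 6" "6 * (n div 6)"] by simp
qed

lemma xp_cong: "m mod 6 = n mod 6 \<Longrightarrow> xp m = xp n"
  by (metis xp_mod)

lemma xp_eq_iff: "xp m = xp n \<longleftrightarrow> m mod 6 = n mod 6"
proof
  assume eq: "xp m = xp n"
  have nz: "xp n \<noteq> 0" by (simp add: xp_def xi_nonzero)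
  have "xp (m - n) * xp n = xp n" using eq by (metis diff_add_cancel xp_add)
  then have "xp ((m - n) mod 6) = 1" using nz by (simp add: xp_mod)
  then have "\<xi> ^ nat ((m - n) mod 6) = 1" by (simp add: xp_nat)
  then have "nat ((m - n) mod 6) = 0"
    using prim6 unfolding primitive_6th_root_def by (metis nat_less_iff neq0_conv of_nat_numeral pos_mod_bound pos_mod_sign zero_less_numeral)
  then have "(m - n) mod 6 = 0" by (simp add: order_antisym)
  then show "m mod 6 = n mod 6" by (simp add: mod_eq_dvd_iff mod_0_imp_dvd)
qed (rule xp_cong)

lemma xp_nonzero: "xp n \<noteq> 0" by (simp add: xp_def xi_nonzero)

lemma xp_values: "xp 0 = 1" "xp 1 = \<xi>" "xp 2 = \<xi> - 1" "xp 3 = -1" "xp 4 = - \<xi>" "xp 5 = 1 - \<xi>"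
  by (simp_all add: xp_nat xi2 xi3 xi4 xi5)

lemma xp_minus: "xp (- n) * xp n = 1" "xp n * xp (- n) = 1"
  using xp_add[of "-n" n] xp_add[of n "-n"] by (simp_all add: xp_values)

end

locale hopf_C = root6 \<xi> for \<xi> :: "'k::field_char_0" +
  fixes H :: "('k, 'h::ring_1) hopf" and a b :: 'h
  assumes is_C: "is_C \<xi> H a b"
begin

abbreviation sH where "sH \<equiv> hscale H"
abbreviation \<Delta> where "\<Delta> \<equiv> comult H"

lemma hopfH: "hopf_algebra H"
  and dimH: "has_dim sH 12"
  and presH: "presented_by sH (gens a b)
        {var GX ^ 6 - 1, var GY ^ 2, var GY * var GX - \<xi> \<cdot> (var GX * var GY)}"
  and comult_a: "\<Delta> a = pure sH sH a a + tscale (\<xi> ^ 4 + \<xi> ^ 5) (pure sH sH b (b * a ^ 3))"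
  and comult_b: "\<Delta> b = pure sH sH b (a ^ 4) + pure sH sH a b"
  using is_C unfolding is_C_def Let_def by simp_all

lemma algH: "algebra sH"
  using hopfH unfolding hopf_algebra_def Let_def by blast

sublocale H: algebra_eval sH "gens a b"
  by standard (rule algH)

lemma vsH: "vector_space sH" by (rule H.vs)

lemma comultH_linear: "Vector_Spaces.linear sH tscale \<Delta>"
  using hopfH unfolding hopf_algebra_def Let_def by blast

lemma comultH_in: "\<Delta> h \<in> tensors sH sH"
  using hopfH unfolding hopf_algebra_def Let_def by (elim conjE) (erule spec)

lemma counitH_linform: "linform sH (counit H)"
  using hopfH unfolding hopf_algebra_def Let_def by blast

lemma antipodeH_linear: "Vector_Spaces.linear sH sH (antipode H)"
  using hopfH unfolding hopf_algebra_def Let_def by blast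

lemma coassocH: "trilform sH sH sH \<tau> \<Longrightarrow>
    \<Delta> h (\<lambda>x z. \<Delta> x (\<lambda>x' y. \<tau> x' y z)) = \<Delta> h (\<lambda>x y. \<Delta> y (\<lambda>y' z. \<tau> x y' z))"
  using hopfH unfolding hopf_algebra_def Let_def by blast

lemma counitH: "linform sH \<phi> \<Longrightarrow> \<Delta> h (\<lambda>x y. counit H x * \<phi> y) = \<phi> h"
    "linform sH \<phi> \<Longrightarrow> \<Delta> h (\<lambda>x y. \<phi> x * counit H y) = \<phi> h"
  using hopfH unfolding hopf_algebra_def Let_def by blast+

lemma comultH_one: "\<Delta> 1 = pure sH sH 1 1"
  using hopfH unfolding hopf_algebra_def Let_def by blast

lemma comultH_mult: "bilform sH sH \<beta> \<Longrightarrow>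
    \<Delta> (g * h) \<beta> = \<Delta> g (\<lambda>g1 g2. \<Delta> h (\<lambda>h1 h2. \<beta> (g1 * h1) (g2 * h2)))"
  using hopfH unfolding hopf_algebra_def Let_def by blast

lemma counitH_mult: "counit H (g * h) = counit H g * counit H h" "counit H 1 = 1"
  using hopfH unfolding hopf_algebra_def Let_def by blast+

lemma counitH_ab: "counit H a = 1" "counit H b = 0"
  using is_C unfolding is_C_def Let_def by simp_all

lemma antipodeH: "linform sH \<phi> \<Longrightarrow> \<Delta> h (\<lambda>x y. \<phi> (antipode H x * y)) = counit H h * \<phi> 1"
  using hopfH unfolding hopf_algebra_def Let_def by blast

lemma comultH_list: "\<exists>L. \<forall>\<beta>. bilform sH sH \<beta> \<longrightarrow> \<Delta> x \<beta> = lsum L \<beta>"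
proof -
  obtain L where "\<And>\<beta>. bilform sH sH \<beta> \<Longrightarrow> \<Delta> x \<beta> = lsum L \<beta>"
    by (rule tspan_list[OF vsH vsH comultH_in[of x]]) auto
  then show ?thesis by metis
qed

lemma relations: "a ^ 6 = 1" "b * b = 0" "b * a = sH \<xi> (a * b)"
proof -
  note ev = H.fa_eval_diff H.fa_eval_power H.fa_eval_one H.fa_eval_mult H.fa_eval_var H.fa_eval_fscale
  show "a ^ 6 = 1" using H.presented_relation[OF presH, of "var GX ^ 6 - 1"]
    by (simp add: ev gens_def)
  show "b * b = 0" using H.presented_relation[OF presH, of "var GY ^ 2"]
    by (simp add: ev gens_def power2_eq_square)
  show "b * a = sH \<xi> (a * b)"
    using H.presented_relation[OF presH, of "var GY * var GX - \<xi> \<cdot> (var GX * var GY)"]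
    by (simp add: ev gens_def)
qed

definition A :: "int \<Rightarrow> 'h" where "A n = apow a n"

lemma a_power_mod: "a ^ n = a ^ (n mod 6)"
proof -
  have "a ^ n = a ^ (6 * (n div 6) + n mod 6)" by simp
  also have "\<dots> = (a ^ 6) ^ (n div 6) * a ^ (n mod 6)" by (simp only: power_add power_mult)
  finally show ?thesis by (simp add: relations(1))
qed

lemma A_nat: "A (int n) = a ^ n"
proof -
  have "nat (int n mod 6) = n mod 6" by (simp add: nat_mod_distrib)
  then show ?thesis using a_power_mod[of n] by (simp add: A_def apow_def)
qed

lemma A_numeral: "A 0 = 1" "A 1 = a" "A 3 = a ^ 3" "A 4 = a ^ 4" "A 2 = a ^ 2" "A 5 = a ^ 5"
  using A_nat[of 0] A_nat[of 1] A_nat[of 3] A_nat[of 4] A_nat[of 2] A_nat[of 5] by simp_all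

lemma A_mod: "A (n mod 6) = A n"
  by (simp add: A_def apow_def)

lemma A_cong: "m mod 6 = n mod 6 \<Longrightarrow> A m = A n"
  by (metis A_mod)

lemma A_add: "A (m + n) = A m * A n"
proof -
  have "A (m + n) = A (int (nat (m mod 6)) + int (nat (n mod 6)))"
    by (rule A_cong) (simp add: mod_add_eq)
  also have "\<dots> = A (int (nat (m mod 6) + nat (n mod 6)))" by simp
  also have "\<dots> = A (int (nat (m mod 6))) * A (int (nat (n mod 6)))"
    by (simp only: A_nat power_add)
  also have "\<dots> = A m * A n" by (simp add: A_mod)
  finally show ?thesis .
qed

lemma A_mult: "A m * A n = A (m + n)" "A m * (A n * x) = A (m + n) * x"
  by (simp_all add: A_add mult.assoc)

lemma A_b: "A n * b = sH (xp (- n)) (b * A n)"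
proof -
  have ab: "a * b = sH (xp (- 1)) (b * a)"
    using xp_minus(1)[of 1] by (simp add: relations(3) xp_values mult.commute)
  have "a ^ k * b = sH (xp (- int k)) (b * a ^ k)" for k
  proof (induction k)
    case 0
    then show ?case by (simp add: xp_values)
  next
    case (Suc k)
    have "a ^ Suc k * b = a * (a ^ k * b)" by (simp add: mult.assoc)
    also have "\<dots> = sH (xp (- int k)) (a * b * a ^ k)" by (simp add: Suc H.scale_mult mult.assoc)
    also have "\<dots> = sH (xp (- int (Suc k))) (b * a ^ Suc k)"
      using xp_add[of "- int k" "-1"] by (simp add: ab H.scale_mult mult.assoc algebra_simps)
    finally show ?case .
  qed
  from this[of "nat (n mod 6)"] have "A (n mod 6) * b = sH (xp (- (n mod 6))) (b * A (n mod 6))"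
    using A_nat[of "nat (n mod 6)"] by simp
  moreover have "xp (- (n mod 6)) = xp (- n)" by (rule xp_cong) (simp add: mod_minus_eq)
  ultimately show ?thesis by (simp add: A_mod)
qed

lemma A_b_assoc: "A n * (b * x) = sH (xp (- n)) (b * (A n * x))"
  using A_b[of n] by (metis H.scale_mult(1) mult.assoc)

lemma b_b: "b * (b * x) = 0"
  by (metis mult.assoc mult_zero_left relations(2))

lemma a_mult: "a * A n = A (n + 1)" "A n * a = A (n + 1)" "A n * (a * x) = A (n + 1) * x"
    "a * b = sH (xp (- 1)) (b * a)" "a * (b * x) = sH (xp (- 1)) (b * (a * x))"
proof -
  have a: "a = A 1" by (simp add: A_numeral)
  show "a * A n = A (n + 1)" "A n * a = A (n + 1)" "A n * (a * x) = A (n + 1) * x"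
    using A_mult(1)[of 1 n] A_mult(1)[of n 1] A_mult(2)[of n 1 x] unfolding a[symmetric] by (simp_all add: add.commute)
  show "a * b = sH (xp (- 1)) (b * a)" "a * (b * x) = sH (xp (- 1)) (b * (a * x))"
    using A_b[of 1] A_b_assoc[of 1 x] unfolding a[symmetric] by simp_all
qed

text \<open>The monomials \<open>a\<^sup>n\<close> and \<open>b a\<^sup>n\<close>, spanning and as many as the dimension, form a basis.\<close>

definition bas :: "int \<times> bool \<Rightarrow> 'h"
  where "bas i = (if snd i then b * A (fst i) else A (fst i))"

abbreviation I :: "(int \<times> bool) set" where "I \<equiv> {0..<6} \<times> UNIV"

lemma bas_pair: "bas (n, t) = (if t then b * A n else A n)"
  by (simp add: bas_def)

lemma bas_in: "A n \<in> bas ` I" "b * A n \<in> bas ` I"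
proof -
  have "A n = bas (n mod 6, False)" "b * A n = bas (n mod 6, True)"
    by (simp_all add: bas_def A_mod)
  then show "A n \<in> bas ` I" "b * A n \<in> bas ` I" by auto
qed

lemma bas_span: "H.span (bas ` I) = UNIV"
proof (rule H.left_stable_subspace)
  show "surj (fa_eval sH (gens a b))" using presH by (simp add: presented_by_def)
  show "H.subspace (H.span (bas ` I))" by simp
  show "1 \<in> H.span (bas ` I)" using bas_in(1)[of 0] by (simp add: A_numeral H.span_base)
  fix g x assume "x \<in> H.span (bas ` I)"
  then show "gens a b g * x \<in> H.span (bas ` I)"
  proof (induction rule: H.span_induct_alt)
    case base
    then show ?case by (simp add: H.span_zero)
  next
    case (step c x y)
    from step(1) obtain i where "x = bas i" by blast
    moreover obtain n t where "i = (n, t)" by (cases i)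
    ultimately have x: "x = bas (n, t)" by simp
    have "gens a b g * x \<in> H.span (bas ` I)"
      by (cases g; cases t)
        (auto simp: x gens_def bas_pair a_mult A_mult A_b_assoc b_b H.span_zero
          intro!: H.span_base H.span_scale bas_in)
    then show ?case using step(2)
      by (simp add: distrib_left H.scale_mult H.span_add H.span_scale)
  qed
qed

lemma bas_basis: "H.independent (bas ` I)" "inj_on bas I"
proof -
  obtain B where "finite_dimensional_vector_space sH B" using dimH by (auto simp: has_dim_def finite_dim_def)
  then interpret F: finite_dimensional_vector_space sH B .
  have dim: "H.dim (UNIV :: 'h set) = 12" using dimH by (simp add: has_dim_def)
  have cI: "card I = 12" by simp
  have fin: "finite (bas ` I)" by simp
  have "H.dim (UNIV :: 'h set) \<le> card (bas ` I)"
    by (rule H.dim_le_card) (use bas_span in auto)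
  moreover have "card (bas ` I) \<le> 12" using card_image_le[of I bas] cI by simp
  ultimately have card: "card (bas ` I) = 12" using dim by simp
  then show "inj_on bas I" using cI by (intro eq_card_imp_inj_on) auto
  show "H.independent (bas ` I)"
    by (rule F.card_le_dim_spanning[of _ UNIV]) (use bas_span card dim in auto)
qed

text \<open>The linear form with prescribed values on this basis.\<close>

definition hform :: "(int \<Rightarrow> 'k) \<Rightarrow> (int \<Rightarrow> 'k) \<Rightarrow> 'h \<Rightarrow> 'k"
  where "hform u w = (SOME \<phi>. linform sH \<phi> \<and> (\<forall>n\<in>{0..<6}. \<phi> (A n) = u n \<and> \<phi> (b * A n) = w n))"

lemma hform: "linform sH (hform u w)"
    "n \<in> {0..<6} \<Longrightarrow> hform u w (A n) = u n" "n \<in> {0..<6} \<Longrightarrow> hform u w (b * A n) = w n"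
proof -
  interpret P: vector_space_pair sH "(*) :: 'k \<Rightarrow> 'k \<Rightarrow> 'k"
    by (rule vector_space_pair.intro[OF vsH vector_space_times])
  define F where "F x = (\<lambda>(n, t). if t then w n else u n) (inv_into I bas x)" for x
  obtain \<phi> where \<phi>: "linform sH \<phi>" "\<forall>x\<in>bas ` I. \<phi> x = F x"
    using P.linear_independent_extend[OF bas_basis(1), of F] unfolding linform_def by blast
  have "\<phi> (bas i) = (\<lambda>(n, t). if t then w n else u n) i" if "i \<in> I" for i
  proof -
    have "\<phi> (bas i) = F (bas i)" using \<phi>(2) that by blast
    then show ?thesis by (simp only: F_def inv_into_f_f[OF bas_basis(2) that])
  qed
  from this[of "(_, False)"] this[of "(_, True)"]
  have "linform sH \<phi> \<and> (\<forall>n\<in>{0..<6}. \<phi> (A n) = u n \<and> \<phi> (b * A n) = w n)"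
    using \<phi>(1) by (simp add: bas_pair)
  then have *: "linform sH (hform u w) \<and>
      (\<forall>n\<in>{0..<6}. hform u w (A n) = u n \<and> hform u w (b * A n) = w n)"
    unfolding hform_def by (rule someI[where P = "\<lambda>\<phi>. linform sH \<phi> \<and> (\<forall>n\<in>{0..<6}. \<phi> (A n) = u n \<and> \<phi> (b * A n) = w n)"])
  show "linform sH (hform u w)" using * by blast
  show "n \<in> {0..<6} \<Longrightarrow> hform u w (A n) = u n" "n \<in> {0..<6} \<Longrightarrow> hform u w (b * A n) = w n"
    using * by blast+
qed

lemma hform_periodic:
  assumes "\<And>n. u (n mod 6) = u n" "\<And>n. w (n mod 6) = w n"
  shows "hform u w (A n) = u n" "hform u w (b * A n) = w n"
  using hform(2)[of "n mod 6" u w] hform(3)[of "n mod 6" u w] by (simp_all add: assms A_mod)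

lemma linform_H_eqI:
  assumes \<phi>: "linform sH \<phi>" and \<psi>: "linform sH \<psi>"
    and "\<And>n. \<phi> (A n) = \<psi> (A n)" "\<And>n. \<phi> (b * A n) = \<psi> (b * A n)"
  shows "\<phi> = \<psi>"
proof (rule linear_ext_span[OF _ _ bas_span])
  show "Vector_Spaces.linear sH (*) \<phi>" "Vector_Spaces.linear sH (*) \<psi>"
    using \<phi> \<psi> by (simp_all add: linform_def)
  fix x assume "x \<in> bas ` I"
  then show "\<phi> x = \<psi> x" using assms(3,4) by (auto simp: bas_def)
qed

text \<open>
  The comultiplication of the basis.  In \<open>C \<otimes> C\<close> the two summands of \<open>\<Delta> a\<close> commute up to \<open>\<xi>\<^sup>-\<^sup>2\<close> and the
  second one has square zero, so the powers of \<open>\<Delta> a\<close> carry the quantum integers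
  \<open>(1 - \<xi>\<^sup>-\<^sup>2\<^sup>n) / (1 - \<xi>\<^sup>-\<^sup>2)\<close>.  Multiplied by \<open>\<xi>\<^sup>4 + \<xi>\<^sup>5\<close> they become \<open>- \<xi> (1 - \<xi>\<^sup>-\<^sup>2\<^sup>n)\<close>.
\<close>

lemma comult_A:
  assumes \<beta>: "bilform sH sH \<beta>"
  shows "\<Delta> (A n) \<beta> = \<beta> (A n) (A n) - \<xi> * (1 - xp (- 2 * n)) * \<beta> (b * A (n - 1)) (b * A (n + 2))"
proof -
  have "\<Delta> (A (int k)) \<beta> = \<beta> (A (int k)) (A (int k)) -
      \<xi> * (1 - xp (- 2 * int k)) * \<beta> (b * A (int k - 1)) (b * A (int k + 2))"
    if \<beta>: "bilform sH sH \<beta>" for k \<beta>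
    using \<beta>
  proof (induction k arbitrary: \<beta>)
    case 0
    then show ?case by (simp add: A_numeral comultH_one pure_def xp_values)
  next
    case (Suc k)
    note bs = bilform_simps[OF Suc.prems]
    let ?A = "A (int k)"
    have bil: "bilform sH sH (\<lambda>h1 h2. \<beta> (g1 * h1) (g2 * h2))" for g1 g2
      by (rule bilformI[OF vsH vsH]) (simp_all add: distrib_left bs H.scale_mult)
    have da: "\<Delta> a (\<lambda>h1 h2. \<beta> (g1 * h1) (g2 * h2)) =
        \<beta> (g1 * A 1) (g2 * A 1) + (1 - 2 * \<xi>) * \<beta> (g1 * b) (g2 * (b * A 3))" for g1 g2
      using bil[of g1 g2] by (simp add: comult_a pure_def xi4 xi5 A_numeral algebra_simps)
    have bil2: "bilform sH sH (\<lambda>g1 g2. \<Delta> a (\<lambda>h1 h2. \<beta> (g1 * h1) (g2 * h2)))"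
      unfolding da by (rule bilformI[OF vsH vsH]) (simp_all add: distrib_right bs H.scale_mult algebra_simps)
    have "A (int (Suc k)) = A (int k) * a" by (simp add: A_nat power_Suc2 del: of_nat_Suc power_Suc)
    then have "\<Delta> (A (int (Suc k))) \<beta> = \<Delta> (A (int k)) (\<lambda>g1 g2. \<Delta> a (\<lambda>h1 h2. \<beta> (g1 * h1) (g2 * h2)))"
      by (simp only: comultH_mult[OF Suc.prems])
    also have "\<dots> = \<Delta> a (\<lambda>h1 h2. \<beta> (?A * h1) (?A * h2)) - \<xi> * (1 - xp (- 2 * int k)) *
        \<Delta> a (\<lambda>h1 h2. \<beta> (b * A (int k - 1) * h1) (b * A (int k + 2) * h2))"
      by (rule Suc.IH[OF bil2])
    also have "\<dots> = \<beta> (A (int k + 1)) (A (int k + 1)) +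
       ((1 - 2 * \<xi>) * (xp (- int k) * xp (- int k)) - \<xi> * (1 - xp (- 2 * int k))) * \<beta> (b * A (int k)) (b * A (int k + 3))"
      unfolding da by (simp add: A_mult A_b A_b_assoc bs H.scale_mult mult.assoc b_b algebra_simps)
    also have "(1 - 2 * \<xi>) * (xp (- int k) * xp (- int k)) - \<xi> * (1 - xp (- 2 * int k)) =
       - \<xi> * (1 - xp (- 2 * int (Suc k)))"
    proof -
      have 1: "xp (- int k) * xp (- int k) = xp (- 2 * int k)" by (simp flip: xp_add)
      have "xp (- 2 * int (Suc k)) = xp (- 2 * int k) * xp 4"
        unfolding xp_add[symmetric] by (rule xp_cong) (simp add: algebra_simps mod_eq_dvd_iff)
      then have 2: "xp (- 2 * int (Suc k)) = - \<xi> * xp (- 2 * int k)" by (simp add: xp_values)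
      show ?thesis unfolding 1 2 by (simp add: algebra_simps xi_mult)
    qed
    finally show ?case by (simp add: algebra_simps)
  qed
  from this[OF \<beta>, of "nat (n mod 6)"]
  have "\<Delta> (A (n mod 6)) \<beta> = \<beta> (A (n mod 6)) (A (n mod 6)) -
      \<xi> * (1 - xp (- 2 * (n mod 6))) * \<beta> (b * A (n mod 6 - 1)) (b * A (n mod 6 + 2))" by simp
  moreover have "xp (- 2 * (n mod 6)) = xp (- 2 * n)"
    by (rule xp_cong) (metis mod_mult_right_eq)
  moreover have "A (n mod 6 - 1) = A (n - 1)" "A (n mod 6 + 2) = A (n + 2)"
    by (rule A_cong; simp add: mod_diff_left_eq mod_add_left_eq)+
  ultimately show ?thesis by (simp add: A_mod)
qed

lemma comult_bA:
  assumes \<beta>: "bilform sH sH \<beta>"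
  shows "\<Delta> (b * A n) \<beta> = \<beta> (b * A n) (A (n + 4)) + \<beta> (A (n + 1)) (b * A n)"
proof -
  note bs = bilform_simps[OF \<beta>]
  have bil: "bilform sH sH (\<lambda>h1 h2. \<beta> (g1 * h1) (g2 * h2))" for g1 g2
    by (rule bilformI[OF vsH vsH]) (simp_all add: distrib_left bs H.scale_mult)
  have bil2: "bilform sH sH (\<lambda>g1 g2. \<Delta> (A n) (\<lambda>h1 h2. \<beta> (g1 * h1) (g2 * h2)))"
    unfolding comult_A[OF bil] by (rule bilformI[OF vsH vsH]) (simp_all add: distrib_right bs H.scale_mult algebra_simps)
  have "\<Delta> (b * A n) \<beta> = \<Delta> b (\<lambda>g1 g2. \<Delta> (A n) (\<lambda>h1 h2. \<beta> (g1 * h1) (g2 * h2)))"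
    by (rule comultH_mult[OF \<beta>])
  also have "\<dots> = \<beta> (b * A n) (A (n + 4)) + \<beta> (A (n + 1)) (b * A n)"
    using bil2 unfolding comult_b
    by (simp add: pure_def comult_A[OF bil] a_mult A_mult A_b_assoc b_b bs flip: A_numeral(4))
      (simp add: add.commute)
  finally show ?thesis .
qed

end

section \<open>Yetter-Drinfeld modules as modules over four operators\<close>

locale yd_C = hopf_C \<xi> H a b for \<xi> :: "'k::field_char_0" and H :: "('k, 'h::ring_1) hopf" and a b +
  fixes V :: "('k, 'h, 'v::ab_group_add) yd"
  assumes yd: "yd_module H V"
begin

abbreviation sV where "sV \<equiv> scale V"
abbreviation \<delta> where "\<delta> \<equiv> coact V"

lemma vsV: "vector_space sV"
  using yd unfolding yd_module_def Let_def by blast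

sublocale V: vector_space sV by (rule vsV)

lemma act_linear: "Vector_Spaces.linear sH sV (\<lambda>h. act V h v)" "Vector_Spaces.linear sV sV (act V h)"
  using yd unfolding yd_module_def Let_def by blast+

lemma act_one: "act V 1 v = v"
  using yd unfolding yd_module_def Let_def by blast

lemma act_mult: "act V (g * h) v = act V g (act V h v)"
  using yd unfolding yd_module_def Let_def by blast

lemma coact_linear: "Vector_Spaces.linear sV tscale \<delta>"
  using yd unfolding yd_module_def Let_def by blast

lemma coact_in: "\<delta> v \<in> tensors sH sV"
  using yd unfolding yd_module_def Let_def by (elim conjE) (erule spec)

lemma coact_coassoc: "trilform sH sH sV \<tau> \<Longrightarrow>
    \<delta> v (\<lambda>h w. \<Delta> h (\<lambda>x y. \<tau> x y w)) = \<delta> v (\<lambda>x w. \<delta> w (\<lambda>y w'. \<tau> x y w'))"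
  using yd unfolding yd_module_def Let_def by blast

lemma coact_counit: "linform sV \<phi> \<Longrightarrow> \<delta> v (\<lambda>h w. counit H h * \<phi> w) = \<phi> v"
  using yd unfolding yd_module_def Let_def by blast

lemma yd_condition: "bilform sH sV \<beta> \<Longrightarrow> \<delta> (act V h v) \<beta> =
    \<Delta> h (\<lambda>h1 h'. \<Delta> h' (\<lambda>h2 h3. \<delta> v (\<lambda>g w. \<beta> (h1 * g * antipode H h3) (act V h2 w))))"
  using yd unfolding yd_module_def Let_def by blast

lemma coact_list: "\<exists>L. \<forall>\<beta>. \<delta> x \<beta> = (if bilform sH sV \<beta> then lsum L \<beta> else 0)"
proof -
  obtain L where "\<And>\<beta>. bilform sH sV \<beta> \<Longrightarrow> \<delta> x \<beta> = lsum L \<beta>" "\<And>\<beta>. \<not> bilform sH sV \<beta> \<Longrightarrow> \<delta> x \<beta> = 0"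
    by (rule tspan_list[OF vsH vsV coact_in[of x]]) auto
  then show ?thesis by metis
qed

text \<open>The antipode-free form of the Yetter-Drinfeld condition: \<open>(h\<^sub>1 v)\<^sub>-\<^sub>1 h\<^sub>2 \<otimes> (h\<^sub>1 v)\<^sub>0 = h\<^sub>1 v\<^sub>-\<^sub>1 \<otimes> h\<^sub>2 v\<^sub>0\<close>.\<close>

lemma yd_compat:
  assumes \<beta>: "bilform sH sV \<beta>"
  shows "\<Delta> h (\<lambda>h1 h2. \<delta> (act V h1 v) (\<lambda>g w. \<beta> (g * h2) w)) =
    \<Delta> h (\<lambda>h1 h2. \<delta> v (\<lambda>g w. \<beta> (h1 * g) (act V h2 w)))"
proof -
  note bs = bilform_simps[OF \<beta>] bilform_left_simps[OF \<beta>]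
  note as = linear_simps[OF act_linear(1)] linear_simps[OF act_linear(2)]
  note Ss = linear_simps[OF antipodeH_linear]
  note ms = distrib_left distrib_right H.scale_mult
  obtain L where L: "\<And>\<beta>. bilform sH sV \<beta> \<Longrightarrow> \<delta> v \<beta> = lsum L \<beta>" using coact_list[of v] by metis
  define \<Phi> where "\<Phi> k1 k2 z = \<delta> v (\<lambda>g w. \<beta> (k1 * g * z) (act V k2 w))" for k1 k2 z
  have bil: "bilform sH sV (\<lambda>g w. \<beta> (k1 * g * z) (act V k2 w))" for k1 k2 z
    by (rule bilformI[OF vsH vsV]) (simp_all add: ms bs as)
  have \<Phi>: "\<Phi> k1 k2 z = lsum L (\<lambda>g w. \<beta> (k1 * g * z) (act V k2 w))" for k1 k2 z
    unfolding \<Phi>_def by (rule L[OF bil])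
  have \<Phi>_lin: "\<Phi> (x + y) k2 z = \<Phi> x k2 z + \<Phi> y k2 z" "\<Phi> (sH c x) k2 z = c * \<Phi> x k2 z"
    "\<Phi> k1 (x + y) z = \<Phi> k1 x z + \<Phi> k1 y z" "\<Phi> k1 (sH c x) z = c * \<Phi> k1 x z"
    "\<Phi> k1 k2 (x + y) = \<Phi> k1 k2 x + \<Phi> k1 k2 y" "\<Phi> k1 k2 (sH c x) = c * \<Phi> k1 k2 x"
    for x y z k1 k2 c
    unfolding \<Phi> by (simp_all add: ms bs as lsum_add lsum_mult mult.assoc)
  define F where "F k1 k2 k3 h2 = \<Phi> k1 k2 (antipode H k3 * h2)" for k1 k2 k3 h2
  have F_lin: "F (x + y) k2 k3 z = F x k2 k3 z + F y k2 k3 z" "F (sH c x) k2 k3 z = c * F x k2 k3 z"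
    "F k1 (x + y) k3 z = F k1 x k3 z + F k1 y k3 z" "F k1 (sH c x) k3 z = c * F k1 x k3 z"
    "F k1 k2 (x + y) z = F k1 k2 x z + F k1 k2 y z" "F k1 k2 (sH c x) z = c * F k1 k2 x z"
    "F k1 k2 k3 (x + y) = F k1 k2 k3 x + F k1 k2 k3 y" "F k1 k2 k3 (sH c x) = c * F k1 k2 k3 x"
    for x y z k1 k2 k3 c
    unfolding F_def by (simp_all add: \<Phi>_lin ms Ss)
  have bilF: "bilform sH sH (\<lambda>k2 k3. F k1 k2 k3 z)" for k1 z
    by (rule bilformI[OF vsH vsH]) (simp_all add: F_lin)
  define \<tau> where "\<tau> k1 k' h2 = \<Delta> k' (\<lambda>k2 k3. F k1 k2 k3 h2)" for k1 k' h2
  have \<tau>_lin: "\<tau> (x + y) k' z = \<tau> x k' z + \<tau> y k' z" "\<tau> (sH c x) k' z = c * \<tau> x k' z"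
    "\<tau> k1 (x + y) z = \<tau> k1 x z + \<tau> k1 y z" "\<tau> k1 (sH c x) z = c * \<tau> k1 x z"
    "\<tau> k1 k' (x + y) = \<tau> k1 k' x + \<tau> k1 k' y" "\<tau> k1 k' (sH c x) = c * \<tau> k1 k' x"
    for x y z k1 k' c
  proof -
    obtain M where M: "\<And>\<beta>. bilform sH sH \<beta> \<Longrightarrow> \<Delta> k' \<beta> = lsum M \<beta>" using comultH_list[of k'] by blast
    show "\<tau> (x + y) k' z = \<tau> x k' z + \<tau> y k' z" "\<tau> (sH c x) k' z = c * \<tau> x k' z"
      "\<tau> k1 k' (x + y) = \<tau> k1 k' x + \<tau> k1 k' y" "\<tau> k1 k' (sH c x) = c * \<tau> k1 k' x"
      unfolding \<tau>_def M[OF bilF] by (simp_all add: F_lin lsum_add lsum_mult)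
    show "\<tau> k1 (x + y) z = \<tau> k1 x z + \<tau> k1 y z" "\<tau> k1 (sH c x) z = c * \<tau> k1 x z"
      by (simp_all add: \<tau>_def linear_simps[OF comultH_linear])
  qed
  have tri\<tau>: "trilform sH sH sH \<tau>"
    unfolding trilform_def by (intro conjI allI linformI vsH) (simp_all add: \<tau>_lin)
  have triF: "trilform sH sH sH (F k1)" for k1
    unfolding trilform_def by (intro conjI allI linformI vsH) (simp_all add: F_lin)
  have "\<Delta> h (\<lambda>h1 h2. \<delta> (act V h1 v) (\<lambda>g w. \<beta> (g * h2) w)) =
      \<Delta> h (\<lambda>h1 h2. \<Delta> h1 (\<lambda>k1 k'. \<tau> k1 k' h2))"
  proof -
    have "\<delta> (act V h1 v) (\<lambda>g w. \<beta> (g * h2) w) = \<Delta> h1 (\<lambda>k1 k'. \<tau> k1 k' h2)" for h1 h2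
    proof -
      have "bilform sH sV (\<lambda>g w. \<beta> (g * h2) w)"
        by (rule bilformI[OF vsH vsV]) (simp_all add: ms bs)
      from yd_condition[OF this, of h1 v] show ?thesis
        unfolding \<tau>_def F_def \<Phi>_def by (simp add: mult.assoc)
    qed
    then show ?thesis by simp
  qed
  also have "\<dots> = \<Delta> h (\<lambda>k1 x. \<Delta> x (\<lambda>k' h2. \<tau> k1 k' h2))" by (rule coassocH[OF tri\<tau>])
  also have "\<dots> = \<Delta> h (\<lambda>k1 x. \<delta> v (\<lambda>g w. \<beta> (k1 * g) (act V x w)))"
  proof -
    have "\<Delta> x (\<lambda>k' h2. \<tau> k1 k' h2) = \<delta> v (\<lambda>g w. \<beta> (k1 * g) (act V x w))" for k1 x
    proof -
      have "\<Delta> x (\<lambda>k' h2. \<tau> k1 k' h2) = \<Delta> x (\<lambda>k2 y. \<Delta> y (\<lambda>k3 h2. F k1 k2 k3 h2))"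
        unfolding \<tau>_def by (rule coassocH[OF triF])
      also have "\<dots> = \<Delta> x (\<lambda>k2 y. \<Phi> k1 k2 1 * counit H y)"
      proof -
        have "\<Delta> y (\<lambda>k3 h2. F k1 k2 k3 h2) = \<Phi> k1 k2 1 * counit H y" for k2 y
        proof -
          have "linform sH (\<Phi> k1 k2)" by (rule linformI[OF vsH]) (simp_all add: \<Phi>_lin)
          from antipodeH[OF this] show ?thesis by (simp add: F_def mult.commute)
        qed
        then show ?thesis by simp
      qed
      also have "\<dots> = \<Phi> k1 x 1"
        by (rule counitH(2)) (rule linformI[OF vsH], simp_all add: \<Phi>_lin)
      finally show ?thesis by (simp add: \<Phi>_def)
    qed
    then show ?thesis by simp
  qed
  finally show ?thesis .
qed

text \<open>The operator \<open>v \<mapsto> \<phi>(v\<^sub>-\<^sub>1) v\<^sub>0\<close> of a linear form \<open>\<phi>\<close> on \<open>C\<close>.\<close>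

definition slice :: "('h \<Rightarrow> 'k) \<Rightarrow> 'v \<Rightarrow> 'v"
  where "slice \<phi> v = (SOME w. \<forall>f. linform sV f \<longrightarrow> f w = \<delta> v (\<lambda>h x. \<phi> h * f x))"

lemma slice:
  assumes \<phi>: "linform sH \<phi>" and f: "linform sV f"
  shows "f (slice \<phi> v) = \<delta> v (\<lambda>h x. \<phi> h * f x)"
proof -
  obtain L where L: "\<And>\<beta>. bilform sH sV \<beta> \<Longrightarrow> \<delta> v \<beta> = lsum L \<beta>" using coact_list[of v] by metis
  have "f (\<Sum>(h, x)\<leftarrow>L. sV (\<phi> h) x) = \<delta> v (\<lambda>h x. \<phi> h * f x)" if f: "linform sV f" for f
    unfolding L[OF bilform_prod[OF \<phi> f]] lsum_def linform_sum_list[OF f]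
    by (rule arg_cong[of _ _ sum_list]) (auto simp: linform_simps[OF f])
  then have "\<exists>w. \<forall>f. linform sV f \<longrightarrow> f w = \<delta> v (\<lambda>h x. \<phi> h * f x)" by blast
  from someI_ex[OF this] show ?thesis using f by (simp add: slice_def)
qed

lemma slice_linear:
  assumes \<phi>: "linform sH \<phi>" shows "Vector_Spaces.linear sV sV (slice \<phi>)"
proof (rule linearI[OF vsV vsV])
  fix x y c
  show "slice \<phi> (x + y) = slice \<phi> x + slice \<phi> y"
    by (rule linform_separates[OF vsV])
      (simp add: slice[OF \<phi>] linform_simps linear_simps[OF coact_linear])
  show "slice \<phi> (sV c x) = sV c (slice \<phi> x)"
    by (rule linform_separates[OF vsV])
      (simp add: slice[OF \<phi>] linform_simps linear_simps[OF coact_linear])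
qed

lemma slice_comb:
  assumes \<phi>: "linform sH \<phi>" and \<psi>: "linform sH \<psi>"
  shows "slice (\<lambda>h. c * \<phi> h + d * \<psi> h) v = sV c (slice \<phi> v) + sV d (slice \<psi> v)"
proof (rule linform_separates[OF vsV])
  fix f assume f: "linform sV f"
  obtain L where L: "\<And>\<beta>. bilform sH sV \<beta> \<Longrightarrow> \<delta> v \<beta> = lsum L \<beta>" using coact_list[of v] by metis
  have l: "linform sH (\<lambda>h. c * \<phi> h + d * \<psi> h)"
    by (rule linformI[OF vsH]) (simp_all add: linform_simps[OF \<phi>] linform_simps[OF \<psi>] algebra_simps)
  show "f (slice (\<lambda>h. c * \<phi> h + d * \<psi> h) v) = f (sV c (slice \<phi> v) + sV d (slice \<psi> v))"
    by (simp add: linform_simps[OF f] slice[OF l f] slice[OF \<phi> f] slice[OF \<psi> f]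
        L bilform_prod[OF l f] bilform_prod[OF \<phi> f] bilform_prod[OF \<psi> f])
      (simp add: algebra_simps lsum_add lsum_mult)
qed

lemma slice_add:
  "linform sH \<phi> \<Longrightarrow> linform sH \<psi> \<Longrightarrow> slice (\<lambda>h. \<phi> h + \<psi> h) v = slice \<phi> v + slice \<psi> v"
  using slice_comb[of \<phi> \<psi> 1 1 v] by simp

lemma slice_scale: "linform sH \<phi> \<Longrightarrow> slice (\<lambda>h. c * \<phi> h) v = sV c (slice \<phi> v)"
  using slice_comb[of \<phi> \<phi> c 0 v] by simp

lemma slice_zero: "slice (\<lambda>h. 0) v = 0"
proof -
  have "linform sH (\<lambda>h. 0)" by (rule linformI[OF vsH]) simp_all
  from slice_scale[OF this, of 0 v] show ?thesis by simp
qed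

lemma slice_counit: "slice (counit H) v = v"
  by (rule linform_separates[OF vsV]) (simp add: slice[OF counitH_linform] coact_counit)

lemma conv_linform:
  assumes \<phi>: "linform sH \<phi>" and \<psi>: "linform sH \<psi>"
  shows "linform sH (\<lambda>h. \<Delta> h (\<lambda>x y. \<phi> x * \<psi> y))"
  by (rule linformI[OF vsH]) (simp_all add: linear_simps[OF comultH_linear])

lemma slice_slice:
  assumes \<phi>: "linform sH \<phi>" and \<psi>: "linform sH \<psi>"
  shows "slice \<psi> (slice \<phi> v) = slice (\<lambda>h. \<Delta> h (\<lambda>x y. \<phi> x * \<psi> y)) v"
proof (rule linform_separates[OF vsV])
  fix f assume f: "linform sV f"
  note fs = linform_simps[OF f] linform_simps[OF \<phi>] linform_simps[OF \<psi>]
  have F: "linform sV (\<lambda>w. \<delta> w (\<lambda>y x. \<psi> y * f x))"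
    by (rule linformI[OF vsV]) (simp_all add: linear_simps[OF coact_linear])
  have tri: "trilform sH sH sV (\<lambda>x y w. \<phi> x * (\<psi> y * f w))"
    unfolding trilform_def by (intro conjI allI linformI vsH vsV) (simp_all add: fs algebra_simps)
  have "f (slice \<psi> (slice \<phi> v)) = \<delta> v (\<lambda>h w. \<phi> h * \<delta> w (\<lambda>y x. \<psi> y * f x))"
    by (simp add: slice[OF \<psi> f] slice[OF \<phi> F])
  also have "\<dots> = \<delta> v (\<lambda>x w. \<delta> w (\<lambda>y w'. \<phi> x * (\<psi> y * f w')))"
  proof -
    have "\<phi> x * \<delta> w (\<lambda>y x. \<psi> y * f x) = \<delta> w (\<lambda>y w'. \<phi> x * (\<psi> y * f w'))" for x w
    proof -
      obtain L where L: "\<And>\<beta>. bilform sH sV \<beta> \<Longrightarrow> \<delta> w \<beta> = lsum L \<beta>" using coact_list[of w] by metis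
      have "bilform sH sV (\<lambda>y w'. \<phi> x * (\<psi> y * f w'))"
        by (rule bilformI[OF vsH vsV]) (simp_all add: fs algebra_simps)
      then show ?thesis by (simp add: L bilform_prod[OF \<psi> f] lsum_mult)
    qed
    then show ?thesis by simp
  qed
  also have "\<dots> = \<delta> v (\<lambda>h w. \<Delta> h (\<lambda>x y. \<phi> x * (\<psi> y * f w)))"
    by (rule coact_coassoc[OF tri, symmetric])
  also have "\<dots> = \<delta> v (\<lambda>h w. \<Delta> h (\<lambda>x y. \<phi> x * \<psi> y) * f w)"
  proof -
    have "\<Delta> h (\<lambda>x y. \<phi> x * (\<psi> y * f w)) = \<Delta> h (\<lambda>x y. \<phi> x * \<psi> y) * f w" for h w
    proof -
      obtain L where L: "\<And>\<beta>. bilform sH sH \<beta> \<Longrightarrow> \<Delta> h \<beta> = lsum L \<beta>" using comultH_list[of h] by blast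
      have b: "bilform sH sH (\<lambda>x y. \<phi> x * \<psi> y * f w)"
        by (rule bilformI[OF vsH vsH]) (simp_all add: fs algebra_simps)
      have "\<Delta> h (\<lambda>x y. \<phi> x * \<psi> y * f w) = \<Delta> h (\<lambda>x y. \<phi> x * \<psi> y) * f w"
        unfolding L[OF b] L[OF bilform_prod[OF \<phi> \<psi>]] by (rule lsum_mult_right)
      then show ?thesis by (simp only: mult.assoc)
    qed
    then show ?thesis by simp
  qed
  also have "\<dots> = f (slice (\<lambda>h. \<Delta> h (\<lambda>x y. \<phi> x * \<psi> y)) v)"
    by (rule slice[OF conv_linform[OF \<phi> \<psi>] f, symmetric])
  finally show "f (slice \<psi> (slice \<phi> v)) = f (slice (\<lambda>h. \<Delta> h (\<lambda>x y. \<phi> x * \<psi> y)) v)" .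
qed

lemma linform_mult:
  assumes \<phi>: "linform sH \<phi>"
  shows "linform sH (\<lambda>g. \<phi> (g * h))" "linform sH (\<lambda>g. \<phi> (h * g))"
  by (rule linformI[OF vsH], simp_all add: distrib_left distrib_right H.scale_mult linform_simps[OF \<phi>])+

lemma linform_act: "linform sV f \<Longrightarrow> linform sV (\<lambda>w. f (act V h w))"
  using Vector_Spaces.linear_compose[OF act_linear(2), of "(*)" f] by (simp add: linform_def o_def)

text \<open>The Yetter-Drinfeld condition for the two generators, contracted with a linear form.\<close>

lemma slice_compat:
  assumes \<phi>: "linform sH \<phi>"
  shows "slice (\<lambda>g. \<phi> (g * a)) (act V a v) + sV (1 - 2 * \<xi>) (slice (\<lambda>g. \<phi> (g * (b * A 3))) (act V b v)) =
      act V a (slice (\<lambda>g. \<phi> (a * g)) v) + sV (1 - 2 * \<xi>) (act V (b * A 3) (slice (\<lambda>g. \<phi> (b * g)) v))"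
    and "slice (\<lambda>g. \<phi> (g * A 4)) (act V b v) + slice (\<lambda>g. \<phi> (g * b)) (act V a v) =
      act V (A 4) (slice (\<lambda>g. \<phi> (b * g)) v) + act V b (slice (\<lambda>g. \<phi> (a * g)) v)"
proof -
  have main: "\<Delta> h (\<lambda>h1 h2. f (slice (\<lambda>g. \<phi> (g * h2)) (act V h1 v))) =
      \<Delta> h (\<lambda>h1 h2. f (act V h2 (slice (\<lambda>g. \<phi> (h1 * g)) v)))"
    and bil1: "bilform sH sH (\<lambda>h1 h2. f (slice (\<lambda>g. \<phi> (g * h2)) (act V h1 v)))"
    and bil2: "bilform sH sH (\<lambda>h1 h2. f (act V h2 (slice (\<lambda>g. \<phi> (h1 * g)) v)))"
    if f: "linform sV f" for h f
  proof -
    note fs = linform_simps[OF f] linform_simps[OF \<phi>]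
    have 1: "f (slice (\<lambda>g. \<phi> (g * h2)) (act V h1 v)) = \<delta> (act V h1 v) (\<lambda>g w. \<phi> (g * h2) * f w)" for h1 h2
      by (rule slice[OF linform_mult(1)[OF \<phi>] f])
    have 2: "f (act V h2 (slice (\<lambda>g. \<phi> (h1 * g)) v)) = \<delta> v (\<lambda>g w. \<phi> (h1 * g) * f (act V h2 w))" for h1 h2
      by (rule slice[OF linform_mult(2)[OF \<phi>] linform_act[OF f]])
    show "\<Delta> h (\<lambda>h1 h2. f (slice (\<lambda>g. \<phi> (g * h2)) (act V h1 v))) =
      \<Delta> h (\<lambda>h1 h2. f (act V h2 (slice (\<lambda>g. \<phi> (h1 * g)) v)))"
      unfolding 1 2 by (rule yd_compat[OF bilform_prod[OF \<phi> f]])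
    show "bilform sH sH (\<lambda>h1 h2. f (slice (\<lambda>g. \<phi> (g * h2)) (act V h1 v)))"
    proof (rule bilformI[OF vsH vsH])
      fix x y w z c
      show "f (slice (\<lambda>g. \<phi> (g * w)) (act V (x + y) v)) =
          f (slice (\<lambda>g. \<phi> (g * w)) (act V x v)) + f (slice (\<lambda>g. \<phi> (g * w)) (act V y v))"
        "f (slice (\<lambda>g. \<phi> (g * w)) (act V (sH c x) v)) = c * f (slice (\<lambda>g. \<phi> (g * w)) (act V x v))"
        by (simp_all add: linear_simps[OF act_linear(1)] linear_simps[OF slice_linear[OF linform_mult(1)[OF \<phi>]]] fs)
      have "(\<lambda>g. \<phi> (g * (w + z))) = (\<lambda>g. \<phi> (g * w) + \<phi> (g * z))"
        "(\<lambda>g. \<phi> (g * sH c w)) = (\<lambda>g. c * \<phi> (g * w))"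
        by (simp_all add: distrib_left H.scale_mult fs)
      then show "f (slice (\<lambda>g. \<phi> (g * (w + z))) (act V x v)) =
          f (slice (\<lambda>g. \<phi> (g * w)) (act V x v)) + f (slice (\<lambda>g. \<phi> (g * z)) (act V x v))"
        "f (slice (\<lambda>g. \<phi> (g * sH c w)) (act V x v)) = c * f (slice (\<lambda>g. \<phi> (g * w)) (act V x v))"
        by (simp_all only: slice_add[OF linform_mult(1)[OF \<phi>] linform_mult(1)[OF \<phi>]]
            slice_scale[OF linform_mult(1)[OF \<phi>]] fs)
    qed
    show "bilform sH sH (\<lambda>h1 h2. f (act V h2 (slice (\<lambda>g. \<phi> (h1 * g)) v)))"
    proof (rule bilformI[OF vsH vsH])
      fix x y w z c
      have "(\<lambda>g. \<phi> ((x + y) * g)) = (\<lambda>g. \<phi> (x * g) + \<phi> (y * g))"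
        "(\<lambda>g. \<phi> (sH c x * g)) = (\<lambda>g. c * \<phi> (x * g))"
        by (simp_all add: distrib_right H.scale_mult fs)
      then show "f (act V w (slice (\<lambda>g. \<phi> ((x + y) * g)) v)) =
          f (act V w (slice (\<lambda>g. \<phi> (x * g)) v)) + f (act V w (slice (\<lambda>g. \<phi> (y * g)) v))"
        "f (act V w (slice (\<lambda>g. \<phi> (sH c x * g)) v)) = c * f (act V w (slice (\<lambda>g. \<phi> (x * g)) v))"
        by (simp_all only: slice_add[OF linform_mult(2)[OF \<phi>] linform_mult(2)[OF \<phi>]]
            slice_scale[OF linform_mult(2)[OF \<phi>]] fs linear_simps[OF act_linear(2)])
      show "f (act V (w + z) (slice (\<lambda>g. \<phi> (x * g)) v)) =
          f (act V w (slice (\<lambda>g. \<phi> (x * g)) v)) + f (act V z (slice (\<lambda>g. \<phi> (x * g)) v))"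
        "f (act V (sH c w) (slice (\<lambda>g. \<phi> (x * g)) v)) = c * f (act V w (slice (\<lambda>g. \<phi> (x * g)) v))"
        by (simp_all add: linear_simps[OF act_linear(1)] fs)
    qed
  qed
  show "slice (\<lambda>g. \<phi> (g * a)) (act V a v) + sV (1 - 2 * \<xi>) (slice (\<lambda>g. \<phi> (g * (b * A 3))) (act V b v)) =
      act V a (slice (\<lambda>g. \<phi> (a * g)) v) + sV (1 - 2 * \<xi>) (act V (b * A 3) (slice (\<lambda>g. \<phi> (b * g)) v))"
  proof (rule linform_separates[OF vsV])
    fix f assume f: "linform sV f"
    have "\<xi> ^ 4 + \<xi> ^ 5 = 1 - 2 * \<xi>" by (simp add: xi4 xi5)
    with main[OF f, of a] bil1[OF f] bil2[OF f]
    show "f (slice (\<lambda>g. \<phi> (g * a)) (act V a v) + sV (1 - 2 * \<xi>) (slice (\<lambda>g. \<phi> (g * (b * A 3))) (act V b v))) =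
        f (act V a (slice (\<lambda>g. \<phi> (a * g)) v) + sV (1 - 2 * \<xi>) (act V (b * A 3) (slice (\<lambda>g. \<phi> (b * g)) v)))"
      unfolding comult_a by (simp add: pure_def linform_simps[OF f] A_numeral)
  qed
  show "slice (\<lambda>g. \<phi> (g * A 4)) (act V b v) + slice (\<lambda>g. \<phi> (g * b)) (act V a v) =
      act V (A 4) (slice (\<lambda>g. \<phi> (b * g)) v) + act V b (slice (\<lambda>g. \<phi> (a * g)) v)"
  proof (rule linform_separates[OF vsV])
    fix f assume f: "linform sV f"
    from main[OF f, of b] bil1[OF f] bil2[OF f]
    show "f (slice (\<lambda>g. \<phi> (g * A 4)) (act V b v) + slice (\<lambda>g. \<phi> (g * b)) (act V a v)) =
        f (act V (A 4) (slice (\<lambda>g. \<phi> (b * g)) v) + act V b (slice (\<lambda>g. \<phi> (a * g)) v))"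
      unfolding comult_b by (simp add: pure_def linform_simps[OF f] A_numeral)
  qed
qed

text \<open>
  The dual algebra of \<open>C\<close> is generated by the character \<open>\<kappa>\<close> and the form \<open>\<theta>\<close> below; they act on
  \<open>V\<close> by the operators \<open>Y\<close> and \<open>X\<close>.
\<close>

definition \<kappa> where "\<kappa> = hform (\<lambda>n. xp (- n)) (\<lambda>n. 0)"
definition \<theta> where "\<theta> = hform (\<lambda>n. 0) (\<lambda>n. 1)"
definition Y where "Y = slice \<kappa>"
definition X where "X = slice \<theta>"

lemma \<kappa>: "linform sH \<kappa>" "\<kappa> (A n) = xp (- n)" "\<kappa> (b * A n) = 0"
proof -
  have "xp (- (n mod 6)) = xp (- n)" for n by (rule xp_cong) (simp add: mod_minus_eq)
  then show "linform sH \<kappa>" "\<kappa> (A n) = xp (- n)" "\<kappa> (b * A n) = 0"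
    by (simp_all add: \<kappa>_def hform(1) hform_periodic)
qed

lemma \<theta>: "linform sH \<theta>" "\<theta> (A n) = 0" "\<theta> (b * A n) = 1"
  by (simp_all add: \<theta>_def hform(1) hform_periodic)

lemma counit_values: "counit H (A n) = 1" "counit H (b * A n) = 0"
proof -
  have "counit H (a ^ k) = 1" for k
    by (induction k) (simp_all add: counitH_mult counitH_ab)
  then show "counit H (A n) = 1" by (simp add: A_def apow_def)
  show "counit H (b * A n) = 0" by (simp add: counitH_mult counitH_ab)
qed

lemma Y_linear: "Vector_Spaces.linear sV sV Y" and X_linear: "Vector_Spaces.linear sV sV X"
  by (simp_all add: Y_def X_def slice_linear \<kappa> \<theta>)

abbreviation opA where "opA \<equiv> act V a"
abbreviation opB where "opB \<equiv> act V b"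

lemmas op_simps = linear_simps[OF act_linear(2)] linear_simps[OF Y_linear] linear_simps[OF X_linear]

lemma conv_values:
  assumes "linform sH \<phi>" "linform sH \<psi>"
  shows "\<Delta> (A n) (\<lambda>x y. \<phi> x * \<psi> y) = \<phi> (A n) * \<psi> (A n)
      - \<xi> * (1 - xp (- 2 * n)) * (\<phi> (b * A (n - 1)) * \<psi> (b * A (n + 2)))"
    "\<Delta> (b * A n) (\<lambda>x y. \<phi> x * \<psi> y) = \<phi> (b * A n) * \<psi> (A (n + 4)) + \<phi> (A (n + 1)) * \<psi> (b * A n)"
  using bilform_prod[OF assms] by (simp_all add: comult_A comult_bA)

lemma Y_X: "Y (X v) = - X (Y v)"
proof -
  have "(\<lambda>h. \<Delta> h (\<lambda>x y. \<theta> x * \<kappa> y)) = (\<lambda>h. (- 1) * \<Delta> h (\<lambda>x y. \<kappa> x * \<theta> y))"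
  proof (rule linform_H_eqI)
    show "linform sH (\<lambda>h. \<Delta> h (\<lambda>x y. \<theta> x * \<kappa> y))" by (intro conv_linform \<theta> \<kappa>)
    show "linform sH (\<lambda>h. (- 1) * \<Delta> h (\<lambda>x y. \<kappa> x * \<theta> y))"
      by (rule linformI[OF vsH]) (simp_all add: linear_simps[OF comultH_linear])
    fix n
    show "\<Delta> (A n) (\<lambda>x y. \<theta> x * \<kappa> y) = (- 1) * \<Delta> (A n) (\<lambda>x y. \<kappa> x * \<theta> y)"
      by (simp add: conv_values \<kappa> \<theta>)
    have "xp (- (n + 4)) = xp 3 * xp (- (n + 1))"
      unfolding xp_add[symmetric] by (rule xp_cong) (simp add: mod_eq_dvd_iff)
    then show "\<Delta> (b * A n) (\<lambda>x y. \<theta> x * \<kappa> y) = (- 1) * \<Delta> (b * A n) (\<lambda>x y. \<kappa> x * \<theta> y)"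
      by (simp add: conv_values \<kappa> \<theta> xp_values)
  qed
  then have "Y (X v) = sV (- 1) (X (Y v))"
    unfolding X_def Y_def
    by (simp only: slice_slice \<kappa>(1) \<theta>(1) slice_scale[OF conv_linform[OF \<kappa>(1) \<theta>(1)]])
  then show ?thesis by simp
qed

lemma X_X: "X (X v) = sV \<xi> (Y (Y v)) - sV \<xi> v"
proof -
  have "(\<lambda>h. \<Delta> h (\<lambda>x y. \<theta> x * \<theta> y)) = (\<lambda>h. \<xi> * \<Delta> h (\<lambda>x y. \<kappa> x * \<kappa> y) + (- \<xi>) * counit H h)"
  proof (rule linform_H_eqI)
    show "linform sH (\<lambda>h. \<Delta> h (\<lambda>x y. \<theta> x * \<theta> y))" by (intro conv_linform \<theta>)
    show "linform sH (\<lambda>h. \<xi> * \<Delta> h (\<lambda>x y. \<kappa> x * \<kappa> y) + (- \<xi>) * counit H h)"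
      by (rule linformI[OF vsH])
        (simp_all add: linear_simps[OF comultH_linear] linform_simps[OF counitH_linform] algebra_simps)
    fix n
    have "xp (- n) * xp (- n) = xp (- 2 * n)" by (simp flip: xp_add)
    then show "\<Delta> (A n) (\<lambda>x y. \<theta> x * \<theta> y) = \<xi> * \<Delta> (A n) (\<lambda>x y. \<kappa> x * \<kappa> y) + (- \<xi>) * counit H (A n)"
      by (simp add: conv_values \<kappa> \<theta> counit_values algebra_simps)
    show "\<Delta> (b * A n) (\<lambda>x y. \<theta> x * \<theta> y) = \<xi> * \<Delta> (b * A n) (\<lambda>x y. \<kappa> x * \<kappa> y) + (- \<xi>) * counit H (b * A n)"
      by (simp add: conv_values \<kappa> \<theta> counit_values)
  qed
  then have "X (X v) = sV \<xi> (Y (Y v)) + sV (- \<xi>) v"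
    unfolding X_def Y_def
    by (simp only: slice_slice \<kappa>(1) \<theta>(1) slice_comb[OF conv_linform[OF \<kappa>(1) \<kappa>(1)] counitH_linform] slice_counit)
  then show ?thesis by simp
qed

lemma form_identities:
  "(\<lambda>g. \<kappa> (g * a)) = (\<lambda>g. xp (- 1) * \<kappa> g)" "(\<lambda>g. \<kappa> (a * g)) = (\<lambda>g. xp (- 1) * \<kappa> g)"
  "(\<lambda>g. \<kappa> (g * (b * A 3))) = (\<lambda>g. 0)" "(\<lambda>g. \<kappa> (b * g)) = (\<lambda>g. 0)"
  "(\<lambda>g. \<kappa> (g * A 4)) = (\<lambda>g. xp (- 4) * \<kappa> g)" "(\<lambda>g. \<kappa> (g * b)) = (\<lambda>g. 0)"
  "(\<lambda>g. \<theta> (g * a)) = \<theta>" "(\<lambda>g. \<theta> (a * g)) = (\<lambda>g. xp (- 1) * \<theta> g)"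
  "(\<lambda>g. \<theta> (g * (b * A 3))) = \<kappa>" "(\<lambda>g. \<theta> (b * g)) = counit H"
  "(\<lambda>g. \<theta> (g * A 4)) = \<theta>" "(\<lambda>g. \<theta> (g * b)) = \<kappa>"
proof -
  have lin: "linform sH (\<lambda>g. c * \<phi> g)" "linform sH (\<lambda>g. 0)" if "linform sH \<phi>" for c \<phi>
    using that by (auto intro!: linformI vsH simp: linform_simps algebra_simps)
  have e: "xp (- n - 1) = xp (- 1) * xp (- n)" "xp (- n - 4) = xp (- 4) * xp (- n)" for n
    using xp_add[of "- n" "- 1"] xp_add[of "- n" "- 4"] by (simp_all add: mult.commute)
  note vals = H.scale_mult \<kappa> \<theta> counit_values a_mult A_mult A_b A_b_assoc b_b relations(2) mult.assoc e linform_simps[OF \<kappa>(1)]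
    linform_simps[OF \<theta>(1)]
  show "(\<lambda>g. \<kappa> (g * a)) = (\<lambda>g. xp (- 1) * \<kappa> g)"
    by (rule linform_H_eqI[OF linform_mult(1)[OF \<kappa>(1)] lin(1)[OF \<kappa>(1)]]) (simp_all add: vals)
  show "(\<lambda>g. \<kappa> (a * g)) = (\<lambda>g. xp (- 1) * \<kappa> g)"
    by (rule linform_H_eqI[OF linform_mult(2)[OF \<kappa>(1)] lin(1)[OF \<kappa>(1)]]) (simp_all add: vals)
  show "(\<lambda>g. \<kappa> (g * (b * A 3))) = (\<lambda>g. 0)"
    by (rule linform_H_eqI[OF linform_mult(1)[OF \<kappa>(1)] lin(2)[OF \<kappa>(1)]]) (simp_all add: vals)
  show "(\<lambda>g. \<kappa> (b * g)) = (\<lambda>g. 0)"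
    by (rule linform_H_eqI[OF linform_mult(2)[OF \<kappa>(1)] lin(2)[OF \<kappa>(1)]]) (simp_all add: vals)
  show "(\<lambda>g. \<kappa> (g * A 4)) = (\<lambda>g. xp (- 4) * \<kappa> g)"
    by (rule linform_H_eqI[OF linform_mult(1)[OF \<kappa>(1)] lin(1)[OF \<kappa>(1)]]) (simp_all add: vals)
  show "(\<lambda>g. \<kappa> (g * b)) = (\<lambda>g. 0)"
    by (rule linform_H_eqI[OF linform_mult(1)[OF \<kappa>(1)] lin(2)[OF \<kappa>(1)]]) (simp_all add: vals)
  show "(\<lambda>g. \<theta> (g * a)) = \<theta>"
    by (rule linform_H_eqI[OF linform_mult(1)[OF \<theta>(1)] \<theta>(1)]) (simp_all add: vals)
  show "(\<lambda>g. \<theta> (a * g)) = (\<lambda>g. xp (- 1) * \<theta> g)"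
    by (rule linform_H_eqI[OF linform_mult(2)[OF \<theta>(1)] lin(1)[OF \<theta>(1)]]) (simp_all add: vals)
  show "(\<lambda>g. \<theta> (g * (b * A 3))) = \<kappa>"
    by (rule linform_H_eqI[OF linform_mult(1)[OF \<theta>(1)] \<kappa>(1)]) (simp_all add: vals)
  show "(\<lambda>g. \<theta> (b * g)) = counit H"
    by (rule linform_H_eqI[OF linform_mult(2)[OF \<theta>(1)] counitH_linform]) (simp_all add: vals)
  show "(\<lambda>g. \<theta> (g * A 4)) = \<theta>"
    by (rule linform_H_eqI[OF linform_mult(1)[OF \<theta>(1)] \<theta>(1)]) (simp_all add: vals)
  show "(\<lambda>g. \<theta> (g * b)) = \<kappa>"
    by (rule linform_H_eqI[OF linform_mult(1)[OF \<theta>(1)] \<kappa>(1)]) (simp_all add: vals)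
qed

lemma op_relations:
  "opB (opB v) = 0" "opB (opA v) = sV \<xi> (opA (opB v))"
  "Y (opA v) = opA (Y v)" "Y (opB v) = - opB (Y v)"
  "X (opA v) + sV (1 - 2 * \<xi>) (Y (opB v)) = sV (xp (- 1)) (opA (X v)) + sV (1 - 2 * \<xi>) (opB (act V (A 3) v))"
  "X (opB v) + Y (opA v) = act V (A 4) v + sV (xp (- 1)) (opB (X v))"
proof -
  have "act V (b * b) v = 0" by (simp add: relations(2) linear_simps[OF act_linear(1)])
  then show "opB (opB v) = 0" by (simp add: act_mult)
  have "act V (b * a) v = sV \<xi> (act V (a * b) v)" by (simp add: relations(3) linear_simps[OF act_linear(1)])
  then show "opB (opA v) = sV \<xi> (opA (opB v))" by (simp add: act_mult)
  have "sV (xp (- 1)) (Y (opA v)) = sV (xp (- 1)) (opA (Y v))"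
    using slice_compat(1)[OF \<kappa>(1), of v] unfolding form_identities
    by (simp add: slice_scale[OF \<kappa>(1)] slice_zero op_simps Y_def)
  then show "Y (opA v) = opA (Y v)" using xp_nonzero by simp
  have "sV (xp (- 4)) (Y (opB v)) = sV (xp (- 1)) (opB (Y v))"
    using slice_compat(2)[OF \<kappa>(1), of v] unfolding form_identities
    by (simp add: slice_scale[OF \<kappa>(1)] slice_zero op_simps Y_def)
  then have "sV (xp 4) (sV (xp (- 4)) (Y (opB v))) = sV (xp 4) (sV (xp (- 1)) (opB (Y v)))" by simp
  moreover have "xp 4 * xp (- 1) = - 1" using xp_add[of 4 "- 1"] by (simp add: xp_values)
  ultimately show "Y (opB v) = - opB (Y v)" by (simp add: xp_minus)
  show "X (opA v) + sV (1 - 2 * \<xi>) (Y (opB v)) = sV (xp (- 1)) (opA (X v)) + sV (1 - 2 * \<xi>) (opB (act V (A 3) v))"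
    using slice_compat(1)[OF \<theta>(1), of v] unfolding form_identities
    by (simp add: slice_scale[OF \<theta>(1)] slice_counit op_simps act_mult flip: X_def Y_def)
  show "X (opB v) + Y (opA v) = act V (A 4) v + sV (xp (- 1)) (opB (X v))"
    using slice_compat(2)[OF \<theta>(1), of v] unfolding form_identities
    by (simp add: slice_scale[OF \<theta>(1)] slice_counit op_simps act_mult flip: X_def Y_def)
qed

end

section \<open>Weights\<close>

context root6
begin

text \<open>The projection onto the eigenspace for \<open>\<xi>\<^sup>k\<close> of an operator \<open>T\<close> with \<open>T\<^sup>6 = 1\<close>.\<close>

definition wp :: "('k \<Rightarrow> 'v::ab_group_add \<Rightarrow> 'v) \<Rightarrow> ('v \<Rightarrow> 'v) \<Rightarrow> int \<Rightarrow> 'v \<Rightarrow> 'v"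
  where "wp s T k v = s (1 / 6) (\<Sum>m<6. s (xp (- k) ^ m) ((T ^^ m) v))"

lemma xp_power: "xp n ^ m = xp (n * int m)"
  by (induction m) (simp_all add: xp_values xp_add algebra_simps)

context
  fixes s :: "'k \<Rightarrow> 'v::ab_group_add \<Rightarrow> 'v" and T :: "'v \<Rightarrow> 'v"
  assumes T: "Vector_Spaces.linear s s T" and T6: "\<And>v. (T ^^ 6) v = v"
begin

interpretation vector_space s using T by (rule linear_imp_vector_space)

lemma funpow_linear: "Vector_Spaces.linear s s (T ^^ m)"
proof (induction m)
  case 0
  show ?case by (simp add: id_def) (auto intro!: linearI vector_space_axioms)
next
  case (Suc m)
  then show ?case using Vector_Spaces.linear_compose[OF Suc T] by (simp add: o_def)
qed

lemma wp_linear: "Vector_Spaces.linear s s (wp s T k)"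
  by (rule linearI[OF vector_space_axioms vector_space_axioms])
    (simp_all add: wp_def linear_simps[OF funpow_linear] scale_right_distrib sum.distrib
      scale_sum_right mult.commute mult.left_commute)

lemma wp_commute:
  assumes S: "Vector_Spaces.linear s s S" and ST: "\<And>v. S (T v) = T (S v)"
  shows "S (wp s T k v) = wp s T k (S v)"
proof -
  have "S ((T ^^ m) v) = (T ^^ m) (S v)" for m
    by (induction m) (simp_all add: ST)
  moreover have "S (\<Sum>m\<in>M. g m) = (\<Sum>m\<in>M. S (g m))" for g :: "nat \<Rightarrow> 'v" and M
    by (induction M rule: infinite_finite_induct) (simp_all add: linear_simps[OF S])
  ultimately show ?thesis by (simp add: wp_def linear_simps[OF S])
qed

lemma wp_eigen: "T (wp s T k v) = s (xp k) (wp s T k v)"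
proof -
  define g where "g m = s (xp k * xp (- k) ^ m) ((T ^^ m) v)" for m
  have T_sum: "T (\<Sum>m\<in>M. h m) = (\<Sum>m\<in>M. T (h m))" for h :: "nat \<Rightarrow> 'v" and M
    by (induction M rule: infinite_finite_induct) (simp_all add: linear_simps[OF T])
  have "T (s (xp (- k) ^ m) ((T ^^ m) v)) = g (Suc m)" for m
    by (simp add: g_def linear_simps[OF T] xp_minus flip: mult.assoc)
  then have "T (wp s T k v) = s (1 / 6) (\<Sum>m<6. g (Suc m))"
    by (simp add: wp_def linear_simps[OF T] T_sum)
  also have "(\<Sum>m<6. g (Suc m)) = (\<Sum>m<6. g m) - g 0 + g 6"
    using sum.lessThan_Suc_shift[of g 6] sum.lessThan_Suc[of g 6] by (simp add: algebra_simps eq_diff_eq)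
  also have "g 6 = g 0"
  proof -
    have "xp (- k) ^ 6 = xp 0" unfolding xp_power by (rule xp_cong) simp
    then show ?thesis by (simp add: g_def T6 xp_values)
  qed
  also have "s (1 / 6) ((\<Sum>m<6. g m) - g 0 + g 0) = s (xp k) (wp s T k v)"
    by (simp add: wp_def g_def scale_sum_right mult.commute mult.left_commute)
  finally show ?thesis .
qed

lemma wp_fix: assumes "T v = s (xp k) v" shows "wp s T k v = v"
proof -
  have "(T ^^ m) v = s (xp k ^ m) v" for m
    by (induction m) (simp_all add: assms linear_simps[OF T] mult.commute)
  then have "s (xp (- k) ^ m) ((T ^^ m) v) = v" for m
    by (simp add: xp_minus flip: power_mult_distrib)
  then show ?thesis by (simp add: wp_def sum_constant_scale)
qed

lemma wp_sum: "(\<Sum>k<6. wp s T (int k) v) = v"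
proof -
  have geo: "(\<Sum>k<6. xp (- int k) ^ m) = (if m = 0 then 6 else 0)" if "m < 6" for m
  proof (cases "m = 0")
    case False
    have "xp (- int k) ^ m = xp (- int m) ^ k" for k
      by (simp add: xp_power mult.commute)
    moreover have "xp (- int m) ^ 6 = xp 0" unfolding xp_power by (rule xp_cong) simp
    moreover have "xp (- int m) \<noteq> xp 0"
      using False that by (simp add: xp_eq_iff) presburger
    ultimately show ?thesis using False one_diff_power_eq[of "xp (- int m)" 6]
      by (auto simp: xp_values)
  qed simp
  have "(\<Sum>k<6. wp s T (int k) v) = s (1 / 6) (\<Sum>m<6. s (\<Sum>k<6. xp (- int k) ^ m) ((T ^^ m) v))"
    unfolding wp_def scale_sum_right[symmetric] scale_sum_left
    by (subst sum.swap) simp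
  also have "\<dots> = s (1 / 6) (\<Sum>m<(6::nat). if m = 0 then s 6 v else 0)"
    by (intro arg_cong[of _ _ "s (1 / 6)"] sum.cong) (auto simp: geo)
  also have "\<dots> = v" by simp
  finally show ?thesis .
qed

lemma wp_in:
  assumes "subspace S" "\<And>v. v \<in> S \<Longrightarrow> T v \<in> S" "v \<in> S" shows "wp s T k v \<in> S"
proof -
  have "(T ^^ m) v \<in> S" for m by (induction m) (simp_all add: assms)
  then show ?thesis unfolding wp_def using assms(1) by (intro subspace_scale subspace_sum) auto
qed

end

end

context yd_C
begin

lemma act_power: "act V (a ^ n) v = (opA ^^ n) v"
  by (induction n) (simp_all add: act_one act_mult)

lemma opA_linear: "Vector_Spaces.linear sV sV opA" by (rule act_linear)

lemma opA6: "(opA ^^ 6) v = v"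
  using act_power[of 6 v] by (simp add: relations(1) act_one)

lemma Y6: "(Y ^^ 6) v = v"
proof -
  define \<kappa>s where "\<kappa>s j = hform (\<lambda>n. xp (- n * int j)) (\<lambda>n. 0)" for j
  have per: "xp (- (n mod 6) * int j) = xp (- n * int j)" for n j
    by (rule xp_cong) (metis minus_mult_left mod_minus_cong mod_mod_trivial mod_mult_left_eq)
  have \<kappa>s: "linform sH (\<kappa>s j)" "\<kappa>s j (A n) = xp (- n * int j)" "\<kappa>s j (b * A n) = 0" for j n
    unfolding \<kappa>s_def by (rule hform(1), (subst hform_periodic; use per in simp)+)
  have "(Y ^^ j) v = slice (\<kappa>s j) v" for j
  proof (induction j)
    case 0
    have "\<kappa>s 0 = counit H"
      by (rule linform_H_eqI[OF \<kappa>s(1) counitH_linform]) (simp_all add: \<kappa>s counit_values xp_values)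
    then show ?case by (simp add: slice_counit)
  next
    case (Suc j)
    have "(\<lambda>h. \<Delta> h (\<lambda>x y. \<kappa>s j x * \<kappa> y)) = \<kappa>s (Suc j)"
      by (rule linform_H_eqI[OF conv_linform[OF \<kappa>s(1) \<kappa>(1)] \<kappa>s(1)])
        (simp_all add: conv_values[OF \<kappa>s(1) \<kappa>(1)] \<kappa>s \<kappa> algebra_simps flip: xp_add)
    then show ?case by (simp add: Suc) (simp add: Y_def slice_slice[OF \<kappa>s(1) \<kappa>(1)])
  qed
  moreover have "\<kappa>s 6 = counit H"
  proof (rule linform_H_eqI[OF \<kappa>s(1) counitH_linform])
    fix n
    have "xp (- n * 6) = xp 0" by (rule xp_cong) simp
    then show "\<kappa>s 6 (A n) = counit H (A n)" by (simp add: \<kappa>s counit_values xp_values)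
  qed (simp add: \<kappa>s counit_values)
  ultimately show ?thesis by (simp add: slice_counit)
qed

text \<open>\<open>wt m k v\<close>: \<open>v\<close> is in the eigenspaces of \<open>a\<close> for \<open>\<xi>\<^sup>m\<close> and of \<open>Y\<close> for \<open>\<xi>\<^sup>-\<^sup>k\<close>.\<close>

definition wt :: "int \<Rightarrow> int \<Rightarrow> 'v \<Rightarrow> bool"
  where "wt m k v \<longleftrightarrow> opA v = sV (xp m) v \<and> Y v = sV (xp (- k)) v"

definition wproj :: "int \<Rightarrow> int \<Rightarrow> 'v \<Rightarrow> 'v"
  where "wproj m k v = wp sV opA m (wp sV Y (- k) v)"

lemmas wpA = wp_linear[OF opA_linear opA6] wp_eigen[OF opA_linear opA6] wp_fix[OF opA_linear opA6]
  wp_commute[OF opA_linear opA6]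
lemmas wpY = wp_linear[OF Y_linear Y6] wp_eigen[OF Y_linear Y6] wp_fix[OF Y_linear Y6]
  wp_commute[OF Y_linear Y6]

lemma wproj_linear: "Vector_Spaces.linear sV sV (wproj m k)"
  using Vector_Spaces.linear_compose[OF wpY(1) wpA(1)] by (simp add: wproj_def[abs_def] o_def)

lemma wproj_A: "wproj m k (opA v) = sV (xp m) (wproj m k v)"
  unfolding wproj_def
  by (metis wpY(4)[OF opA_linear] op_relations(3) wpA(2) wpA(4)[OF opA_linear])

lemma wproj_Y: "wproj m k (Y v) = sV (xp (- k)) (wproj m k v)"
proof -
  have "wp sV Y (- k) (Y v) = sV (xp (- k)) (wp sV Y (- k) v)"
    using wpY(4)[OF Y_linear, of "- k" v] wpY(2)[of "- k" v] by simp
  then show ?thesis by (simp add: wproj_def linear_simps[OF wpA(1)])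
qed

lemma wproj_wt: "wt m k (wproj m k v)"
proof -
  have "Y (wproj m k v) = wproj m k (Y v)"
    unfolding wproj_def
    by (metis op_relations(3) wpA(4)[OF Y_linear] wpY(4)[OF Y_linear])
  then show ?thesis unfolding wt_def by (simp add: wproj_Y) (simp add: wproj_def wpA(2))
qed

lemma wproj_fix: "wt m k v \<Longrightarrow> wproj m k v = v"
  by (simp add: wproj_def wt_def wpA(3) wpY(3))

lemma wproj_sum: "(\<Sum>p<6. \<Sum>q<6. wproj (int p) (- int q) v) = v"
proof -
  have "(\<Sum>q<6. wproj (int p) (- int q) v) = wp sV opA (int p) (\<Sum>q<6. wp sV Y (int q) v)" for p
  proof -
    have "wp sV opA (int p) (\<Sum>q\<in>Q. g q) = (\<Sum>q\<in>Q. wp sV opA (int p) (g q))" for g :: "nat \<Rightarrow> 'v" and Q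
      by (induction Q rule: infinite_finite_induct) (simp_all add: linear_simps[OF wpA(1)])
    then show ?thesis by (simp add: wproj_def)
  qed
  then show ?thesis by (simp add: wp_sum[OF opA_linear opA6] wp_sum[OF Y_linear Y6])
qed

lemma weight_ext:
  assumes f: "Vector_Spaces.linear sV sV f" and g: "Vector_Spaces.linear sV sV g"
    and eq: "\<And>m k v. wt m k v \<Longrightarrow> f v = g v"
  shows "f v = g v"
proof -
  have sum: "h (\<Sum>q\<in>Q. x q) = (\<Sum>q\<in>Q. h (x q))" if "Vector_Spaces.linear sV sV h"
    for h and x :: "nat \<Rightarrow> 'v" and Q
    by (induction Q rule: infinite_finite_induct) (simp_all add: linear_simps[OF that])
  have "f (\<Sum>p<6. \<Sum>q<6. wproj (int p) (- int q) v) = g (\<Sum>p<6. \<Sum>q<6. wproj (int p) (- int q) v)"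
    unfolding sum[OF f] sum[OF g] by (intro sum.cong refl eq[OF wproj_wt])
  then show ?thesis by (simp add: wproj_sum)
qed

lemma weight_exists: "(v :: 'v) \<noteq> 0 \<Longrightarrow> \<exists>m k w. wt m k w \<and> w \<noteq> 0"
proof (rule ccontr)
  assume "v \<noteq> 0" "\<nexists>m k w. wt m k w \<and> w \<noteq> 0"
  then have "wproj m k v = 0" for m k using wproj_wt by blast
  then show False using wproj_sum[of v] \<open>v \<noteq> 0\<close> by simp
qed

lemma act_A: assumes "opA v = sV (xp m) v" shows "act V (A n) v = sV (xp (m * n)) v"
proof -
  have "(opA ^^ j) v = sV (xp (m * int j)) v" for j
    by (induction j) (simp_all add: assms op_simps xp_values xp_add algebra_simps)
  then have "act V (A n) v = sV (xp (m * (n mod 6))) v"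
    by (simp add: A_def apow_def act_power)
  moreover have "xp (m * (n mod 6)) = xp (m * n)" by (rule xp_cong) (rule mod_mult_right_eq)
  ultimately show ?thesis by simp
qed

lemma wt_B: assumes "wt m k v" shows "wt (m - 1) (k + 3) (opB v)"
proof -
  have "sV \<xi> (opA (opB v)) = sV (xp m) (opB v)"
    using assms op_relations(2)[of v] by (simp add: wt_def op_simps)
  then have "sV (xp (- 1)) (sV \<xi> (opA (opB v))) = sV (xp (- 1)) (sV (xp m) (opB v))" by simp
  moreover have "xp (- 1) * \<xi> = 1" using xp_minus(1)[of 1] by (simp add: xp_values)
  ultimately have 1: "opA (opB v) = sV (xp (m - 1)) (opB v)"
    using xp_add[of "- 1" m] by simp
  have "xp (- (k + 3)) = xp 3 * xp (- k)"
    unfolding xp_add[symmetric] by (rule xp_cong) (simp add: mod_eq_dvd_iff)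
  then show ?thesis using 1 assms op_relations(4)[of v] by (simp add: wt_def op_simps xp_values)
qed

lemma A_X: assumes "wt m k v"
  shows "opA (X v) = sV (xp (m + 1)) (X v) + sV ((\<xi> - 2) * (xp (- k) + xp (3 * m))) (opB v)"
proof -
  have YB: "Y (opB v) = sV (- xp (- k)) (opB v)"
    using assms op_relations(4)[of v] by (simp add: wt_def op_simps)
  have A3: "act V (A 3) v = sV (xp (3 * m)) v"
    using act_A[of v m 3] assms by (simp add: wt_def mult.commute)
  have "sV (xp m) (X v) + sV (1 - 2 * \<xi>) (Y (opB v)) = sV (xp (- 1)) (opA (X v)) + sV (1 - 2 * \<xi>) (opB (act V (A 3) v))"
    using op_relations(5)[of v] assms by (simp add: wt_def op_simps)
  then have "sV (xp (- 1)) (opA (X v)) = sV (xp m) (X v) - sV ((1 - 2 * \<xi>) * (xp (- k) + xp (3 * m))) (opB v)"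
    by (simp add: YB A3 op_simps algebra_simps V.scale_left_distrib V.scale_left_diff_distrib)
  then have "sV \<xi> (sV (xp (- 1)) (opA (X v))) = sV \<xi> (sV (xp m) (X v) - sV ((1 - 2 * \<xi>) * (xp (- k) + xp (3 * m))) (opB v))"
    by simp
  moreover have "\<xi> * xp (- 1) = 1" using xp_minus(2)[of 1] by (simp add: xp_values)
  moreover have "\<xi> * xp m = xp (m + 1)" using xp_add[of m 1] by (simp add: xp_values mult.commute)
  moreover have "- (\<xi> * ((1 - 2 * \<xi>) * c)) = (\<xi> - 2) * c" for c
    by (simp add: algebra_simps xi_mult)
  ultimately show ?thesis
    by (simp add: V.scale_right_diff_distrib)
      (metis V.scale_minus_left diff_conv_add_uminus)
qed

text \<open>Corrected by a multiple of \<open>b v\<close>, the vector \<open>X v\<close> is again a weight vector.\<close>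

definition shift :: "int \<Rightarrow> int \<Rightarrow> 'k"
  where "shift m k = \<xi> * (xp (2 * m) + xp (5 * m - k))"

lemma wt_X1: assumes v: "wt m k v" shows "wt (m + 1) (k + 3) (X v + sV (shift m k) (opB v))"
proof -
  have B: "opA (opB v) = sV (xp (m - 1)) (opB v)" using wt_B[OF v] by (simp add: wt_def)
  have "(\<xi> - 2) * (xp (- k) + xp (3 * m)) + shift m k * xp (m - 1) = xp (m + 1) * shift m k"
  proof -
    have "xp (2 * m) * xp (m - 1) = xp 5 * xp (3 * m)"
      unfolding xp_add[symmetric] by (rule xp_cong) (simp add: mod_eq_dvd_iff)
    then have e1: "xp (2 * m) * xp (m - 1) = (1 - \<xi>) * xp (3 * m)" by (simp only: xp_values)
    have "xp (5 * m - k) * xp (m - 1) = xp 5 * xp (- k)"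
      unfolding xp_add[symmetric] by (rule xp_cong) (simp add: mod_eq_dvd_iff)
    then have e2: "xp (5 * m - k) * xp (m - 1) = (1 - \<xi>) * xp (- k)" by (simp only: xp_values)
    have "xp (m + 1) * xp (2 * m) = xp 1 * xp (3 * m)"
      unfolding xp_add[symmetric] by (rule xp_cong) (simp add: mod_eq_dvd_iff)
    then have e3: "xp (m + 1) * xp (2 * m) = \<xi> * xp (3 * m)" by (simp only: xp_values)
    have "xp (m + 1) * xp (5 * m - k) = xp 1 * xp (- k)"
      unfolding xp_add[symmetric] by (rule xp_cong) (simp add: mod_eq_dvd_iff)
    then have e4: "xp (m + 1) * xp (5 * m - k) = \<xi> * xp (- k)" by (simp only: xp_values)
    have "shift m k * xp (m - 1) = \<xi> * ((1 - \<xi>) * (xp (3 * m) + xp (- k)))"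
      by (simp add: shift_def distrib_right distrib_left mult.assoc e1 e2)
    moreover have "xp (m + 1) * shift m k = \<xi> * (\<xi> * (xp (3 * m) + xp (- k)))"
      unfolding shift_def using e3 e4 by (simp add: distrib_left mult.left_commute)
    ultimately show ?thesis by (simp add: algebra_simps xi_mult)
  qed
  then have 1: "opA (X v + sV (shift m k) (opB v)) = sV (xp (m + 1)) (X v + sV (shift m k) (opB v))"
    by (simp add: op_simps A_X[OF v] B V.scale_right_distrib add.assoc flip: V.scale_left_distrib)
  have "xp (- (k + 3)) = - xp (- k)"
    using xp_add[of 3 "- k"] xp_cong[of "3 - k" "- (k + 3)"] by (simp add: mod_eq_dvd_iff xp_values)
  then have "Y (X v + sV (shift m k) (opB v)) = sV (xp (- (k + 3))) (X v + sV (shift m k) (opB v))"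
    using v op_relations(4)[of v] by (simp add: wt_def op_simps Y_X V.scale_right_distrib mult.commute)
  then show ?thesis using 1 by (simp add: wt_def)
qed

lemma X_B: assumes v: "wt m k v"
  shows "X (opB v) = sV (xp (- 1)) (opB (X v)) + sV (xp (4 * m) - xp (m - k)) v"
proof -
  have "X (opB v) + sV (xp (m - k)) v = sV (xp (4 * m)) v + sV (xp (- 1)) (opB (X v))"
    using op_relations(6)[of v] act_A[of v m 4] v xp_add[of m "- k"]
    by (simp add: wt_def op_simps mult.commute)
  then show ?thesis by (simp add: V.scale_left_diff_distrib algebra_simps eq_diff_eq)
qed

lemma X_X_wt: assumes "wt m k v" shows "X (X v) = sV (\<xi> * (xp (- 2 * k) - 1)) v"
proof -
  have "xp (- k) * xp (- k) = xp (- 2 * k)" by (simp flip: xp_add)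
  then have "Y (Y v) = sV (xp (- 2 * k)) v" using assms by (simp add: wt_def op_simps)
  then show ?thesis by (simp add: X_X algebra_simps V.scale_left_diff_distrib)
qed

text \<open>On a weight vector the coaction has two terms only.\<close>

lemma coact_wt:
  assumes v: "wt m k v"
  shows "\<delta> v = pure sH sV (A k) v + pure sH sV (b * A (k - 1)) (X v)"
proof
  fix \<beta>
  define ca where "ca i = hform (\<lambda>n. if n mod 6 = i mod 6 then 1 else 0) (\<lambda>n. 0)" for i :: int
  define cb where "cb i = hform (\<lambda>n. 0) (\<lambda>n. if n mod 6 = i mod 6 then 1 else 0)" for i :: int
  have ca: "linform sH (ca i)" "ca i (A n) = (if n mod 6 = i mod 6 then 1 else 0)" "ca i (b * A n) = 0"
    and cb: "linform sH (cb i)" "cb i (A n) = 0" "cb i (b * A n) = (if n mod 6 = i mod 6 then 1 else 0)" for i n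
    unfolding ca_def cb_def by (rule hform(1), (subst hform_periodic; simp)+)+
  have eigen: "slice (ca i) v = 0" if "i mod 6 \<noteq> k mod 6" for i
  proof -
    have "(\<lambda>h. \<Delta> h (\<lambda>x y. \<kappa> x * ca i y)) = (\<lambda>h. xp (- i) * ca i h)"
    proof (rule linform_H_eqI[OF conv_linform[OF \<kappa>(1) ca(1)]])
      show "linform sH (\<lambda>h. xp (- i) * ca i h)"
        by (rule linformI[OF vsH]) (simp_all add: linform_simps[OF ca(1)] algebra_simps)
      fix n
      have "n mod 6 = i mod 6 \<Longrightarrow> xp (- n) = xp (- i)"
        by (rule xp_cong) (rule mod_minus_cong)
      then show "\<Delta> (A n) (\<lambda>x y. \<kappa> x * ca i y) = xp (- i) * ca i (A n)"
        by (simp add: conv_values \<kappa> ca)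
      show "\<Delta> (b * A n) (\<lambda>x y. \<kappa> x * ca i y) = xp (- i) * ca i (b * A n)"
        by (simp add: conv_values \<kappa> ca)
    qed
    then have "slice (ca i) (Y v) = sV (xp (- i)) (slice (ca i) v)"
      by (simp add: Y_def slice_slice[OF \<kappa>(1) ca(1)] slice_scale[OF ca(1)])
    then have "sV (xp (- k)) (slice (ca i) v) = sV (xp (- i)) (slice (ca i) v)"
      using v by (simp add: wt_def linear_simps[OF slice_linear[OF ca(1)]])
    moreover have "xp (- k) \<noteq> xp (- i)"
      unfolding xp_eq_iff using that by (metis minus_minus mod_minus_cong)
    ultimately show ?thesis by simp
  qed
  have cb_ca: "slice (cb i) v = X (slice (ca (i + 1)) v)" for i
  proof -
    have "(\<lambda>h. \<Delta> h (\<lambda>x y. ca (i + 1) x * \<theta> y)) = cb i"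
    proof (rule linform_H_eqI[OF conv_linform[OF ca(1) \<theta>(1)] cb(1)])
      fix n
      have "(n + 1) mod 6 = (i + 1) mod 6 \<longleftrightarrow> n mod 6 = i mod 6"
        by (simp add: mod_eq_dvd_iff)
      then show "\<Delta> (b * A n) (\<lambda>x y. ca (i + 1) x * \<theta> y) = cb i (b * A n)"
        by (simp add: conv_values ca cb \<theta>)
    qed (simp add: conv_values ca cb \<theta>)
    then show ?thesis by (simp add: X_def slice_slice[OF ca(1) \<theta>(1)])
  qed
  obtain L where L: "\<And>\<beta>. \<delta> v \<beta> = (if bilform sH sV \<beta> then lsum L \<beta> else 0)"
    using coact_list[of v] by metis
  have slf: "f (slice \<phi> v) = lsum L (\<lambda>h x. \<phi> h * f x)" if "linform sH \<phi>" "linform sV f" for \<phi> f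
    using slice[OF that] L bilform_prod[OF that] by simp
  have swap: "lsum L (\<lambda>h x. \<Sum>i\<in>N. g i h x) = (\<Sum>i\<in>N. lsum L (g i))" for N :: "int set" and g
    by (induction L) (auto simp: sum.distrib)
  have fixk: "slice (ca k) v = v"
  proof (rule linform_separates[OF vsV])
    fix f assume f: "linform sV f"
    have cu: "counit H = (\<lambda>h. \<Sum>i\<in>{0..<6}. ca i h)"
    proof (rule linform_H_eqI[OF counitH_linform])
      show "linform sH (\<lambda>h. \<Sum>i\<in>{0..<6}. ca i h)"
        by (rule linformI[OF vsH]) (simp_all add: linform_simps[OF ca(1)] sum.distrib sum_distrib_left)
      fix n :: int
      have "(\<Sum>i\<in>{0..<6}. ca i (A n)) = (\<Sum>i\<in>{0..<6}. if i = n mod 6 then 1 else 0)"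
        by (rule sum.cong) (auto simp: ca)
      then show "counit H (A n) = (\<Sum>i\<in>{0..<6}. ca i (A n))" by (simp add: counit_values)
      show "counit H (b * A n) = (\<Sum>i\<in>{0..<6}. ca i (b * A n))" by (simp add: counit_values ca)
    qed
    have "f v = lsum L (\<lambda>h x. counit H h * f x)"
      using slf[OF counitH_linform f] by (simp add: slice_counit)
    also have "\<dots> = lsum L (\<lambda>h x. \<Sum>i\<in>{0..<6}. ca i h * f x)"
      by (simp only: cu sum_distrib_right)
    also have "\<dots> = (\<Sum>i\<in>{0..<6}. f (slice (ca i) v))"
      by (simp add: swap slf[OF ca(1) f])
    also have "\<dots> = (\<Sum>i\<in>{k mod 6}. f (slice (ca i) v))"
      by (rule sum.mono_neutral_right) (auto simp: eigen linform_simps[OF f])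
    finally have "f v = f (slice (ca (k mod 6)) v)" by simp
    moreover have "ca (k mod 6) = ca k" by (simp add: ca_def)
    ultimately show "f (slice (ca k) v) = f v" by simp
  qed
  show "\<delta> v \<beta> = (pure sH sV (A k) v + pure sH sV (b * A (k - 1)) (X v)) \<beta>"
  proof (cases "bilform sH sV \<beta>")
    case True
    note bs = bilform_simps[OF True]
    have expand: "\<beta> h x = (\<Sum>i\<in>{0..<6}. ca i h * \<beta> (A i) x + cb i h * \<beta> (b * A i) x)" for h x
    proof -
      have lin: "linform sH (\<lambda>h. \<beta> h x)" using True by (simp add: bilform_def)
      have "(\<lambda>h. \<beta> h x) = (\<lambda>h. \<Sum>i\<in>{0..<6}. ca i h * \<beta> (A i) x + cb i h * \<beta> (b * A i) x)"
      proof (rule linform_H_eqI[OF lin])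
        show "linform sH (\<lambda>h. \<Sum>i\<in>{0..<6}. ca i h * \<beta> (A i) x + cb i h * \<beta> (b * A i) x)"
          by (rule linformI[OF vsH])
            (simp_all add: linform_simps[OF ca(1)] linform_simps[OF cb(1)] sum.distrib sum_distrib_left algebra_simps)
        fix n :: int
        have "(\<Sum>i\<in>{0..<6}. ca i (A n) * \<beta> (A i) x + cb i (A n) * \<beta> (b * A i) x) =
            (\<Sum>i\<in>{0..<6}. if i = n mod 6 then \<beta> (A i) x else 0)"
          by (rule sum.cong) (auto simp: ca cb)
        then show "\<beta> (A n) x = (\<Sum>i\<in>{0..<6}. ca i (A n) * \<beta> (A i) x + cb i (A n) * \<beta> (b * A i) x)"
          by (simp add: A_mod)
        have "(\<Sum>i\<in>{0..<6}. ca i (b * A n) * \<beta> (A i) x + cb i (b * A n) * \<beta> (b * A i) x) =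
            (\<Sum>i\<in>{0..<6}. if i = n mod 6 then \<beta> (b * A i) x else 0)"
          by (rule sum.cong) (auto simp: ca cb)
        then show "\<beta> (b * A n) x = (\<Sum>i\<in>{0..<6}. ca i (b * A n) * \<beta> (A i) x + cb i (b * A n) * \<beta> (b * A i) x)"
          by (simp add: A_mod)
      qed
      then show ?thesis by (rule fun_cong)
    qed
    have lf: "linform sV (\<beta> h)" for h using True by (simp add: bilform_def)
    have "\<delta> v \<beta> = lsum L (\<lambda>h x. \<Sum>i\<in>{0..<6}. ca i h * \<beta> (A i) x + cb i h * \<beta> (b * A i) x)"
      using True by (simp only: L expand[symmetric] if_True)
    also have "\<dots> = (\<Sum>i\<in>{0..<6}. \<beta> (A i) (slice (ca i) v) + \<beta> (b * A i) (slice (cb i) v))"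
      unfolding swap by (simp add: lsum_add slf[OF ca(1) lf] slf[OF cb(1) lf])
    also have "\<dots> = (\<Sum>i\<in>{0..<6}. \<beta> (A i) (slice (ca i) v)) + (\<Sum>i\<in>{0..<6}. \<beta> (b * A i) (X (slice (ca (i + 1)) v)))"
      by (simp add: sum.distrib cb_ca)
    also have "(\<Sum>i\<in>{0..<6}. \<beta> (A i) (slice (ca i) v)) = (\<Sum>i\<in>{k mod 6}. \<beta> (A i) (slice (ca i) v))"
      by (rule sum.mono_neutral_right) (auto simp: eigen bs)
    also have "\<dots> = \<beta> (A k) v"
    proof -
      have "ca (k mod 6) = ca k" by (simp add: ca_def)
      then show ?thesis by (simp add: A_mod fixk)
    qed
    also have "(\<Sum>i\<in>{0..<6}. \<beta> (b * A i) (X (slice (ca (i + 1)) v))) =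
        (\<Sum>i\<in>{(k - 1) mod 6}. \<beta> (b * A i) (X (slice (ca (i + 1)) v)))"
    proof (rule sum.mono_neutral_right)
      show "\<forall>i\<in>{0..<6} - {(k - 1) mod 6}. \<beta> (b * A i) (X (slice (ca (i + 1)) v)) = 0"
      proof
        fix i assume i: "i \<in> {0..<6} - {(k - 1) mod 6}"
        have "(i + 1) mod 6 \<noteq> k mod 6"
        proof
          assume "(i + 1) mod 6 = k mod 6"
          then have "i mod 6 = (k - 1) mod 6" by (simp add: mod_eq_dvd_iff algebra_simps)
          then show False using i by simp
        qed
        then show "\<beta> (b * A i) (X (slice (ca (i + 1)) v)) = 0" by (simp add: eigen bs op_simps)
      qed
    qed auto
    also have "\<dots> = \<beta> (b * A (k - 1)) (X v)"
    proof -
      have "((k - 1) mod 6 + 1) mod 6 = k mod 6" by (simp add: mod_add_left_eq)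
      then have "ca ((k - 1) mod 6 + 1) = ca k" by (simp add: ca_def)
      then show ?thesis by (simp add: A_mod fixk)
    qed
    finally show ?thesis using True by (simp add: pure_def)
  next
    case False
    then show ?thesis by (simp add: L pure_def)
  qed
qed

text \<open>A subspace stable under the four operators is a subobject, and conversely.\<close>

lemma act_in:
  assumes S: "V.subspace S" and A: "\<And>u. u \<in> S \<Longrightarrow> opA u \<in> S" and B: "\<And>u. u \<in> S \<Longrightarrow> opB u \<in> S"
    and u: "u \<in> S"
  shows "act V h u \<in> S"
proof -
  have An: "act V (A n) u \<in> S" for n
  proof -
    have "(opA ^^ j) u \<in> S" for j by (induction j) (simp_all add: u A)
    then show ?thesis by (simp add: A_def apow_def act_power)
  qed
  have "h \<in> H.span (bas ` I)" by (simp add: bas_span)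
  then show ?thesis
  proof (induction rule: H.span_induct_alt)
    case base
    then show ?case by (simp add: linear_simps[OF act_linear(1)] V.subspace_0[OF S])
  next
    case (step c x y)
    have "act V x u \<in> S" using step(1) An B by (auto simp: bas_def act_mult)
    then show ?case using step(2)
      by (simp add: linear_simps[OF act_linear(1)] V.subspace_add[OF S] V.subspace_scale[OF S])
  qed
qed

lemma yd_subI:
  assumes S: "V.subspace S" and A: "\<And>u. u \<in> S \<Longrightarrow> opA u \<in> S" and B: "\<And>u. u \<in> S \<Longrightarrow> opB u \<in> S"
    and Y: "\<And>u. u \<in> S \<Longrightarrow> Y u \<in> S" and X: "\<And>u. u \<in> S \<Longrightarrow> X u \<in> S"
  shows "yd_sub H V S"
proof -
  have "\<delta> u \<in> tspan sH sV UNIV S" if u: "u \<in> S" for u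
  proof -
    have w: "wproj m k u \<in> S" for m k
      unfolding wproj_def
      by (intro wp_in[OF opA_linear opA6 S A] wp_in[OF Y_linear Y6 S Y] u)
    have hom: "\<delta> (wproj m k u) \<in> tspan sH sV UNIV S" for m k
      unfolding coact_wt[OF wproj_wt] by (intro tspan_closed pure_in_tspan UNIV_I w X)
    have sum: "\<delta> (\<Sum>q\<in>Q. x q) \<in> tspan sH sV UNIV S" if "\<And>q. \<delta> (x q) \<in> tspan sH sV UNIV S"
      for x :: "nat \<Rightarrow> 'v" and Q
    proof (induction Q rule: infinite_finite_induct)
      case (insert q Q)
      have "\<delta> (x q) + \<delta> (sum x Q) \<in> tspan sH sV UNIV S" using that insert.IH by (rule tspan_closed(2))
      then show ?case by (simp only: sum.insert[OF insert.hyps] linear_simps(1)[OF coact_linear])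
    qed (simp_all only: sum.infinite not_False_eq_True sum.empty linear_simps(3)[OF coact_linear] tspan_closed(1))
    have "\<delta> (\<Sum>p<6. \<Sum>q<6. wproj (int p) (- int q) u) \<in> tspan sH sV UNIV S"
      by (intro sum hom)
    then show ?thesis by (simp add: wproj_sum)
  qed
  then show ?thesis using S act_in[OF S A B] by (simp add: yd_sub_def)
qed

lemma yd_sub_stable:
  assumes "yd_sub H V S" "u \<in> S" and \<phi>: "linform sH \<phi>"
  shows "act V h u \<in> S" "slice \<phi> u \<in> S"
proof -
  show "act V h u \<in> S" using assms by (simp add: yd_sub_def)
  have S: "V.subspace S" using assms by (simp add: yd_sub_def)
  have "\<delta> u \<in> tspan sH sV UNIV S" using assms by (simp add: yd_sub_def)
  then obtain L where L: "set L \<subseteq> UNIV \<times> S" "\<And>\<beta>. bilform sH sV \<beta> \<Longrightarrow> \<delta> u \<beta> = lsum L \<beta>"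
    by (rule tspan_list[OF vsH vsV]) auto
  have "slice \<phi> u = (\<Sum>(h, x)\<leftarrow>L. sV (\<phi> h) x)"
  proof (rule linform_separates[OF vsV])
    fix f assume f: "linform sV f"
    have "f (\<Sum>(h, x)\<leftarrow>L. sV (\<phi> h) x) = lsum L (\<lambda>h x. \<phi> h * f x)"
      unfolding lsum_def linform_sum_list[OF f]
      by (rule arg_cong[of _ _ sum_list]) (auto simp: linform_simps[OF f])
    then show "f (slice \<phi> u) = f (\<Sum>(h, x)\<leftarrow>L. sV (\<phi> h) x)"
      using slice[OF \<phi> f] L(2)[OF bilform_prod[OF \<phi> f]] by simp
  qed
  moreover have "(\<Sum>(h, x)\<leftarrow>L. sV (\<phi> h) x) \<in> S"
    using L(1) by (induction L) (auto simp: V.subspace_0[OF S] V.subspace_add[OF S] V.subspace_scale[OF S])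
  ultimately show "slice \<phi> u \<in> S" by simp
qed

end

section \<open>Indecomposable objects\<close>

context yd_C
begin

lemma linform_one: "v \<noteq> 0 \<Longrightarrow> \<exists>f. linform sV f \<and> f v = 1"
proof -
  assume v: "v \<noteq> 0"
  interpret P: vector_space_pair sV "(*) :: 'k \<Rightarrow> 'k \<Rightarrow> 'k"
    by (rule vector_space_pair.intro[OF vsV vector_space_times])
  have "V.independent {v}" using v by simp
  from P.linear_independent_extend[OF this, of "\<lambda>_. 1"] show ?thesis
    by (auto simp: linform_def)
qed

text \<open>
  The operator \<open>a\<^sup>3 Y\<^sup>-\<^sup>1\<close> commutes with the whole action and coaction.  Its eigenvalue 1 belongs to
  the one-dimensional objects, the other eigenvalues to the objects \<open>V\<^sub>i\<^sub>,\<^sub>j\<close>.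
\<close>

definition z :: "'v \<Rightarrow> 'v" where "z v = (opA ^^ 3) ((Y ^^ 5) v)"

lemma z_linear: "Vector_Spaces.linear sV sV z"
  using Vector_Spaces.linear_compose[OF funpow_linear[OF Y_linear Y6] funpow_linear[OF opA_linear opA6]]
  by (simp add: z_def[abs_def] o_def)

lemma z_wt: assumes "wt m k v" shows "z v = sV (xp (3 * m + k)) v"
proof -
  have "(Y ^^ j) v = sV (xp (- k * int j)) v" for j
    using assms by (induction j) (simp_all add: wt_def op_simps xp_values algebra_simps flip: xp_add)
  moreover have "(opA ^^ j) v = sV (xp (m * int j)) v" for j
    using assms by (induction j) (simp_all add: wt_def op_simps xp_values algebra_simps flip: xp_add)
  ultimately have "z v = sV (xp (- k * 5) * xp (m * 3)) v"
    by (simp add: z_def linear_simps[OF funpow_linear[OF opA_linear opA6]])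
  also have "xp (- k * 5) * xp (m * 3) = xp (3 * m + k)"
    unfolding xp_add[symmetric] by (rule xp_cong) (simp add: mod_eq_dvd_iff algebra_simps)
  finally show ?thesis .
qed

lemma z6: "(z ^^ 6) v = v"
proof -
  have lin: "Vector_Spaces.linear sV sV (z ^^ j)" for j
  proof (induction j)
    case 0
    show ?case by (simp add: id_def) (auto intro!: linearI vsV)
  next
    case (Suc j)
    then show ?case using Vector_Spaces.linear_compose[OF Suc z_linear] by (simp add: o_def)
  qed
  have "(z ^^ 6) v = id v"
  proof (rule weight_ext[OF lin])
    show "Vector_Spaces.linear sV sV id" using lin[of 0] by simp
    fix m k v assume v: "wt m k v"
    have "(z ^^ j) v = sV (xp ((3 * m + k) * int j)) v" for j
      by (induction j) (simp_all add: z_wt[OF v] linear_simps[OF z_linear] xp_values algebra_simps flip: xp_add)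
    moreover have "xp ((3 * m + k) * int 6) = xp 0" by (rule xp_cong) simp
    ultimately show "(z ^^ 6) v = id v" by (simp only: xp_values V.scale_one id_def)
  qed
  then show ?thesis by simp
qed

lemma z_wt_shift: assumes "wt m k v"
  shows "z (opB v) = sV (xp (3 * m + k)) (opB v)" "z (X v) = sV (xp (3 * m + k)) (X v)"
proof -
  have e: "xp (3 * (m - 1) + (k + 3)) = xp (3 * m + k)" "xp (3 * (m + 1) + (k + 3)) = xp (3 * m + k)"
    by (rule xp_cong, simp add: mod_eq_dvd_iff algebra_simps)+
  show B: "z (opB v) = sV (xp (3 * m + k)) (opB v)"
    using z_wt[OF wt_B[OF assms]] by (simp only: e)
  have "z (X v + sV (shift m k) (opB v)) = sV (xp (3 * m + k)) (X v + sV (shift m k) (opB v))"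
    using z_wt[OF wt_X1[OF assms]] by (simp only: e)
  then show "z (X v) = sV (xp (3 * m + k)) (X v)"
    by (simp add: linear_simps[OF z_linear] B V.scale_right_distrib mult.commute)
qed

lemma z_commute: "opA (z v) = z (opA v)" "opB (z v) = z (opB v)" "Y (z v) = z (Y v)" "X (z v) = z (X v)"
proof -
  have comp: "Vector_Spaces.linear sV sV (\<lambda>v. f (z v))" "Vector_Spaces.linear sV sV (\<lambda>v. z (f v))"
    if "Vector_Spaces.linear sV sV f" for f
    using Vector_Spaces.linear_compose[OF z_linear that] Vector_Spaces.linear_compose[OF that z_linear]
    by (simp_all add: o_def)
  have main: "f (z v) = z (f v)" if "Vector_Spaces.linear sV sV f"
    "\<And>m k v. wt m k v \<Longrightarrow> z (f v) = sV (xp (3 * m + k)) (f v)" for f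
    by (rule weight_ext[OF comp[OF that(1)]]) (simp add: z_wt that(2) linear_simps[OF that(1)])
  show "opA (z v) = z (opA v)"
    by (rule main[OF opA_linear]) (frule z_wt, simp add: wt_def linear_simps[OF z_linear] mult.commute)
  show "opB (z v) = z (opB v)" by (rule main[OF act_linear(2)]) (rule z_wt_shift)
  show "Y (z v) = z (Y v)"
    by (rule main[OF Y_linear]) (frule z_wt, simp add: wt_def linear_simps[OF z_linear] mult.commute)
  show "X (z v) = z (X v)" by (rule main[OF X_linear]) (rule z_wt_shift)
qed

lemma subspace_eq: assumes "Vector_Spaces.linear sV sV f" "Vector_Spaces.linear sV sV g"
  shows "V.subspace {v. f v = g v}"
  by (rule V.subspaceI) (simp_all add: linear_simps[OF assms(1)] linear_simps[OF assms(2)])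

lemma indecomposable_z:
  assumes "yd_indecomposable H V"
  shows "(\<forall>v. z v = v) \<or> (\<forall>v. wp sV z 0 v = 0)"
proof -
  let ?N = "wp sV z 0"
  note Nl = wp_linear[OF z_linear z6, of 0]
  have Nc: "f (?N v) = ?N (f v)" if "Vector_Spaces.linear sV sV f" "\<And>v. f (z v) = z (f v)" for f v
    by (rule wp_commute[OF z_linear z6 that])
  have zN: "z (?N v) = ?N v" for v using wp_eigen[OF z_linear z6, of 0 v] by (simp add: xp_values)
  have NN: "z v = v \<Longrightarrow> ?N v = v" for v using wp_fix[OF z_linear z6, of v 0] by (simp add: xp_values)
  have id: "Vector_Spaces.linear sV sV (\<lambda>v. v)" "Vector_Spaces.linear sV sV (\<lambda>v. 0)"
    by (auto intro!: linearI vsV)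
  let ?U = "{v. z v = v}" and ?W = "{v. ?N v = 0}"
  have U: "yd_sub H V ?U"
    by (rule yd_subI[OF subspace_eq[OF z_linear id(1)]]) (simp_all flip: z_commute)
  have W: "yd_sub H V ?W"
  proof (rule yd_subI[OF subspace_eq[OF Nl id(2)]])
    fix u assume "u \<in> {v. ?N v = 0}"
    then show "opA u \<in> {v. ?N v = 0}" "opB u \<in> {v. ?N v = 0}" "Y u \<in> {v. ?N v = 0}" "X u \<in> {v. ?N v = 0}"
      using Nc[OF opA_linear z_commute(1), of u] Nc[OF act_linear(2) z_commute(2), of u]
        Nc[OF Y_linear z_commute(3), of u] Nc[OF X_linear z_commute(4), of u] by (simp_all add: op_simps)
  qed
  have "?U \<inter> ?W = {0}" using NN by (auto simp: linear_simps[OF z_linear] linear_simps[OF Nl])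
  moreover have "\<exists>u\<in>?U. \<exists>w\<in>?W. v = u + w" for v
    by (rule bexI[of _ "?N v"], rule bexI[of _ "v - ?N v"]) (simp_all add: zN NN linear_simps[OF Nl])
  ultimately have "?U = {0} \<or> ?W = {0}"
    using assms U W unfolding yd_indecomposable_def by blast
  then show ?thesis
  proof
    assume "?U = {0}"
    then have "?N v = 0" for v using zN[of v] by blast
    then show ?thesis by blast
  next
    assume "?W = {0}"
    moreover have "v - ?N v \<in> ?W" for v by (simp add: zN NN linear_simps[OF Nl])
    ultimately have "v - ?N v = 0" for v by blast
    then have "?N v = v" for v by simp
    then have "z v = v" for v using zN[of v] by simp
    then show ?thesis by blast
  qed
qed

text \<open>
  A linear form that is nonzero on a weight vector \<open>v\<close> and sees only its weight space: a subspace
  cut out by it and its composites with \<open>b\<close> and \<open>X\<close> is a complement of the subobject generated by \<open>v\<close>.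
\<close>

lemma weight_form:
  assumes "wt m k v" "v \<noteq> 0"
  shows "\<exists>F. linform sV F \<and> F v = 1 \<and> (\<forall>x. F (opA x) = xp m * F x) \<and> (\<forall>x. F (Y x) = xp (- k) * F x)"
proof -
  obtain f where f: "linform sV f" "f v = 1" using linform_one[OF assms(2)] by blast
  have "linform sV (\<lambda>x. f (wproj m k x))"
    using Vector_Spaces.linear_compose[OF wproj_linear, of "(*)" f m k] f(1) by (simp add: linform_def o_def)
  then show ?thesis
    by (intro exI[of _ "\<lambda>x. f (wproj m k x)"])
      (simp add: wproj_fix[OF assms(1)] f(2) wproj_A wproj_Y linform_simps[OF f(1)])
qed

lemma indecomposable_chi:
  assumes ind: "yd_indecomposable H V" and z1: "\<And>v. z v = v"
    and odd: "\<And>m k v. wt m k v \<Longrightarrow> even m \<Longrightarrow> v = 0"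
  shows "\<exists>i\<in>{1, 3, 5}. \<exists>v. is_chi \<xi> H a b i V v"
proof -
  obtain v0 :: 'v where "v0 \<noteq> 0" using ind by (auto simp: yd_indecomposable_def)
  then obtain m k v where v: "wt m k v" "v \<noteq> 0" using weight_exists by blast
  have Bw: "opB w = 0" if w: "wt m k w" for m k w
  proof (cases "even m")
    case True
    then show ?thesis using odd[OF w] by (simp add: op_simps)
  next
    case False
    then show ?thesis using odd[OF wt_B[OF w]] by simp
  qed
  have zero: "Vector_Spaces.linear sV sV (\<lambda>v. 0)" by (auto intro!: linearI vsV)
  have B: "opB w = 0" for w
    by (rule weight_ext[OF act_linear(2) zero Bw])
  have Xw: "X w = 0" if w: "wt m k w" for m k w
  proof (cases "even m")
    case True
    then show ?thesis using odd[OF w] by (simp add: op_simps)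
  next
    case False
    then show ?thesis using odd[OF wt_X1[OF w]] B by simp
  qed
  have X: "X w = 0" for w
    by (rule weight_ext[OF X_linear zero Xw])
  obtain F where F: "linform sV F" "F v = 1" "\<And>x. F (opA x) = xp m * F x" "\<And>x. F (Y x) = xp (- k) * F x"
    using weight_form[OF v] by blast
  note Fs = linform_simps[OF F(1)]
  let ?U = "range (\<lambda>c. sV c v)" and ?W = "{w. F w = 0}"
  have "yd_sub H V ?U"
  proof (rule yd_subI)
    have "?U = V.span {v}" by (simp add: V.span_singleton)
    then show "V.subspace ?U" by simp
    fix u assume "u \<in> ?U"
    then obtain c where u: "u = sV c v" by blast
    have mem: "sV e v \<in> ?U" for e by blast
    show "opA u \<in> ?U" "Y u \<in> ?U"
      using v(1) mem[of "c * xp m"] mem[of "c * xp (- k)"] by (simp_all add: u op_simps wt_def)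
    have "sV 0 v \<in> ?U" by blast
    then show "opB u \<in> ?U" "X u \<in> ?U" by (simp_all add: B X)
  qed
  moreover have "yd_sub H V ?W"
    by (rule yd_subI) (simp_all add: V.subspace_def Fs F B X)
  moreover have "?U \<inter> ?W = {0}"
  proof
    show "?U \<inter> ?W \<subseteq> {0}" using F(2) by (auto simp: Fs)
    have "sV 0 v \<in> ?U" by blast
    then show "{0} \<subseteq> ?U \<inter> ?W" by (simp add: Fs)
  qed
  moreover have "\<exists>u\<in>?U. \<exists>w\<in>?W. x = u + w" for x
    by (rule bexI[of _ "sV (F x) v"], rule bexI[of _ "x - sV (F x) v"]) (auto simp: Fs F(2))
  ultimately have "?U = {0} \<or> ?W = {0}"
    using ind unfolding yd_indecomposable_def by blast
  moreover have "sV 1 v \<in> ?U" by blast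
  ultimately have W0: "?W = {0}" using v(2) by auto
  have x: "x = sV (F x) v" for x
  proof -
    have "x - sV (F x) v \<in> ?W" by (simp add: Fs F(2))
    then show ?thesis using W0 by auto
  qed
  have "x \<in> V.span {v}" for x
    using x[of x] V.span_scale[OF V.span_base[of v "{v}"], of "F x"] by simp
  then have span: "V.span {v} = UNIV" by blast
  have basis: "has_basis sV {v}" using v(2) span by (simp add: has_basis_def)
  have "odd m" using odd[OF v(1)] v(2) by blast
  have "sV (xp (3 * m + k)) v = sV (xp 0) v" using z1[of v] z_wt[OF v(1)] by (simp add: xp_values)
  then have "xp (3 * m + k) = xp 0" using v(2) by simp
  then have mk: "(3 * m + k) mod 6 = 0" by (simp add: xp_eq_iff)
  define i where "i = m mod 6"
  have i: "i \<in> {1, 3, 5}"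
  proof -
    have "i \<in> {0, 1, 2, 3, 4, 5}" unfolding i_def by simp presburger
    moreover have "odd i" unfolding i_def using \<open>odd m\<close> by presburger
    ultimately show ?thesis by auto
  qed
  have "is_chi \<xi> H a b i V v"
    unfolding is_chi_def
  proof (intro conjI yd basis B)
    show "opA v = sV (\<xi> powi i) v"
      using v(1) xp_mod[of m] by (simp add: wt_def i_def xp_def)
    have "6 dvd (3 * m + k) - 6 * m" using mk by (intro dvd_diff) auto
    then have "k mod 6 = 3 * m mod 6" by (simp add: mod_eq_dvd_iff)
    then have "A k = A (3 * i)" by (intro A_cong) (simp add: i_def mod_mult_right_eq)
    then have "A k = apow a (3 * i)" by (simp add: A_def)
    moreover have "pure sH sV (b * A (k - 1)) (0 :: 'v) = 0"
      by (auto simp: pure_def fun_eq_iff bilform_simps)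
    ultimately show "\<delta> v = pure sH sV (apow a (3 * i)) v"
      using coact_wt[OF v(1)] by (simp only: X add_0_right)
  qed
  then show ?thesis using i by blast
qed

lemma indecomposable_V:
  assumes ind: "yd_indecomposable H V" and N0: "\<And>v. wp sV z 0 v = 0"
  shows "\<exists>i\<in>{0..<6}. \<exists>j\<in>{0..<6}. \<exists>v1 v2. is_V \<xi> H a b i j V v1 v2"
proof -
  have regular: "xp (4 * m) \<noteq> xp (m - k)" if v: "wt m k v" "v \<noteq> 0" for m k v
  proof
    assume "xp (4 * m) = xp (m - k)"
    then have "4 * m mod 6 = (m - k) mod 6" by (simp only: xp_eq_iff)
    then have "(3 * m + k) mod 6 = 0 mod 6" by (simp add: mod_eq_dvd_iff)
    then have "xp (3 * m + k) = xp 0" by (rule xp_cong)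
    then have "z v = v" using z_wt[OF v(1)] by (simp add: xp_values)
    then have "wp sV z 0 v = v" using wp_fix[OF z_linear z6, of v 0] by (simp add: xp_values)
    then show False using N0 v(2) by simp
  qed
  obtain v0 :: 'v where "v0 \<noteq> 0" using ind by (auto simp: yd_indecomposable_def)
  then obtain m0 k0 w0 where w0: "wt m0 k0 w0" "w0 \<noteq> 0" using weight_exists by blast
  obtain m k v1 where v1: "wt m k v1" "v1 \<noteq> 0" "opB v1 = 0"
  proof (cases "opB w0 = 0")
    case True
    then show ?thesis using that w0 by blast
  next
    case False
    then show ?thesis using that[OF wt_B[OF w0(1)] False] op_relations(1) by blast
  qed
  define \<gamma> where "\<gamma> = xp (4 * m) - xp (m - k)"
  have \<gamma>: "\<gamma> \<noteq> 0" using regular[OF v1(1,2)] by (simp add: \<gamma>_def)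
  define v2 where "v2 = sV (- inverse (\<xi> * \<gamma>)) (X v1)"
  have unit: "(- \<xi> * \<gamma>) * (- inverse (\<xi> * \<gamma>)) = 1" using \<gamma> xi_nonzero by (simp add: field_simps)
  have Xv1: "X v1 = sV (- \<xi> * \<gamma>) v2"
    by (simp only: v2_def V.scale_scale unit V.scale_one)
  have "sV (xp (- 1)) (opB (X v1)) = sV (- \<gamma>) v1"
    using X_B[OF v1(1)] by (simp add: v1(3) op_simps eq_neg_iff_add_eq_0 flip: \<gamma>_def)
  then have "sV (xp 1) (sV (xp (- 1)) (opB (X v1))) = sV (xp 1) (sV (- \<gamma>) v1)" by simp
  then have BX: "opB (X v1) = sV (- \<xi> * \<gamma>) v1" by (simp add: xp_minus) (simp add: xp_values)
  have Bv2: "opB v2 = v1"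
    using unit by (simp only: v2_def op_simps BX V.scale_scale V.scale_one mult.commute)
  have v2: "wt (m + 1) (k + 3) v2"
    using wt_X1[OF v1(1)] by (simp add: v1(3) v2_def wt_def op_simps mult.commute)
  have XX: "X (X v1) = sV (\<xi> * (xp (- 2 * k) - 1)) v1" by (rule X_X_wt[OF v1(1)])
  have Xv2: "X v2 = sV (xp (2 * m) + xp (- k - m)) v1"
  proof -
    have "(xp (2 * m) + xp (- k - m)) * \<gamma> = 1 - xp (- 2 * k)"
    proof -
      have "xp (2 * m) * xp (4 * m) = xp 0" "xp (- k - m) * xp (4 * m) = xp (3 * m - k)"
        "xp (2 * m) * xp (m - k) = xp (3 * m - k)" "xp (- k - m) * xp (m - k) = xp (- 2 * k)"
        unfolding xp_add[symmetric] by (rule xp_cong; simp add: mod_eq_dvd_iff algebra_simps)+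
      then show ?thesis by (simp add: \<gamma>_def algebra_simps xp_values)
    qed
    then have q: "xp (- 2 * k) - 1 = - ((xp (2 * m) + xp (- k - m)) * \<gamma>)" by simp
    have "- inverse (\<xi> * \<gamma>) * (\<xi> * (- (S * \<gamma>))) = S" for S
      using \<gamma> xi_nonzero by (simp add: field_simps)
    then have "- inverse (\<xi> * \<gamma>) * (\<xi> * (xp (- 2 * k) - 1)) = xp (2 * m) + xp (- k - m)"
      unfolding q .
    then show ?thesis by (simp only: v2_def op_simps XX V.scale_scale)
  qed
  obtain F where F: "linform sV F" "F v1 = 1" "\<And>x. F (opA x) = xp m * F x" "\<And>x. F (Y x) = xp (- k) * F x"
    using weight_form[OF v1(1,2)] by blast
  note Fs = linform_simps[OF F(1)]
  let ?U = "{w. \<exists>c d. w = sV c v1 + sV d v2}" and ?W = "{w. F (opB w) = 0 \<and> F (opB (X w)) = 0}"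
  have U_sub: "V.subspace ?U"
  proof (rule V.subspaceI)
    show "0 \<in> ?U" by (auto intro!: exI[of _ 0])
    fix x y assume "x \<in> ?U" "y \<in> ?U"
    then obtain c d c' d' where xy: "x = sV c v1 + sV d v2" "y = sV c' v1 + sV d' v2" by blast
    show "x + y \<in> ?U" unfolding xy
      by (intro CollectI exI[of _ "c + c'"] exI[of _ "d + d'"]) (simp add: V.scale_left_distrib)
    fix e show "sV e x \<in> ?U" unfolding xy
      by (intro CollectI exI[of _ "e * c"] exI[of _ "e * d"]) (simp add: V.scale_right_distrib)
  qed
  have gens_U: "sV c v1 \<in> ?U" "sV c v2 \<in> ?U" for c
    by (auto intro: exI[of _ c] exI[of _ 0])
  have "yd_sub H V ?U"
  proof (rule yd_subI[OF U_sub])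
    fix u assume "u \<in> ?U"
    then obtain c d where u: "u = sV c v1 + sV d v2" by blast
    have "opA u = sV (c * xp m) v1 + sV (d * xp (m + 1)) v2" "opB u = sV d v1"
      "Y u = sV (c * xp (- k)) v1 + sV (d * xp (- (k + 3))) v2"
      "X u = sV (c * (- \<xi> * \<gamma>)) v2 + sV (d * (xp (2 * m) + xp (- k - m))) v1"
      using v1(1) v2 by (simp_all add: u op_simps wt_def v1(3) Bv2 Xv1 Xv2)
    then show "opA u \<in> ?U" "opB u \<in> ?U" "Y u \<in> ?U" "X u \<in> ?U"
      by (simp_all only: V.subspace_add[OF U_sub] gens_U)
  qed
  moreover have "yd_sub H V ?W"
  proof (rule yd_subI)
    show "V.subspace ?W" by (rule V.subspaceI) (simp_all add: op_simps Fs)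
    fix u assume "u \<in> ?W"
    then have u: "F (opB u) = 0" "F (opB (X u)) = 0" by auto
    have BA: "F (opB (opA x)) = \<xi> * (xp m * F (opB x))" for x
      by (simp add: op_relations(2) Fs F(3))
    have BY: "F (opB (Y x)) = - (xp (- k) * F (opB x))" for x
      using op_relations(4)[of x] F(4)[of "opB x"] by (simp add: Fs equation_minus_iff)
    have BAn: "F (opB ((opA ^^ n) x)) = (\<xi> * xp m) ^ n * F (opB x)" for n x
      by (induction n) (simp_all add: BA)
    have BXA: "F (opB (X (opA u))) = 0"
    proof -
      have "opB (Y (opB u)) = 0" "opB (opB (act V (A 3) u)) = 0"
        using op_relations(1,4)[of u] by (simp_all add: op_relations op_simps)
      moreover have "opB (X (opA u)) + sV (1 - 2 * \<xi>) (opB (Y (opB u))) =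
          sV (xp (- 1)) (opB (opA (X u))) + sV (1 - 2 * \<xi>) (opB (opB (act V (A 3) u)))"
        using arg_cong[OF op_relations(5)[of u], of opB] by (simp add: op_simps)
      ultimately show ?thesis by (simp add: Fs BA u)
    qed
    show "opA u \<in> ?W" by (simp add: BA BXA u)
    show "Y u \<in> ?W" using BY[of u] BY[of "X u"] u Y_X[of u]
      by (simp add: op_simps Fs equation_minus_iff)
    have "opB (X (opB u)) + opB (Y (opA u)) = opB (act V (A 4) u)"
      using arg_cong[OF op_relations(6)[of u], of opB] by (simp add: op_simps op_relations(1))
    then have "F (opB (X (opB u))) + F (opB (Y (opA u))) = F (opB (act V (A 4) u))"
      by (metis Fs(1))
    moreover have "act V (A 4) u = (opA ^^ 4) u" by (simp add: A_numeral act_power)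
    ultimately have "F (opB (X (opB u))) = 0" by (simp only: BY BA BAn u) simp
    then show "opB u \<in> ?W" by (simp add: op_relations(1) Fs)
    have "F (opB (X (X u))) = 0" by (simp add: X_X op_simps Fs BY u)
    then show "X u \<in> ?W" using u by simp
  qed
  moreover have "?U \<inter> ?W = {0}"
  proof
    show "?U \<inter> ?W \<subseteq> {0}"
    proof
      fix w assume "w \<in> ?U \<inter> ?W"
      then obtain c d where w: "w = sV c v1 + sV d v2" "F (opB w) = 0" "F (opB (X w)) = 0" by auto
      have "d = 0" using w(2) by (simp add: w(1) op_simps v1(3) Bv2 Fs F(2))
      moreover have "c = 0"
        using w(3) \<gamma> xi_nonzero by (simp add: w(1) op_simps BX Xv2 v1(3) Fs F(2))
      ultimately show "w \<in> {0}" by (simp add: w(1))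
    qed
    show "{0} \<subseteq> ?U \<inter> ?W" using V.subspace_0[OF U_sub] by (simp add: op_simps Fs)
  qed
  moreover have cover: "\<exists>u\<in>?U. \<exists>w\<in>?W. x = u + w" for x
  proof -
    define c d where "c = - F (opB (X x)) / (\<xi> * \<gamma>)" and "d = F (opB x)"
    have "x - (sV c v1 + sV d v2) \<in> ?W"
      using \<gamma> xi_nonzero by (simp add: op_simps Fs v1(3) Bv2 BX Xv2 F(2) c_def d_def)
    moreover have "sV c v1 + sV d v2 \<in> ?U" by blast
    moreover have "x = (sV c v1 + sV d v2) + (x - (sV c v1 + sV d v2))" by simp
    ultimately show ?thesis by blast
  qed
  ultimately have "?U = {0} \<or> ?W = {0}"
    using ind unfolding yd_indecomposable_def by blast
  then have "?W = {0}" using gens_U(1)[of 1] v1(2) by auto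
  then have all: "x \<in> ?U" for x using cover[of x] by auto
  have indep: "c = 0 \<and> d = 0" if "sV c v1 + sV d v2 = 0" for c d
  proof -
    have "opB (sV c v1 + sV d v2) = 0" using that by (simp add: op_simps)
    then have "d = 0" using v1(2) by (simp add: op_simps v1(3) Bv2)
    then show ?thesis using that v1(2) by simp
  qed
  have ne: "v1 \<noteq> v2" using indep[of 1 "- 1"] by auto
  have "V.independent {v1, v2}"
  proof -
    have "v1 \<notin> V.span {v2}"
    proof
      assume "v1 \<in> V.span {v2}"
      then obtain c where "v1 = sV c v2" by (auto simp: V.span_singleton)
      then show False using indep[of 1 "- c"] by simp
    qed
    moreover have "v2 \<noteq> 0" using Bv2 v1(2) by (auto simp: op_simps)
    ultimately show ?thesis by (simp add: V.independent_insert ne)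
  qed
  moreover have "V.span {v1, v2} = UNIV"
  proof -
    have "x \<in> V.span {v1, v2}" for x
    proof -
      obtain c d where x: "x = sV c v1 + sV d v2" using all[of x] by blast
      show ?thesis unfolding x by (intro V.span_add V.span_scale V.span_base) simp_all
    qed
    then show ?thesis by blast
  qed
  ultimately have basis: "has_basis sV {v1, v2}" by (simp add: has_basis_def)
  define i j where "i = m mod 6" and "j = (- k) mod 6"
  have xpi: "xp (c * i + d * j + e) = xp (c * m - d * k + e)" for c d e
  proof (rule xp_cong)
    have "(c * i + d * j + e) mod 6 = (c * m + d * (- k) + e) mod 6"
      unfolding i_def j_def by (intro mod_add_cong mod_mult_cong) simp_all
    then show "(c * i + d * j + e) mod 6 = (c * m - d * k + e) mod 6" by simp
  qed
  have Ai: "A (c * i + d * j + e) = A (c * m - d * k + e)" for c d e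
  proof (rule A_cong)
    have "(c * i + d * j + e) mod 6 = (c * m + d * (- k) + e) mod 6"
      unfolding i_def j_def by (intro mod_add_cong mod_mult_cong) simp_all
    then show "(c * i + d * j + e) mod 6 = (c * m - d * k + e) mod 6" by simp
  qed
  have scal: "pure sH sV h (sV c w) = tscale c (pure sH sV h w)" for h c w
    by (rule ext) (simp add: pure_def bilform_simps(7))
  have "is_V \<xi> H a b i j V v1 v2"
    unfolding is_V_def Let_def xp_def[symmetric] A_def[symmetric]
  proof (intro conjI yd ne basis v1(3) Bv2)
    show "3 * i mod 6 \<noteq> j mod 6"
    proof
      assume "3 * i mod 6 = j mod 6"
      then have "3 * m mod 6 = (- k) mod 6" by (simp add: i_def j_def mod_mult_right_eq)
      then have "4 * m mod 6 = (m - k) mod 6" by (simp add: mod_eq_dvd_iff)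
      then show False using \<gamma> xp_cong[of "4 * m" "m - k"] by (simp add: \<gamma>_def)
    qed
    show "opA v1 = sV (xp i) v1" "opA v2 = sV (xp (i + 1)) v2"
      using v1(1) v2 xpi[of 1 0 0] xpi[of 1 0 1] by (simp_all add: wt_def)
    have "A (- j) = A k" "A (- 1 - j) = A (k - 1)" "A (3 - j) = A (k + 3)" "A (2 - j) = A (k + 3 - 1)"
      using Ai[of 0 "- 1" 0] Ai[of 0 "- 1" "- 1"] Ai[of 0 "- 1" 3] Ai[of 0 "- 1" 2] by (simp_all add: algebra_simps)
    moreover have "\<xi> ^ 4 * (xp (4 * i) - xp (i + j)) = - \<xi> * \<gamma>"
      using xpi[of 4 0 0] xpi[of 1 1 0] by (simp add: xi4 \<gamma>_def)
    moreover have "xp (2 * i) + xp (j - i) = xp (2 * m) + xp (- k - m)"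
    proof -
      have "xp (- m - k) = xp (- k - m)" by (rule arg_cong[of _ _ xp]) simp
      then show ?thesis using xpi[of 2 0 0] xpi[of "- 1" 1 0] by (simp add: algebra_simps)
    qed
    ultimately show "\<delta> v1 = pure sH sV (A (- j)) v1 +
        tscale (\<xi> ^ 4 * (xp (4 * i) - xp (i + j))) (pure sH sV (b * A (- 1 - j)) v2)"
      "\<delta> v2 = pure sH sV (A (3 - j)) v2 + tscale (xp (2 * i) + xp (j - i)) (pure sH sV (b * A (2 - j)) v1)"
      using coact_wt[OF v1(1)] coact_wt[OF v2] by (simp_all only: Xv1 Xv2 scal)
  qed
  moreover have "i \<in> {0..<6}" "j \<in> {0..<6}" by (simp_all add: i_def j_def)
  ultimately show ?thesis by blast
qed

lemma is_chi_simple: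
  assumes "is_chi \<xi> H a b i V v" shows "yd_simple H V"
proof -
  have v: "V.independent {v}" "V.span {v} = UNIV" using assms by (simp_all add: is_chi_def has_basis_def)
  then have v0: "v \<noteq> 0" using V.dependent_zero[of "{v}"] by auto
  show ?thesis
    unfolding yd_simple_def
  proof (intro conjI allI impI)
    show "(UNIV :: 'v set) \<noteq> {0}" using v0 by blast
    fix U assume U: "yd_sub H V U"
    then have S: "V.subspace U" by (simp add: yd_sub_def)
    show "U = {0} \<or> U = UNIV"
    proof (cases "\<exists>u\<in>U. u \<noteq> 0")
      case True
      then obtain u where u: "u \<in> U" "u \<noteq> 0" by blast
      obtain c where c: "u = sV c v" using v(2) by (auto simp: V.span_singleton)
      have "sV (inverse c) u \<in> U" using u(1) by (rule V.subspace_scale[OF S])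
      then have "v \<in> U" using c u(2) by auto
      then have "V.span {v} \<subseteq> U" using S by (intro V.span_minimal) auto
      then show ?thesis using v(2) by auto
    next
      case False
      then show ?thesis using V.subspace_0[OF S] by blast
    qed
  qed
qed

lemma is_V_coords:
  assumes "is_V \<xi> H a b i j V v1 v2"
  shows "\<exists>c d. x = sV c v1 + sV d v2" "sV c v1 + sV d v2 = 0 \<Longrightarrow> c = 0 \<and> d = 0"
proof -
  have v: "V.independent {v1, v2}" "V.span {v1, v2} = UNIV" "v1 \<noteq> v2"
    using assms by (simp_all add: is_V_def Let_def has_basis_def)
  have "x \<in> V.span {v1, v2}" by (simp add: v)
  then obtain p where "x - sV p v1 \<in> V.span {v2}" using V.span_breakdown_eq by blast
  then obtain q where "x - sV p v1 = sV q v2" by (auto simp: V.span_singleton)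
  then have "x = sV p v1 + sV q v2" by (simp add: algebra_simps eq_diff_eq)
  then show "\<exists>c d. x = sV c v1 + sV d v2" by blast
  assume 0: "sV c v1 + sV d v2 = 0"
  have n1: "v1 \<notin> V.span {v2}" and v2: "v2 \<noteq> 0"
    using v(1,3) V.independent_insert[of v1 "{v2}"] V.dependent_zero[of "{v2}"] by auto
  have "c = 0"
  proof (rule ccontr)
    assume c: "c \<noteq> 0"
    have "sV c v1 = - sV d v2" using 0 by (simp add: eq_neg_iff_add_eq_0)
    then have "sV (inverse c) (sV c v1) = sV (inverse c) (- sV d v2)" by simp
    then have "v1 = sV (- (inverse c * d)) v2" using c by simp
    then have "v1 \<in> V.span {v2}" by (metis V.span_base V.span_scale insertI1)
    then show False using n1 by simp
  qed
  then show "c = 0 \<and> d = 0" using 0 v2 by simp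
qed

lemma is_V_simple:
  assumes V: "is_V \<xi> H a b i j V v1 v2" shows "yd_simple H V"
proof -
  note coords = is_V_coords[OF V]
  have ij: "3 * i mod 6 \<noteq> j mod 6" and B: "opB v1 = 0" "opB v2 = v1"
    and cv1: "\<delta> v1 = pure sH sV (A (- j)) v1 +
        tscale (\<xi> ^ 4 * (xp (4 * i) - xp (i + j))) (pure sH sV (b * A (- 1 - j)) v2)"
    using V unfolding is_V_def Let_def by (simp_all add: xp_def A_def)
  define c0 where "c0 = \<xi> ^ 4 * (xp (4 * i) - xp (i + j))"
  have c0: "c0 \<noteq> 0"
  proof
    assume "c0 = 0"
    then have "xp (4 * i) = xp (i + j)" using xi_nonzero by (simp add: c0_def)
    then have "4 * i mod 6 = (i + j) mod 6" by (simp only: xp_eq_iff)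
    then have "3 * i mod 6 = j mod 6" by (simp add: mod_eq_dvd_iff)
    then show False using ij by simp
  qed
  have X: "X v1 = sV c0 v2"
  proof (rule linform_separates[OF vsV])
    fix f assume f: "linform sV f"
    show "f (X v1) = f (sV c0 v2)"
      using bilform_prod[OF \<theta>(1) f]
      by (simp add: X_def slice[OF \<theta>(1) f] cv1 pure_def \<theta> linform_simps[OF f] flip: c0_def)
  qed
  have v10: "v1 \<noteq> 0" using coords(2)[of 1 0] by auto
  show ?thesis
    unfolding yd_simple_def
  proof (intro conjI allI impI)
    show "(UNIV :: 'v set) \<noteq> {0}" using v10 by blast
    fix U assume U: "yd_sub H V U"
    then have S: "V.subspace U" by (simp add: yd_sub_def)
    show "U = {0} \<or> U = UNIV"
    proof (cases "\<exists>u\<in>U. u \<noteq> 0")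
      case True
      then obtain u where u: "u \<in> U" "u \<noteq> 0" by blast
      obtain c d where cd: "u = sV c v1 + sV d v2" using coords(1) by blast
      have "v1 \<in> U"
      proof (cases "d = 0")
        case True
        have "sV (inverse c) u \<in> U" using u(1) by (rule V.subspace_scale[OF S])
        then show ?thesis using True cd u(2) by auto
      next
        case False
        have "opB u \<in> U" using yd_sub_stable(1)[OF U u(1) \<theta>(1)] .
        then have "sV (inverse d) (opB u) \<in> U" by (rule V.subspace_scale[OF S])
        then show ?thesis using False by (simp add: cd op_simps B)
      qed
      moreover from this have "X v1 \<in> U" unfolding X_def by (rule yd_sub_stable(2)[OF U _ \<theta>(1)])
      then have "sV (inverse c0) (X v1) \<in> U" by (rule V.subspace_scale[OF S])
      then have "v2 \<in> U" using c0 by (simp add: X)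
      ultimately have "x \<in> U" for x
        using coords(1)[of x] V.subspace_add[OF S] V.subspace_scale[OF S] by metis
      then show ?thesis by blast
    next
      case False
      then show ?thesis using V.subspace_0[OF S] by blast
    qed
  qed
qed

text \<open>Transport of structure along a linear bijection.\<close>

definition transport :: "('k \<Rightarrow> 'w::ab_group_add \<Rightarrow> 'w) \<Rightarrow> ('v \<Rightarrow> 'w) \<Rightarrow> ('k, 'h, 'w) yd"
  where "transport t f = \<lparr>scale = t, act = (\<lambda>h w. f (act V h (inv f w))),
    coact = (\<lambda>w \<beta>. \<delta> (inv f w) (\<lambda>h x. \<beta> h (f x)))\<rparr>"

context
  fixes t :: "'k \<Rightarrow> 'w::ab_group_add \<Rightarrow> 'w" and f :: "'v \<Rightarrow> 'w"
  assumes f: "Vector_Spaces.linear sV t f" and bij: "bij f"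
begin

interpretation W: vector_space t using f by (rule linear_imp_vector_space)

lemma inv_f [simp]: "inv f (f x) = x" "f (inv f w) = w"
  using bij by (simp_all add: bij_is_inj bij_is_surj surj_f_inv_f)

lemma inv_linear: "Vector_Spaces.linear t sV (inv f)"
proof (rule linearI[OF W.vector_space_axioms vsV])
  fix x y c
  have "x + y = f (inv f x + inv f y)" "t c x = f (sV c (inv f x))"
    by (simp_all only: inv_f linear_simps[OF f])
  then show "inv f (x + y) = inv f x + inv f y" "inv f (t c x) = sV c (inv f x)"
    by (simp_all only: inv_f)
qed

lemma id_linear: "Vector_Spaces.linear sH sH (\<lambda>h. h)"
  by (rule linearI[OF vsH vsH]) simp_all

lemma bilform_f_iff: "bilform sH sV (\<lambda>h x. \<beta> h (f x)) \<longleftrightarrow> bilform sH t \<beta>"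
  using bilform_compose[OF _ id_linear f, of \<beta>]
    bilform_compose[OF _ id_linear inv_linear, of "\<lambda>h x. \<beta> h (f x)"] by auto

lemma pure_transport: "pure sH sV h x (\<lambda>h x. \<beta> h (f x)) = pure sH t h (f x) \<beta>"
  by (simp add: pure_def bilform_f_iff)

lemma transport_yd: "yd_module H (transport t f)"
  unfolding yd_module_def Let_def transport_def yd.simps
proof (intro conjI allI impI)
  show "vector_space t" by (rule W.vector_space_axioms)
  note ls = linear_simps[OF f] linear_simps[OF inv_linear] linear_simps[OF act_linear(1)]
    linear_simps[OF act_linear(2)] linear_simps[OF coact_linear]
  fix v w :: 'w and g h :: 'h
  show "Vector_Spaces.linear sH t (\<lambda>h. f (act V h (inv f v)))"
    by (rule linearI[OF vsH W.vector_space_axioms]) (simp_all add: ls)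
  show "Vector_Spaces.linear t t (\<lambda>w. f (act V h (inv f w)))"
    by (rule linearI[OF W.vector_space_axioms W.vector_space_axioms]) (simp_all add: ls)
  show "f (act V 1 (inv f v)) = v" by (simp add: act_one)
  show "f (act V (g * h) (inv f v)) = f (act V g (inv f (f (act V h (inv f v)))))" by (simp add: act_mult)
  show "Vector_Spaces.linear t tscale (\<lambda>w \<beta>. \<delta> (inv f w) (\<lambda>h x. \<beta> h (f x)))"
    by (rule linearI[OF W.vector_space_axioms vector_space_tscale])
      (simp_all add: ls fun_eq_iff)
  show "(\<lambda>\<beta>. \<delta> (inv f v) (\<lambda>h x. \<beta> h (f x))) \<in> tensors sH t"
  proof -
    interpret T: vector_space "tscale :: 'k \<Rightarrow> ('k, 'h, 'v) tensor \<Rightarrow> ('k, 'h, 'v) tensor"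
      by (rule vector_space_tscale)
    have "(\<lambda>\<beta>. D (\<lambda>h x. \<beta> h (f x))) \<in> tensors sH t" if "D \<in> tensors sH sV" for D
      using that unfolding tspan_def[of sH sV]
    proof (induction rule: T.span_induct_alt)
      case base
      have "(\<lambda>\<beta>. (0 :: ('k, 'h, 'v) tensor) (\<lambda>h x. \<beta> h (f x))) = 0" by (simp add: fun_eq_iff)
      then show ?case by (simp only: tspan_closed(1))
    next
      case (step c x y)
      then obtain h u where x: "x = pure sH sV h u" by blast
      have "(\<lambda>\<beta>. (tscale c x + y) (\<lambda>h x. \<beta> h (f x))) =
          tscale c (pure sH t h (f u)) + (\<lambda>\<beta>. y (\<lambda>h x. \<beta> h (f x)))"
        by (simp add: fun_eq_iff x pure_transport)
      then show ?case
        using tspan_closed(2)[OF tspan_closed(3)[OF pure_in_tspan[OF UNIV_I UNIV_I, of sH t h "f u"]] step(2), of c]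
        by simp
    qed
    then show ?thesis using coact_in by blast
  qed
  show "\<delta> (inv f v) (\<lambda>h x. \<Delta> h (\<lambda>xa y. \<tau> xa y (f x))) =
      \<delta> (inv f v) (\<lambda>h x. \<delta> (inv f (f x)) (\<lambda>ha x. \<tau> h ha (f x)))" if "trilform sH sH t \<tau>" for \<tau>
  proof -
    have 1: "linform sH (\<lambda>x. \<tau> x y w)" "linform sH (\<lambda>y. \<tau> x y w)" "linform t (\<lambda>w. \<tau> x y w)" for x y w
      using that by (simp_all add: trilform_def)
    have "trilform sH sH sV (\<lambda>x y w. \<tau> x y (f w))"
      unfolding trilform_def using 1
      by (auto intro!: linformI vsV simp: ls linform_simps[OF 1(3)])
    from coact_coassoc[OF this] show ?thesis by simp
  qed
  show "\<delta> (inv f v) (\<lambda>h x. counit H h * \<phi> (f x)) = \<phi> v" if "linform t \<phi>" for \<phi>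
  proof -
    have "linform sV (\<lambda>x. \<phi> (f x))"
      by (rule linformI[OF vsV]) (simp_all add: ls linform_simps[OF that])
    from coact_counit[OF this] show ?thesis by simp
  qed
  show "\<delta> (inv f (f (act V h (inv f v)))) (\<lambda>h x. \<beta> h (f x)) =
      \<Delta> h (\<lambda>h1 h'. \<Delta> h' (\<lambda>h2 h3. \<delta> (inv f v) (\<lambda>ha x. \<beta> (h1 * ha * antipode H h3) (f (act V h2 (inv f (f x)))))))"
    if "bilform sH t \<beta>" for \<beta>
    using yd_condition[of "\<lambda>h x. \<beta> h (f x)" h "inv f v"] that by (simp add: bilform_f_iff)
qed

lemma transport_iso: "yd_isomorphic H V (transport t f)"
  unfolding yd_isomorphic_def yd_hom_def
  by (rule exI[of _ f]) (simp add: f bij transport_def)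

end

lemma is_chi_iso:
  assumes V: "is_chi \<xi> H a b i V v" shows "iso_to_chi \<xi> H a b i V"
proof -
  have v: "V.independent {v}" "V.span {v} = UNIV" "opA v = sV (\<xi> powi i) v" "opB v = 0"
    "\<delta> v = pure sH sV (apow a (3 * i)) v"
    using V by (simp_all add: is_chi_def has_basis_def)
  then have "v \<noteq> 0" using V.dependent_zero[of "{v}"] by auto
  then obtain f where f: "linform sV f" "f v = 1" using linform_one by blast
  note fs = linform_simps[OF f(1)]
  have x: "x = sV (f x) v" for x
  proof -
    obtain c where "x = sV c v" using v(2) by (auto simp: V.span_singleton)
    then show ?thesis by (simp add: fs f(2))
  qed
  have bij: "bij f"
  proof (rule bijI)
    show "inj f" by (rule injI) (metis x)
    show "surj f" by (rule surjI[of f "\<lambda>c. sV c v"]) (simp add: fs f(2))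
  qed
  have lin: "Vector_Spaces.linear sV (*) f" using f(1) by (simp add: linform_def)
  have inv1: "inv f 1 = v" using inv_f(1)[OF lin bij, of v] f(2) by simp
  interpret K: vector_space "(*) :: 'k \<Rightarrow> 'k \<Rightarrow> 'k" by (rule vector_space_times)
  have "is_chi \<xi> H a b i (transport (*) f) 1"
    unfolding is_chi_def
  proof (intro conjI transport_yd[OF lin bij])
    have "K.span {1} = UNIV" by (auto simp: K.span_singleton)
    then show "has_basis (scale (transport (*) f)) {1}" by (simp add: transport_def has_basis_def)
    show "act (transport (*) f) a 1 = scale (transport (*) f) (\<xi> powi i) 1"
      "act (transport (*) f) b 1 = 0"
      by (simp_all add: transport_def inv1 v(3,4) fs f(2))
    show "coact (transport (*) f) 1 = pure sH (scale (transport (*) f)) (apow a (3 * i)) 1"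
      by (simp add: transport_def inv1 v(5) pure_transport[OF lin bij] f(2))
  qed
  then show ?thesis
    unfolding iso_to_chi_def using transport_iso[OF lin bij]
    by (intro exI[of _ "transport (*) f"]) (simp add: transport_def)
qed

lemma is_V_iso:
  assumes V: "is_V \<xi> H a b i j V v1 v2" shows "iso_to_V \<xi> H a b i j V"
proof -
  note coords = is_V_coords[OF V]
  define t where "t = (\<lambda>c (x, y). (c * x, c * y) :: 'k \<times> 'k)"
  have vt: "vector_space t"
    by standard (auto simp: t_def algebra_simps)
  interpret K: vector_space t by (rule vt)
  have v: "V.independent {v1, v2}" "v1 \<noteq> v2"
    using V by (simp_all add: is_V_def Let_def has_basis_def)
  interpret P: vector_space_pair sV t
    by (rule vector_space_pair.intro[OF vsV vt])
  define e where "e x = (if x = v1 then (1 :: 'k, 0 :: 'k) else (0, 1))" for x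
  obtain f where f: "Vector_Spaces.linear sV t f" "f v1 = (1, 0)" "f v2 = (0, 1)"
    using P.linear_independent_extend[OF v(1), of e] v(2) by (auto simp: e_def)
  note fs = linear_simps[OF f(1)]
  have fcd: "f (sV c v1 + sV d v2) = (c, d)" for c d
    by (simp add: fs f(2,3) t_def)
  have bij: "bij f"
  proof (rule bijI)
    show "inj f"
    proof (rule injI)
      fix x y assume "f x = f y"
      moreover obtain c d c' d' where "x = sV c v1 + sV d v2" "y = sV c' v1 + sV d' v2"
        using coords(1) by meson
      ultimately show "x = y" by (simp add: fcd)
    qed
    show "surj f" by (rule surjI[of _ "\<lambda>(c, d). sV c v1 + sV d v2"]) (auto simp: fcd)
  qed
  have inv1: "inv f (1, 0) = v1" "inv f (0, 1) = v2"
    using inv_f(1)[OF f(1) bij, of v1] inv_f(1)[OF f(1) bij, of v2] f(2,3) by simp_all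
  have V': "3 * i mod 6 \<noteq> j mod 6" "opA v1 = sV (\<xi> powi i) v1" "opB v1 = 0"
    "opA v2 = sV (\<xi> powi (i + 1)) v2" "opB v2 = v1"
    "\<delta> v1 = pure sH sV (apow a (- j)) v1 +
      tscale (\<xi> ^ 4 * (\<xi> powi (4 * i) - \<xi> powi (i + j))) (pure sH sV (b * apow a (- 1 - j)) v2)"
    "\<delta> v2 = pure sH sV (apow a (3 - j)) v2 +
      tscale (\<xi> powi (2 * i) + \<xi> powi (j - i)) (pure sH sV (b * apow a (2 - j)) v1)"
    using V unfolding is_V_def Let_def by blast+
  have "is_V \<xi> H a b i j (transport t f) (1, 0) (0, 1)"
    unfolding is_V_def Let_def
  proof (intro conjI transport_yd[OF f(1) bij] V'(1))
    have sp: "x \<in> K.span {(1, 0), (0, 1)}" for x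
    proof -
      have "x = t (fst x) (1, 0) + t (snd x) (0, 1)" by (simp add: t_def)
      then show ?thesis by (metis K.span_add K.span_base K.span_scale insertI1 insertI2)
    qed
    have "(1, 0) \<notin> K.span {(0, 1)}"
    proof
      assume "(1, 0) \<in> K.span {(0, 1)}"
      then obtain c where "(1, 0) = t c (0, 1)" by (auto simp: K.span_singleton)
      then show False by (simp add: t_def)
    qed
    then have "K.independent {(1, 0), (0, 1)}"
      by (simp add: K.independent_insert zero_prod_def)
    then show "has_basis (scale (transport t f)) {(1, 0), (0, 1)}"
      using sp by (auto simp: transport_def has_basis_def)
    show "((1, 0) :: 'k \<times> 'k) \<noteq> (0, 1)" by simp
    show "act (transport t f) a (1, 0) = scale (transport t f) (\<xi> powi i) (1, 0)"
      "act (transport t f) b (1, 0) = 0"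
      "act (transport t f) a (0, 1) = scale (transport t f) (\<xi> powi (i + 1)) (0, 1)"
      "act (transport t f) b (0, 1) = (1, 0)"
      by (simp_all only: transport_def yd.simps inv1 V' fs f(2,3))
    show "coact (transport t f) (1, 0) = pure sH (scale (transport t f)) (apow a (- j)) (1, 0) +
      tscale (\<xi> ^ 4 * (\<xi> powi (4 * i) - \<xi> powi (i + j))) (pure sH (scale (transport t f)) (b * apow a (- 1 - j)) (0, 1))"
      "coact (transport t f) (0, 1) = pure sH (scale (transport t f)) (apow a (3 - j)) (0, 1) +
      tscale (\<xi> powi (2 * i) + \<xi> powi (j - i)) (pure sH (scale (transport t f)) (b * apow a (2 - j)) (1, 0))"
      by (simp_all add: transport_def inv1 V'(6,7) pure_transport[OF f(1) bij] f(2,3) fun_eq_iff)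
  qed
  then show ?thesis
    unfolding iso_to_V_def using transport_iso[OF f(1) bij]
    by (intro exI[of _ "transport t f"]) (simp add: transport_def t_def)
qed

end

section \<open>Presentations from a monomial basis\<close>

lemma fscale_algebra: "algebra (fscale :: 'k::field \<Rightarrow> ('g, 'k) free_alg \<Rightarrow> ('g, 'k) free_alg)"
proof -
  have comm: "p * Poly_Mapping.single 0 c = Poly_Mapping.single 0 c * p" for p :: "('g, 'k) free_alg" and c
    by (induction p rule: free_alg_induct) (simp_all add: distrib_left distrib_right mult_single mult.commute)
  have "vector_space (fscale :: 'k \<Rightarrow> ('g, 'k) free_alg \<Rightarrow> ('g, 'k) free_alg)"
    by standard (simp_all add: fscale_def distrib_left distrib_right single_add mult_single flip: mult.assoc)
  moreover have "c \<cdot> (p * q) = p * c \<cdot> q" for c and p q :: "('g, 'k) free_alg"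
    by (metis comm fscale_def mult.assoc)
  ultimately show ?thesis by (simp add: algebra_def fscale_def mult.assoc)
qed

global_interpretation F: algebra_eval fscale "var :: 'g \<Rightarrow> ('g, 'k::field) free_alg"
  by standard (rule fscale_algebra)

lemma F_word_val: "F.word_val w = Poly_Mapping.single w (1 :: 'k::field)"
proof -
  have "prod_list (map var l) = Poly_Mapping.single (Word l) (1 :: 'k)" for l :: "'g list"
    by (induction l)
      (simp_all add: var_def mult_single plus_word_def flip: zero_word_def single_one)
  from this[of "letters w"] show ?thesis by (simp add: F.word_val_def)
qed

lemma ideal_generated_ideal: "two_sided_ideal (ideal_generated S)"
  unfolding ideal_generated_def by (rule hull_in) (auto simp: two_sided_ideal_def)

lemma ideal_generated_superset: "S \<subseteq> ideal_generated S"
  unfolding ideal_generated_def by (rule hull_subset)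

lemma ideal_generated_least: "S \<subseteq> J \<Longrightarrow> two_sided_ideal J \<Longrightarrow> ideal_generated S \<subseteq> J"
  unfolding ideal_generated_def by (rule hull_minimal)

lemma ideal_closed:
  assumes "two_sided_ideal J"
  shows "0 \<in> J" "p \<in> J \<Longrightarrow> q \<in> J \<Longrightarrow> p + q \<in> J" "p \<in> J \<Longrightarrow> u * p \<in> J" "p \<in> J \<Longrightarrow> p * u \<in> J"
    "p \<in> J \<Longrightarrow> - p \<in> J" "p \<in> J \<Longrightarrow> q \<in> J \<Longrightarrow> p - q \<in> J"
proof -
  show *: "0 \<in> J" "p \<in> J \<Longrightarrow> q \<in> J \<Longrightarrow> p + q \<in> J" "p \<in> J \<Longrightarrow> u * p \<in> J" "p \<in> J \<Longrightarrow> p * u \<in> J" for p q u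
    using assms by (auto simp: two_sided_ideal_def)
  show neg: "p \<in> J \<Longrightarrow> - p \<in> J" for p using *(3)[of p "- 1"] by simp
  show "p \<in> J \<Longrightarrow> q \<in> J \<Longrightarrow> p - q \<in> J" using *(2)[of p "- q"] neg[of q] by simp
qed

lemma ideal_fscale:
  assumes "two_sided_ideal J" "p \<in> J" shows "c \<cdot> p \<in> J"
  unfolding fscale_def by (rule ideal_closed(3)[OF assms])

text \<open>The elements congruent to a combination of the words in \<open>B\<close>.\<close>

definition reducible_to :: "('g, 'k::field) free_alg set \<Rightarrow> 'g word set \<Rightarrow> ('g, 'k) free_alg set"
  where "reducible_to J B = {p. \<exists>q\<in>F.span ((\<lambda>w. Poly_Mapping.single w 1) ` B). p - q \<in> J}"

lemma reducible_subspace: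
  assumes J: "two_sided_ideal J" shows "F.subspace (reducible_to J B)"
proof (rule F.subspaceI)
  show "0 \<in> reducible_to J B"
    unfolding reducible_to_def by (intro CollectI bexI[of _ 0]) (simp_all add: F.span_zero ideal_closed[OF J])
next
  fix x y assume "x \<in> reducible_to J B" "y \<in> reducible_to J B"
  then obtain p q where "p \<in> F.span ((\<lambda>w. Poly_Mapping.single w 1) ` B)" "x - p \<in> J"
    "q \<in> F.span ((\<lambda>w. Poly_Mapping.single w 1) ` B)" "y - q \<in> J" by (auto simp: reducible_to_def)
  then show "x + y \<in> reducible_to J B"
    unfolding reducible_to_def
    by (intro CollectI bexI[of _ "p + q"])
      (use ideal_closed(2)[OF J, of "x - p" "y - q"] in \<open>simp_all add: F.span_add algebra_simps\<close>)
next
  fix c x assume "x \<in> reducible_to J B"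
  then obtain p where "p \<in> F.span ((\<lambda>w. Poly_Mapping.single w 1) ` B)" "x - p \<in> J"
    by (auto simp: reducible_to_def)
  then show "c \<cdot> x \<in> reducible_to J B"
    unfolding reducible_to_def
    by (intro CollectI bexI[of _ "c \<cdot> p"])
      (use ideal_fscale[OF J, of "x - p" c] in \<open>simp_all add: F.span_scale F.scale_right_diff_distrib\<close>)
qed

lemma reducible_mono: "B \<subseteq> B' \<Longrightarrow> reducible_to J B \<subseteq> reducible_to J B'"
  unfolding reducible_to_def using F.span_mono[OF image_mono] by blast

lemma reducible_cong:
  assumes J: "two_sided_ideal J" and "p - q \<in> J" "q \<in> reducible_to J B" shows "p \<in> reducible_to J B"
proof -
  obtain u where u: "u \<in> F.span ((\<lambda>w. Poly_Mapping.single w 1) ` B)" "q - u \<in> J"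
    using assms(3) by (auto simp: reducible_to_def)
  have "p - u \<in> J" using ideal_closed(2)[OF J assms(2) u(2)] by simp
  then show ?thesis using u(1) by (auto simp: reducible_to_def)
qed

lemma reducible_word: "w \<in> B \<Longrightarrow> two_sided_ideal J \<Longrightarrow> Poly_Mapping.single w 1 \<in> reducible_to J B"
  unfolding reducible_to_def
  by (intro CollectI bexI[of _ "Poly_Mapping.single w 1"]) (auto simp: ideal_closed intro: F.span_base)

context algebra_eval
begin

theorem presented_from_basis:
  assumes surj: "surj (fa_eval s e)" and rels: "\<And>r. r \<in> rels \<Longrightarrow> fa_eval s e r = 0"
    and red: "\<And>w. Poly_Mapping.single w 1 \<in> reducible_to (ideal_generated rels) B"
    and B: "finite B" "inj_on word_val B" "independent (word_val ` B)"
  shows "presented_by s e rels" "has_dim s (card B)"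
proof -
  let ?J = "ideal_generated rels" and ?m = "\<lambda>w. Poly_Mapping.single w (1 :: 'k)"
  note J = ideal_generated_ideal[of rels]
  have JK: "?J \<subseteq> {p. fa_eval s e p = 0}"
    by (rule ideal_generated_least) (use rels kernel_two_sided_ideal in auto)
  have all: "p \<in> reducible_to ?J B" for p
  proof (induction p rule: free_alg_induct)
    case zero
    show ?case by (rule F.subspace_0[OF reducible_subspace[OF J]])
  next
    case (add c w p)
    have "Poly_Mapping.single w c = c \<cdot> ?m w" by (simp add: fscale_def mult_single)
    then show ?case
      using F.subspace_add[OF reducible_subspace[OF J] F.subspace_scale[OF reducible_subspace[OF J] red[of w], of c] add]
      by simp
  qed
  have ev_m: "fa_eval s e (?m w) = word_val w" for w by (simp add: fa_eval_single)
  have kernel: "q = 0" if q: "q \<in> F.span (?m ` B)" and 0: "fa_eval s e q = 0" for q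
  proof -
    obtain u where u: "q = (\<Sum>p\<in>?m ` B. u p \<cdot> p)"
      using q F.span_finite[of "?m ` B"] B(1) by auto
    have injm: "inj_on ?m B"
    proof (rule inj_onI)
      fix v w assume "?m v = ?m w"
      then have "Poly_Mapping.lookup (?m v) w = Poly_Mapping.lookup (?m w) w" by simp
      then show "v = w" by (simp add: lookup_single when_def split: if_splits)
    qed
    have "fa_eval s e (\<Sum>w\<in>C. u (?m w) \<cdot> ?m w) = (\<Sum>w\<in>C. s (u (?m w)) (word_val w))" if "finite C" for C
      using that by (induction C rule: finite_induct)
        (simp_all add: fa_eval_zero fa_eval_add fa_eval_fscale ev_m)
    then have "0 = (\<Sum>w\<in>B. s (u (?m w)) (word_val w))"
      using 0 u B(1) by (simp add: sum.reindex[OF injm])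
    also have "\<dots> = (\<Sum>x\<in>word_val ` B. s (u (?m (inv_into B word_val x))) x)"
      using B(2) by (simp add: sum.reindex)
    finally have "u (?m (inv_into B word_val x)) = 0" if "x \<in> word_val ` B" for x
      using B(1,3) that unfolding dependent_finite[OF finite_imageI[OF B(1)]] by metis
    then have "u (?m w) = 0" if "w \<in> B" for w
      using that B(2) by (metis image_eqI inv_into_f_f)
    then show ?thesis unfolding u by (intro sum.neutral) auto
  qed
  have "p \<in> ?J" if p: "fa_eval s e p = 0" for p
  proof -
    obtain q where q: "q \<in> F.span (?m ` B)" "p - q \<in> ?J" using all[of p] by (auto simp: reducible_to_def)
    have "fa_eval s e (p - q) = 0" using JK q(2) by blast
    then have "q = 0" using kernel[OF q(1)] p by (simp add: fa_eval_diff)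
    then show ?thesis using q(2) by simp
  qed
  then have "{p. fa_eval s e p = 0} = ?J" using JK by blast
  then show "presented_by s e rels" using surj alg by (simp add: presented_by_def)
  have span: "span (word_val ` B) = UNIV"
  proof -
    have "fa_eval s e p \<in> span (word_val ` B)" for p
    proof -
      obtain q where q: "q \<in> F.span (?m ` B)" "p - q \<in> ?J" using all[of p] by (auto simp: reducible_to_def)
      have "fa_eval s e p = fa_eval s e q" using JK q(2) by (auto simp: fa_eval_diff)
      moreover have "fa_eval s e q \<in> span (word_val ` B)"
        using q(1)
      proof (induction rule: F.span_induct_alt)
        case base
        then show ?case by (simp add: fa_eval_zero span_zero)
      next
        case (step c x y)
        then obtain w where "w \<in> B" "x = ?m w" by blast
        then have "fa_eval s e x \<in> span (word_val ` B)" by (simp add: ev_m span_base)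
        then show ?case using step(2) by (simp add: fa_eval_add fa_eval_fscale span_add span_scale)
      qed
      ultimately show ?thesis by simp
    qed
    then have "range (fa_eval s e) \<subseteq> span (word_val ` B)" by blast
    then show ?thesis using surj by auto
  qed
  have "finite_dimensional_vector_space s (word_val ` B)"
    by unfold_locales (use B span in auto)
  then have "finite_dim s" by (auto simp: finite_dim_def)
  moreover have "dim (UNIV :: 'a set) = card B"
    using dim_eq_card[OF _ B(3), of UNIV] span card_image[OF B(2)] by simp
  ultimately show "has_dim s (card B)" by (simp add: has_dim_def)
qed

end

section \<open>Computing with noncommutative polynomials over the Eisenstein integers\<close>

text \<open>
  A pair \<open>(p, q)\<close> stands for \<open>p + q \<zeta>\<close> with \<open>\<zeta>\<^sup>2 = \<zeta> - 1\<close>.  A polynomial is a list of words with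
  coefficients; words are stored with the last letter first, because the skew derivations are
  computed by recursion on the last letter.
\<close>

type_synonym eis = "int \<times> int"
type_synonym epoly = "(gen list \<times> eis) list"

fun emult :: "eis \<Rightarrow> eis \<Rightarrow> eis" where
  "emult (p, q) (r, t) = (p * r - q * t, p * t + q * r + q * t)"

fun enorm :: "eis \<Rightarrow> int" where
  "enorm (p, q) = p * p + p * q + q * q"

fun ins :: "gen list \<Rightarrow> eis \<Rightarrow> epoly \<Rightarrow> epoly" where
  "ins w c [] = (if c = (0, 0) then [] else [(w, c)])"
| "ins w c ((v, d) # P) = (if v = w then
      (let f = (fst c + fst d, snd c + snd d) in if f = (0, 0) then P else (w, f) # P)
    else (v, d) # ins w c P)"

fun add_to :: "eis \<Rightarrow> epoly \<Rightarrow> epoly \<Rightarrow> epoly" where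
  "add_to c [] P = P"
| "add_to c ((w, d) # Q) P = ins w (emult c d) (add_to c Q P)"

definition embed :: "gen list \<Rightarrow> gen list \<Rightarrow> epoly \<Rightarrow> epoly"
  where "embed u v P = map (\<lambda>(w, c). (u @ w @ v, c)) P"

definition cf :: "'k::field_char_0 \<Rightarrow> eis \<Rightarrow> 'k"
  where "cf \<zeta> c = of_int (fst c) + of_int (snd c) * \<zeta>"

lemma cf_simps:
  assumes "\<zeta> * \<zeta> = \<zeta> - 1"
  shows "cf \<zeta> (emult c d) = cf \<zeta> c * cf \<zeta> d" "cf \<zeta> (0, 0) = 0" "cf \<zeta> (1, 0) = 1"
    "cf \<zeta> (fst c + fst d, snd c + snd d) = cf \<zeta> c + cf \<zeta> d"
    "enorm c \<noteq> 0 \<Longrightarrow> cf \<zeta> c \<noteq> 0"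
proof -
  have z: "\<zeta> * (\<zeta> * x) = \<zeta> * x - x" for x
    using assms by (metis left_diff_distrib mult.assoc mult_1)
  obtain p q where c: "c = (p, q)" by (cases c)
  obtain r t where d: "d = (r, t)" by (cases d)
  show "cf \<zeta> (emult c d) = cf \<zeta> c * cf \<zeta> d"
    by (simp add: c d cf_def algebra_simps z assms)
  show "cf \<zeta> (0, 0) = 0" "cf \<zeta> (1, 0) = 1"
    "cf \<zeta> (fst c + fst d, snd c + snd d) = cf \<zeta> c + cf \<zeta> d"
    by (simp_all add: cf_def algebra_simps)
  have "cf \<zeta> c * cf \<zeta> (p + q, - q) = of_int (enorm c)"
    by (simp add: c cf_def algebra_simps z assms)
  then show "enorm c \<noteq> 0 \<Longrightarrow> cf \<zeta> c \<noteq> 0" by auto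
qed

text \<open>
  The skew derivations for the braiding with \<open>x x \<mapsto> q11 x x\<close>, \<open>x y \<mapsto> q12 y x + s x y\<close>,
  \<open>y x \<mapsto> q21 x y\<close>, \<open>y y \<mapsto> q22 y y + t x x\<close>.
\<close>

datatype braiding = Braiding eis eis eis eis eis eis

fun dword :: "braiding \<Rightarrow> gen list \<Rightarrow> epoly \<times> epoly" where
  "dword q [] = ([], [])"
| "dword (Braiding q11 q12 s q21 q22 t) (GX # w) =
    (let (P, Q) = dword (Braiding q11 q12 s q21 q22 t) w in
      (ins w (1, 0) (add_to q11 (embed [GX] [] P) []), add_to q21 (embed [GX] [] Q) []))"
| "dword (Braiding q11 q12 s q21 q22 t) (GY # w) =
    (let (P, Q) = dword (Braiding q11 q12 s q21 q22 t) w in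
      (add_to q12 (embed [GY] [] P) (add_to t (embed [GX] [] Q) []),
       ins w (1, 0) (add_to s (embed [GX] [] P) (add_to q22 (embed [GY] [] Q) []))))"

fun dpoly :: "braiding \<Rightarrow> epoly \<Rightarrow> epoly \<times> epoly" where
  "dpoly q [] = ([], [])"
| "dpoly q ((w, c) # P) =
    (let (A, B) = dword q w; (A', B') = dpoly q P in (add_to c A A', add_to c B B'))"

definition homog :: "nat \<Rightarrow> epoly \<Rightarrow> bool"
  where "homog n P \<longleftrightarrow> (\<forall>(w, c)\<in>set P. length w = n)"

fun null :: "braiding \<Rightarrow> nat \<Rightarrow> epoly \<Rightarrow> bool" where
  "null q 0 P \<longleftrightarrow> P = []"
| "null q (Suc n) P \<longleftrightarrow> P = [] \<or> (let (A, B) = dpoly q P in null q n A \<and> null q n B)"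

fun contract :: "braiding \<Rightarrow> gen list \<Rightarrow> epoly \<Rightarrow> epoly" where
  "contract q [] P = P"
| "contract q (g # u) P = contract q u (case g of GX \<Rightarrow> fst (dpoly q P) | GY \<Rightarrow> snd (dpoly q P))"

text \<open>
  A rewriting rule \<open>(l, Q, c, C)\<close> replaces the word \<open>l\<close> by \<open>Q\<close>; the certificate \<open>C\<close> expresses
  \<open>c (l - Q)\<close>, with \<open>c\<close> nonzero, through two-sided multiples of the relations.
\<close>

type_synonym rule = "gen list \<times> epoly \<times> eis \<times> (eis \<times> gen list \<times> nat \<times> gen list) list"

fun combine :: "epoly list \<Rightarrow> (eis \<times> gen list \<times> nat \<times> gen list) list \<Rightarrow> epoly" where
  "combine rels [] = []"
| "combine rels ((c, u, k, v) # C) = add_to c (embed v u (rels ! k)) (combine rels C)"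

fun wvalue :: "gen list \<Rightarrow> nat" where
  "wvalue [] = 0"
| "wvalue (g # w) = (case g of GX \<Rightarrow> 0 | GY \<Rightarrow> 1) + 2 * wvalue w"

fun rule_ok :: "epoly list \<Rightarrow> rule \<Rightarrow> bool" where
  "rule_ok rels (l, Q, c, C) \<longleftrightarrow> enorm c \<noteq> 0 \<and>
    (\<forall>(w, d)\<in>set Q. length w = length l \<and> wvalue w < wvalue l) \<and>
    (\<forall>(d, u, k, v)\<in>set C. k < length rels) \<and>
    add_to (- 1, 0) (combine rels C) (ins l c (add_to (- fst c, - snd c) Q [])) = []"

fun starts :: "gen list \<Rightarrow> gen list \<Rightarrow> bool" where
  "starts [] w = True"
| "starts (g # l) [] = False"
| "starts (g # l) (h # w) = (g = h \<and> starts l w)"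

fun find_rule :: "rule list \<Rightarrow> gen list \<Rightarrow> epoly option" where
  "find_rule [] w = None"
| "find_rule ((l, Q, c, C) # rs) w =
    (if starts l w then Some (embed [] (drop (length l) w) Q) else find_rule rs w)"

fun rewrite :: "rule list \<Rightarrow> gen list \<Rightarrow> epoly option" where
  "rewrite rs [] = find_rule rs []"
| "rewrite rs (g # w) = (case find_rule rs (g # w) of Some Q \<Rightarrow> Some Q
    | None \<Rightarrow> (case rewrite rs w of Some Q \<Rightarrow> Some (embed [g] [] Q) | None \<Rightarrow> None))"

fun nf :: "rule list \<Rightarrow> nat \<Rightarrow> epoly \<Rightarrow> epoly" where
  "nf rs 0 P = P"
| "nf rs (Suc n) [] = []"
| "nf rs (Suc n) ((w, c) # P) = (case rewrite rs w of None \<Rightarrow> ins w c (nf rs n P)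
    | Some Q \<Rightarrow> nf rs n (add_to c Q P))"

text \<open>
  The monomials \<open>x\<^sup>i (y x)\<^sup>e y\<^sup>k\<close> with \<open>i < N\<close>, \<open>e < E\<close>, \<open>k < M\<close>.  Each comes with two words by which it
  is multiplied to reach the monomial of largest degree: multiplication by \<open>x\<^sup>N\<^sup>-\<^sup>1\<^sup>-\<^sup>i\<close> on the left kills
  the monomials with larger exponent of \<open>x\<close>, multiplication by \<open>y\<^sup>M\<^sup>-\<^sup>1\<^sup>-\<^sup>k\<close> on the right those of the same
  degree with larger exponent of \<open>y\<close>.
\<close>

definition monomial :: "nat \<Rightarrow> nat \<Rightarrow> nat \<Rightarrow> gen list"
  where "monomial i e k = replicate k GY @ concat (replicate e [GX, GY]) @ replicate i GX"

definition monomials :: "nat \<Rightarrow> nat \<Rightarrow> nat \<Rightarrow> (gen list \<times> gen list \<times> gen list) list"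
  where "monomials N E M = concat (map (\<lambda>d. concat (map (\<lambda>i. concat (map (\<lambda>e. concat (map (\<lambda>k.
      if i + 2 * e + k = d then [(monomial i e k, replicate (N - 1 - i) GX,
        (if e = E - 1 then [] else [GY, GX]) @ replicate (M - 1 - k) GY)] else [])
    [0..<M])) (rev [0..<E]))) [0..<N])) [0..<N + 2 * E + M])"

definition multiple_of_word :: "gen list \<Rightarrow> epoly \<Rightarrow> bool"
  where "multiple_of_word w P \<longleftrightarrow> length P = 1 \<and> fst (hd P) = w \<and> enorm (snd (hd P)) \<noteq> 0"

lemma multiple_of_wordE:
  assumes "multiple_of_word w P" obtains c where "P = [(w, c)]" "enorm c \<noteq> 0"
  using assms by (cases P) (auto simp: multiple_of_word_def)

fun triangular :: "rule list \<Rightarrow> gen list \<Rightarrow> (gen list \<times> gen list \<times> gen list) list \<Rightarrow> bool" where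
  "triangular rs tp [] = True"
| "triangular rs tp ((b, u, v) # T) \<longleftrightarrow>
    multiple_of_word tp (nf rs 100 [(v @ b @ u, (1, 0))]) \<and>
    length (v @ b @ u) = length tp \<and>
    (\<forall>(b', u', v')\<in>set T. length b \<le> length b') \<and>
    (\<forall>(b', u', v')\<in>set (filter (\<lambda>(b', u', v'). length b' = length b) T).
      nf rs 100 [(v @ b' @ u, (1, 0))] = []) \<and>
    triangular rs tp T"

definition closed_basis :: "rule list \<Rightarrow> gen list list \<Rightarrow> bool"
  where "closed_basis rs B \<longleftrightarrow> [] \<in> set B \<and>
    (\<forall>b\<in>set B. \<forall>g\<in>{GX, GY}. g # b \<in> set B \<or> (\<exists>(l, Q)\<in>set rs. starts l (g # b)))"

definition nichols_certificate ::
  "braiding \<Rightarrow> epoly list \<Rightarrow> rule list \<Rightarrow> nat \<Rightarrow> nat \<Rightarrow> nat \<Rightarrow> gen list \<Rightarrow> bool"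
  where "nichols_certificate q rels rs N E M path \<longleftrightarrow>
    (let T = monomials N E M; tp = monomial (N - 1) (E - 1) (M - 1) in
      (\<forall>P\<in>set rels. P \<noteq> [] \<and> (let n = length (fst (hd P)) in n > 0 \<and> homog n P \<and> null q n P)) \<and>
      (\<forall>r\<in>set rs. rule_ok rels r) \<and>
      closed_basis rs (map fst T) \<and> distinct (map fst T) \<and>
      (\<forall>b\<in>set (map fst T). length b \<le> length tp) \<and>
      triangular rs tp T \<and>
      multiple_of_word [] (contract q path [(tp, (1, 0))]))"

section \<open>Soundness of the computations\<close>

locale eisenstein_eval = algebra_eval s e for s :: "'k::field_char_0 \<Rightarrow> 'a::ring_1 \<Rightarrow> 'a" and e :: "gen \<Rightarrow> 'a" +
  fixes \<zeta> :: 'k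
  assumes zeta: "\<zeta> * \<zeta> = \<zeta> - 1"
begin

lemmas cfs = cf_simps[OF zeta]

primrec wv :: "gen list \<Rightarrow> 'a" where
  "wv [] = 1"
| "wv (g # w) = wv w * e g"

lemma wv_append: "wv (u @ v) = wv v * wv u"
  by (induction u) (simp_all add: mult.assoc)

lemma wv_word: "wv w = word_val (Word (rev w))"
  by (induction w) (simp_all add: word_val_def)

definition evp :: "epoly \<Rightarrow> 'a"
  where "evp P = (\<Sum>(w, c)\<leftarrow>P. s (cf \<zeta> c) (wv w))"

lemma evp_simps: "evp [] = 0" "evp ((w, c) # P) = s (cf \<zeta> c) (wv w) + evp P"
  by (simp_all add: evp_def)

lemma evp_ins: "evp (ins w c P) = s (cf \<zeta> c) (wv w) + evp P"
proof (induction w c P rule: ins.induct)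
  case (1 w c)
  then show ?case by (simp add: evp_simps cfs)
next
  case (2 w c v d P)
  show ?case
  proof (cases "v = w")
    case True
    define f where "f = (fst c + fst d, snd c + snd d)"
    have eq: "s (cf \<zeta> f) (wv w) = s (cf \<zeta> c) (wv w) + s (cf \<zeta> d) (wv w)"
      by (simp only: f_def cfs(4) scale_left_distrib)
    have ins: "ins w c ((v, d) # P) = (if f = (0, 0) then P else (w, f) # P)"
      using True by (simp add: f_def Let_def)
    show ?thesis
    proof (cases "f = (0, 0)")
      case f: True
      have "s (cf \<zeta> c) (wv w) + s (cf \<zeta> d) (wv w) = 0"
        unfolding eq[symmetric] by (simp only: f cfs(2) scale_zero_left)
      then show ?thesis using True f unfolding ins by (simp add: evp_simps add.assoc[symmetric])
    next
      case f: False
      then show ?thesis using True eq unfolding ins by (simp add: evp_simps add.assoc[symmetric])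
    qed
  next
    case False
    then show ?thesis using 2 by (simp add: evp_simps algebra_simps)
  qed
qed

lemma evp_add_to: "evp (add_to c Q P) = s (cf \<zeta> c) (evp Q) + evp P"
  by (induction c Q P rule: add_to.induct)
    (simp_all add: evp_simps evp_ins cfs(1) scale_right_distrib add.assoc)

lemma evp_embed: "evp (embed u v P) = wv v * evp P * wv u"
proof (induction P)
  case Nil
  then show ?case by (simp add: embed_def evp_simps)
next
  case (Cons t P)
  obtain w c where t: "t = (w, c)" by (cases t)
  have "embed u v (t # P) = (u @ w @ v, c) # embed u v P" by (simp add: embed_def t)
  then show ?case using Cons
    by (simp add: t evp_simps wv_append distrib_left distrib_right scale_mult mult.assoc)
qed

lemma find_rule_sound:
  assumes "\<And>l Q c C. (l, Q, c, C) \<in> set rs \<Longrightarrow> wv l = evp Q" "find_rule rs w = Some P"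
  shows "wv w = evp P"
  using assms
proof (induction rs w rule: find_rule.induct)
  case (2 l Q c C rs w)
  have st: "starts l w \<Longrightarrow> w = l @ drop (length l) w" for l w
    by (induction l w rule: starts.induct) auto
  show ?case
  proof (cases "starts l w")
    case True
    have "wv w = wv (drop (length l) w) * wv l" using st[OF True] wv_append by metis
    moreover have "wv l = evp Q" using 2(2)[of l Q c C] by simp
    moreover have "P = embed [] (drop (length l) w) Q" using 2(3) True by simp
    ultimately show ?thesis by (simp add: evp_embed)
  next
    case False
    then have "find_rule rs w = Some P" using 2(3) by simp
    then show ?thesis using 2(1)[OF False] 2(2) by (metis list.set_intros(2))
  qed
qed simp

lemma rewrite_sound:
  assumes rs: "\<And>l Q c C. (l, Q, c, C) \<in> set rs \<Longrightarrow> wv l = evp Q" and "rewrite rs w = Some P"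
  shows "wv w = evp P"
  using assms(2)
proof (induction w arbitrary: P)
  case Nil
  then have "find_rule rs [] = Some P" by simp
  then show ?case using find_rule_sound[of rs "[]" P] rs by blast
next
  case (Cons g w)
  show ?case
  proof (cases "find_rule rs (g # w)")
    case None
    then obtain Q where "rewrite rs w = Some Q" "P = embed [g] [] Q"
      using Cons.prems by (auto split: option.splits)
    then show ?thesis using Cons.IH by (simp add: evp_embed)
  next
    case (Some Q)
    then have "find_rule rs (g # w) = Some P" using Cons.prems by simp
    then show ?thesis using find_rule_sound[of rs "g # w" P] rs by blast
  qed
qed

lemma nf_sound:
  assumes rs: "\<And>l Q c C. (l, Q, c, C) \<in> set rs \<Longrightarrow> wv l = evp Q"
  shows "evp (nf rs n P) = evp P"
proof (induction n arbitrary: P)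
  case (Suc n)
  show ?case
  proof (cases P)
    case (Cons a P')
    obtain w c where a: "a = (w, c)" by (cases a)
    show ?thesis
    proof (cases "rewrite rs w")
      case None
      then show ?thesis by (simp add: Cons a evp_ins evp_simps Suc)
    next
      case (Some Q)
      have "wv w = evp Q" using rewrite_sound[of rs w Q] Some rs by blast
      then show ?thesis using Some by (simp add: Cons a evp_add_to evp_simps Suc)
    qed
  qed (simp add: evp_simps)
qed simp

lemma triangular_independent:
  assumes rs: "\<And>l Q c C. (l, Q, c, C) \<in> set rs \<Longrightarrow> wv l = evp Q"
    and tp: "wv tp \<noteq> 0" and long: "\<And>w. length w > length tp \<Longrightarrow> wv w = 0"
    and "triangular rs tp T" and "(\<Sum>t\<leftarrow>T. s (k (fst t)) (wv (fst t))) = 0"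
  shows "\<forall>b\<in>fst ` set T. k b = 0"
  using assms(4,5)
proof (induction T)
  case Nil
  then show ?case by simp
next
  case (Cons t T)
  obtain b u v where t: "t = (b, u, v)" by (metis prod_cases3)
  note tri = Cons.prems(1)[unfolded t triangular.simps]
  obtain c where c: "nf rs 100 [(v @ b @ u, (1, 0))] = [(tp, c)]" "enorm c \<noteq> 0"
    using tri by (elim conjE multiple_of_wordE)
  have nf_sound: "evp (nf rs 100 P) = evp P" for P using nf_sound[of rs 100 P] rs by blast
  have head: "wv u * wv b * wv v = s (cf \<zeta> c) (wv tp)"
    using nf_sound[of "[(v @ b @ u, (1, 0))]"] unfolding c(1)
    by (simp add: evp_simps wv_append cfs mult.assoc)
  have len: "length (v @ b @ u) = length tp" using tri by blast
  have rest: "wv u * wv b' * wv v = 0" if t': "(b', u', v') \<in> set T" for b' u' v'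
  proof (cases "length b' = length b")
    case True
    then have "nf rs 100 [(v @ b' @ u, (1, 0))] = []" using tri t' by force
    then show ?thesis using nf_sound[of "[(v @ b' @ u, (1, 0))]"]
      by (simp add: evp_simps wv_append cfs mult.assoc)
  next
    case False
    then have "length (v @ b' @ u) > length tp" using tri t' len by fastforce
    from long[OF this] show ?thesis by (simp add: wv_append mult.assoc)
  qed
  have "wv u * (\<Sum>t\<leftarrow>T'. s (k (fst t)) (wv (fst t))) * wv v =
      (\<Sum>t\<leftarrow>T'. s (k (fst t)) (wv u * wv (fst t) * wv v))"
    for T' :: "(gen list \<times> gen list \<times> gen list) list"
    by (induction T') (simp_all add: distrib_left distrib_right scale_mult)
  from this[of "t # T"] have "0 = s (k b) (wv u * wv b * wv v) +
      (\<Sum>t\<leftarrow>T. s (k (fst t)) (wv u * wv (fst t) * wv v))"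
    unfolding Cons.prems(2) by (simp add: t)
  also have "(\<Sum>t\<leftarrow>T. s (k (fst t)) (wv u * wv (fst t) * wv v)) = (\<Sum>t\<leftarrow>T. 0)"
    by (rule arg_cong[of _ _ sum_list], rule map_cong) (use rest in auto)
  finally have "s (k b * cf \<zeta> c) (wv tp) = 0" by (simp add: head)
  then have kb: "k b = 0" using tp cfs(5)[OF c(2)] by simp
  then have "(\<Sum>t\<leftarrow>T. s (k (fst t)) (wv (fst t))) = 0" using Cons.prems(2) by (simp add: t)
  then show ?case using Cons.IH tri kb by (simp add: t)
qed

end

lemma wvalue_append: "wvalue (u @ w) = wvalue u + 2 ^ length u * wvalue w"
  by (induction u) (auto split: gen.splits)

context
  fixes \<zeta> :: "'k::field_char_0" assumes z: "\<zeta> * \<zeta> = \<zeta> - 1"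
begin

interpretation FE: eisenstein_eval fscale "var :: gen \<Rightarrow> (gen, 'k) free_alg" \<zeta>
  by standard (rule z)

lemma rule_in_ideal:
  assumes J: "two_sided_ideal J" and rels: "\<And>P. P \<in> set rels \<Longrightarrow> FE.evp P \<in> J"
    and ok: "rule_ok rels (l, Q, c, C)"
  shows "FE.wv l - FE.evp Q \<in> J"
proof -
  note scale = ideal_fscale[OF J]
  have comb: "FE.evp (combine rels C) \<in> J" if "\<forall>(d, u, k, v)\<in>set C. k < length rels"
    using that
  proof (induction C)
    case Nil
    then show ?case by (simp add: FE.evp_simps ideal_closed(1)[OF J])
  next
    case (Cons a C)
    obtain c u k v where a: "a = (c, u, k, v)" by (metis prod_cases4)
    have "rels ! k \<in> set rels" using Cons.prems by (simp add: a)
    then have "FE.evp (rels ! k) \<in> J" by (rule rels)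
    moreover have "FE.evp (combine rels C) \<in> J" using Cons by simp
    ultimately show ?case
      by (simp add: a FE.evp_add_to FE.evp_embed ideal_closed(2,3,4)[OF J] scale)
  qed
  have cm: "cf \<zeta> (- 1, 0) = - 1" "cf \<zeta> (- fst c, - snd c) = - cf \<zeta> c" by (simp_all add: cf_def)
  have "FE.evp (add_to (- 1, 0) (combine rels C) (ins l c (add_to (- fst c, - snd c) Q []))) = 0"
    using ok by (simp add: FE.evp_simps)
  then have "cf \<zeta> c \<cdot> (FE.wv l - FE.evp Q) = FE.evp (combine rels C)"
    by (simp add: FE.evp_add_to FE.evp_ins FE.evp_simps cm F.scale_right_diff_distrib algebra_simps)
  then have "cf \<zeta> c \<cdot> (FE.wv l - FE.evp Q) \<in> J" using comb ok by simp
  then have "inverse (cf \<zeta> c) \<cdot> (cf \<zeta> c \<cdot> (FE.wv l - FE.evp Q)) \<in> J" by (rule scale)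
  then show ?thesis using FE.cfs(5)[of c] ok by (simp add: F.scale_scale)
qed

lemma word_factor:
  assumes "closed_basis rs B"
  shows "w \<in> set B \<or> (\<exists>u l v Q. w = u @ l @ v \<and> (l, Q) \<in> set rs)"
proof (induction w)
  case Nil
  then show ?case using assms by (simp add: closed_basis_def)
next
  case (Cons g w)
  have st: "starts l w \<Longrightarrow> w = l @ drop (length l) w" for l w
    by (induction l w rule: starts.induct) auto
  have g: "g \<in> {GX, GY}" by (cases g) auto
  from Cons show ?case
  proof
    assume "w \<in> set B"
    then have "g # w \<in> set B \<or> (\<exists>(l, Q)\<in>set rs. starts l (g # w))"
      by (rule bspec[OF bspec[OF conjunct2[OF assms[unfolded closed_basis_def]]] g])
    then show ?thesis
    proof
      assume "\<exists>(l, Q)\<in>set rs. starts l (g # w)"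
      then obtain l Q where lQ: "(l, Q) \<in> set rs" "starts l (g # w)" by blast
      have "g # w = [] @ l @ drop (length l) (g # w)" using st[OF lQ(2)] by simp
      then show ?thesis using lQ(1) by blast
    qed simp
  next
    assume "\<exists>u l v Q. w = u @ l @ v \<and> (l, Q) \<in> set rs"
    then obtain u l v Q where "g # w = (g # u) @ l @ v" "(l, Q) \<in> set rs" by auto
    then show ?thesis by blast
  qed
qed

text \<open>
  The value of a word, read as a binary number, decreases under rewriting inside any context;
  so every word reduces to words of the same length without a left-hand side as a factor.
\<close>

lemma word_reducible:
  assumes J: "two_sided_ideal J" and rels: "\<And>P. P \<in> set rels \<Longrightarrow> FE.evp P \<in> J"
    and ok: "\<And>r. r \<in> set rs \<Longrightarrow> rule_ok rels r" and B: "closed_basis rs B"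
  shows "FE.wv w \<in> reducible_to J ((\<lambda>b. Word (rev b)) ` {b \<in> set B. length b = length w})"
proof (induction "wvalue w" arbitrary: w rule: less_induct)
  case less
  let ?B = "(\<lambda>b. Word (rev b)) ` {b \<in> set B. length b = length w}"
  from word_factor[OF B, of w] show ?case
  proof
    assume "w \<in> set B"
    then show ?thesis unfolding FE.wv_word F_word_val by (intro reducible_word J) auto
  next
    assume "\<exists>u l v Q. w = u @ l @ v \<and> (l, Q) \<in> set rs"
    then obtain u l v Q c C where w: "w = u @ l @ v" and r: "(l, Q, c, C) \<in> set rs" by (metis prod_cases3)
    note sub = reducible_subspace[OF J, of ?B]
    have Q: "FE.evp (embed u v Q) \<in> reducible_to J ?B"
    proof -
      have "\<forall>(q, d)\<in>set Q. length q = length l \<and> wvalue q < wvalue l" using ok[OF r] by simp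
      then show ?thesis
      proof (induction Q)
        case Nil
        then show ?case by (simp add: embed_def FE.evp_simps F.subspace_0[OF sub])
      next
        case (Cons t Q)
        obtain q d where t: "t = (q, d)" by (cases t)
        have q: "length q = length l" "wvalue q < wvalue l" using Cons.prems by (auto simp: t)
        have "wvalue (u @ q @ v) < wvalue w" using q by (simp add: w wvalue_append)
        then have "FE.wv (u @ q @ v) \<in> reducible_to J ?B"
          using less[of "u @ q @ v"] q(1) by (simp add: w)
        moreover have "embed u v (t # Q) = (u @ q @ v, d) # embed u v Q" by (simp add: embed_def t)
        ultimately show ?case using Cons
          by (auto simp: FE.evp_simps intro!: F.subspace_add[OF sub] F.subspace_scale[OF sub])
      qed
    qed
    have "FE.wv w - FE.evp (embed u v Q) = FE.wv v * (FE.wv l - FE.evp Q) * FE.wv u"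
      by (simp add: w FE.wv_append FE.evp_embed algebra_simps)
    also have "\<dots> \<in> J"
      by (intro ideal_closed(3,4)[OF J] rule_in_ideal[OF J rels ok[OF r]])
    finally show ?thesis using reducible_cong[OF J _ Q] by blast
  qed
qed

end

lemma (in eisenstein_eval) fa_eval_evp:
  "fa_eval s e (eisenstein_eval.evp fscale var \<zeta> P) = evp P"
    "fa_eval s e (eisenstein_eval.wv var w) = wv w"
proof -
  interpret FE: eisenstein_eval fscale "var :: gen \<Rightarrow> (gen, 'k) free_alg" \<zeta>
    by standard (rule zeta)
  show w: "fa_eval s e (FE.wv w) = wv w" for w
    by (induction w) (simp_all add: fa_eval_one fa_eval_mult fa_eval_var)
  show "fa_eval s e (FE.evp P) = evp P"
    by (induction P) (auto simp: FE.evp_simps evp_simps fa_eval_zero fa_eval_add fa_eval_fscale w)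
qed

section \<open>Nichols algebras of rank two\<close>

locale nichols_rank2 = nichols H V R \<iota> G
  for H :: "('k::field_char_0, 'h::ring_1) hopf" and V :: "('k, 'h, 'v::ab_group_add) yd"
    and R :: "('k, 'h, 'r::ring_1) braided_hopf" and \<iota> and G +
  fixes v1 v2 :: 'v and \<zeta> :: 'k and q11 q12 s q21 q22 t :: eis
  assumes zeta: "\<zeta> * \<zeta> = \<zeta> - 1"
    and basis: "has_basis sV {v1, v2}" "v1 \<noteq> v2"
    and braids: "braids v1 v1 [(sV (cf \<zeta> q11) v1, v1)]"
      "braids v1 v2 [(sV (cf \<zeta> q12) v2, v1), (sV (cf \<zeta> s) v1, v2)]"
      "braids v2 v1 [(sV (cf \<zeta> q21) v1, v2)]"
      "braids v2 v2 [(sV (cf \<zeta> q22) v2, v2), (sV (cf \<zeta> t) v1, v1)]"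
begin

lemma gens_simps: "gens x y GX = x" "gens x y GY = y"
  by (simp_all add: gens_def)

sublocale E: eisenstein_eval sR "gens (\<iota> v1) (\<iota> v2)" \<zeta>
  by standard (rule algR, rule zeta)

abbreviation brd where "brd \<equiv> Braiding q11 q12 s q21 q22 t"

definition D :: "'r \<Rightarrow> 'r \<Rightarrow> 'r \<Rightarrow> bool"
  where "D r p q \<longleftrightarrow> derives r [(p, v1), (q, v2)]"

lemma D_zero: "D 0 0 0" and D_one: "D 1 0 0"
  unfolding D_def
  by (rule derives_cong[OF derives_zero], simp add: bilform_simps)
    (rule derives_cong[OF derives_one], simp add: bilform_simps)

lemma D_add: "D r p q \<Longrightarrow> D r' p' q' \<Longrightarrow> D (r + r') (p + p') (q + q')"
  unfolding D_def
  by (rule derives_cong[OF derives_add], assumption, assumption) (simp add: bilform_simps algebra_simps)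

lemma D_scale: "D r p q \<Longrightarrow> D (sR c r) (sR c p) (sR c q)"
  unfolding D_def by (rule derives_cong[OF derives_scale], assumption) (simp add: bilform_simps)

lemma D_x:
  assumes "D r p q" shows "D (r * \<iota> v1) (r + sR (cf \<zeta> q11) (p * \<iota> v1)) (sR (cf \<zeta> q21) (q * \<iota> v1))"
proof -
  define N where "N w = (if w = v1 then [(sV (cf \<zeta> q11) v1, v1)] else [(sV (cf \<zeta> q21) v1, v2)])" for w
  have "derives (r * \<iota> v1) ((r, v1) # concat (map (\<lambda>(p, w). map (\<lambda>(u', w'). (p * \<iota> u', w')) (N w)) [(p, v1), (q, v2)]))"
    by (rule derives_mult_braids[OF assms[unfolded D_def]]) (use braids basis(2) in \<open>auto simp: N_def\<close>)
  then show ?thesis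
    unfolding D_def
    by (rule derives_cong)
      (use basis(2) in \<open>simp add: N_def bilform_simps linear_simps[OF iota_linear] mult_sR algebra_simps\<close>)
qed

lemma D_y:
  assumes "D r p q"
  shows "D (r * \<iota> v2) (sR (cf \<zeta> q12) (p * \<iota> v2) + sR (cf \<zeta> t) (q * \<iota> v1))
    (r + (sR (cf \<zeta> s) (p * \<iota> v1) + sR (cf \<zeta> q22) (q * \<iota> v2)))"
proof -
  define N where "N w = (if w = v1 then [(sV (cf \<zeta> q12) v2, v1), (sV (cf \<zeta> s) v1, v2)]
    else [(sV (cf \<zeta> q22) v2, v2), (sV (cf \<zeta> t) v1, v1)])" for w
  have "derives (r * \<iota> v2) ((r, v2) # concat (map (\<lambda>(p, w). map (\<lambda>(u', w'). (p * \<iota> u', w')) (N w)) [(p, v1), (q, v2)]))"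
    by (rule derives_mult_braids[OF assms[unfolded D_def]]) (use braids basis(2) in \<open>auto simp: N_def\<close>)
  then show ?thesis
    unfolding D_def
    by (rule derives_cong)
      (use basis(2) in \<open>simp add: N_def bilform_simps linear_simps[OF iota_linear] mult_sR algebra_simps\<close>)
qed

lemma dword_sound: "D (E.wv w) (E.evp (fst (dword brd w))) (E.evp (snd (dword brd w)))"
proof (induction w)
  case Nil
  then show ?case by (simp add: D_one E.evp_simps)
next
  case (Cons g w)
  obtain P Q where PQ: "dword brd w = (P, Q)" by (cases "dword brd w")
  have IH: "D (E.wv w) (E.evp P) (E.evp Q)" using Cons by (simp add: PQ)
  show ?case
  proof (cases g)
    case GX
    then show ?thesis using D_x[OF IH]
      by (simp add: PQ gens_simps E.evp_simps E.evp_ins E.evp_add_to E.evp_embed E.cfs)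
  next
    case GY
    then show ?thesis using D_y[OF IH]
      by (simp add: PQ gens_simps E.evp_simps E.evp_ins E.evp_add_to E.evp_embed E.cfs)
  qed
qed

lemma dpoly_sound: "D (E.evp P) (E.evp (fst (dpoly brd P))) (E.evp (snd (dpoly brd P)))"
proof (induction P)
  case Nil
  then show ?case by (simp add: D_zero E.evp_simps)
next
  case (Cons a P)
  obtain w c where a: "a = (w, c)" by (cases a)
  from D_add[OF D_scale[OF dword_sound[of w], of "cf \<zeta> c"] Cons] show ?case
    by (cases "dword brd w"; cases "dpoly brd P"; simp add: a E.evp_simps E.evp_add_to)
qed

lemma homog_ops:
  "length w = n \<Longrightarrow> homog n P \<Longrightarrow> homog n (ins w c P)"
  "homog n Q \<Longrightarrow> homog n P \<Longrightarrow> homog n (add_to c Q P)"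
  "homog m P \<Longrightarrow> length u + m + length v = n \<Longrightarrow> homog n (embed u v P)"
proof -
  show 1: "length w = n \<Longrightarrow> homog n P \<Longrightarrow> homog n (ins w c P)" for w c P
    by (induction w c P rule: ins.induct) (auto simp: homog_def Let_def)
  show "homog n Q \<Longrightarrow> homog n P \<Longrightarrow> homog n (add_to c Q P)"
  proof (induction Q)
    case Nil
    then show ?case by simp
  next
    case (Cons a Q)
    obtain w d where a: "a = (w, d)" by (cases a)
    have "homog n Q" "length w = n" using Cons.prems(1) by (auto simp: homog_def a)
    then show ?case using Cons.IH[OF _ Cons.prems(2)] by (simp add: a 1)
  qed
  show "homog m P \<Longrightarrow> length u + m + length v = n \<Longrightarrow> homog n (embed u v P)"
    by (auto simp: homog_def embed_def)
qed

lemma homog_dword: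
  "homog (length w - 1) (fst (dword brd w)) \<and> homog (length w - 1) (snd (dword brd w)) \<and>
    (w = [] \<longrightarrow> dword brd w = ([], []))"
proof (induction w)
  case Nil
  then show ?case by (simp add: homog_def)
next
  case (Cons g w)
  obtain P Q where PQ: "dword brd w = (P, Q)" by (cases "dword brd w")
  have nil: "homog n []" for n by (simp add: homog_def)
  have emb: "homog (length w) (embed [h] [] P)" "homog (length w) (embed [h] [] Q)" for h
  proof -
    have h: "homog (length w - 1) P" "homog (length w - 1) Q" using Cons by (simp_all add: PQ)
    have h3: "w = [] \<longrightarrow> P = [] \<and> Q = []" using PQ by auto
    have "homog (length w) (embed [h] [] P) \<and> homog (length w) (embed [h] [] Q)"
    proof (cases w)
      case Nil
      then show ?thesis using h3 by (simp add: embed_def nil)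
    next
      case (Cons g' w')
      have "length [h] + (length w - 1) + length ([] :: gen list) = length w" by (simp add: Cons)
      then show ?thesis using homog_ops(3)[OF h(1)] homog_ops(3)[OF h(2)] by metis
    qed
    then show "homog (length w) (embed [h] [] P)" "homog (length w) (embed [h] [] Q)" by simp_all
  qed
  show ?case by (cases g) (simp_all add: PQ homog_ops(1,2) nil emb)
qed

lemma homog_dpoly:
  "homog (Suc n) P \<Longrightarrow> homog n (fst (dpoly brd P)) \<and> homog n (snd (dpoly brd P))"
proof (induction P)
  case Nil
  then show ?case by (simp add: homog_def)
next
  case (Cons a P)
  obtain w c where a: "a = (w, c)" by (cases a)
  have "length w = Suc n" "homog (Suc n) P" using Cons.prems by (auto simp: a homog_def)
  then show ?case using Cons.IH homog_dword[of w]
    by (auto simp: a split: prod.splits intro!: homog_ops(2))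
qed

lemma wv_G: "E.wv w \<in> G (length w)"
proof (induction w)
  case Nil
  then show ?case by (simp add: G_one)
next
  case (Cons g w)
  have "gens (\<iota> v1) (\<iota> v2) g \<in> G 1" by (cases g) (simp_all add: gens_simps iota_G)
  from G_mult[OF Cons this] show ?case by (simp flip: Suc_eq_plus1)
qed

lemma evp_G: "homog n P \<Longrightarrow> E.evp P \<in> G n"
proof (induction P)
  case Nil
  then show ?case by (simp add: E.evp_simps R.subspace_0[OF G_sub])
next
  case (Cons a P)
  then show ?case using wv_G
    by (cases a) (auto simp: E.evp_simps homog_def intro!: R.subspace_add[OF G_sub] R.subspace_scale[OF G_sub])
qed

lemma null_sound: "homog n P \<Longrightarrow> null brd n P \<Longrightarrow> E.evp P = 0"
proof (induction n arbitrary: P)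
  case 0
  then show ?case by (simp add: E.evp_simps)
next
  case (Suc n)
  show ?case
  proof (cases "P = []")
    case False
    then have "null brd n (fst (dpoly brd P))" "null brd n (snd (dpoly brd P))"
      using Suc.prems(2) by (simp_all split: prod.splits)
    then have "D (E.evp P) 0 0"
      using dpoly_sound[of P] Suc.IH homog_dpoly[OF Suc.prems(1)] by metis
    then have "derives (E.evp P) []"
      unfolding D_def by (rule derives_cong) (simp add: bilform_simps)
    then show ?thesis
      using derives_nil_imp_zero[OF evp_G[OF Suc.prems(1)] zero_less_Suc] by blast
  qed (simp add: E.evp_simps)
qed

lemma D_unique: assumes "D 0 p q" shows "p = 0" "q = 0"
proof -
  interpret P: vector_space_pair sV "(*) :: 'k \<Rightarrow> 'k \<Rightarrow> 'k"
    by (rule vector_space_pair.intro[OF vsV vector_space_times])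
  have ind: "V.independent {v1, v2}" using basis by (simp add: has_basis_def)
  have coord: "\<exists>f. linform sR f \<and> f (\<iota> v1) = c \<and> f (\<iota> v2) = d" for c d
  proof -
    obtain f where "linform sV f" "f v1 = c" "f v2 = d"
      using P.linear_independent_extend[OF ind, of "\<lambda>x. if x = v1 then c else d"] basis(2)
      by (auto simp: linform_def)
    then show ?thesis using linform_extends by metis
  qed
  have main: "\<psi> p * c + \<psi> q * d = 0" if "linform sR \<psi>" for \<psi> c d
  proof -
    obtain f where f: "linform sR f" "f (\<iota> v1) = c" "f (\<iota> v2) = d" using coord by blast
    have "lsum [(p, v1), (q, v2)] (\<lambda>p w. \<psi> p * f (\<iota> w)) = lsum [] (\<lambda>p w. \<psi> p * f (\<iota> w))"
      using assms[unfolded D_def derives_def, rule_format, OF bilform_prod[OF that f(1)]]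
        derives_zero[unfolded derives_def, rule_format, OF bilform_prod[OF that f(1)]] by simp
    then show ?thesis by (simp add: f(2,3))
  qed
  show "p = 0" by (rule linform_separates[OF vsR]) (use main[of _ 1 0] in \<open>auto simp: linform_simps\<close>)
  show "q = 0" by (rule linform_separates[OF vsR]) (use main[of _ 0 1] in \<open>auto simp: linform_simps\<close>)
qed

lemma contract_sound: "E.evp P = 0 \<Longrightarrow> E.evp (contract brd u P) = 0"
proof (induction u arbitrary: P)
  case (Cons g u)
  have "D 0 (E.evp (fst (dpoly brd P))) (E.evp (snd (dpoly brd P)))"
    using dpoly_sound[of P] Cons.prems by simp
  from D_unique[OF this] show ?case using Cons.IH by (cases g) simp_all
qed simp

lemma eval_surj: "surj (fa_eval sR (gens (\<iota> v1) (\<iota> v2)))"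
proof -
  let ?e = "fa_eval sR (gens (\<iota> v1) (\<iota> v2))"
  have "R.subspace (range ?e)"
  proof (rule R.subspaceI)
    show "0 \<in> range ?e" by (metis E.fa_eval_zero rangeI)
    show "x + y \<in> range ?e" if "x \<in> range ?e" "y \<in> range ?e" for x y
      using that by (auto simp flip: E.fa_eval_add)
    show "sR c x \<in> range ?e" if "x \<in> range ?e" for c x
      using that by (auto simp flip: E.fa_eval_fscale)
  qed
  moreover have "1 \<in> range ?e" by (metis E.fa_eval_one rangeI)
  moreover have "x * y \<in> range ?e" if "x \<in> range ?e" "y \<in> range ?e" for x y
    using that by (auto simp flip: E.fa_eval_mult)
  ultimately have sub: "subalgebra sR (range ?e)" by (simp add: subalgebra_def)
  have "G 1 \<subseteq> range ?e"
  proof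
    fix r assume "r \<in> G 1"
    then obtain v where r: "r = \<iota> v" using G1 by blast
    have "v \<in> V.span {v1, v2}" using basis by (simp add: has_basis_def)
    then show "r \<in> range ?e"
      unfolding r
    proof (induction rule: V.span_induct_alt)
      case base
      then show ?case by (metis E.fa_eval_zero linear_simps(3)[OF iota_linear] rangeI)
    next
      case (step c x y)
      have "\<iota> x \<in> range ?e"
        using step(1) E.fa_eval_var[of GX] E.fa_eval_var[of GY] unfolding gens_simps by (metis insertE rangeI singletonD)
      then show ?case using step(2)
        by (auto simp: linear_simps[OF iota_linear] simp flip: E.fa_eval_fscale E.fa_eval_add)
    qed
  qed
  then have "subalgebra sR hull (G 1) \<subseteq> range ?e" using sub by (rule hull_minimal)
  then show ?thesis using gen by auto
qed

theorem certificate_sound: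
  assumes cert: "nichols_certificate brd rels rs N E' M path"
  shows "presented_by sR (gens (\<iota> v1) (\<iota> v2)) (eisenstein_eval.evp fscale var \<zeta> ` set rels)"
    and "has_dim sR (length (monomials N E' M))"
proof -
  interpret FE: eisenstein_eval fscale "var :: gen \<Rightarrow> (gen, 'k) free_alg" \<zeta>
    by standard (rule zeta)
  define T where "T = monomials N E' M"
  define tp where "tp = monomial (N - 1) (E' - 1) (M - 1)"
  note cert' = cert[unfolded nichols_certificate_def Let_def, folded T_def tp_def]
  let ?J = "ideal_generated (FE.evp ` set rels)" and ?B = "(\<lambda>b. Word (rev b)) ` fst ` set T"
  note J = ideal_generated_ideal[of "FE.evp ` set rels"]
  have ev0: "E.evp P = 0" if "P \<in> set rels" for P
    using cert' that null_sound[of "length (fst (hd P))" P] by blast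
  have rels0: "fa_eval sR (gens (\<iota> v1) (\<iota> v2)) r = 0" if "r \<in> FE.evp ` set rels" for r
    using that ev0 by (auto simp: E.fa_eval_evp)
  have relJ: "FE.evp P \<in> ?J" if "P \<in> set rels" for P
    using that ideal_generated_superset by blast
  have ok: "rule_ok rels r" if "r \<in> set rs" for r using cert' that by blast
  have closed: "closed_basis rs (map fst T)" using cert' by blast
  have JK: "?J \<subseteq> {p. fa_eval sR (gens (\<iota> v1) (\<iota> v2)) p = 0}"
    by (rule ideal_generated_least) (use rels0 E.kernel_two_sided_ideal in auto)
  have rules: "E.wv l = E.evp Q" if "(l, Q, c, C) \<in> set rs" for l Q c C
  proof -
    have "FE.wv l - FE.evp Q \<in> ?J"
      by (rule rule_in_ideal[OF zeta J relJ ok[OF that]])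
    then have "fa_eval sR (gens (\<iota> v1) (\<iota> v2)) (FE.wv l - FE.evp Q) = 0" using JK by blast
    then show ?thesis by (simp add: E.fa_eval_diff E.fa_eval_evp)
  qed
  have red: "FE.wv w \<in> reducible_to ?J ((\<lambda>b. Word (rev b)) ` {b \<in> set (map fst T). length b = length w})" for w
    by (rule word_reducible[OF zeta J relJ ok closed])
  have long: "E.wv w = 0" if "length w > length tp" for w
  proof -
    have "{b \<in> set (map fst T). length b = length w} = {}" using cert' that by fastforce
    then have "FE.wv w \<in> reducible_to ?J ((\<lambda>b. Word (rev b)) ` {})" using red[of w] by (simp only:)
    then have "FE.wv w \<in> reducible_to ?J {}" by (simp only: image_empty)
    then have "FE.wv w \<in> ?J" by (auto simp: reducible_to_def)
    then have "fa_eval sR (gens (\<iota> v1) (\<iota> v2)) (FE.wv w) = 0" using JK by blast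
    then show ?thesis by (simp add: E.fa_eval_evp)
  qed
  have top: "E.wv tp \<noteq> 0"
  proof
    assume "E.wv tp = 0"
    then have "E.evp [(tp, (1, 0))] = 0" by (simp add: E.evp_simps)
    then have "E.evp (contract brd path [(tp, (1, 0))]) = 0" by (rule contract_sound)
    moreover obtain c where c: "contract brd path [(tp, (1, 0))] = [([], c)]" "enorm c \<noteq> 0"
      using cert' by (elim conjE multiple_of_wordE)
    ultimately have "sR (cf \<zeta> c) 1 = 0" by (simp add: E.evp_simps)
    then show False using E.cfs(5)[OF c(2)] by simp
  qed
  have dist: "distinct (map fst T)" using cert' by blast
  have indep: "\<forall>b\<in>fst ` set T. k b = 0" if "(\<Sum>b\<in>fst ` set T. sR (k b) (E.wv b)) = 0" for k
  proof (rule E.triangular_independent[OF rules top long])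
    show "triangular rs tp T" using cert' by blast
    have "(\<Sum>t\<leftarrow>T. sR (k (fst t)) (E.wv (fst t))) = (\<Sum>b\<leftarrow>map fst T. sR (k b) (E.wv b))"
      by (simp add: o_def)
    also have "\<dots> = (\<Sum>b\<in>set (map fst T). sR (k b) (E.wv b))"
      by (rule sum_list_distinct_conv_sum_set[OF dist])
    finally show "(\<Sum>t\<leftarrow>T. sR (k (fst t)) (E.wv (fst t))) = 0" using that by simp
  qed
  have inj: "inj_on E.wv (fst ` set T)"
  proof (rule inj_onI, rule ccontr)
    fix b c assume bc: "b \<in> fst ` set T" "c \<in> fst ` set T" "E.wv b = E.wv c" "b \<noteq> c"
    define k where "k x = (if x = b then 1 else 0) - (if x = c then 1 else (0 :: 'k))" for x
    have "(\<Sum>x\<in>fst ` set T. sR (k x) (E.wv x)) =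
        (\<Sum>x\<in>fst ` set T. (if x = b then E.wv b else 0) - (if x = c then E.wv c else 0))"
      by (rule sum.cong) (auto simp: k_def R.scale_left_diff_distrib)
    also have "\<dots> = 0" using bc by (simp add: sum_subtractf)
    finally have "k b = 0" using indep bc(1) by blast
    then show False using bc(4) by (simp add: k_def)
  qed
  have injB: "inj_on E.word_val ?B"
  proof (rule inj_onI)
    fix x y assume "x \<in> ?B" "y \<in> ?B" and eq: "E.word_val x = E.word_val y"
    then obtain b c where bc: "b \<in> fst ` set T" "c \<in> fst ` set T" "x = Word (rev b)" "y = Word (rev c)" by blast
    then have "E.wv b = E.wv c" using eq by (simp only: E.wv_word)
    then show "x = y" using inj bc by (simp add: inj_on_eq_iff)
  qed
  have image: "E.word_val ` ?B = E.wv ` fst ` set T"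
    unfolding image_image E.wv_word ..
  have indB: "R.independent (E.word_val ` ?B)"
    unfolding image R.dependent_finite[OF finite_imageI[OF finite_imageI[OF finite_set]]]
  proof
    assume "\<exists>u. (\<exists>v\<in>E.wv ` fst ` set T. u v \<noteq> 0) \<and> (\<Sum>v\<in>E.wv ` fst ` set T. sR (u v) v) = 0"
    then obtain u b where ub: "b \<in> fst ` set T" "u (E.wv b) \<noteq> 0" "(\<Sum>v\<in>E.wv ` fst ` set T. sR (u v) v) = 0" by blast
    have "(\<Sum>b\<in>fst ` set T. sR (u (E.wv b)) (E.wv b)) = 0" using ub(3) by (simp add: sum.reindex[OF inj])
    from indep[OF this] ub(1,2) show False by blast
  qed
  have redB: "Poly_Mapping.single w 1 \<in> reducible_to ?J ?B" for w
  proof -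
    have w: "Poly_Mapping.single w 1 = FE.wv (rev (letters w))"
      by (simp add: FE.wv_word F_word_val)
    have sub: "(\<lambda>b. Word (rev b)) ` {b \<in> set (map fst T). length b = length (rev (letters w))} \<subseteq> ?B"
      by auto
    show ?thesis unfolding w by (rule subsetD[OF reducible_mono[OF sub] red[of "rev (letters w)"]])
  qed
  have "finite ?B" by simp
  note pres = E.presented_from_basis[OF eval_surj rels0 redB this injB indB]
  show "presented_by sR (gens (\<iota> v1) (\<iota> v2)) (FE.evp ` set rels)" by (rule pres(1))
  have "inj_on (\<lambda>b. Word (rev b)) (fst ` set T)" by (rule inj_onI) simp
  then have "card ?B = card (set (map fst T))" by (simp add: card_image)
  also have "\<dots> = length T" using distinct_card[OF dist] by simp
  finally show "has_dim sR (length (monomials N E' M))" using pres(2) by (simp add: T_def)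
qed

end

section \<open>Nichols algebras over the 12-dimensional Hopf algebra\<close>

locale nichols_C = hopf_C \<xi> H a b + N: nichols H V R \<iota> G
  for \<xi> :: "'k::field_char_0" and H :: "('k, 'h::ring_1) hopf" and a b
    and V :: "('k, 'h, 'v::ab_group_add) yd" and R :: "('k, 'h, 'r::ring_1) braided_hopf" and \<iota> and G

sublocale nichols_C \<subseteq> yd_C \<xi> H a b V
  by unfold_locales (rule N.ydV)

context nichols_C
begin

lemma is_V_braids:
  assumes V: "is_V \<xi> H a b i j V v1 v2"
  shows "N.braids v1 v1 [(sV (xp (i * - j)) v1, v1)]"
    "N.braids v1 v2 [(sV (xp ((i + 1) * - j)) v2, v1),
      (sV (\<xi> ^ 4 * (xp (4 * i) - xp (i + j)) * xp ((i + 1) * (- 1 - j))) v1, v2)]"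
    "N.braids v2 v1 [(sV (xp (i * (3 - j))) v1, v2)]"
    "N.braids v2 v2 [(sV (xp ((i + 1) * (3 - j))) v2, v2),
      (sV ((xp (2 * i) + xp (j - i)) * xp ((i + 1) * (2 - j))) v1, v1)]"
proof -
  have V': "opA v1 = sV (xp i) v1" "opB v1 = 0" "opA v2 = sV (xp (i + 1)) v2" "opB v2 = v1"
    "\<delta> v1 = pure sH sV (A (- j)) v1 +
      tscale (\<xi> ^ 4 * (xp (4 * i) - xp (i + j))) (pure sH sV (b * A (- 1 - j)) v2)"
    "\<delta> v2 = pure sH sV (A (3 - j)) v2 + tscale (xp (2 * i) + xp (j - i)) (pure sH sV (b * A (2 - j)) v1)"
    using V unfolding is_V_def Let_def xp_def[symmetric] A_def[symmetric] by blast+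
  have "act V (A n) v1 = sV (xp (i * n)) v1" "act V (A n) v2 = sV (xp ((i + 1) * n)) v2" for n
    using act_A V'(1,3) by auto
  then have act: "act V (A n) v1 = sV (xp (i * n)) v1" "act V (A n) v2 = sV (xp ((i + 1) * n)) v2"
    "act V (b * A n) v1 = 0" "act V (b * A n) v2 = sV (xp ((i + 1) * n)) v1" for n
    by (simp_all add: act_mult op_simps V'(2,4))
  note bil = N.bilform_actV
  show "N.braids v1 v1 [(sV (xp (i * - j)) v1, v1)]"
    "N.braids v1 v2 [(sV (xp ((i + 1) * - j)) v2, v1),
      (sV (\<xi> ^ 4 * (xp (4 * i) - xp (i + j)) * xp ((i + 1) * (- 1 - j))) v1, v2)]"
    "N.braids v2 v1 [(sV (xp (i * (3 - j))) v1, v2)]"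
    "N.braids v2 v2 [(sV (xp ((i + 1) * (3 - j))) v2, v2),
      (sV ((xp (2 * i) + xp (j - i)) * xp ((i + 1) * (2 - j))) v1, v1)]"
    unfolding N.braids_def V'(5,6)
    by (simp_all add: pure_def bil act bilform_simps mult.assoc)
qed

lemma char0: "of_nat (Suc n) \<noteq> (0 :: 'k)"
  by (rule of_nat_neq_0)

lemma span_pair: "is_V \<xi> H a b i j V v1 v2 \<Longrightarrow> N.V.span {v1, v2} = UNIV"
  by (simp add: is_V_def Let_def has_basis_def)

text \<open>
  The Nichols algebra of \<open>V\<^sub>i\<^sub>,\<^sub>j\<close> is infinite-dimensional if \<open>v\<^sub>1\<close> has trivial self-braiding, or \<open>v\<^sub>2\<close> has
  trivial self-braiding modulo \<open>v\<^sub>1\<close>.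
\<close>

lemma infinite_V:
  assumes V: "is_V \<xi> H a b i j V v1 v2" and q: "xp (i * - j) = 1 \<or> xp ((i + 1) * (3 - j)) = 1"
  shows "\<not> finite_dim (scale R)"
  using q
proof
  note br = is_V_braids[OF V]
  assume q: "xp (i * - j) = 1"
  have U: "N.V.span {v1} = N.V.span (insert v1 {0})" by (simp add: N.V.span_insert_0 insert_commute)
  have v1: "v1 \<notin> {0}" using is_V_coords(2)[OF V, of 1 0] by auto
  have 1: "N.braids v1 v1 [(v1, v1)]" using br(1)[unfolded q] by simp
  have sc: "(sV c p, r) \<in> N.V.span {v1} \<times> N.V.span {v1}" if "(p, r) \<in> N.V.span {v1} \<times> N.V.span {v1}" for c p r
    using that by (auto intro: N.V.span_scale)
  have nil: "\<exists>N. N.braids w u N \<and> set N \<subseteq> M" if "w = 0 \<or> u = 0" for w u M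
    using that
  proof
    assume "w = 0"
    then show ?thesis
      by (intro exI[of _ "[]"]) (simp add: N.braids_def linear_simps[OF coact_linear] zero_fun_def)
  next
    assume u: "u = 0"
    have "\<exists>N. N.braids w 0 N \<and> set N \<subseteq> {(p, q). False}"
      by (rule N.braids_span[of UNIV "{}"]) (auto intro: N.V.span_base)
    then obtain N where "N.braids w 0 N" "N = []" by auto
    then show ?thesis using u by (intro exI[of _ "[]"]) simp
  qed
  show ?thesis
  proof (rule N.infinite_if_braiding_trivial[OF N.V.subspace_single_0 v1 U char0])
    show "\<exists>N. N.braids w u N \<and> set N \<subseteq> N.V.span {v1} \<times> N.V.span {v1}"
      if "w \<in> N.V.span {v1}" "u \<in> N.V.span {v1}" for w u
      by (rule N.braids_span[OF _ sc that]) (use 1 in \<open>auto intro!: exI[of _ "[(v1, v1)]"] N.V.span_base\<close>)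
    show "\<exists>N. N.braids v1 v1 ((v1, v1) # N) \<and> set N \<subseteq> N.mixed {0} (N.V.span {v1})"
      using 1 by (intro exI[of _ "[]"]) simp
  qed (use nil in auto)
next
  note br = is_V_braids[OF V]
  assume q: "xp ((i + 1) * (3 - j)) = 1"
  have ind: "N.V.independent {v1, v2}" using V by (simp add: is_V_def Let_def has_basis_def)
  have v2: "v2 \<notin> N.V.span {v1}"
  proof
    assume "v2 \<in> N.V.span {v1}"
    then obtain c where "v2 = sV c v1" by (auto simp: N.V.span_singleton)
    then show False using is_V_coords(2)[OF V, of "- c" 1] by simp
  qed
  have sp: "N.V.span {v1, v2} = UNIV" by (rule span_pair[OF V])
  have U: "UNIV = N.V.span (insert v2 (N.V.span {v1}))"
  proof -
    have "{v1, v2} \<subseteq> N.V.span (insert v2 (N.V.span {v1}))" by (auto intro: N.V.span_base)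
    then have "N.V.span {v1, v2} \<subseteq> N.V.span (insert v2 (N.V.span {v1}))" by (simp add: N.V.span_minimal)
    then show ?thesis unfolding sp by blast
  qed
  let ?M = "N.mixed (N.V.span {v1}) UNIV"
  have m: "(p, r) \<in> ?M \<longleftrightarrow> p \<in> N.V.span {v1} \<or> r \<in> N.V.span {v1}" for p r
    by (simp add: N.mixed_def[OF N.V.subspace_span v2 U char0])
  have sc: "(sV c p, r) \<in> ?M" if "(p, r) \<in> ?M" for c p r
    using that by (auto simp: m intro: N.V.span_scale)
  have b1: "v1 \<in> N.V.span {v1}" by (simp add: N.V.span_base)
  have M1: "set [(sV c v1, r)] \<subseteq> ?M" "set [(sV c v2, v1), (sV d v1, v2)] \<subseteq> ?M" for c d r
    by (simp_all add: m b1 N.V.span_scale)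
  have all: "w \<in> N.V.span {v1, v2}" for w unfolding sp by (rule UNIV_I)
  show ?thesis
  proof (rule N.infinite_if_braiding_trivial[OF N.V.subspace_span v2 U char0])
    show "\<exists>N. N.braids w u N \<and> set N \<subseteq> UNIV \<times> UNIV" for w u
      by (rule N.braids_span[OF _ _ all all]) (use br in auto)
    show "\<exists>N. N.braids w u N \<and> set N \<subseteq> ?M" if "w \<in> N.V.span {v1}" for w u
    proof (rule N.braids_span[OF _ sc that all])
      fix w u assume "w \<in> {v1}" "u \<in> {v1, v2}"
      then have "w = v1 \<and> (u = v1 \<or> u = v2)" by simp
      then show "\<exists>N. N.braids w u N \<and> set N \<subseteq> ?M" using br(1,2) M1 by blast
    qed
    show "\<exists>N. N.braids w u N \<and> set N \<subseteq> ?M" if "u \<in> N.V.span {v1}" for w u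
    proof (rule N.braids_span[OF _ sc all that])
      fix w u assume "w \<in> {v1, v2}" "u \<in> {v1}"
      then have "u = v1 \<and> (w = v1 \<or> w = v2)" by simp
      then show "\<exists>N. N.braids w u N \<and> set N \<subseteq> ?M" using br(1,3) M1(1) by blast
    qed
    show "\<exists>N. N.braids v2 v2 ((v2, v2) # N) \<and> set N \<subseteq> ?M"
      using br(4)[unfolded q N.V.scale_one] M1(1) by blast
  qed
qed

text \<open>
  If the central element acts trivially, a vector of even weight has trivial self-braiding modulo
  the subobject generated by its images under \<open>b\<close> and \<open>X\<close>, in which it does not lie.
\<close>

lemma infinite_even:
  assumes z1: "\<And>v. z v = v" and v: "wt m k v" "v \<noteq> 0" "even m"
  shows "\<not> finite_dim (scale R)"
proof -
  have reg: "xp (4 * m') = xp (m' - k')" if "wt m' k' w" "w \<noteq> 0" for m' k' w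
  proof -
    have "sV (xp (3 * m' + k')) w = sV (xp 0) w" using z_wt[OF that(1)] z1[of w] by (simp add: xp_values)
    then have "xp (3 * m' + k') = xp 0" using that(2) by simp
    then have "(3 * m' + k') mod 6 = 0" by (simp add: xp_eq_iff)
    then show ?thesis by (intro xp_cong) (simp add: mod_eq_dvd_iff dvd_eq_mod_eq_0)
  qed
  have XB: "X (opB w) = sV (xp (- 1)) (opB (X w))" if w: "wt m' k' w" for m' k' w
  proof (cases "w = 0")
    case False
    then show ?thesis using X_B[OF w] reg[OF w] by simp
  qed (simp add: op_simps)
  define y where "y = X v + sV (shift m k) (opB v)"
  define p where "p = opB v"
  define r where "r = opB y"
  have wy: "wt (m + 1) (k + 3) y" unfolding y_def by (rule wt_X1[OF v(1)])
  have wp: "wt (m - 1) (k + 3) p" unfolding p_def by (rule wt_B[OF v(1)])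
  have wr: "wt m (k + 6) r" using wt_B[OF wy] by (simp add: r_def add.commute)
  have r: "r = opB (X v)" by (simp add: r_def y_def op_simps op_relations(1))
  have k0: "xp (- 2 * k) = 1" "A k = 1"
  proof -
    have "4 * m mod 6 = (m - k) mod 6" using reg[OF v(1,2)] by (simp only: xp_eq_iff)
    moreover obtain m' where "m = 2 * m'" using v(3) by blast
    ultimately have "6 dvd 6 * m' + k" by (simp add: mod_eq_dvd_iff)
    then have k: "6 dvd k" by (simp add: dvd_add_right_iff)
    have "xp (- 2 * k) = xp 0" by (rule xp_cong) (use k in auto)
    then show "xp (- 2 * k) = 1" by (simp add: xp_values)
    have "A k = A 0" by (rule A_cong) (use k in auto)
    then show "A k = 1" by (simp add: A_numeral)
  qed
  have Xv: "X v = sV 1 y + sV (- shift m k) p" by (simp add: y_def p_def)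
  have Xp: "X p = sV (xp (- 1)) r" unfolding p_def r by (rule XB[OF v(1)])
  have Xy: "X y = sV (shift m k * xp (- 1)) r"
  proof -
    have "X (X v) = 0" using X_X_wt[OF v(1)] unfolding k0(1) by simp
    then show ?thesis unfolding y_def using Xp[unfolded p_def] by (simp add: op_simps)
  qed
  have Xr: "X r = 0"
    unfolding r_def using XB[OF wy] Xy by (simp add: op_simps r_def op_relations(1))
  let ?S = "{p, y, r}"
  let ?U0 = "N.V.span ?S"
  have vU0: "v \<notin> ?U0"
  proof
    assume "v \<in> ?U0"
    then obtain c1 where "v - sV c1 p \<in> N.V.span {y, r}" using N.V.span_breakdown_eq by blast
    then obtain c2 where "v - sV c1 p - sV c2 y \<in> N.V.span {r}" using N.V.span_breakdown_eq by blast
    then obtain c3 where "v - sV c1 p - sV c2 y = sV c3 r" by (auto simp: N.V.span_singleton)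
    then have veq: "v = sV c1 p + sV c2 y + sV c3 r" by (simp add: algebra_simps eq_diff_eq)
    have pr: "p = sV c2 r"
      using arg_cong[OF veq, of opB] by (simp add: op_simps op_relations(1) p_def r_def)
    define e where "e = c1 * xp (- 1) + c2 * (shift m k * xp (- 1))"
    have Xv': "X v = sV e r"
      using arg_cong[OF veq, of X] by (simp add: op_simps Xp Xy Xr N.V.scale_left_distrib e_def)
    have "opB r = 0" by (simp add: r_def op_relations(1))
    then have "r = 0" using r[unfolded Xv'] by (simp add: op_simps)
    moreover from this have "p = 0" using pr by simp
    moreover have "X v = 0" using Xv' \<open>r = 0\<close> by simp
    ultimately have "y = 0" by (simp add: y_def p_def)
    then show False using veq v(2) \<open>r = 0\<close> \<open>p = 0\<close> by simp
  qed
  define U where "U = N.V.span (insert v ?U0)"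
  have U': "U = N.V.span (insert v ?S)"
  proof -
    have "insert v ?U0 \<subseteq> N.V.span (insert v ?S)"
      using N.V.span_mono[of ?S "insert v ?S"] by (auto intro: N.V.span_base)
    then have "U \<subseteq> N.V.span (insert v ?S)" unfolding U_def by (simp add: N.V.span_minimal)
    moreover have "insert v ?S \<subseteq> insert v ?U0" using N.V.span_superset[of ?S] by auto
    then have "N.V.span (insert v ?S) \<subseteq> U" unfolding U_def by (rule N.V.span_mono)
    ultimately show ?thesis by blast
  qed
  have U0U: "?U0 \<subseteq> U" unfolding U' by (rule N.V.span_mono) auto
  have hom: "\<exists>m k. wt m k w" if "w \<in> insert v ?S" for w
    using that v(1) wp wy wr by auto
  have XU: "X w \<in> ?U0" if "w \<in> insert v ?S" for w
  proof -
    have "p \<in> ?U0" "y \<in> ?U0" "r \<in> ?U0" by (simp_all add: N.V.span_base)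
    then have "X v \<in> ?U0" "X p \<in> ?U0" "X y \<in> ?U0" "X r \<in> ?U0"
      unfolding Xv Xp Xy Xr by (simp_all only: N.V.span_zero N.V.span_add N.V.span_scale)
    then show ?thesis using that by blast
  qed
  have BU: "opB w \<in> ?U0" if "w \<in> insert v ?S" for w
  proof -
    have "opB v = p" "opB p = 0" "opB y = r" "opB r = 0" by (simp_all add: p_def r_def op_relations(1))
    then show ?thesis using that by (auto simp: N.V.span_zero intro: N.V.span_base)
  qed
  have braid: "\<exists>c d. N.braids w u [(sV c u, w), (sV d (opB u), X w)]"
    if wu: "w \<in> insert v ?S" "u \<in> insert v ?S" for w u
  proof -
    obtain mw kw mu ku where w: "wt mw kw w" and u: "wt mu ku u" using hom[OF wu(1)] hom[OF wu(2)] by blast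
    have act: "act V (A n) u = sV (xp (mu * n)) u" for n using act_A u by (simp add: wt_def)
    then have act': "act V (b * A n) u = sV (xp (mu * n)) (opB u)" for n by (simp add: act_mult op_simps)
    have "N.braids w u [(sV (xp (mu * kw)) u, w), (sV (xp (mu * (kw - 1))) (opB u), X w)]"
      unfolding N.braids_def coact_wt[OF w]
      by (simp add: pure_def N.bilform_actV act act')
    then show ?thesis by blast
  qed
  let ?M = "N.mixed ?U0 U"
  have m: "(p, r) \<in> ?M \<longleftrightarrow> p \<in> ?U0 \<and> r \<in> U \<or> p \<in> U \<and> r \<in> ?U0" for p r
    by (simp add: N.mixed_def[OF N.V.subspace_span vU0 U_def char0])
  have subU: "N.V.subspace U" by (simp add: U_def)
  have sc: "(sV c p, r) \<in> ?M" if "(p, r) \<in> ?M" for c p r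
    using that by (auto simp: m intro: N.V.span_scale N.V.subspace_scale[OF subU])
  have scU: "(sV c p, r) \<in> U \<times> U" if "(p, r) \<in> U \<times> U" for c p r
    using that by (auto intro: N.V.subspace_scale[OF subU])
  have inU: "w \<in> U" if "w \<in> insert v ?S" for w using that unfolding U' by (rule N.V.span_base)
  have inU0: "w \<in> ?U0" if "w \<in> ?S" for w using that by (rule N.V.span_base)
  have second: "sV d (opB u) \<in> ?U0" "X w \<in> ?U0" if "w \<in> insert v ?S" "u \<in> insert v ?S" for d w u
    using N.V.span_scale[OF BU[OF that(2)]] XU[OF that(1)] by simp_all
  have first: "sV c u \<in> U" if "u \<in> insert v ?S" for c u using N.V.subspace_scale[OF subU inU[OF that]] .
  have mixed2: "(sV d (opB u), X w) \<in> ?M" if "w \<in> insert v ?S" "u \<in> insert v ?S" for d w u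
    using second[OF that] U0U by (auto simp: m)
  show ?thesis
  proof (rule N.infinite_if_braiding_trivial[OF N.V.subspace_span vU0 U_def char0])
    show "\<exists>N. N.braids w u N \<and> set N \<subseteq> U \<times> U" if "w \<in> U" "u \<in> U" for w u
    proof (rule N.braids_span[OF _ scU that[unfolded U']])
      fix w u assume wu: "w \<in> insert v ?S" "u \<in> insert v ?S"
      obtain c d where "N.braids w u [(sV c u, w), (sV d (opB u), X w)]" using braid[OF wu] by blast
      moreover have "set [(sV c u, w), (sV d (opB u), X w)] \<subseteq> U \<times> U"
        using first[OF wu(2), of c] inU[OF wu(1)] second[OF wu] U0U by auto
      ultimately show "\<exists>N. N.braids w u N \<and> set N \<subseteq> U \<times> U" by blast
    qed
    show "\<exists>N. N.braids w u N \<and> set N \<subseteq> ?M" if "w \<in> ?U0" "u \<in> U" for w u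
    proof (rule N.braids_span[OF _ sc that[unfolded U']])
      fix w u assume wu: "w \<in> ?S" "u \<in> insert v ?S"
      then have w: "w \<in> insert v ?S" by blast
      obtain c d where "N.braids w u [(sV c u, w), (sV d (opB u), X w)]" using braid[OF w wu(2)] by blast
      moreover have "set [(sV c u, w), (sV d (opB u), X w)] \<subseteq> ?M"
        using first[OF wu(2), of c] inU0[OF wu(1)] mixed2[OF w wu(2)] by (auto simp: m)
      ultimately show "\<exists>N. N.braids w u N \<and> set N \<subseteq> ?M" by blast
    qed
    show "\<exists>N. N.braids w u N \<and> set N \<subseteq> ?M" if "w \<in> U" "u \<in> ?U0" for w u
    proof (rule N.braids_span[OF _ sc that(1)[unfolded U'] that(2)])
      fix w u assume wu: "w \<in> insert v ?S" "u \<in> ?S"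
      then have u: "u \<in> insert v ?S" by blast
      obtain c d where "N.braids w u [(sV c u, w), (sV d (opB u), X w)]" using braid[OF wu(1) u] by blast
      moreover have "set [(sV c u, w), (sV d (opB u), X w)] \<subseteq> ?M"
        using N.V.span_scale[OF inU0[OF wu(2)], of c] inU[OF wu(1)] mixed2[OF wu(1) u] by (auto simp: m)
      ultimately show "\<exists>N. N.braids w u N \<and> set N \<subseteq> ?M" by blast
    qed
    have act1: "act V (A 0) v = v" by (simp add: A_numeral act_one)
    have "N.braids v v [(v, v), (act V (b * A (k - 1)) v, X v)]"
      unfolding N.braids_def coact_wt[OF v(1)] k0(2)
      by (simp add: pure_def N.bilform_actV act_one)
    moreover have "act V (b * A (k - 1)) v \<in> ?U0"
      using act_A[of v m "k - 1"] v(1) N.V.span_scale[OF BU[of v]] by (simp add: wt_def act_mult op_simps)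
    moreover have "X v \<in> ?U0" by (rule XU) simp
    ultimately show "\<exists>N. N.braids v v ((v, v) # N) \<and> set N \<subseteq> ?M"
      using U0U by (intro exI[of _ "[(act V (b * A (k - 1)) v, X v)]"]) (auto simp: m)
  qed
qed

theorem classification:
  assumes ind: "yd_indecomposable H V" and fin: "finite_dim (scale R)"
  shows "yd_simple H V \<and> ((\<exists>k\<in>{1, 3, 5}. iso_to_chi \<xi> H a b k V) \<or>
    (\<exists>(i, j)\<in>{(1,1), (4,2), (3,1), (2,2), (1,4), (4,5), (2,4), (3,5), (4,4), (1,5), (4,1), (1,2)}.
      iso_to_V \<xi> H a b i j V))"
  using indecomposable_z[OF ind]
proof
  assume z1: "\<forall>v. z v = v"
  have "\<exists>i\<in>{1, 3, 5}. \<exists>v. is_chi \<xi> H a b i V v"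
    by (rule indecomposable_chi[OF ind]) (use z1 infinite_even fin in blast)+
  then obtain i v where "i \<in> {1, 3, 5}" "is_chi \<xi> H a b i V v" by blast
  then show ?thesis using is_chi_simple is_chi_iso by blast
next
  assume "\<forall>v. wp sV z 0 v = 0"
  then obtain i j v1 v2 where ij: "i \<in> {0..<6}" "j \<in> {0..<6}" and V: "is_V \<xi> H a b i j V v1 v2"
    using indecomposable_V[OF ind] by blast
  have "xp (i * - j) \<noteq> xp 0" "xp ((i + 1) * (3 - j)) \<noteq> xp 0"
    using infinite_V[OF V] fin by (auto simp: xp_values)
  then have ne: "(i * - j) mod 6 \<noteq> 0" "((i + 1) * (3 - j)) mod 6 \<noteq> 0" "3 * i mod 6 \<noteq> j mod 6"
    using V by (auto simp: xp_eq_iff is_V_def Let_def)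
  have "i = 0 \<or> i = 1 \<or> i = 2 \<or> i = 3 \<or> i = 4 \<or> i = 5" "j = 0 \<or> j = 1 \<or> j = 2 \<or> j = 3 \<or> j = 4 \<or> j = 5"
    using ij by auto
  then have "(i, j) \<in> {(1,1), (4,2), (3,1), (2,2), (1,4), (4,5), (2,4), (3,5), (4,4), (1,5), (4,1), (1,2)}"
    using ne by (elim disjE) simp_all
  then show ?thesis using is_V_simple[OF V] is_V_iso[OF V] by blast
qed

section \<open>The presentations\<close>

lemma chi_presentation:
  assumes V: "is_chi \<xi> H a b l V v" and l: "l \<in> {1, 3, 5}"
  shows "presented_by (scale R) (\<lambda>_::unit. \<iota> v) {var () ^ 2} \<and> has_dim (scale R) 2"
proof -
  interpret E: algebra_eval "scale R" "\<lambda>_::unit. \<iota> v" by standard (rule N.algR)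
  have V': "has_basis sV {v}" "opA v = sV (xp l) v" "\<delta> v = pure sH sV (A (3 * l)) v"
    using V unfolding is_chi_def xp_def[symmetric] A_def[symmetric] by blast+
  have "xp (l * (3 * l)) = xp 3" using l by (intro xp_cong) auto
  then have act: "act V (A (3 * l)) v = - v" using act_A[OF V'(2), of "3 * l"] by (simp add: xp_values)
  have br: "N.braids v v [(- v, v)]"
    unfolding N.braids_def V'(3) by (simp add: pure_def N.bilform_actV act)
  have d1: "N.derives (1 * \<iota> v) [(1, v)]"
    using N.derives_mult_braids[OF N.derives_one, of v "\<lambda>_. []"] by simp
  have d2: "N.derives (1 * \<iota> v * \<iota> v)
      ((1 * \<iota> v, v) # concat (map (\<lambda>(p, w). map (\<lambda>(u', w'). (p * \<iota> u', w')) [(- v, v)]) [(1, v)]))"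
    by (rule N.derives_mult_braids[OF d1, of v "\<lambda>_. [(- v, v)]"]) (auto simp: br)
  have "N.derives (1 * \<iota> v * \<iota> v) []"
    by (rule N.derives_cong[OF d2]) (simp add: linear_simps[OF N.iota_linear] bilform_simps)
  then have "N.derives (\<iota> v * \<iota> v) []" by simp
  moreover have "\<iota> v * \<iota> v \<in> G 2" using N.power_iota_G[of v 2] by (simp add: power2_eq_square)
  ultimately have sq: "\<iota> v * \<iota> v = 0" by (intro N.derives_nil_imp_zero[of _ 2]) simp_all
  have v0: "v \<noteq> 0" using V'(1) N.V.dependent_zero[of "{v}"] by (auto simp: has_basis_def)
  have iv: "\<iota> v \<noteq> 0" using v0 N.inj linear_simps(3)[OF N.iota_linear] by (metis injD)
  have surj: "surj (fa_eval (scale R) (\<lambda>_::unit. \<iota> v))"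
  proof -
    let ?e = "fa_eval (scale R) (\<lambda>_::unit. \<iota> v)"
    have "N.R.subspace (range ?e)"
    proof (rule N.R.subspaceI)
      show "0 \<in> range ?e" by (metis E.fa_eval_zero rangeI)
      show "x + y \<in> range ?e" if "x \<in> range ?e" "y \<in> range ?e" for x y
        using that by (auto simp flip: E.fa_eval_add)
      show "scale R c x \<in> range ?e" if "x \<in> range ?e" for c x
        using that by (auto simp flip: E.fa_eval_fscale)
    qed
    moreover have "1 \<in> range ?e" by (metis E.fa_eval_one rangeI)
    moreover have "x * y \<in> range ?e" if "x \<in> range ?e" "y \<in> range ?e" for x y
      using that by (auto simp flip: E.fa_eval_mult)
    ultimately have sub: "subalgebra (scale R) (range ?e)" by (simp add: subalgebra_def)
    have "G 1 \<subseteq> range ?e"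
    proof
      fix r assume "r \<in> G 1"
      then obtain u where r: "r = \<iota> u" using N.G1 by blast
      have "u \<in> N.V.span {v}" using V'(1) by (simp add: has_basis_def)
      then obtain c where "u = sV c v" by (auto simp: N.V.span_singleton)
      then have "r = ?e (c \<cdot> var ())"
        by (simp add: r linear_simps[OF N.iota_linear] E.fa_eval_fscale E.fa_eval_var)
      then show "r \<in> range ?e" by blast
    qed
    then have "subalgebra (scale R) hull (G 1) \<subseteq> range ?e" using sub by (rule hull_minimal)
    then show ?thesis using N.gen by auto
  qed
  let ?B = "{0, Word [()]}"
  let ?J = "ideal_generated {var () ^ 2 :: (unit, 'k) free_alg}"
  note J = ideal_generated_ideal[of "{var () ^ 2 :: (unit, 'k) free_alg}"]
  have red: "Poly_Mapping.single w 1 \<in> reducible_to ?J ?B" for w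
  proof -
    obtain xs where w: "w = Word xs" by (cases w)
    have xs: "xs = replicate (length xs) ()" by (induction xs) auto
    show ?thesis
    proof (cases "length xs < 2")
      case True
      then have "xs = [] \<or> xs = [()]" using xs by (cases xs; cases "tl xs") auto
      then have "w \<in> ?B" by (auto simp: w zero_word_def)
      then show ?thesis using J by (rule reducible_word)
    next
      case False
      then obtain ys where ys: "xs = () # () # ys" by (cases xs; cases "tl xs") auto
      have "Poly_Mapping.single w 1 = (var () ^ 2 :: (unit, 'k) free_alg) * Poly_Mapping.single (Word ys) 1"
        by (simp add: w ys power2_eq_square var_def mult_single plus_word_def)
      also have "\<dots> \<in> ?J"
        using ideal_generated_superset by (intro ideal_closed(4)[OF J]) blast
      finally show ?thesis
        unfolding reducible_to_def by (intro CollectI bexI[of _ 0]) (simp_all add: F.span_zero)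
    qed
  qed
  have val: "E.word_val 0 = 1" "E.word_val (Word [()]) = \<iota> v" by (rule E.word_val_simps(1), simp add: E.word_val_def)
  have indep: "1 \<notin> N.R.span {\<iota> v}"
  proof
    assume "1 \<in> N.R.span {\<iota> v}"
    then obtain c where "1 = scale R c (\<iota> v)" by (auto simp: N.R.span_singleton)
    then have "scale R c (\<iota> v) \<in> G 0" using N.G_one by simp
    then have "N.pr 0 (scale R c (\<iota> v)) = scale R c (\<iota> v)" by (rule N.pr_same)
    moreover have "N.pr 0 (scale R c (\<iota> v)) = 0"
      by (rule N.pr_other[of _ 1]) (simp_all add: N.R.subspace_scale[OF N.G_sub] N.iota_G)
    ultimately show False using \<open>1 = scale R c (\<iota> v)\<close> by simp
  qed
  then have ne: "1 \<noteq> \<iota> v" using N.R.span_base[of "\<iota> v" "{\<iota> v}"] by auto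
  have rel: "fa_eval (scale R) (\<lambda>_::unit. \<iota> v) r = 0" if "r \<in> {var () ^ 2}" for r
    using that by (simp add: E.fa_eval_mult E.fa_eval_var power2_eq_square sq)
  have fin: "finite ?B" by simp
  have inj: "inj_on E.word_val ?B"
    by (rule inj_onI) (use ne val in \<open>auto simp del: E.word_val_simps\<close>)
  have ind: "N.R.independent (E.word_val ` ?B)" using ne iv indep by (simp add: val N.R.independent_insert)
  note pres = E.presented_from_basis[OF surj rel red fin inj ind]
  have "presented_by (scale R) (\<lambda>_::unit. \<iota> v) {var () ^ 2}" "has_dim (scale R) (card ?B)"
    using pres by blast+
  moreover have "card ?B = 2" by (simp add: zero_word_def)
  ultimately show ?thesis by simp
qed

lemma V_presentation:
  assumes V: "is_V \<xi> H a b i j V v1 v2" and zeta: "\<zeta> * \<zeta> = \<zeta> - 1"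
    and q: "cf \<zeta> q11 = xp (i * - j)" "cf \<zeta> q12 = xp ((i + 1) * - j)"
      "cf \<zeta> s = \<xi> ^ 4 * (xp (4 * i) - xp (i + j)) * xp ((i + 1) * (- 1 - j))"
      "cf \<zeta> q21 = xp (i * (3 - j))" "cf \<zeta> q22 = xp ((i + 1) * (3 - j))"
      "cf \<zeta> t = (xp (2 * i) + xp (j - i)) * xp ((i + 1) * (2 - j))"
    and cert: "nichols_certificate (Braiding q11 q12 s q21 q22 t) rels rs n e m path"
  shows "presented_by (scale R) (gens (\<iota> v1) (\<iota> v2)) (eisenstein_eval.evp fscale var \<zeta> ` set rels)"
    "has_dim (scale R) (length (monomials n e m))"
proof -
  have "has_basis sV {v1, v2}" "v1 \<noteq> v2" using V by (simp_all add: is_V_def Let_def)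
  then interpret rank2: nichols_rank2 H V R \<iota> G v1 v2 \<zeta> q11 q12 s q21 q22 t
    using is_V_braids[OF V] by unfold_locales (simp_all add: zeta q)
  show "presented_by (scale R) (gens (\<iota> v1) (\<iota> v2)) (eisenstein_eval.evp fscale var \<zeta> ` set rels)"
    "has_dim (scale R) (length (monomials n e m))"
    by (rule rank2.certificate_sound[OF cert])+
qed

end

context root6
begin

lemma xp_eval: "xp n = (let r = n mod 6 in if r = 0 then 1 else if r = 1 then \<xi> else if r = 2 then \<xi> - 1
    else if r = 3 then - 1 else if r = 4 then - \<xi> else 1 - \<xi>)"
proof -
  have "n mod 6 = 0 \<or> n mod 6 = 1 \<or> n mod 6 = 2 \<or> n mod 6 = 3 \<or> n mod 6 = 4 \<or> n mod 6 = 5" by presburger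
  then show ?thesis using xp_mod[of n] by (elim disjE) (simp_all add: xp_values Let_def)
qed

lemma powi_eval: "\<xi> powi n = xp n" by (simp add: xp_def)

lemma zeta_xp: "j \<in> {1, 5} \<Longrightarrow> xp j * xp j = xp j - 1"
  by (auto simp: xp_values algebra_simps xi_mult)

end

lemma evp_free_alg:
  assumes "\<zeta> * \<zeta> = \<zeta> - (1 :: 'k::field_char_0)"
  shows "eisenstein_eval.evp fscale var \<zeta> P =
    (\<Sum>(w, c)\<leftarrow>P. cf \<zeta> c \<cdot> (prod_list (map var (rev w)) :: (gen, 'k) free_alg))"
proof -
  interpret FE: eisenstein_eval fscale "var :: gen \<Rightarrow> (gen, 'k) free_alg" \<zeta>
    by standard (rule assms)
  show ?thesis unfolding FE.evp_def FE.wv_word F.word_val_def by simp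
qed

lemma certificate_rank2_3_1: "nichols_certificate (Braiding (-1, 0) (-1, 1) (-2, 1) (1, 0) (-1, 1) (-1, 0))
    [[([GX, GX], (1, 0))],
     [([GY, GX], (1, 0)), ([GX, GY], (1, -1))],
     [([GY, GY, GY], (1, 0))]]
    [([GX, GY], [([GY, GX], (0, -1))], (1, 0), [((0, 1), [], 1, [])]),
     ([GX, GX], [], (1, 0), [((1, 0), [], 0, [])]),
     ([GY, GY, GY], [], (1, 0), [((1, 0), [], 2, [])])]
    2 1 3 [GX, GX, GX]"
  by code_simp

lemma certificate_rank2_3_5: "nichols_certificate (Braiding (-1, 0) (0, -1) (-1, -1) (1, 0) (0, -1) (0, 1))
    [[([GX, GX], (1, 0))],
     [([GY, GX], (1, 0)), ([GX, GY], (0, 1))],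
     [([GY, GY, GY], (1, 0))]]
    [([GX, GY], [([GY, GX], (-1, 1))], (1, 0), [((1, -1), [], 1, [])]),
     ([GX, GX], [], (1, 0), [((1, 0), [], 0, [])]),
     ([GY, GY, GY], [], (1, 0), [((1, 0), [], 2, [])])]
    2 1 3 [GX, GX, GX]"
  by code_simp

lemma certificate_rank2_2_4: "nichols_certificate (Braiding (0, -1) (1, 0) (-1, -1) (0, -1) (-1, 0) (-1, 0))
    [[([GY, GY], (1, 0)), ([GX, GX], (0, 1))],
     [([GY, GX], (1, 0)), ([GX, GY], (-1, 0))],
     [([GX, GX, GX], (1, 0))]]
    [([GY, GY], [([GX, GX], (0, -1))], (1, 0), [((1, 0), [], 0, [])]),
     ([GX, GY], [([GY, GX], (1, 0))], (1, 0), [((-1, 0), [], 1, [])]),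
     ([GX, GX, GX], [], (1, 0), [((1, 0), [], 2, [])])]
    3 1 2 [GX, GX, GY]"
  by code_simp

lemma certificate_rank2_2_2: "nichols_certificate (Braiding (-1, 1) (1, 0) (-2, 1) (-1, 1) (-1, 0) (1, -1))
    [[([GY, GY], (1, 0)), ([GX, GX], (0, 1))],
     [([GY, GX], (1, 0)), ([GX, GY], (-1, 0))],
     [([GX, GX, GX], (1, 0))]]
    [([GY, GY], [([GX, GX], (0, -1))], (1, 0), [((1, 0), [], 0, [])]),
     ([GX, GY], [([GY, GX], (1, 0))], (1, 0), [((-1, 0), [], 1, [])]),
     ([GX, GX, GX], [], (1, 0), [((1, 0), [], 2, [])])]
    3 1 2 [GX, GX, GY]"
  by code_simp

lemma certificate_rank2_1_j: "nichols_certificate (Braiding (1, -1) (0, -1) (1, -2) (-1, 1) (0, -1) (-1, 0))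
    [[([GX, GX, GX, GX, GX, GX], (1, 0))],
     [([GY, GX, GX], (1, 0)), ([GX, GX, GY], (0, 1)), ([GX, GY, GX], (1, 1))],
     [([GX, GX, GX], (1, 0)), ([GX, GY, GY], (1, 0)), ([GY, GY, GX], (1, 0)), ([GY, GX, GY], (1, 0))],
     [([GY, GX, GX], (1, 0)), ([GX, GX, GY], (1, 0)), ([GX, GY, GX], (1, 0)), ([GY, GY, GY], (1, 0))]]
    [([GX, GX, GY], [([GX, GY, GX], (-2, 1)), ([GY, GX, GX], (-1, 1))], (1, 0), [((1, -1), [], 1, [])]),
     ([GX, GY, GY], [([GY, GX, GY], (-1, 0)), ([GY, GY, GX], (-1, 0)), ([GX, GX, GX], (-1, 0))], (1, 0), [((1, 0), [], 2, [])]),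
     ([GY, GY, GY], [([GX, GY, GX], (1, -1)), ([GY, GX, GX], (0, -1))], (1, 0), [((1, 0), [], 3, []), ((-1, 1), [], 1, [])]),
     ([GX, GY, GX, GY], [([GY, GX, GY, GX], (2, -2)), ([GY, GY, GX, GX], (1, -2))], (1, 0), [((0, -1), [], 2, [GX]), ((1, 0), [GY], 1, []), ((-1, 1), [], 1, [GY]), ((0, 1), [GX], 2, [])]),
     ([GX, GX, GX, GX, GX, GX], [], (1, 0), [((1, 0), [], 0, [])])]
    6 2 3 [GY, GY, GX, GY, GX, GX, GX, GX, GX]"
  by code_simp

lemma certificate_rank2_4_j: "nichols_certificate (Braiding (-1, 1) (0, 1) (-1, 0) (-1, 1) (0, -1) (-1, 2))
    [[([GX, GX, GX], (1, 0))],
     [([GY, GY, GY], (1, 0)), ([GY, GX, GX], (-1, 0)), ([GX, GX, GY], (-1, 0)), ([GX, GY, GX], (1, 0))],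
     [([GX, GY, GY], (1, 0)), ([GY, GY, GX], (1, 0)), ([GY, GX, GY], (-1, 0))],
     [([GY, GX, GX], (0, 1)), ([GX, GX, GY], (1, -1)), ([GX, GY, GX], (1, 0))]]
    [([GX, GX, GY], [([GX, GY, GX], (0, -1)), ([GY, GX, GX], (1, -1))], (1, 0), [((0, 1), [], 3, [])]),
     ([GX, GY, GY], [([GY, GX, GY], (1, 0)), ([GY, GY, GX], (-1, 0))], (1, 0), [((1, 0), [], 2, [])]),
     ([GY, GY, GY], [([GX, GX, GY], (1, 0)), ([GX, GY, GX], (-1, 0)), ([GY, GX, GX], (1, 0))], (1, 0), [((1, 0), [], 1, [])]),
     ([GX, GY, GX, GY], [([GY, GY, GX, GX], (-1, 0))], (1, 1), [((-1, 0), [], 2, [GX]), ((0, 1), [GY], 3, []), ((1, 0), [], 3, [GY]), ((1, 0), [GX], 2, [])]),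
     ([GX, GX, GX], [], (1, 0), [((1, 0), [], 0, [])])]
    3 2 3 [GY, GY, GX, GY, GX, GX]"
  by code_simp

lemma certificate_rank2_4_j3: "nichols_certificate (Braiding (-1, 1) (0, -1) (-1, 2) (-1, 1) (0, 1) (-1, 0))
    [[([GX, GX, GX], (1, 0))],
     [([GY, GX, GX], (-1, 1)), ([GX, GY, GX], (0, -1)), ([GX, GX, GY], (1, 0))],
     [([GY, GY, GY, GY, GY, GY], (1, 0))],
     [([GX, GY, GY], (1, 0)), ([GY, GX, GY], (1, -2)), ([GY, GY, GX], (-1, 0))]]
    [([GX, GX, GY], [([GX, GY, GX], (0, 1)), ([GY, GX, GX], (1, -1))], (1, 0), [((1, 0), [], 1, [])]),
     ([GX, GY, GY], [([GY, GX, GY], (-1, 2)), ([GY, GY, GX], (1, 0))], (1, 0), [((1, 0), [], 3, [])]),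
     ([GX, GY, GX, GY], [([GY, GX, GY, GX], (-2, 0)), ([GY, GY, GX, GX], (-1, 2))], (1, 0), [((0, 1), [], 3, [GX]), ((0, -1), [GY], 1, []), ((-1, 0), [], 1, [GY]), ((0, 1), [GX], 3, [])]),
     ([GX, GX, GX], [], (1, 0), [((1, 0), [], 0, [])]),
     ([GY, GY, GY, GY, GY, GY], [], (1, 0), [((1, 0), [], 2, [])])]
    3 2 6 [GY, GY, GY, GY, GY, GX, GY, GX, GX]"
  by code_simp

lemma certificate_rank2_1_j3: "nichols_certificate (Braiding (-1, 1) (0, -1) (-1, 0) (1, -1) (0, -1) (1, -2))
    [[([GX, GX, GX], (1, 0))],
     [([GY, GY, GY], (1, 0)), ([GY, GX, GX], (1, 0)), ([GX, GX, GY], (1, 0)), ([GX, GY, GX], (1, 0))],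
     [([GX, GY, GY], (1, 0)), ([GY, GY, GX], (1, 0)), ([GY, GX, GY], (1, 0))],
     [([GY, GX, GX], (-1, 1)), ([GX, GY, GX], (0, -1)), ([GX, GX, GY], (1, 0))]]
    [([GX, GX, GY], [([GX, GY, GX], (0, 1)), ([GY, GX, GX], (1, -1))], (1, 0), [((1, 0), [], 3, [])]),
     ([GX, GY, GY], [([GY, GX, GY], (-1, 0)), ([GY, GY, GX], (-1, 0))], (1, 0), [((1, 0), [], 2, [])]),
     ([GY, GY, GY], [([GX, GX, GY], (-1, 0)), ([GX, GY, GX], (-1, 0)), ([GY, GX, GX], (-1, 0))], (1, 0), [((1, 0), [], 1, [])]),
     ([GX, GY, GX, GY], [([GY, GY, GX, GX], (1, 0))], (1, 1), [((1, 0), [], 2, [GX]), ((-1, 0), [GY], 3, []), ((-1, 1), [], 3, [GY]), ((-1, 0), [GX], 2, [])]),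
     ([GX, GX, GX], [], (1, 0), [((1, 0), [], 0, [])])]
    3 2 3 [GY, GY, GX, GY, GX, GX]"
  by code_simp

lemma length_monomials: "length (monomials 2 1 3) = 6" "length (monomials 3 1 2) = 6"
    "length (monomials 6 2 3) = 36" "length (monomials 3 2 3) = 18" "length (monomials 3 2 6) = 36"
  by code_simp+


theorem theoremA:
  fixes \<xi> :: "'k::{alg_closed_field, field_char_0}"
    and H :: "('k, 'h::ring_1) hopf" and a b :: 'h
    and V :: "('k, 'h, 'v::ab_group_add) yd"
    and R :: "('k, 'h, 'r::ring_1) braided_hopf" and \<iota> :: "'v \<Rightarrow> 'r"
    and x y :: "(gen, 'k) free_alg"
  assumes "primitive_6th_root \<xi>" and "is_C \<xi> H a b"
    and "yd_module H V" and "nichols_algebra H V R \<iota>"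
    and x: "x = var GX" and y: "y = var GY"
  shows
    "(yd_indecomposable H V \<and> finite_dim (scale R) \<longrightarrow>
      yd_simple H V \<and>
      ((\<exists>k\<in>{1, 3, 5}. iso_to_chi \<xi> H a b k V) \<or>
       (\<exists>(i, j)\<in>{(1,1), (4,2), (3,1), (2,2), (1,4), (4,5), (2,4), (3,5), (4,4), (1,5), (4,1), (1,2)}.
          iso_to_V \<xi> H a b i j V))) \<and>
    (\<forall>l\<in>{1, 3, 5}. \<forall>v. is_chi \<xi> H a b l V v \<longrightarrow>
      presented_by (scale R) (\<lambda>_::unit. \<iota> v) {var () ^ 2} \<and> has_dim (scale R) 2) \<and>
    (\<forall>j\<in>{1, 5}. \<forall>v\<^sub>1 v\<^sub>2. is_V \<xi> H a b 3 j V v\<^sub>1 v\<^sub>2 \<longrightarrow>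
      presented_by (scale R) (gens (\<iota> v\<^sub>1) (\<iota> v\<^sub>2))
        {x ^ 2,
         x * y + \<xi> powi (- j) \<cdot> (y * x),
         y ^ 3} \<and>
      has_dim (scale R) 6) \<and>
    (\<forall>j\<in>{1, 5}. \<forall>v\<^sub>1 v\<^sub>2. is_V \<xi> H a b 2 (j + 3) V v\<^sub>1 v\<^sub>2 \<longrightarrow>
      presented_by (scale R) (gens (\<iota> v\<^sub>1) (\<iota> v\<^sub>2))
        {y ^ 2 + \<xi> \<cdot> x ^ 2,
         x * y - y * x,
         x ^ 3} \<and>
      has_dim (scale R) 6) \<and>
    (\<forall>j\<in>{1, 5}. \<forall>v\<^sub>1 v\<^sub>2. is_V \<xi> H a b 1 j V v\<^sub>1 v\<^sub>2 \<longrightarrow>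
      presented_by (scale R) (gens (\<iota> v\<^sub>1) (\<iota> v\<^sub>2))
        {x ^ 6,
         x ^ 2 * y + \<xi> powi j \<cdot> (y * x ^ 2) + (1 + \<xi> powi j) \<cdot> (x * y * x),
         x ^ 3 + y ^ 2 * x + x * y ^ 2 + y * x * y,
         x ^ 2 * y + y * x ^ 2 + x * y * x + y ^ 3} \<and>
      has_dim (scale R) 36) \<and>
    (\<forall>j\<in>{1, 5}. \<forall>v\<^sub>1 v\<^sub>2. is_V \<xi> H a b 4 j V v\<^sub>1 v\<^sub>2 \<longrightarrow>
      presented_by (scale R) (gens (\<iota> v\<^sub>1) (\<iota> v\<^sub>2))
        {x ^ 3,
         y ^ 3 - x ^ 2 * y - y * x ^ 2 + x * y * x,
         y ^ 2 * x + x * y ^ 2 - y * x * y,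
         \<xi> powi j \<cdot> (x ^ 2 * y) + \<xi> powi (5 * j) \<cdot> (y * x ^ 2) + x * y * x} \<and>
      has_dim (scale R) 18) \<and>
    (\<forall>j\<in>{1, 5}. \<forall>v\<^sub>1 v\<^sub>2. is_V \<xi> H a b 4 (j + 3) V v\<^sub>1 v\<^sub>2 \<longrightarrow>
      presented_by (scale R) (gens (\<iota> v\<^sub>1) (\<iota> v\<^sub>2))
        {x ^ 3,
         \<xi> powi (2 * j) \<cdot> (x ^ 2 * y) + \<xi> powi (4 * j) \<cdot> (x * y * x) + y * x ^ 2,
         y ^ 6,
         y ^ 2 * x + (\<xi> powi (5 * j) + \<xi> powi (4 * j)) \<cdot> (y * x * y) - x * y ^ 2} \<and>
      has_dim (scale R) 36) \<and>
    (\<forall>j\<in>{1, 5}. \<forall>v\<^sub>1 v\<^sub>2. is_V \<xi> H a b 1 (j + 3) V v\<^sub>1 v\<^sub>2 \<longrightarrow>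
      presented_by (scale R) (gens (\<iota> v\<^sub>1) (\<iota> v\<^sub>2))
        {x ^ 3,
         y ^ 3 + x ^ 2 * y + y * x ^ 2 + x * y * x,
         y ^ 2 * x + x * y ^ 2 + y * x * y,
         \<xi> powi (2 * j) \<cdot> (x ^ 2 * y) + \<xi> powi (4 * j) \<cdot> (x * y * x) + y * x ^ 2} \<and>
      has_dim (scale R) 18)"
proof -
  have C: "hopf_C \<xi> H a b" by (intro hopf_C.intro root6.intro hopf_C_axioms.intro assms(1,2))
  have "\<exists>G. nichols H V R \<iota> G"
    using assms(4)
    by (simp only: nichols_algebra_def nichols_def hopf_C.hopfH[OF C] assms(3) simp_thms conj_assoc)
  then obtain G where G: "nichols H V R \<iota> G" ..
  interpret nichols_C \<xi> H a b V R \<iota> G by (rule nichols_C.intro[OF C G])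
  have sixth: "p ^ 6 = p * (p * (p * (p * (p * p))))" for p :: "(gen, 'k) free_alg"
  proof -
    have "p ^ 6 = p ^ (2 + 2 + 2)" by simp
    then show ?thesis by (simp only: power_add power2_eq_square mult.assoc)
  qed
  note unf = cf_def x y sixth F.scale_one F.scale_minus_left
    power2_eq_square power3_eq_cube algebra_simps
  note q = cf_def xp_eval Let_def xi4 algebra_simps xi_mult
  have powi: "\<xi> powi j = xp j" "\<xi> powi (2 * j) = xp j - 1" "\<xi> powi (4 * j) = - xp j"
    "\<xi> powi (5 * j) = 1 - xp j" if "j \<in> {1, 5}" for j
    unfolding powi_eval using that by (auto simp: xp_eval)
  have powi_sum: "\<xi> powi (5 * j) + \<xi> powi (4 * j) = 1 - 2 * xp j" if "j \<in> {1, 5}" for j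
    by (simp add: powi[OF that])
  have p2: "presented_by (scale R) (gens (\<iota> v\<^sub>1) (\<iota> v\<^sub>2))
      {x ^ 2,
       x * y + \<xi> powi (- j) \<cdot> (y * x),
       y ^ 3}"
    and d2: "has_dim (scale R) 6"
    if j: "j \<in> {1, 5}" and V: "is_V \<xi> H a b 3 j V v\<^sub>1 v\<^sub>2" for j v\<^sub>1 v\<^sub>2
  proof -
    have *: "presented_by (scale R) (gens (\<iota> v\<^sub>1) (\<iota> v\<^sub>2))
      {x ^ 2,
       x * y + \<xi> powi (- j) \<cdot> (y * x),
       y ^ 3}" "has_dim (scale R) 6" if 1: "j = 1"
    proof -
      note pres = V_presentation[OF V xi_mult(1) _ _ _ _ _ _ certificate_rank2_3_1]
      have pm: "\<xi> powi (- j) = 1 - \<xi>" unfolding powi_eval using 1 by (simp add: xp_eval)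
      show "presented_by (scale R) (gens (\<iota> v\<^sub>1) (\<iota> v\<^sub>2))
      {x ^ 2,
       x * y + \<xi> powi (- j) \<cdot> (y * x),
       y ^ 3}"
        by (rule back_subst[where P = "presented_by (scale R) (gens (\<iota> v\<^sub>1) (\<iota> v\<^sub>2))",
          OF pres(1)],
        (simp_all add: q 1)[6],
        simp only: pm, simp add: evp_free_alg[OF xi_mult(1)] unf)
      show "has_dim (scale R) 6"
        by (rule pres(2)[unfolded length_monomials]) (simp_all add: q 1)
    qed
    have **: "presented_by (scale R) (gens (\<iota> v\<^sub>1) (\<iota> v\<^sub>2))
      {x ^ 2,
       x * y + \<xi> powi (- j) \<cdot> (y * x),
       y ^ 3}" "has_dim (scale R) 6" if 5: "j = 5"
    proof -
      note pres = V_presentation[OF V xi_mult(1) _ _ _ _ _ _ certificate_rank2_3_5]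
      have pm: "\<xi> powi (- j) = \<xi>" unfolding powi_eval using 5 by (simp add: xp_eval)
      show "presented_by (scale R) (gens (\<iota> v\<^sub>1) (\<iota> v\<^sub>2))
      {x ^ 2,
       x * y + \<xi> powi (- j) \<cdot> (y * x),
       y ^ 3}"
        by (rule back_subst[where P = "presented_by (scale R) (gens (\<iota> v\<^sub>1) (\<iota> v\<^sub>2))",
          OF pres(1)],
        (simp_all add: q 5)[6],
        simp only: pm, simp add: evp_free_alg[OF xi_mult(1)] unf)
      show "has_dim (scale R) 6"
        by (rule pres(2)[unfolded length_monomials]) (simp_all add: q 5)
    qed
    show "presented_by (scale R) (gens (\<iota> v\<^sub>1) (\<iota> v\<^sub>2))
      {x ^ 2,
       x * y + \<xi> powi (- j) \<cdot> (y * x),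
       y ^ 3}" using j *(1) **(1) by blast
    show "has_dim (scale R) 6" using j *(2) **(2) by blast
  qed
  have p3: "presented_by (scale R) (gens (\<iota> v\<^sub>1) (\<iota> v\<^sub>2))
      {y ^ 2 + \<xi> \<cdot> x ^ 2,
       x * y - y * x,
       x ^ 3}"
    and d3: "has_dim (scale R) 6"
    if j: "j \<in> {1, 5}" and V: "is_V \<xi> H a b 2 (j + 3) V v\<^sub>1 v\<^sub>2" for j v\<^sub>1 v\<^sub>2
  proof -
    have *: "presented_by (scale R) (gens (\<iota> v\<^sub>1) (\<iota> v\<^sub>2))
      {y ^ 2 + \<xi> \<cdot> x ^ 2,
       x * y - y * x,
       x ^ 3}" "has_dim (scale R) 6" if 1: "j = 1"
    proof -
      note pres = V_presentation[OF V xi_mult(1) _ _ _ _ _ _ certificate_rank2_2_4]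
      show "presented_by (scale R) (gens (\<iota> v\<^sub>1) (\<iota> v\<^sub>2))
      {y ^ 2 + \<xi> \<cdot> x ^ 2,
       x * y - y * x,
       x ^ 3}"
        by (rule back_subst[where P = "presented_by (scale R) (gens (\<iota> v\<^sub>1) (\<iota> v\<^sub>2))",
          OF pres(1)],
        (simp_all add: q 1)[6],
        simp add: evp_free_alg[OF xi_mult(1)] unf)
      show "has_dim (scale R) 6"
        by (rule pres(2)[unfolded length_monomials]) (simp_all add: q 1)
    qed
    have **: "presented_by (scale R) (gens (\<iota> v\<^sub>1) (\<iota> v\<^sub>2))
      {y ^ 2 + \<xi> \<cdot> x ^ 2,
       x * y - y * x,
       x ^ 3}" "has_dim (scale R) 6" if 5: "j = 5"
    proof -
      note pres = V_presentation[OF V xi_mult(1) _ _ _ _ _ _ certificate_rank2_2_2]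
      show "presented_by (scale R) (gens (\<iota> v\<^sub>1) (\<iota> v\<^sub>2))
      {y ^ 2 + \<xi> \<cdot> x ^ 2,
       x * y - y * x,
       x ^ 3}"
        by (rule back_subst[where P = "presented_by (scale R) (gens (\<iota> v\<^sub>1) (\<iota> v\<^sub>2))",
          OF pres(1)],
        (simp_all add: q 5)[6],
        simp add: evp_free_alg[OF xi_mult(1)] unf)
      show "has_dim (scale R) 6"
        by (rule pres(2)[unfolded length_monomials]) (simp_all add: q 5)
    qed
    show "presented_by (scale R) (gens (\<iota> v\<^sub>1) (\<iota> v\<^sub>2))
      {y ^ 2 + \<xi> \<cdot> x ^ 2,
       x * y - y * x,
       x ^ 3}" using j *(1) **(1) by blast
    show "has_dim (scale R) 6" using j *(2) **(2) by blast
  qed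
  have p4: "presented_by (scale R) (gens (\<iota> v\<^sub>1) (\<iota> v\<^sub>2))
      {x ^ 6,
       x ^ 2 * y + \<xi> powi j \<cdot> (y * x ^ 2) + (1 + \<xi> powi j) \<cdot> (x * y * x),
       x ^ 3 + y ^ 2 * x + x * y ^ 2 + y * x * y,
       x ^ 2 * y + y * x ^ 2 + x * y * x + y ^ 3}"
    and d4: "has_dim (scale R) 36"
    if j: "j \<in> {1, 5}" and V: "is_V \<xi> H a b 1 j V v\<^sub>1 v\<^sub>2" for j v\<^sub>1 v\<^sub>2
  proof -
    have cases: "j = 1 \<or> j = 5" using j by blast
    note pres = V_presentation[OF V zeta_xp[OF j] _ _ _ _ _ _ certificate_rank2_1_j]
    show "presented_by (scale R) (gens (\<iota> v\<^sub>1) (\<iota> v\<^sub>2))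
      {x ^ 6,
       x ^ 2 * y + \<xi> powi j \<cdot> (y * x ^ 2) + (1 + \<xi> powi j) \<cdot> (x * y * x),
       x ^ 3 + y ^ 2 * x + x * y ^ 2 + y * x * y,
       x ^ 2 * y + y * x ^ 2 + x * y * x + y ^ 3}"
      by (rule back_subst[where P = "presented_by (scale R) (gens (\<iota> v\<^sub>1) (\<iota> v\<^sub>2))",
          OF pres(1)],
        ((rule disjE[OF cases]; simp add: q)+)[6],
        simp only: powi[OF j], simp add: evp_free_alg[OF zeta_xp[OF j]] unf)
    show "has_dim (scale R) 36"
      by (rule pres(2)[unfolded length_monomials]; rule disjE[OF cases]; simp add: q)
  qed
  have p5: "presented_by (scale R) (gens (\<iota> v\<^sub>1) (\<iota> v\<^sub>2))
      {x ^ 3,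
       y ^ 3 - x ^ 2 * y - y * x ^ 2 + x * y * x,
       y ^ 2 * x + x * y ^ 2 - y * x * y,
       \<xi> powi j \<cdot> (x ^ 2 * y) + \<xi> powi (5 * j) \<cdot> (y * x ^ 2) + x * y * x}"
    and d5: "has_dim (scale R) 18"
    if j: "j \<in> {1, 5}" and V: "is_V \<xi> H a b 4 j V v\<^sub>1 v\<^sub>2" for j v\<^sub>1 v\<^sub>2
  proof -
    have cases: "j = 1 \<or> j = 5" using j by blast
    note pres = V_presentation[OF V zeta_xp[OF j] _ _ _ _ _ _ certificate_rank2_4_j]
    show "presented_by (scale R) (gens (\<iota> v\<^sub>1) (\<iota> v\<^sub>2))
      {x ^ 3,
       y ^ 3 - x ^ 2 * y - y * x ^ 2 + x * y * x,
       y ^ 2 * x + x * y ^ 2 - y * x * y,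
       \<xi> powi j \<cdot> (x ^ 2 * y) + \<xi> powi (5 * j) \<cdot> (y * x ^ 2) + x * y * x}"
      by (rule back_subst[where P = "presented_by (scale R) (gens (\<iota> v\<^sub>1) (\<iota> v\<^sub>2))",
          OF pres(1)],
        ((rule disjE[OF cases]; simp add: q)+)[6],
        simp only: powi[OF j], simp add: evp_free_alg[OF zeta_xp[OF j]] unf)
    show "has_dim (scale R) 18"
      by (rule pres(2)[unfolded length_monomials]; rule disjE[OF cases]; simp add: q)
  qed
  have p6: "presented_by (scale R) (gens (\<iota> v\<^sub>1) (\<iota> v\<^sub>2))
      {x ^ 3,
       \<xi> powi (2 * j) \<cdot> (x ^ 2 * y) + \<xi> powi (4 * j) \<cdot> (x * y * x) + y * x ^ 2,
       y ^ 6,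
       y ^ 2 * x + (\<xi> powi (5 * j) + \<xi> powi (4 * j)) \<cdot> (y * x * y) - x * y ^ 2}"
    and d6: "has_dim (scale R) 36"
    if j: "j \<in> {1, 5}" and V: "is_V \<xi> H a b 4 (j + 3) V v\<^sub>1 v\<^sub>2" for j v\<^sub>1 v\<^sub>2
  proof -
    have cases: "j = 1 \<or> j = 5" using j by blast
    note pres = V_presentation[OF V zeta_xp[OF j] _ _ _ _ _ _ certificate_rank2_4_j3]
    show "presented_by (scale R) (gens (\<iota> v\<^sub>1) (\<iota> v\<^sub>2))
      {x ^ 3,
       \<xi> powi (2 * j) \<cdot> (x ^ 2 * y) + \<xi> powi (4 * j) \<cdot> (x * y * x) + y * x ^ 2,
       y ^ 6,
       y ^ 2 * x + (\<xi> powi (5 * j) + \<xi> powi (4 * j)) \<cdot> (y * x * y) - x * y ^ 2}"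
      by (rule back_subst[where P = "presented_by (scale R) (gens (\<iota> v\<^sub>1) (\<iota> v\<^sub>2))",
          OF pres(1)],
        ((rule disjE[OF cases]; simp add: q)+)[6],
        subst powi_sum[OF j], simp only: powi[OF j], simp add: evp_free_alg[OF zeta_xp[OF j]] unf)
    show "has_dim (scale R) 36"
      by (rule pres(2)[unfolded length_monomials]; rule disjE[OF cases]; simp add: q)
  qed
  have p7: "presented_by (scale R) (gens (\<iota> v\<^sub>1) (\<iota> v\<^sub>2))
      {x ^ 3,
       y ^ 3 + x ^ 2 * y + y * x ^ 2 + x * y * x,
       y ^ 2 * x + x * y ^ 2 + y * x * y,
       \<xi> powi (2 * j) \<cdot> (x ^ 2 * y) + \<xi> powi (4 * j) \<cdot> (x * y * x) + y * x ^ 2}"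
    and d7: "has_dim (scale R) 18"
    if j: "j \<in> {1, 5}" and V: "is_V \<xi> H a b 1 (j + 3) V v\<^sub>1 v\<^sub>2" for j v\<^sub>1 v\<^sub>2
  proof -
    have cases: "j = 1 \<or> j = 5" using j by blast
    note pres = V_presentation[OF V zeta_xp[OF j] _ _ _ _ _ _ certificate_rank2_1_j3]
    show "presented_by (scale R) (gens (\<iota> v\<^sub>1) (\<iota> v\<^sub>2))
      {x ^ 3,
       y ^ 3 + x ^ 2 * y + y * x ^ 2 + x * y * x,
       y ^ 2 * x + x * y ^ 2 + y * x * y,
       \<xi> powi (2 * j) \<cdot> (x ^ 2 * y) + \<xi> powi (4 * j) \<cdot> (x * y * x) + y * x ^ 2}"
      by (rule back_subst[where P = "presented_by (scale R) (gens (\<iota> v\<^sub>1) (\<iota> v\<^sub>2))",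
          OF pres(1)],
        ((rule disjE[OF cases]; simp add: q)+)[6],
        simp only: powi[OF j], simp add: evp_free_alg[OF zeta_xp[OF j]] unf)
    show "has_dim (scale R) 18"
      by (rule pres(2)[unfolded length_monomials]; rule disjE[OF cases]; simp add: q)
  qed
  show ?thesis
    by (intro conjI ballI allI impI; (elim conjE)?;
      (rule conjunct1[OF classification], assumption, assumption | rule conjunct2[OF classification], assumption, assumption |
       rule conjunct1[OF chi_presentation], assumption, assumption | rule conjunct2[OF chi_presentation], assumption, assumption |
       rule p2, assumption, assumption | rule d2, assumption, assumption |
       rule p3, assumption, assumption | rule d3, assumption, assumption |
       rule p4, assumption, assumption | rule d4, assumption, assumption |
       rule p5, assumption, assumption | rule d5, assumption, assumption |
       rule p6, assumption, assumption | rule d6, assumption, assumption |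
       rule p7, assumption, assumption | rule d7, assumption, assumption))
qed

end
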